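(* Let $K\geq 1$ and $\ell\in\mathbb{N}\setminus\{0\}$ be fixed but arbitrary constants. If $\mathcal{A}$ and $\mathcal{B}$ are unital $C^*$-algebras with $d_{cb}(\mathcal{A},\mathcal{B})<1+10^{-4}\,4^{-\ell}K^{-2}$ and $\mathcal{A}$ has length at most $\ell$ and length constant at most $K$, then $\mathcal{B}$ has length at most $\ell$.
   Context: For operator spaces $\mathcal{X},\mathcal{Y}$, $d_{cb}(\mathcal{X},\mathcal{Y})=\inf\{\|T\|_{cb}\,\|T^{-1}\|_{cb}\}$, where the infimum runs over all linear completely bounded isomorphisms $T:\mathcal{X}\to\mathcal{Y}$ (with completely bounded inverse), with value $+\infty$ if there is none. Length (in the sense of Pisier): for a unital operator algebra $\mathcal{A}$, let $\max(\mathcal{A})$ denote the Banach space $\mathcal{A}$ endowed with its maximal operator space structure, and let $T_\ell:\max(\mathcal{A})^{\otimes_h\ell}\to\mathcal{A}$ be the completely bounded linear map on the $\ell$-fold Haagerup tensor product induced by the product, $a_1\otimes\cdots\otimes a_\ell\mapsto a_1\cdots a_\ell$. The algebra $\mathcal{A}$ has length at most $\ell$ if the induced map $\widetilde{T_\ell}:\max(\mathcal{A})^{\otimes_h\ell}/\ker T_\ell\to\mathcal{A}$ is a cb-isomorphism (a completely bounded bijection with completely bounded inverse); it has length at most $\ell$ and length constant at most $K$ if moreover $\|\widetilde{T_\ell}^{-1}\|_{cb}\leq K$. *)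

theory Defs
  imports
    Complex_Main
    "HOL-Library.Extended_Real"
    "HOL-Library.Poly_Mapping"
    "Jordan_Normal_Form.Matrix"
begin

class unital_cstar_algebra = real_normed_algebra_1 + banach +
  fixes scaleC :: "complex \<Rightarrow> 'a \<Rightarrow> 'a"  (infixr \<open>*\<^sub>C\<close> 75)
    and star :: "'a \<Rightarrow> 'a"
  assumes scaleC_add_right: "c *\<^sub>C (x + y) = c *\<^sub>C x + c *\<^sub>C y"
    and scaleC_add_left: "(c + d) *\<^sub>C x = c *\<^sub>C x + d *\<^sub>C x"
    and scaleC_scaleC: "c *\<^sub>C d *\<^sub>C x = (c * d) *\<^sub>C x"
    and scaleC_of_real: "complex_of_real r *\<^sub>C x = r *\<^sub>R x"
    and mult_scaleC_left: "(c *\<^sub>C x) * y = c *\<^sub>C (x * y)"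
    and mult_scaleC_right: "x * (c *\<^sub>C y) = c *\<^sub>C (x * y)"
    and norm_scaleC: "norm (c *\<^sub>C x) = cmod c * norm x"
    and star_add: "star (x + y) = star x + star y"
    and star_scaleC: "star (c *\<^sub>C x) = cnj c *\<^sub>C star x"
    and star_mult: "star (x * y) = star y * star x"
    and star_star: "star (star x) = x"
    and cstar_identity: "norm (star x * x) = (norm x)\<^sup>2"

instantiation complex :: unital_cstar_algebra
begin

definition scaleC_complex :: "complex \<Rightarrow> complex \<Rightarrow> complex"
  where "scaleC_complex c x = c * x"

definition star_complex :: "complex \<Rightarrow> complex"
  where "star_complex = cnj"

instance
  by standard
    (simp_all add: scaleC_complex_def star_complex_def algebra_simps scaleR_conv_of_real
      norm_mult power2_eq_square)

end

text \<open>The C*-norm on matrices. The space of column vectors of length \<open>n\<close> over a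
  C*-algebra \<open>A\<close> is a Hilbert C*-module with inner product \<open>\<Sum>i. star (v i) * w i\<close>. As
  \<open>A\<close> is unital, the \<open>n \<times> n\<close> matrices over \<open>A\<close> are exactly the adjointable operators on it,
  and their unique C*-norm is the operator norm. For complex entries this is the usual operator
  norm.\<close>

definition module_norm :: "'a::unital_cstar_algebra vec \<Rightarrow> real"
  where "module_norm v = sqrt (norm (\<Sum>i<dim_vec v. star (v $ i) * v $ i))"

definition cstar_mnorm :: "'a::unital_cstar_algebra mat \<Rightarrow> real"
  where "cstar_mnorm x =
    Sup {module_norm (x *\<^sub>v v) |v. v \<in> carrier_vec (dim_col x) \<and> module_norm v \<le> 1}"

record 'v cvspace =
  points :: "'v set"
  vadd :: "'v \<Rightarrow> 'v \<Rightarrow> 'v"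
  vscale :: "complex \<Rightarrow> 'v \<Rightarrow> 'v"

text \<open>Only the values of \<open>mnorm\<close> at square matrices of positive size with entries in \<open>points\<close>
  are meaningful.\<close>

record 'v opspace = "'v cvspace" +
  mnorm :: "'v mat \<Rightarrow> real"

definition square_mats :: "'v opspace \<Rightarrow> 'v mat set"
  where "square_mats X = {x. \<exists>n>0. x \<in> carrier_mat n n \<and> elements_mat x \<subseteq> points X}"

definition linear_map ::
    "('v, 'm) cvspace_scheme \<Rightarrow> ('w, 'n) cvspace_scheme \<Rightarrow> ('v \<Rightarrow> 'w) \<Rightarrow> bool"
  where "linear_map X Y T \<longleftrightarrow>
    (\<forall>x\<in>points X. T x \<in> points Y) \<and>
    (\<forall>x\<in>points X. \<forall>y\<in>points X. T (vadd X x y) = vadd Y (T x) (T y)) \<and>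
    (\<forall>c. \<forall>x\<in>points X. T (vscale X c x) = vscale Y c (T x))"

definition cb_norm :: "'v opspace \<Rightarrow> 'w opspace \<Rightarrow> ('v \<Rightarrow> 'w) \<Rightarrow> ereal"
  where "cb_norm X Y T =
    (SUP x\<in>{x \<in> square_mats X. mnorm X x \<le> 1}. ereal (mnorm Y (map_mat T x)))"

definition completely_bounded :: "'v opspace \<Rightarrow> 'w opspace \<Rightarrow> ('v \<Rightarrow> 'w) \<Rightarrow> bool"
  where "completely_bounded X Y T \<longleftrightarrow> linear_map X Y T \<and> cb_norm X Y T < \<infinity>"

definition cb_isomorphism :: "'v opspace \<Rightarrow> 'w opspace \<Rightarrow> ('v \<Rightarrow> 'w) \<Rightarrow> bool"
  where "cb_isomorphism X Y T \<longleftrightarrow>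
    completely_bounded X Y T \<and> bij_betw T (points X) (points Y) \<and>
    completely_bounded Y X (inv_into (points X) T)"

definition d_cb :: "'v opspace \<Rightarrow> 'w opspace \<Rightarrow> ereal"
  where "d_cb X Y =
    (INF T\<in>{T. cb_isomorphism X Y T}. cb_norm X Y T * cb_norm Y X (inv_into (points X) T))"

definition cstar_opspace :: "'a::unital_cstar_algebra opspace"
  where "cstar_opspace =
    \<lparr>points = UNIV, vadd = (+), vscale = scaleC, mnorm = cstar_mnorm\<rparr>"

definition scalar_conj :: "complex mat \<Rightarrow> 'a::unital_cstar_algebra mat \<Rightarrow> complex mat \<Rightarrow> 'a mat"
  where "scalar_conj \<alpha> x \<beta> = mat (dim_row \<alpha>) (dim_col \<beta>)
    (\<lambda>(i, j). \<Sum>k<dim_row x. \<Sum>l<dim_col x. (\<alpha> $$ (i, k) * \<beta> $$ (l, j)) *\<^sub>C x $$ (k, l))"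

text \<open>Ruan's axioms for a sequence of matrix norms extending the norm of \<open>'a\<close>.\<close>

definition opspace_structure :: "('a::unital_cstar_algebra mat \<Rightarrow> real) \<Rightarrow> bool"
  where "opspace_structure N \<longleftrightarrow>
    (\<forall>a. N (mat 1 1 (\<lambda>_. a)) = norm a) \<and>
    (\<forall>n>0. \<forall>x\<in>carrier_mat n n.
      0 \<le> N x \<and> (N x = 0 \<longleftrightarrow> x = 0\<^sub>m n n) \<and>
      (\<forall>c. N (map_mat (scaleC c) x) = cmod c * N x) \<and>
      (\<forall>y\<in>carrier_mat n n. N (x + y) \<le> N x + N y) \<and>
      (\<forall>\<alpha>\<in>carrier_mat n n. \<forall>\<beta>\<in>carrier_mat n n.
        N (scalar_conj \<alpha> x \<beta>) \<le> cstar_mnorm \<alpha> * N x * cstar_mnorm \<beta>) \<and>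
      (\<forall>m>0. \<forall>y\<in>carrier_mat m m.
        N (four_block_mat x (0\<^sub>m n m) (0\<^sub>m m n) y) = max (N x) (N y)))"

definition max_mnorm :: "'a::unital_cstar_algebra mat \<Rightarrow> real"
  where "max_mnorm x = Sup {N x |N. opspace_structure N}"

definition vcoset :: "('v, 'm) cvspace_scheme \<Rightarrow> 'v set \<Rightarrow> 'v \<Rightarrow> 'v set"
  where "vcoset V M x = {vadd V x m |m. m \<in> M}"

definition vquotient :: "('v, 'm) cvspace_scheme \<Rightarrow> 'v set \<Rightarrow> 'v set cvspace"
  where "vquotient V M =
    \<lparr>points = vcoset V M ` points V,
     vadd = (\<lambda>C D. {vadd V c d |c d. c \<in> C \<and> d \<in> D}),
     vscale = (\<lambda>z C. \<Union>c\<in>C. vcoset V M (vscale V z c))\<rparr>"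

definition quotient_opspace :: "'v opspace \<Rightarrow> 'v set \<Rightarrow> 'v set opspace"
  where "quotient_opspace X M = cvspace.extend (vquotient X M) (opspace.fields
    (\<lambda>x. Inf {mnorm X y |y. y \<in> carrier_mat (dim_row x) (dim_col x) \<and>
      (\<forall>i<dim_row x. \<forall>j<dim_col x. y $$ (i, j) \<in> x $$ (i, j))}))"

definition vdist :: "'v opspace \<Rightarrow> 'v \<Rightarrow> 'v \<Rightarrow> real"
  where "vdist X x y = mnorm X (mat 1 1 (\<lambda>_. vadd X x (vscale X (- 1) y)))"

definition cauchy_seqs :: "'v opspace \<Rightarrow> (nat \<Rightarrow> 'v) set"
  where "cauchy_seqs X = {s. range s \<subseteq> points X \<and>
    (\<forall>e>0. \<exists>N. \<forall>m\<ge>N. \<forall>n\<ge>N. vdist X (s m) (s n) < e)}"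

definition cauchy_rel :: "'v opspace \<Rightarrow> ((nat \<Rightarrow> 'v) \<times> (nat \<Rightarrow> 'v)) set"
  where "cauchy_rel X = {(s, t). s \<in> cauchy_seqs X \<and> t \<in> cauchy_seqs X \<and>
    (\<lambda>k. vdist X (s k) (t k)) \<longlonglongrightarrow> 0}"

text \<open>Points are classes of Cauchy sequences; matrix norms are limits along arbitrarily chosen
  representatives of the entries.\<close>

definition completion :: "'v opspace \<Rightarrow> (nat \<Rightarrow> 'v) set opspace"
  where "completion X =
    \<lparr>points = cauchy_seqs X // cauchy_rel X,
     vadd = (\<lambda>C D. cauchy_rel X `` {(\<lambda>k. vadd X (s k) (t k)) |s t. s \<in> C \<and> t \<in> D}),
     vscale = (\<lambda>z C. cauchy_rel X `` {(\<lambda>k. vscale X z (s k)) |s. s \<in> C}),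
     mnorm = (\<lambda>x. lim (\<lambda>k. mnorm X (map_mat (\<lambda>C. (SOME s. s \<in> C) k) x)))\<rparr>"

text \<open>The algebraic tensor power is the free complex vector space on lists of length \<open>l\<close>
  modulo the span of the multilinearity relations.\<close>

type_synonym 'a free = "'a list \<Rightarrow>\<^sub>0 complex"

definition fscale :: "complex \<Rightarrow> 'a free \<Rightarrow> 'a free"
  where "fscale c f = Poly_Mapping.map ((*) c) f"

definition free_space :: "nat \<Rightarrow> 'a free cvspace"
  where "free_space l =
    \<lparr>points = {f. \<forall>as\<in>Poly_Mapping.keys f. length as = l}, vadd = (+), vscale = fscale\<rparr>"

definition multilinear_relators :: "nat \<Rightarrow> 'a::unital_cstar_algebra free set"
  where "multilinear_relators l =
    {Poly_Mapping.single (us @ [a + b] @ vs) 1 - Poly_Mapping.single (us @ [a] @ vs) 1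
        - Poly_Mapping.single (us @ [b] @ vs) 1 |us vs a b. length us + 1 + length vs = l} \<union>
    {Poly_Mapping.single (us @ [c *\<^sub>C a] @ vs) 1 - Poly_Mapping.single (us @ [a] @ vs) c
        |us vs a c. length us + 1 + length vs = l}"

definition multilinear_null :: "nat \<Rightarrow> 'a::unital_cstar_algebra free set"
  where "multilinear_null l = module.span fscale (multilinear_relators l)"

definition tensor_space :: "nat \<Rightarrow> 'a::unital_cstar_algebra free set cvspace"
  where "tensor_space l = vquotient (free_space l) (multilinear_null l)"

text \<open>For matrices \<open>xs ! p\<close> of size \<open>rs ! p \<times> rs ! (p + 1)\<close>, the \<open>(i, j)\<close> entry of
  \<open>tensor_prod xs rs\<close> is the sum over all \<open>i = k 0, k 1, \<dots>, k l = j\<close> of the tensors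
  \<open>xs ! 0 (k 0, k 1) \<otimes> \<dots> \<otimes> xs ! (l - 1) (k (l - 1), k l)\<close>.\<close>

definition tensor_prod ::
    "'a::unital_cstar_algebra mat list \<Rightarrow> nat list \<Rightarrow> 'a free set mat"
  where "tensor_prod xs rs = (let l = length xs in
    mat (rs ! 0) (rs ! l) (\<lambda>(i, j). vcoset (free_space l) (multilinear_null l)
      (\<Sum>ks\<in>{ks. length ks = l + 1 \<and> ks ! 0 = i \<and> ks ! l = j \<and> (\<forall>p\<le>l. ks ! p < rs ! p)}.
        Poly_Mapping.single (map (\<lambda>p. (xs ! p) $$ (ks ! p, ks ! (p + 1))) [0..<l]) 1)))"

text \<open>The norm of a rectangular matrix is that of the square matrix obtained by adding zero rows
  or columns.\<close>

definition pad_square :: "'a::zero mat \<Rightarrow> 'a mat"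
  where "pad_square x = (let n = max (dim_row x) (dim_col x) in
    mat n n (\<lambda>(i, j). if i < dim_row x \<and> j < dim_col x then x $$ (i, j) else 0))"

definition haagerup_mnorm ::
    "('a::unital_cstar_algebra mat \<Rightarrow> real) \<Rightarrow> nat \<Rightarrow> 'a free set mat \<Rightarrow> real"
  where "haagerup_mnorm N l u = Inf {(\<Prod>p<l. N (pad_square (xs ! p))) |xs rs.
    length xs = l \<and> length rs = l + 1 \<and> (\<forall>p\<le>l. 0 < rs ! p) \<and>
    (\<forall>p<l. xs ! p \<in> carrier_mat (rs ! p) (rs ! (p + 1))) \<and> u = tensor_prod xs rs}"

definition haagerup_power ::
    "('a::unital_cstar_algebra mat \<Rightarrow> real) \<Rightarrow> nat \<Rightarrow> (nat \<Rightarrow> 'a free set) set opspace"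
  where "haagerup_power N l =
    completion (cvspace.extend (tensor_space l) (opspace.fields (haagerup_mnorm N l)))"

text \<open>The map induced by the product, successively on the free space, the algebraic tensor power,
  the completion (\<open>T\<^sub>l\<close>), and the quotient by the kernel of \<open>T\<^sub>l\<close>.\<close>

definition free_product_map :: "'a::unital_cstar_algebra free \<Rightarrow> 'a"
  where "free_product_map f =
    (\<Sum>as\<in>Poly_Mapping.keys f. Poly_Mapping.lookup f as *\<^sub>C prod_list as)"

definition tensor_product_map :: "'a::unital_cstar_algebra free set \<Rightarrow> 'a"
  where "tensor_product_map C = the_elem (free_product_map ` C)"

definition product_map :: "(nat \<Rightarrow> 'a::unital_cstar_algebra free set) set \<Rightarrow> 'a"
  where "product_map C = the_elem ((\<lambda>s. lim (\<lambda>k. tensor_product_map (s k))) ` C)"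

definition product_kernel :: "nat \<Rightarrow> (nat \<Rightarrow> 'a::unital_cstar_algebra free set) set set"
  where "product_kernel l = {C \<in> points (haagerup_power max_mnorm l). product_map C = 0}"

definition length_space ::
    "nat \<Rightarrow> (nat \<Rightarrow> 'a::unital_cstar_algebra free set) set set opspace"
  where "length_space l = quotient_opspace (haagerup_power max_mnorm l) (product_kernel l)"

definition induced_product_map ::
    "(nat \<Rightarrow> 'a::unital_cstar_algebra free set) set set \<Rightarrow> 'a"
  where "induced_product_map D = the_elem (product_map ` D)"

definition length_at_most :: "'a::unital_cstar_algebra itself \<Rightarrow> nat \<Rightarrow> bool"
  where "length_at_most A l \<longleftrightarrow>
    cb_isomorphism (length_space l) (cstar_opspace :: 'a opspace) induced_product_map"

definition length_and_constant_at_most ::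
    "'a::unital_cstar_algebra itself \<Rightarrow> nat \<Rightarrow> real \<Rightarrow> bool"
  where "length_and_constant_at_most A l K \<longleftrightarrow> length_at_most A l \<and>
    cb_norm (cstar_opspace :: 'a opspace) (length_space l)
      (inv_into (points (length_space l)) induced_product_map) \<le> ereal K"

end

theory Submission
  imports Defs
begin

text \<open>
  The theorem holds because a cb-isomorphism with \<open>\<parallel>T\<parallel> \<parallel>T\<^sup>-\<^sup>1\<parallel>\<close> close to \<open>1\<close> is almost multiplicative on all
  matrix algebras at once, after a twist by \<open>T 1\<close>, and because length is about factorizations of
  matrices into products, which tolerate a fixed relative error.

  Scale \<open>T\<close> such that it is completely contractive and its inverse has cb-norm at most \<open>L = 1 + \<epsilon>\<close>. The
  operator space structure sees unitaries: a matrix \<open>u\<close> with \<open>u u\<^sup>* = 1\<close> is one for which every row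
  \<open>(u, y)\<close> has the largest possible norm. Hence \<open>T u\<close> is unitary up to \<open>\<eta> = 2 (1 - 1 / L\<^sup>2) \<le> 4 \<epsilon>\<close>
  (\<open>almost_coisometry\<close>). For unitaries \<open>u\<close> and \<open>v\<close> the matrix with rows \<open>(1, u)\<close> and \<open>(- v, v u)\<close> is a
  multiple of a unitary, so its image has almost orthogonal rows; as \<open>T u\<close> is almost unitary, this says
  that \<open>T (v u)\<close> is close to \<open>T v (T 1)\<^sup>* T u\<close> (\<open>mat_ternary\<close>). Since every contraction is a combination of four unitaries,
  \<open>S = (T 1)\<^sup>* T\<close> is multiplicative up to \<open>12 \<eta>\<close> on the unit balls of all matrix algebras
  (\<open>S_multiplicative\<close>), and \<open>b \<mapsto> T\<^sup>-\<^sup>1 (T 1 b)\<close> is an inverse of it up to \<open>\<eta>\<close>.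

  If \<open>A\<close> has length at most \<open>l\<close> and length constant at most \<open>K\<close>, every contraction in a matrix algebra
  over \<open>A\<close> is, up to an arbitrarily small error, \<open>2 K\<close> times a corner of a product of \<open>l\<close> matrices in the
  unit ball of the maximal structure (\<open>approximate_factorization\<close>). Contractions of the Banach spaces
  are completely contractive for the maximal structures (\<open>max_mnorm_contraction\<close>), so \<open>S\<close> maps the
  factors into the unit ball over \<open>B\<close>, and the image of the product is the product of the images up to
  \<open>2 K l 12 \<eta>\<close>. In this way every contraction over \<open>B\<close> is approximated by a bounded multiple of such a
  product with an error below \<open>1 / 2\<close> (\<open>length_at_most_transfer\<close>). Approximating the remainders in turn
  gives a convergent series in the completed Haagerup power, hence a bounded lift
  (\<open>length_at_most_of_approximate_factorization\<close>).

  The groundwork consists of the order structure of a C*-algebra up to the positivity of \<open>x\<^sup>* x\<close>; the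
  norm on matrices, which makes them operators on Hilbert modules; one C*-algebra that contains all
  matrix algebras over \<open>A\<close>, through which unitaries become available for matrices; and the description
  of the Haagerup norm by its unit ball, whose convexity yields the triangle inequality.
\<close>

section \<open>Positive elements of a C*-algebra\<close>

lemma star_0 [simp]: "star (0::'a::unital_cstar_algebra) = 0"
  using star_add[of "0::'a" 0] by simp

lemma star_minus [simp]: "star (- x) = - star (x::'a::unital_cstar_algebra)"
proof -
  have "star (- x) + star x = 0"
    by (simp flip: star_add)
  then show ?thesis by (simp add: eq_neg_iff_add_eq_0)
qed

lemma star_diff: "star (x - y) = star x - star (y::'a::unital_cstar_algebra)"
  using star_add[of x "- y"] by simp

lemma star_1 [simp]: "star (1::'a::unital_cstar_algebra) = 1"
  by (metis mult.right_neutral star_mult star_star mult.left_neutral)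

lemma scaleC_zero_right [simp]: "c *\<^sub>C (0::'a::unital_cstar_algebra) = 0"
  using scaleC_add_right[of c "0::'a" 0] by simp

lemma scaleC_zero_left [simp]: "0 *\<^sub>C (x::'a::unital_cstar_algebra) = 0"
  using scaleC_of_real[of 0 x] by simp

lemma scaleC_one [simp]: "1 *\<^sub>C (x::'a::unital_cstar_algebra) = x"
  using scaleC_of_real[of 1 x] by simp

lemma scaleC_minus_right: "c *\<^sub>C (- x) = - (c *\<^sub>C (x::'a::unital_cstar_algebra))"
  using scaleC_add_right[of c x "- x"] by (simp add: eq_neg_iff_add_eq_0 add.commute)

lemma scaleC_minus_left: "(- c) *\<^sub>C x = - (c *\<^sub>C (x::'a::unital_cstar_algebra))"
  using scaleC_add_left[of c "- c" x] by (simp add: eq_neg_iff_add_eq_0 add.commute)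

lemma scaleC_diff_right: "c *\<^sub>C (x - y) = c *\<^sub>C x - c *\<^sub>C (y::'a::unital_cstar_algebra)"
  using scaleC_add_right[of c x "- y"] by (simp add: scaleC_minus_right)

lemma scaleC_sum_right: "c *\<^sub>C sum f A = (\<Sum>i\<in>A. c *\<^sub>C (f i::'a::unital_cstar_algebra))"
  by (induction A rule: infinite_finite_induct) (auto simp: scaleC_add_right)

lemma scaleC_sum_left: "sum f A *\<^sub>C (x::'a::unital_cstar_algebra) = (\<Sum>i\<in>A. f i *\<^sub>C x)"
  by (induction A rule: infinite_finite_induct) (auto simp: scaleC_add_left)

lemma star_sum: "star (sum f A) = (\<Sum>i\<in>A. star (f i::'a::unital_cstar_algebra))"
  by (induction A rule: infinite_finite_induct) (auto simp: star_add)

lemma star_scaleR [simp]: "star (r *\<^sub>R x) = r *\<^sub>R star (x::'a::unital_cstar_algebra)"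
  by (simp add: star_scaleC flip: scaleC_of_real)

lemma star_of_real [simp]: "star (of_real r) = (of_real r :: 'a::unital_cstar_algebra)"
  by (simp add: of_real_def)

lemma norm_star [simp]: "norm (star x) = norm (x::'a::unital_cstar_algebra)"
proof -
  have le: "norm y \<le> norm (star y)" for y :: 'a
  proof (cases "norm y = 0")
    case False
    have "(norm y)\<^sup>2 \<le> norm (star y) * norm y"
      by (metis cstar_identity norm_mult_ineq)
    with False show ?thesis
      by (simp add: power2_eq_square mult_le_cancel_right)
  qed simp
  show ?thesis using le[of x] le[of "star x"] by (simp add: star_star)
qed

lemma cstar_identity': "norm (x * star x) = (norm (x::'a::unital_cstar_algebra))\<^sup>2"
  using cstar_identity[of "star x"] by (simp add: star_star)

lemma star_mult_self_eq_0: "star x * x = 0 \<longleftrightarrow> x = (0::'a::unital_cstar_algebra)"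
  by (metis cstar_identity mult_zero_right norm_zero norm_eq_zero power2_eq_square mult_eq_0_iff)

text \<open>A constant factor is washed out by taking roots.  All spectral radius arguments below take this
form; only exponents that are powers of two occur, because for these the C*-identity computes the
norm of a power of a self-adjoint element.\<close>

lemma le_of_iterated_squares:
  fixes a b C :: real
  assumes a: "0 \<le> a" and b: "0 \<le> b" and le: "\<And>k. a ^ (2 ^ k) \<le> C * b ^ (2 ^ k)"
  shows "a \<le> b"
proof (rule ccontr)
  assume "\<not> a \<le> b"
  then have ab: "b < a" by simp
  show False
  proof (cases "b = 0")
    case True
    then show ?thesis using le[of 0] ab by simp
  next
    case False
    define q where "q = a / b"
    have q: "1 < q" and b0: "0 < b" using ab b False by (auto simp: q_def)
    obtain n where n: "C < q ^ n" using real_arch_pow[OF q] by blast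
    have "n \<le> 2 ^ n" by (simp add: less_imp_le)
    then have "q ^ n \<le> q ^ (2 ^ n)" using q by (intro power_increasing) auto
    also have "\<dots> \<le> C" using le[of n] b0 by (simp add: q_def power_divide divide_le_eq)
    finally show False using n by simp
  qed
qed

lemma norm_power2_selfadjoint:
  fixes h :: "'a::unital_cstar_algebra"
  assumes "star h = h"
  shows "norm (h ^ (2 ^ k)) = norm h ^ (2 ^ k)"
proof (induction k)
  case (Suc k)
  have s: "star (h ^ n) = h ^ n" for n
    by (induction n) (auto simp: star_mult assms power_commutes)
  have "norm (h ^ (2 ^ Suc k)) = norm (star (h ^ (2 ^ k)) * h ^ (2 ^ k))"
    by (simp add: s mult_2 power_add)
  also have "\<dots> = (norm (h ^ (2 ^ k)))\<^sup>2" by (rule cstar_identity)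
  finally show ?case using Suc by (simp add: mult_2 power_add power2_eq_square)
qed simp

text \<open>Square roots.  The recursion \<open>y \<mapsto> (x + y\<^sup>2) / 2\<close> converges to a \<open>y\<close> with
  \<open>(1 - y)\<^sup>2 = 1 - x\<close>.  Its increments are dominated by those of the scalar recursion with \<open>x = 1\<close>,
  which increases to \<open>1\<close>.\<close>

fun sqrt_iter :: "'a::real_normed_algebra_1 \<Rightarrow> nat \<Rightarrow> 'a" where
  "sqrt_iter x 0 = 0"
| "sqrt_iter x (Suc n) = (1/2) *\<^sub>R (x + sqrt_iter x n * sqrt_iter x n)"

lemma sqrt_iter_commute:
  assumes "z * x = x * z"
  shows "z * sqrt_iter x n = sqrt_iter x n * z"
proof (induction n)
  case (Suc n)
  have "z * (sqrt_iter x n * sqrt_iter x n) = sqrt_iter x n * sqrt_iter x n * z"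
    using Suc by (metis mult.assoc)
  then show ?case using assms by (simp add: algebra_simps)
qed simp

lemma sqrt_iter_one: "0 \<le> sqrt_iter (1::real) n \<and> sqrt_iter (1::real) n \<le> sqrt_iter 1 (Suc n)
    \<and> sqrt_iter (1::real) n \<le> 1"
proof (induction n)
  case (Suc n)
  let ?t = "sqrt_iter (1::real) n"
  have t: "0 \<le> ?t" "?t \<le> 1" using Suc by auto
  have "?t * ?t \<le> 1 * 1" using t by (intro mult_mono) auto
  moreover have "?t * ?t \<le> sqrt_iter 1 (Suc n) * sqrt_iter 1 (Suc n)"
    using Suc by (intro mult_mono) auto
  ultimately show ?case using t by (simp del: mult_cancel_left)
qed simp

lemma sqrt_iter_bounds:
  fixes x :: "'a::real_normed_algebra_1"
  assumes x: "norm x \<le> 1"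
  shows "norm (sqrt_iter x n) \<le> sqrt_iter 1 n"
    and "norm (sqrt_iter x (Suc n) - sqrt_iter x n) \<le> sqrt_iter 1 (Suc n) - sqrt_iter 1 n"
proof -
  have le: "norm (sqrt_iter x n) \<le> sqrt_iter 1 n" for n
  proof (induction n)
    case (Suc n)
    have "norm (sqrt_iter x n * sqrt_iter x n) \<le> sqrt_iter 1 n * sqrt_iter 1 n"
      using Suc by (meson mult_mono norm_ge_zero norm_mult_ineq order_trans)
    then show ?case
      using norm_triangle_ineq[of x "sqrt_iter x n * sqrt_iter x n"] x by simp
  qed simp
  then show "norm (sqrt_iter x n) \<le> sqrt_iter 1 n" .
  show "norm (sqrt_iter x (Suc n) - sqrt_iter x n) \<le> sqrt_iter 1 (Suc n) - sqrt_iter 1 n"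
  proof (induction n)
    case (Suc n)
    let ?p = "sqrt_iter x (Suc n)" and ?q = "sqrt_iter x n"
    let ?s = "sqrt_iter (1::real) (Suc n)" and ?t = "sqrt_iter (1::real) n"
    have comm: "?p * ?q = ?q * ?p"
      by (rule sqrt_iter_commute[symmetric], rule sqrt_iter_commute[symmetric]) simp
    have "sqrt_iter x (Suc (Suc n)) - ?p = (1/2) *\<^sub>R (?p * ?p - ?q * ?q)"
      unfolding sqrt_iter.simps(2)[of x "Suc n"] sqrt_iter.simps(2)[of x n]
      by (simp add: algebra_simps)
    also have "?p * ?p - ?q * ?q = (?p - ?q) * (?p + ?q)"
      using comm by (simp add: algebra_simps del: sqrt_iter.simps)
    finally have "norm (sqrt_iter x (Suc (Suc n)) - ?p) \<le> (1/2) * (norm (?p - ?q) * norm (?p + ?q))"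
      using norm_mult_ineq[of "?p - ?q" "?p + ?q"] by (simp del: sqrt_iter.simps)
    also have "norm (?p - ?q) * norm (?p + ?q) \<le> (?s - ?t) * (?s + ?t)"
    proof (rule mult_mono)
      show "norm (?p + ?q) \<le> ?s + ?t"
        using norm_triangle_ineq[of ?p ?q] le[of "Suc n"] le[of n] by linarith
    qed (use Suc sqrt_iter_one[of n] in auto)
    also have "(1/2) * ((?s - ?t) * (?s + ?t)) = sqrt_iter 1 (Suc (Suc n)) - ?s"
      unfolding sqrt_iter.simps(2)[of 1 "Suc n"] sqrt_iter.simps(2)[of 1 n]
      by (simp add: algebra_simps)
    finally show ?case by simp
  qed (use x in simp)
qed

lemma sqrt_one_minus:
  fixes x :: "'a::unital_cstar_algebra"
  assumes x: "norm x \<le> 1" and sx: "star x = x"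
  obtains y where "norm y \<le> 1" "star y = y" "(1 - y) * (1 - y) = 1 - x"
    "\<And>z. z * x = x * z \<Longrightarrow> z * y = y * z"
proof -
  let ?f = "sqrt_iter x" and ?t = "sqrt_iter (1::real)"
  have "Bseq ?t" by (rule BseqI'[of _ 1]) (use sqrt_iter_one in auto)
  moreover have "incseq ?t" using sqrt_iter_one by (intro incseq_SucI) blast
  ultimately have "Cauchy ?t"
    by (intro convergent_Cauchy Bseq_monoseq_convergent) (auto simp: incseq_imp_monoseq)
  have d: "norm (?f n - ?f m) \<le> ?t n - ?t m" if "m \<le> n" for m n
    using that
  proof (induction n rule: dec_induct)
    case (step n)
    have "norm (?f (Suc n) - ?f m) \<le> norm (?f (Suc n) - ?f n) + norm (?f n - ?f m)"
      using norm_triangle_ineq[of "?f (Suc n) - ?f n" "?f n - ?f m"] by (simp del: sqrt_iter.simps)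
    then show ?case using sqrt_iter_bounds(2)[OF x, of n] step.IH by linarith
  qed simp
  have "Cauchy ?f"
  proof (rule CauchyI)
    fix e :: real assume "0 < e"
    then obtain M where M: "\<And>m n. m \<ge> M \<Longrightarrow> n \<ge> M \<Longrightarrow> norm (?t m - ?t n) < e"
      using \<open>Cauchy ?t\<close> by (meson CauchyD)
    have "norm (?f m - ?f n) < e" if "m \<ge> M" "n \<ge> M" for m n
    proof (cases "m \<le> n")
      case True
      then show ?thesis using d[OF True] M[OF that] by (auto simp: norm_minus_commute)
    next
      case False
      then show ?thesis using d[of n m] M[OF that] by auto
    qed
    then show "\<exists>M. \<forall>m\<ge>M. \<forall>n\<ge>M. norm (?f m - ?f n) < e" by blast
  qed
  then obtain y where y: "?f \<longlonglongrightarrow> y" using Cauchy_convergent_iff convergent_def by blast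
  have star_lim: "(\<lambda>n. star (?f n)) \<longlonglongrightarrow> star y"
  proof -
    have "(\<lambda>n. norm (star (?f n) - star y)) \<longlonglongrightarrow> 0"
      using tendsto_norm_zero[OF LIM_zero[OF y]] by (simp flip: star_diff)
    then show ?thesis by (metis LIM_zero_cancel tendsto_norm_zero_cancel)
  qed
  have "star (?f n) = ?f n" for n
    by (induction n) (auto simp: star_add star_mult sx)
  then have sy: "star y = y" using star_lim y LIMSEQ_unique by auto
  have ny: "norm y \<le> 1"
    by (rule Lim_bounded[OF tendsto_norm[OF y], of 0])
      (meson order_trans sqrt_iter_bounds(1) sqrt_iter_one x)
  have "(\<lambda>n. ?f (Suc n)) \<longlonglongrightarrow> (1/2) *\<^sub>R (x + y * y)"
    unfolding sqrt_iter.simps by (intro tendsto_intros y)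
  then have "y = (1/2) *\<^sub>R (x + y * y)" using y LIMSEQ_unique LIMSEQ_Suc by blast
  then have "2 *\<^sub>R y = x + y * y" by (metis scaleR_half_double scaleR_right_distrib scaleR_2)
  then have sq: "(1 - y) * (1 - y) = 1 - x" by (simp add: algebra_simps scaleR_2)
  have "z * y = y * z" if "z * x = x * z" for z
  proof -
    have "(\<lambda>n. z * ?f n) \<longlonglongrightarrow> z * y" by (intro tendsto_intros y)
    moreover have "(\<lambda>n. z * ?f n) \<longlonglongrightarrow> y * z"
      unfolding sqrt_iter_commute[OF that] by (intro tendsto_intros y)
    ultimately show ?thesis using LIMSEQ_unique by blast
  qed
  with ny sy sq that show thesis by blast
qed

text \<open>Positivity is expressed through the norm: for \<open>t \<ge> 0\<close>, the condition says that the spectrum of the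
self-adjoint \<open>h\<close> lies in \<open>[0, 2 t]\<close>.  The cone properties are immediate in this form.\<close>

definition cpos :: "'a::unital_cstar_algebra \<Rightarrow> bool" where
  "cpos h \<longleftrightarrow> star h = h \<and> (\<exists>t\<ge>0. norm (of_real t - h) \<le> t)"

lemma cpos_selfadjoint: "cpos h \<Longrightarrow> star h = h" by (simp add: cpos_def)

lemma cpos_add: assumes "cpos h" "cpos k" shows "cpos (h + k)"
proof -
  obtain s t where "s \<ge> 0" "t \<ge> 0" "norm (of_real s - h) \<le> s" "norm (of_real t - k) \<le> t"
    using assms by (auto simp: cpos_def)
  then have "norm (of_real (s + t) - (h + k)) \<le> s + t"
    using norm_triangle_ineq[of "of_real s - h" "of_real t - k"] by (simp add: algebra_simps)
  with \<open>s \<ge> 0\<close> \<open>t \<ge> 0\<close> assms show ?thesis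
    unfolding cpos_def by (metis star_add add_nonneg_nonneg)
qed

lemma cpos_scaleR: assumes "cpos h" "0 \<le> r" shows "cpos (r *\<^sub>R h)"
proof -
  obtain s where "s \<ge> 0" "norm (of_real s - h) \<le> s" using assms by (auto simp: cpos_def)
  moreover have "norm (of_real (r * s) - r *\<^sub>R h) = r * norm (of_real s - h)"
    using assms(2) by (metis abs_of_nonneg norm_scaleR scaleR_conv_of_real scaleR_diff_right of_real_mult)
  ultimately have "norm (of_real (r * s) - r *\<^sub>R h) \<le> r * s" "r * s \<ge> 0"
    using assms(2) by (auto simp: mult_left_mono)
  then show ?thesis using assms(1) unfolding cpos_def by auto
qed

lemma cpos_0 [simp]: "cpos 0" by (auto simp: cpos_def)

lemma cpos_of_real: "0 \<le> r \<Longrightarrow> cpos (of_real r)" by (auto simp: cpos_def)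

lemma cpos_norm_minus: "star h = h \<Longrightarrow> cpos (of_real (norm h) - h)"
  unfolding cpos_def by (auto simp: star_diff intro!: exI[of _ "norm h"])

text \<open>Commuting self-adjoint \<open>h, k\<close> are the real and imaginary part of a normal element, whose
  norm they cannot exceed.\<close>

lemma commuting_norm:
  fixes h k :: "'a::unital_cstar_algebra"
  assumes "star h = h" "star k = k" "h * k = k * h"
  shows "(norm h)\<^sup>2 \<le> norm (h * h + k * k)"
proof -
  define u where "u = h + \<i> *\<^sub>C k"
  have su: "star u = h - \<i> *\<^sub>C k"
    using assms by (simp add: u_def star_add star_scaleC scaleC_minus_left)
  have uu: "star u * u = h * h + k * k"
    unfolding su by (simp add: u_def algebra_simps mult_scaleC_left mult_scaleC_right scaleC_scaleC
        scaleC_minus_left scaleC_add_right scaleC_diff_right assms)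
  have "2 *\<^sub>R h = u + star u" unfolding su by (simp add: u_def scaleR_2)
  then have "2 * norm h = norm (u + star u)" by (metis norm_scaleR abs_numeral)
  then have "2 * norm h \<le> 2 * norm u"
    using norm_triangle_ineq[of u "star u"] by simp
  then have "(norm h)\<^sup>2 \<le> (norm u)\<^sup>2" by (simp add: power_mono)
  also have "\<dots> = norm (h * h + k * k)" using cstar_identity[of u] uu by simp
  finally show ?thesis .
qed

text \<open>Reduce to \<open>\<parallel>h\<parallel> = 1\<close>.  Then \<open>h\<close> and \<open>sqrt (1 - h\<^sup>2)\<close> are the two parts of a unitary, so the latter has norm
at most \<open>1\<close>, and so does its square \<open>1 - h\<^sup>2\<close>.\<close>

lemma cpos_square:
  assumes "star k = (k::'a::unital_cstar_algebra)"
  shows "cpos (k * k)"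
proof (cases "k = 0")
  case False
  define h where "h = (1 / norm k) *\<^sub>R k"
  have h: "star h = h" "norm h = 1" using False assms by (auto simp: h_def)
  have n1: "norm (h * h) \<le> 1" using norm_mult_ineq[of h h] h by simp
  obtain y where y: "star y = y" "(1 - y) * (1 - y) = 1 - h * h"
    "\<And>z. z * (h * h) = (h * h) * z \<Longrightarrow> z * y = y * z"
    using sqrt_one_minus[OF n1] h by (metis star_mult)
  have "h * y = y * h" by (rule y(3)) (simp add: mult.assoc)
  then have "(norm (1 - y))\<^sup>2 \<le> norm ((1 - y) * (1 - y) + h * h)"
    by (intro commuting_norm) (auto simp: star_diff y h algebra_simps)
  then have "norm (1 - y) \<le> 1" using y by (simp add: abs_square_le_1)
  then have "norm (1 - h * h) \<le> 1"
    using norm_mult_ineq[of "1 - y" "1 - y"] y(2) mult_le_one[of "norm (1 - y)" "norm (1 - y)"] by simp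
  then have "cpos (h * h)" unfolding cpos_def using h by (auto simp: star_mult intro!: exI[of _ 1])
  then have "cpos ((norm k)\<^sup>2 *\<^sub>R (h * h))" by (intro cpos_scaleR) auto
  then show ?thesis using False by (simp add: h_def power2_eq_square)
qed simp

lemma cpos_sqrt:
  fixes h :: "'a::unital_cstar_algebra"
  assumes "cpos h"
  obtains k where "cpos k" "k * k = h" "\<And>z. z * h = h * z \<Longrightarrow> z * k = k * z"
proof -
  obtain t where t: "t \<ge> 0" "norm (of_real t - h) \<le> t" using assms by (auto simp: cpos_def)
  show thesis
  proof (cases "t = 0")
    case True
    then show ?thesis using that[of 0] t by auto
  next
    case False
    then have t0: "t > 0" using t by simp
    define x where "x = 1 - (1/t) *\<^sub>R h"
    have sx: "star x = x" using assms by (simp add: x_def star_diff cpos_selfadjoint)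
    have hx: "h = t *\<^sub>R (1 - x)" using t0 by (simp add: x_def)
    have "of_real t - h = t *\<^sub>R x" by (simp add: hx algebra_simps of_real_def)
    then have "norm x \<le> 1" using t t0 by simp
    then obtain y where y: "norm y \<le> 1" "star y = y" "(1 - y) * (1 - y) = 1 - x"
      "\<And>z. z * x = x * z \<Longrightarrow> z * y = y * z" using sqrt_one_minus sx by blast
    define k where "k = sqrt t *\<^sub>R (1 - y)"
    have "cpos (1 - y)" unfolding cpos_def using y by (auto simp: star_diff intro!: exI[of _ 1])
    then have "cpos k" unfolding k_def using t0 by (intro cpos_scaleR) auto
    moreover have "k * k = h" using t0 by (simp add: k_def y hx)
    moreover have "z * k = k * z" if "z * h = h * z" for z
    proof -
      have "z * x = x * z" using that by (simp add: x_def algebra_simps)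
      from y(4)[OF this] show ?thesis by (simp add: k_def algebra_simps)
    qed
    ultimately show ?thesis using that by blast
  qed
qed

lemma cpos_mult:
  assumes "cpos h" "cpos k" "h * k = k * h"
  shows "cpos (h * k)"
proof -
  obtain a where a: "cpos a" "a * a = h" "\<And>z. z * h = h * z \<Longrightarrow> z * a = a * z"
    using cpos_sqrt assms by metis
  obtain b where b: "cpos b" "b * b = k" "\<And>z. z * k = k * z \<Longrightarrow> z * b = b * z"
    using cpos_sqrt assms by metis
  have "k * a = a * k" using a(3)[of k] assms(3) by simp
  then have ab: "a * b = b * a" using b(3)[of a] by simp
  have "h * k = (a * b) * (a * b)" using a(2) b(2) ab by (metis mult.assoc)
  moreover have "star (a * b) = a * b" using a(1) b(1) ab by (simp add: star_mult cpos_selfadjoint)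
  ultimately show ?thesis using cpos_square by metis
qed

lemma cpos_antisym:
  assumes "cpos h" "cpos (- h)"
  shows "h = 0"
proof -
  obtain a where a: "cpos a" "a * a = h" "\<And>z. z * h = h * z \<Longrightarrow> z * a = a * z"
    using cpos_sqrt assms by metis
  obtain b where b: "cpos b" "b * b = - h" "\<And>z. z * (- h) = (- h) * z \<Longrightarrow> z * b = b * z"
    using cpos_sqrt assms by metis
  have "a * (- h) = (- h) * a" using a(2) by (simp add: mult.assoc flip: a(2))
  then have "a * b = b * a" using b(3) by blast
  then have "(norm a)\<^sup>2 \<le> norm (a * a + b * b)"
    using a(1) b(1) by (intro commuting_norm) (auto simp: cpos_selfadjoint)
  then show ?thesis using a(2) b(2) by simp
qed

text \<open>The square roots of \<open>h\<close> and \<open>r - h\<close> commute and their squares add up to \<open>r\<close>, so each of them has norm at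
most \<open>sqrt r\<close>.\<close>

lemma cpos_norm_le:
  assumes "cpos h" "cpos (of_real r - h)" "0 \<le> r"
  shows "norm h \<le> r"
proof -
  obtain a where a: "cpos a" "a * a = h" "\<And>z. z * h = h * z \<Longrightarrow> z * a = a * z"
    using cpos_sqrt assms by metis
  obtain b where b: "cpos b" "b * b = of_real r - h"
    "\<And>z. z * (of_real r - h) = (of_real r - h) * z \<Longrightarrow> z * b = b * z"
    using cpos_sqrt assms by metis
  have "a * h = h * a" by (simp add: mult.assoc flip: a(2))
  then have "a * (of_real r - h) = (of_real r - h) * a" by (simp add: algebra_simps of_real_def)
  then have "a * b = b * a" using b(3) by blast
  then have "(norm a)\<^sup>2 \<le> norm (a * a + b * b)"
    using a(1) b(1) by (intro commuting_norm) (auto simp: cpos_selfadjoint)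
  then have "(norm a)\<^sup>2 \<le> r" using a(2) b(2) assms(3) by simp
  then show ?thesis using norm_mult_ineq[of a a] a(2) by (simp add: power2_eq_square)
qed

lemma cpos_norm_mono:
  assumes "cpos h" "cpos (k - h)"
  shows "norm h \<le> norm k"
proof -
  have "cpos k" using cpos_add[OF assms] by simp
  then have "cpos ((of_real (norm k) - k) + (k - h))"
    by (intro cpos_add cpos_norm_minus assms) (auto simp: cpos_selfadjoint)
  then show ?thesis using assms by (intro cpos_norm_le) (auto)
qed

text \<open>As \<open>(t + z y) z = z (t + y z)\<close>, expanding a power of \<open>t + z y\<close> leaves, apart from \<open>t ^ n\<close>, only terms
\<open>z (t + y z) ^ k y\<close>.  So the powers of \<open>t + z y\<close> grow no faster than those of \<open>t + y z\<close>, up to a factor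
linear in \<open>n\<close>; this replaces the fact that \<open>y z\<close> and \<open>z y\<close> have the same nonzero spectrum.\<close>

lemma norm_of_real_add_swap:
  fixes y z :: "'a::unital_cstar_algebra"
  assumes t: "0 \<le> t" and le: "norm (of_real t + y * z) \<le> t"
  shows "norm ((of_real t + z * y) ^ n) \<le> t ^ n + real n * t ^ (n - 1) * (norm z * norm y)"
proof -
  define f where "f = of_real t + y * z"
  define g where "g = of_real t + z * y"
  have zf: "z * f ^ n = g ^ n * z" for n
  proof (induction n)
    case (Suc n)
    have "z * f = g * z" by (simp add: f_def g_def algebra_simps of_real_def)
    then have "z * f ^ Suc n = g * (z * f ^ n)" by (simp add: mult.assoc[symmetric])
    then show ?case using Suc by (simp add: mult.assoc)
  qed simp
  have gn: "g ^ n = of_real (t ^ n) + (\<Sum>k<n. of_real (t ^ (n - 1 - k)) * (z * f ^ k * y))" for n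
  proof (induction n)
    case (Suc n)
    have "g ^ Suc n = g ^ n * of_real t + g ^ n * z * y"
      by (simp add: g_def power_commutes[symmetric] distrib_right distrib_left mult.assoc power_Suc2 del: power_Suc)
    also have "g ^ n * z * y = z * f ^ n * y" by (simp add: zf)
    also have "g ^ n * of_real t = of_real t * g ^ n" by (simp add: of_real_def)
    also have "\<dots> = of_real (t ^ Suc n) + (\<Sum>k<n. of_real (t ^ (n - k)) * (z * f ^ k * y))"
    proof -
      have "of_real t * (of_real (t ^ (n - 1 - k)) * (z * f ^ k * y)) = of_real (t ^ (n - k)) * (z * f ^ k * y)"
        if "k < n" for k
      proof -
        have "n - k = Suc (n - 1 - k)" using that by simp
        then show ?thesis by (metis (no_types, lifting) mult.assoc of_real_mult power_Suc)
      qed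
      then show ?thesis by (simp add: Suc distrib_left sum_distrib_left)
    qed
    finally show ?case by (simp add: algebra_simps)
  qed simp
  have "norm (of_real (t ^ (n - 1 - k)) * (z * f ^ k * y)) \<le> t ^ (n - 1) * (norm z * norm y)"
    if "k < n" for k
  proof -
    have "norm (z * f ^ k * y) \<le> norm z * norm (f ^ k) * norm y"
      by (meson mult_right_mono norm_ge_zero norm_mult_ineq order_trans)
    also have "norm (f ^ k) \<le> t ^ k"
      using le t by (metis f_def norm_ge_zero norm_power_ineq order_trans power_mono)
    finally have "norm (z * f ^ k * y) \<le> norm z * t ^ k * norm y"
      by (simp add: mult_left_mono mult_right_mono)
    then have "t ^ (n - 1 - k) * norm (z * f ^ k * y) \<le> t ^ (n - 1 - k) * (norm z * t ^ k * norm y)"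
      using t by (intro mult_left_mono) auto
    also have "\<dots> = t ^ (n - 1) * (norm z * norm y)"
      using that by (simp add: mult.assoc mult.left_commute flip: power_add)
    finally show ?thesis using t by (metis abs_of_nonneg norm_scaleR scaleR_conv_of_real zero_le_power)
  qed
  then have "norm (\<Sum>k<n. of_real (t ^ (n - 1 - k)) * (z * f ^ k * y)) \<le> (\<Sum>k<n. t ^ (n - 1) * (norm z * norm y))"
    by (intro sum_norm_le) auto
  then have "norm (g ^ n) \<le> t ^ n + (\<Sum>k<n. t ^ (n - 1) * (norm z * norm y))"
    unfolding gn[of n]
    using norm_triangle_ineq[of "of_real (t ^ n)" "\<Sum>k<n. of_real (t ^ (n - 1 - k)) * (z * f ^ k * y)"] t
    by (simp add: norm_power del: of_real_power)
  then show ?thesis by (simp add: g_def)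
qed

text \<open>The linear factor \<open>2 ^ k\<close> is absorbed by an arbitrarily small increase of \<open>t\<close>, by Bernoulli.\<close>

lemma real_le_of_power_bound:
  fixes a t C :: real
  assumes "0 \<le> a" "0 \<le> t" "0 \<le> C" and le: "\<And>k. a ^ (2 ^ k) \<le> t ^ (2 ^ k) + 2 ^ k * t ^ (2 ^ k - 1) * C"
  shows "a \<le> t"
proof (rule field_le_epsilon)
  fix e :: real assume e: "0 < e"
  have e1: "e * real n * t ^ (n - 1) \<le> (t + e) ^ n" for n
  proof (induction n)
    case (Suc n)
    have "e * real (Suc n) * t ^ n = e * t ^ n + t * (e * real n * t ^ (n - 1))"
      by (cases n) (auto simp: algebra_simps)
    also have "\<dots> \<le> e * (t + e) ^ n + t * (t + e) ^ n"
      using e assms by (intro add_mono mult_left_mono Suc power_mono) auto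
    finally show ?case by (simp add: algebra_simps)
  qed simp
  have "a ^ (2 ^ k) \<le> (1 + C / e) * (t + e) ^ (2 ^ k)" for k
  proof -
    have "t ^ (2 ^ k) \<le> (t + e) ^ (2 ^ k)" using e assms by (intro power_mono) auto
    moreover have "2 ^ k * t ^ (2 ^ k - 1) * C \<le> C / e * (t + e) ^ (2 ^ k)"
    proof -
      have "C / e * (e * 2 ^ k * t ^ (2 ^ k - 1)) \<le> C / e * (t + e) ^ (2 ^ k)"
        using e1[of "2 ^ k"] assms e by (intro mult_left_mono) auto
      moreover have "C / e * (e * 2 ^ k * t ^ (2 ^ k - 1)) = 2 ^ k * t ^ (2 ^ k - 1) * C"
        using e by simp
      ultimately show ?thesis by simp
    qed
    ultimately have "a ^ (2 ^ k) \<le> (t + e) ^ (2 ^ k) + C / e * (t + e) ^ (2 ^ k)"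
      using le[of k] by linarith
    then show ?thesis by (metis distrib_right mult_1)
  qed
  moreover have "0 \<le> t + e" using assms(2) e by simp
  ultimately show "a \<le> t + e" using le_of_iterated_squares assms(1) by blast
qed

lemma cpos_minus_swap:
  fixes y :: "'a::unital_cstar_algebra"
  assumes "cpos (- (star y * y))"
  shows "cpos (- (y * star y))"
proof -
  obtain t where t: "t \<ge> 0" "norm (of_real t + star y * y) \<le> t" using assms by (auto simp: cpos_def)
  have s: "star (of_real t + y * star y) = of_real t + y * star y"
    by (simp add: star_add star_mult star_star)
  have "norm (of_real t + y * star y) \<le> t"
  proof (rule real_le_of_power_bound[where C = "norm y * norm (star y)"])
    show "norm (of_real t + y * star y) ^ (2 ^ k) \<le>
      t ^ (2 ^ k) + 2 ^ k * t ^ (2 ^ k - 1) * (norm y * norm (star y))" for k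
      using norm_of_real_add_swap[OF t, of "2 ^ k"] norm_power2_selfadjoint[OF s, of k] by simp
  qed (use t in auto)
  then show ?thesis using t s by (auto simp: cpos_def star_mult star_star)
qed

lemma real_imag_parts:
  fixes y :: "'a::unital_cstar_algebra"
  obtains a b where "star a = a" "star b = b" "y = a + \<i> *\<^sub>C b" "norm a \<le> norm y" "norm b \<le> norm y"
    "star y * y + y * star y = 2 *\<^sub>R (a * a + b * b)"
proof -
  define a where "a = (1/2) *\<^sub>R (y + star y)"
  define b where "b = (- \<i> / 2) *\<^sub>C (y - star y)"
  have a: "star a = a" by (simp add: a_def star_add star_star)
  have b: "star b = b" by (simp add: b_def star_scaleC star_diff star_star scaleC_minus_left
        scaleC_minus_right scaleC_diff_right)
  have y: "y = a + \<i> *\<^sub>C b"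
  proof -
    have "\<i> *\<^sub>C b = (1/2) *\<^sub>R (y - star y)"
      by (simp add: b_def scaleC_scaleC flip: scaleC_of_real)
    then show ?thesis by (simp add: a_def flip: scaleR_add_right)
  qed
  have sy: "star y = a - \<i> *\<^sub>C b"
    by (simp add: y star_add star_scaleC a b scaleC_minus_left)
  have "norm a \<le> norm y" using norm_triangle_ineq[of y "star y"] by (simp add: a_def)
  moreover have "norm b \<le> norm y"
    using norm_triangle_ineq4[of y "star y"] by (simp add: b_def norm_scaleC norm_divide)
  moreover have "star y * y + y * star y = 2 *\<^sub>R (a * a + b * b)"
    unfolding sy by (simp add: y algebra_simps mult_scaleC_left mult_scaleC_right scaleC_scaleC
        scaleC_minus_left scaleC_add_right scaleC_diff_right scaleR_2)
  ultimately show thesis using that a b y by blast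
qed

text \<open>Kaplansky's argument: if \<open>x* x\<close> were not positive, compressing it to its negative part
  would give \<open>y \<noteq> 0\<close> with \<open>y* y \<le> 0\<close>, hence \<open>y y* \<le> 0\<close>, whereas \<open>y* y + y y* \<ge> 0\<close>.\<close>

lemma cpos_star_mult_self:
  fixes x :: "'a::unital_cstar_algebra"
  shows "cpos (star x * x)"
proof -
  define h where "h = star x * x"
  have sh: "star h = h" by (simp add: h_def star_mult star_star)
  obtain m where m: "cpos m" "m * m = h * h" "\<And>z. z * (h * h) = (h * h) * z \<Longrightarrow> z * m = m * z"
    using cpos_sqrt[OF cpos_square[OF sh]] by metis
  obtain k where k: "cpos k" "k * k = m" "\<And>z. z * m = m * z \<Longrightarrow> z * k = k * z"
    using cpos_sqrt[OF m(1)] by metis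
  have hm: "h * m = m * h" by (rule m(3)) (simp add: mult.assoc)
  have hk: "h * k = k * h" by (rule k(3)) (simp add: hm)
  have km: "m * k = k * m" by (rule k(3)) simp
  define n where "n = m - h"
  have sn: "star n = n" using m(1) sh by (simp add: n_def star_diff cpos_selfadjoint)
  have kn: "k * n = n * k" using hk km by (simp add: n_def algebra_simps)
  have hn: "h * n = - (m * n)" using hm m(2) by (simp add: n_def algebra_simps)
  \<comment> \<open>\<open>n\<close> is twice the negative part of \<open>h\<close>\<close>
  define y where "y = x * n"
  have "star y * y = n * (h * n)" by (simp add: y_def h_def star_mult sn mult.assoc)
  also have "\<dots> = - (n * (k * k) * n)" by (simp add: hn k(2) mult.assoc)
  also have "n * (k * k) * n = (k * n) * (k * n)" using kn by (metis mult.assoc)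
  finally have yy: "- (star y * y) = (k * n) * (k * n)" by simp
  have "star (k * n) = k * n" using sn k(1) kn by (simp add: star_mult cpos_selfadjoint)
  then have neg: "cpos (- (star y * y))" unfolding yy by (rule cpos_square)
  then have neg': "cpos (- (y * star y))" by (rule cpos_minus_swap)
  obtain a b where ab: "star a = a" "star b = b" "star y * y + y * star y = 2 *\<^sub>R (a * a + b * b)"
    using real_imag_parts[of y] by metis
  have "cpos (star y * y + y * star y)"
    unfolding ab(3) by (intro cpos_scaleR cpos_add cpos_square ab) auto
  from cpos_add[OF this neg'] have "cpos (star y * y)" by simp
  with neg have "star y * y = 0" using cpos_antisym by blast
  then have "y = 0" by (simp add: star_mult_self_eq_0)
  then have "h * n = 0" by (simp add: y_def h_def mult.assoc)
  then have "m * n = 0" using hn by simp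
  then have "star n * n = 0" using \<open>h * n = 0\<close> by (simp add: sn) (simp add: n_def algebra_simps)
  then have "m = h" by (simp add: star_mult_self_eq_0 n_def)
  then show ?thesis using m(1) h_def by simp
qed

lemma cpos_conj:
  assumes "cpos h"
  shows "cpos (star x * h * x)"
proof -
  obtain k where "cpos k" "k * k = h" using cpos_sqrt assms by metis
  then have "star x * h * x = star (k * x) * (k * x)"
    by (metis cpos_selfadjoint mult.assoc star_mult)
  then show ?thesis using cpos_star_mult_self by metis
qed

lemma norm_one_plus_cpos:
  fixes p :: "'a::unital_cstar_algebra"
  assumes "cpos p"
  shows "1 + norm p \<le> norm (1 + p)"
proof -
  have "cpos (1::'a)" using cpos_of_real[of 1] by simp
  then have "norm (1::'a) \<le> norm (1 + p)" by (rule cpos_norm_mono) (simp add: assms)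
  moreover have "cpos (of_real (norm (1 + p)) - (1 + p))"
    using assms by (intro cpos_norm_minus) (auto simp: star_add cpos_selfadjoint)
  ultimately have "norm p \<le> norm (1 + p) - 1"
    using assms by (intro cpos_norm_le) (auto simp: algebra_simps)
  then show ?thesis by simp
qed

text \<open>A self-adjoint contraction \<open>h\<close> is the mean of the unitaries \<open>h \<plusminus> \<i> sqrt (1 - h\<^sup>2)\<close>.\<close>

lemma contraction_unitary_parts:
  fixes x :: "'a::unital_cstar_algebra"
  assumes "norm x \<le> 1"
  obtains u1 u2 u3 u4 where
    "x = (1/2) *\<^sub>C (u1 + u2 + \<i> *\<^sub>C (u3 + u4))"
    "\<And>u. u \<in> {u1, u2, u3, u4} \<Longrightarrow> star u * u = 1 \<and> u * star u = 1"
proof -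
  have *: "\<exists>u v. h = (1/2) *\<^sub>C (u + v) \<and> star u * u = 1 \<and> u * star u = 1 \<and> star v * v = 1 \<and> v * star v = 1"
    if h: "norm h \<le> 1" "star h = h" for h :: 'a
  proof -
    have "norm (h * h) \<le> 1" using norm_mult_ineq[of h h] h by (meson mult_le_one norm_ge_zero order_trans)
    then obtain y where y: "star y = y" "(1 - y) * (1 - y) = 1 - h * h"
      "\<And>z. z * (h * h) = (h * h) * z \<Longrightarrow> z * y = y * z"
      using sqrt_one_minus h by (metis star_mult)
    have hy: "h * y = y * h" by (rule y(3)) (simp add: mult.assoc)
    define k where "k = 1 - y"
    have k: "star k = k" "k * k = 1 - h * h" "h * k = k * h"
      using y hy by (auto simp: k_def star_diff algebra_simps)
    define u where "u = h + \<i> *\<^sub>C k"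
    define v where "v = h - \<i> *\<^sub>C k"
    have s: "star u = v" "star v = u"
      using h k by (auto simp: u_def v_def star_add star_diff star_scaleC scaleC_minus_left)
    have "u * v = 1" "v * u = 1"
      using k by (auto simp: u_def v_def algebra_simps mult_scaleC_left mult_scaleC_right scaleC_scaleC scaleC_minus_left
        scaleC_add_right scaleC_diff_right)
    moreover have "(1/2) *\<^sub>C (u + v) = h"
    proof -
      have "u + v = 2 *\<^sub>R h" by (simp add: u_def v_def scaleR_2)
      then show ?thesis by (simp add: scaleC_scaleC flip: scaleC_of_real)
    qed
    ultimately show ?thesis using s by metis
  qed
  obtain a b where ab: "star a = a" "star b = b" "x = a + \<i> *\<^sub>C b" "norm a \<le> norm x" "norm b \<le> norm x"
    using real_imag_parts[of x] by metis
  obtain u1 u2 where u: "a = (1/2) *\<^sub>C (u1 + u2)" "star u1 * u1 = 1 \<and> u1 * star u1 = 1 \<and> star u2 * u2 = 1 \<and> u2 * star u2 = 1"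
    using *[of a] ab assms by auto
  obtain u3 u4 where v: "b = (1/2) *\<^sub>C (u3 + u4)" "star u3 * u3 = 1 \<and> u3 * star u3 = 1 \<and> star u4 * u4 = 1 \<and> u4 * star u4 = 1"
    using *[of b] ab assms by auto
  show thesis
    by (rule that[of u1 u2 u3 u4]) (use ab u v in \<open>auto simp: scaleC_add_right scaleC_scaleC mult.commute\<close>)
qed

section \<open>The C*-norm on matrices\<close>

definition mod_ip :: "'a::unital_cstar_algebra vec \<Rightarrow> 'a vec \<Rightarrow> 'a" where
  "mod_ip v w = (\<Sum>i<dim_vec v. star (v $ i) * w $ i)"

lemma module_norm_mod_ip: "module_norm v = sqrt (norm (mod_ip v v))"
  by (simp add: module_norm_def mod_ip_def)

lemma module_norm_square: "(module_norm v)\<^sup>2 = norm (mod_ip v v)"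
  by (simp add: module_norm_mod_ip)

lemma module_norm_nonneg [simp]: "0 \<le> module_norm v"
  by (simp add: module_norm_def)

lemma cpos_sum: "(\<And>i. i \<in> I \<Longrightarrow> cpos (f i)) \<Longrightarrow> cpos (sum f I)"
  by (induction I rule: infinite_finite_induct) (auto intro: cpos_add)

lemma cpos_mod_ip: "cpos (mod_ip v v)"
  unfolding mod_ip_def by (intro cpos_sum cpos_star_mult_self)

lemma star_mod_ip: "dim_vec v = dim_vec w \<Longrightarrow> star (mod_ip v w) = mod_ip w v"
  by (simp add: mod_ip_def star_sum star_mult star_star)

lemma mod_ip_add_right: "dim_vec w = dim_vec v \<Longrightarrow> dim_vec u = dim_vec v
    \<Longrightarrow> mod_ip v (w + u) = mod_ip v w + mod_ip v u"
  by (simp add: mod_ip_def distrib_left sum.distrib)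

lemma mod_ip_add_left: "dim_vec w = dim_vec u \<Longrightarrow> dim_vec v = dim_vec u
    \<Longrightarrow> mod_ip (w + u) v = mod_ip w v + mod_ip u v"
  by (simp add: mod_ip_def distrib_right sum.distrib star_add)

text \<open>The Cauchy--Schwarz inequality, from positivity of the square of
  \<open>v - w \<langle>w, v\<rangle> / \<parallel>w\<parallel>\<^sup>2\<close>.\<close>

lemma mod_ip_cauchy_schwarz:
  assumes "dim_vec v = n" "dim_vec w = n"
  shows "norm (mod_ip w v) \<le> module_norm w * module_norm v"
proof (cases "mod_ip w w = 0")
  case True
  have "w $ i = 0" if "i < n" for i
  proof -
    have "cpos (mod_ip w w - star (w $ i) * w $ i)"
      unfolding mod_ip_def assms
      by (subst sum.remove[of "{..<n}" i]) (use that in \<open>auto intro!: cpos_sum cpos_star_mult_self\<close>)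
    then have "cpos (- (star (w $ i) * w $ i))" by (simp add: True)
    then have "star (w $ i) * w $ i = 0" using cpos_antisym cpos_star_mult_self by blast
    then show ?thesis by (simp add: star_mult_self_eq_0)
  qed
  then have "mod_ip w v = 0" by (simp add: mod_ip_def assms)
  then show ?thesis by simp
next
  case False
  define t where "t = norm (mod_ip w w)"
  have t: "t > 0" using False by (simp add: t_def)
  define q where "q = mod_ip w v"
  have sq: "star q = mod_ip v w" by (simp add: q_def star_mod_ip assms)
  define r where "r = 1 / t"
  define e where "e i = v $ i - w $ i * (r *\<^sub>R q)" for i
  have "star (e i) * e i = star (v $ i) * v $ i - r *\<^sub>R (star (v $ i) * w $ i * q)
      - r *\<^sub>R (star q * (star (w $ i) * v $ i)) + (r * r) *\<^sub>R (star q * (star (w $ i) * w $ i) * q)" for i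
    by (simp add: e_def star_diff star_mult algebra_simps)
  then have "(\<Sum>i<n. star (e i) * e i) = mod_ip v v - r *\<^sub>R (mod_ip v w * q)
      - r *\<^sub>R (star q * mod_ip w v) + (r * r) *\<^sub>R (star q * mod_ip w w * q)"
    unfolding mod_ip_def assms
    by (simp only: sum.distrib sum_subtractf sum_distrib_left sum_distrib_right scaleR_sum_right)
  also have "\<dots> = mod_ip v v - (2 * r) *\<^sub>R (star q * q) + (r * r) *\<^sub>R (star q * mod_ip w w * q)"
    unfolding sq[symmetric] q_def[symmetric]
    by (metis (no_types, lifting) diff_diff_eq mult_2 scaleR_left_distrib)
  finally have eq: "(\<Sum>i<n. star (e i) * e i)
      = mod_ip v v - (2 * r) *\<^sub>R (star q * q) + (r * r) *\<^sub>R (star q * mod_ip w w * q)" .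
  have 1: "cpos (mod_ip v v - (2 * r) *\<^sub>R (star q * q) + (r * r) *\<^sub>R (star q * mod_ip w w * q))"
    unfolding eq[symmetric] by (intro cpos_sum cpos_star_mult_self)
  have "cpos (of_real t - mod_ip w w)"
    unfolding t_def by (intro cpos_norm_minus) (simp add: star_mod_ip)
  then have "cpos (star q * (of_real t - mod_ip w w) * q)" by (rule cpos_conj)
  then have "cpos ((r * r) *\<^sub>R (star q * (of_real t - mod_ip w w) * q))"
    using t by (intro cpos_scaleR) (auto simp: r_def)
  also have "(r * r) *\<^sub>R (star q * (of_real t - mod_ip w w) * q)
      = r *\<^sub>R (star q * q) - (r * r) *\<^sub>R (star q * mod_ip w w * q)"
    using t by (simp add: algebra_simps of_real_def r_def)
  finally have 2: "cpos (r *\<^sub>R (star q * q) - (r * r) *\<^sub>R (star q * mod_ip w w * q))" .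
  have "cpos (mod_ip v v - r *\<^sub>R (star q * q))"
  proof -
    have gen: "a - (2 * r) *\<^sub>R x + y + (r *\<^sub>R x - y) = a - r *\<^sub>R x" for a x y :: 'a
    proof -
      have "(2 * r) *\<^sub>R x = r *\<^sub>R x + r *\<^sub>R x" by (metis mult_2 scaleR_left_distrib)
      then show ?thesis by (simp only: diff_conv_add_uminus minus_add add.assoc) (simp add: add.left_commute)
    qed
    show ?thesis using cpos_add[OF 1 2] unfolding gen .
  qed
  then have "norm (r *\<^sub>R (star q * q)) \<le> norm (mod_ip v v)"
    using t by (intro cpos_norm_mono cpos_scaleR cpos_star_mult_self) (auto simp: r_def)
  then have "(norm q)\<^sup>2 \<le> t * norm (mod_ip v v)"
    using t by (simp add: cstar_identity r_def field_simps)
  also have "\<dots> = (module_norm w * module_norm v)\<^sup>2"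
    by (simp add: power_mult_distrib module_norm_square t_def)
  finally show ?thesis unfolding q_def by (rule power2_le_imp_le) simp
qed

lemma module_norm_triangle:
  assumes "dim_vec v = n" "dim_vec w = n"
  shows "module_norm (v + w) \<le> module_norm v + module_norm w"
proof (rule power2_le_imp_le)
  have "(module_norm (v + w))\<^sup>2 = norm (mod_ip v v + mod_ip v w + mod_ip w v + mod_ip w w)"
    using assms by (simp add: module_norm_square mod_ip_add_left mod_ip_add_right algebra_simps)
  also have "\<dots> \<le> norm (mod_ip v v) + norm (mod_ip v w) + norm (mod_ip w v) + norm (mod_ip w w)"
    by (meson norm_triangle_le order_refl add_mono)
  also have "\<dots> \<le> (module_norm v)\<^sup>2 + module_norm v * module_norm w + module_norm w * module_norm v
      + (module_norm w)\<^sup>2"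
    using assms by (intro add_mono mod_ip_cauchy_schwarz) (auto simp: module_norm_square)
  also have "\<dots> = (module_norm v + module_norm w)\<^sup>2" by (simp add: power2_sum)
  finally show "(module_norm (v + w))\<^sup>2 \<le> (module_norm v + module_norm w)\<^sup>2" .
qed simp

lemma norm_entry_le_module_norm:
  assumes "i < dim_vec v"
  shows "norm (v $ i) \<le> module_norm v"
proof (rule power2_le_imp_le)
  have "cpos (mod_ip v v - star (v $ i) * v $ i)"
    unfolding mod_ip_def
    by (subst sum.remove[of "{..<dim_vec v}" i]) (use assms in \<open>auto intro!: cpos_sum cpos_star_mult_self\<close>)
  then have "norm (star (v $ i) * v $ i) \<le> norm (mod_ip v v)"
    by (intro cpos_norm_mono cpos_star_mult_self)
  then show "(norm (v $ i))\<^sup>2 \<le> (module_norm v)\<^sup>2"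
    by (simp add: cstar_identity module_norm_square)
qed simp

lemma module_norm_le_sum: "module_norm v \<le> (\<Sum>i<dim_vec v. norm (v $ i))"
proof (rule power2_le_imp_le)
  have "norm (mod_ip v v) \<le> (\<Sum>i<dim_vec v. norm (star (v $ i) * v $ i))"
    unfolding mod_ip_def by (rule norm_sum)
  also have "\<dots> = (\<Sum>i<dim_vec v. norm (v $ i) * norm (v $ i))"
    by (simp add: cstar_identity power2_eq_square)
  also have "\<dots> \<le> (\<Sum>i<dim_vec v. norm (v $ i) * (\<Sum>i<dim_vec v. norm (v $ i)))"
    by (intro sum_mono mult_left_mono member_le_sum) auto
  also have "\<dots> = (\<Sum>i<dim_vec v. norm (v $ i))\<^sup>2"
    by (simp add: power2_eq_square sum_distrib_right)
  finally show "(module_norm v)\<^sup>2 \<le> (\<Sum>i<dim_vec v. norm (v $ i))\<^sup>2"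
    by (simp add: module_norm_square)
qed (simp add: sum_nonneg)

lemma module_norm_scaleC: "module_norm (map_vec (scaleC c) v) = cmod c * module_norm v"
proof -
  have "mod_ip (map_vec (scaleC c) v) (map_vec (scaleC c) v) = (cnj c * c) *\<^sub>C mod_ip v v"
    by (simp add: mod_ip_def star_scaleC mult_scaleC_left mult_scaleC_right scaleC_scaleC
        scaleC_sum_right mult.commute)
  then show ?thesis
    by (simp add: module_norm_mod_ip norm_scaleC norm_mult real_sqrt_mult)
qed

lemma index_mat_vec_sum:
  assumes "x \<in> carrier_mat n m" "v \<in> carrier_vec m" "i < n"
  shows "(x *\<^sub>v v) $ i = (\<Sum>j<m. x $$ (i, j) * v $ j)"
  using assms by (auto simp: scalar_prod_def lessThan_atLeast0 intro!: sum.cong)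

lemma index_mat_mult_sum:
  assumes "x \<in> carrier_mat n m" "y \<in> carrier_mat m p" "i < n" "j < p"
  shows "(x * y) $$ (i, j) = (\<Sum>k<m. x $$ (i, k) * y $$ (k, j))"
  using assms by (auto simp: scalar_prod_def lessThan_atLeast0 intro!: sum.cong)

lemma module_norm_mult_le_sum:
  assumes "x \<in> carrier_mat n m" "v \<in> carrier_vec m"
  shows "module_norm (x *\<^sub>v v) \<le> (\<Sum>i<n. \<Sum>j<m. norm (x $$ (i, j))) * module_norm v"
proof -
  have "module_norm (x *\<^sub>v v) \<le> (\<Sum>i<n. norm ((x *\<^sub>v v) $ i))"
    using module_norm_le_sum[of "x *\<^sub>v v"] assms by simp
  also have "\<dots> \<le> (\<Sum>i<n. \<Sum>j<m. norm (x $$ (i, j)) * module_norm v)"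
  proof (rule sum_mono)
    fix i assume "i \<in> {..<n}"
    then have "norm ((x *\<^sub>v v) $ i) = norm (\<Sum>j<m. x $$ (i, j) * v $ j)"
      using index_mat_vec_sum[OF assms, of i] by simp
    also have "\<dots> \<le> (\<Sum>j<m. norm (x $$ (i, j)) * module_norm v)"
    proof (rule sum_norm_le)
      fix j assume "j \<in> {..<m}"
      then have "norm (v $ j) \<le> module_norm v" using assms by (intro norm_entry_le_module_norm) auto
      then show "norm (x $$ (i, j) * v $ j) \<le> norm (x $$ (i, j)) * module_norm v"
        by (meson mult_left_mono norm_ge_zero norm_mult_ineq order_trans)
    qed
    finally show "norm ((x *\<^sub>v v) $ i) \<le> (\<Sum>j<m. norm (x $$ (i, j)) * module_norm v)" .
  qed
  finally show ?thesis by (simp add: sum_distrib_right)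
qed

lemma module_norm_zero_vec [simp]: "module_norm (0\<^sub>v n) = 0"
  by (simp add: module_norm_def)

lemma cstar_mnorm_set_bdd:
  assumes "x \<in> carrier_mat n m"
  shows "bdd_above {module_norm (x *\<^sub>v v) |v. v \<in> carrier_vec (dim_col x) \<and> module_norm v \<le> 1}"
proof (rule bdd_aboveI)
  fix r assume "r \<in> {module_norm (x *\<^sub>v v) |v. v \<in> carrier_vec (dim_col x) \<and> module_norm v \<le> 1}"
  then obtain v where v: "v \<in> carrier_vec m" "module_norm v \<le> 1" "r = module_norm (x *\<^sub>v v)"
    using assms by auto
  have "r \<le> (\<Sum>i<n. \<Sum>j<m. norm (x $$ (i, j))) * module_norm v"
    using v assms module_norm_mult_le_sum by blast
  also have "\<dots> \<le> (\<Sum>i<n. \<Sum>j<m. norm (x $$ (i, j))) * 1"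
    using v by (intro mult_left_mono sum_nonneg) auto
  finally show "r \<le> (\<Sum>i<n. \<Sum>j<m. norm (x $$ (i, j)))" by simp
qed

lemma cstar_mnorm_apply:
  assumes "x \<in> carrier_mat n m" "v \<in> carrier_vec m"
  shows "module_norm (x *\<^sub>v v) \<le> cstar_mnorm x * module_norm v"
proof (cases "module_norm v = 0")
  case True
  then show ?thesis using module_norm_mult_le_sum[OF assms] by simp
next
  case False
  define c where "c = module_norm v"
  have c: "c > 0" using False by (simp add: c_def less_le)
  define w where "w = map_vec (scaleC (complex_of_real (1 / c))) v"
  have w: "w \<in> carrier_vec m" "module_norm w = 1"
    using assms c by (auto simp: w_def module_norm_scaleC norm_divide simp flip: c_def)
  have "x *\<^sub>v w = map_vec (scaleC (complex_of_real (1 / c))) (x *\<^sub>v v)"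
    by (rule eq_vecI)
      (use assms w in \<open>auto simp: index_mat_vec_sum w_def mult_scaleC_right scaleC_sum_right
         simp del: index_mult_mat_vec\<close>)
  then have "module_norm (x *\<^sub>v w) = module_norm (x *\<^sub>v v) / c"
    using c by (simp add: module_norm_scaleC norm_divide del: of_real_divide)
  moreover have "module_norm (x *\<^sub>v w) \<le> cstar_mnorm x"
    unfolding cstar_mnorm_def
    by (rule cSup_upper[OF _ cstar_mnorm_set_bdd[OF assms(1)]]) (use assms w in auto)
  ultimately show ?thesis using c by (simp add: divide_le_eq flip: c_def)
qed

lemma cstar_mnorm_le:
  assumes "x \<in> carrier_mat n m" "0 \<le> c"
    and "\<And>v. v \<in> carrier_vec m \<Longrightarrow> module_norm (x *\<^sub>v v) \<le> c * module_norm v"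
  shows "cstar_mnorm x \<le> c"
  unfolding cstar_mnorm_def
proof (rule cSup_least)
  have "module_norm (x *\<^sub>v 0\<^sub>v m) \<in> {module_norm (x *\<^sub>v v) |v. v \<in> carrier_vec (dim_col x) \<and> module_norm v \<le> 1}"
    using assms by force
  then show "{module_norm (x *\<^sub>v v) |v. v \<in> carrier_vec (dim_col x) \<and> module_norm v \<le> 1} \<noteq> {}" by blast
next
  fix r assume "r \<in> {module_norm (x *\<^sub>v v) |v. v \<in> carrier_vec (dim_col x) \<and> module_norm v \<le> 1}"
  then obtain v where v: "v \<in> carrier_vec m" "module_norm v \<le> 1" "r = module_norm (x *\<^sub>v v)"
    using assms by auto
  then have "r \<le> c * module_norm v" using assms by auto
  also have "\<dots> \<le> c * 1" using v assms by (intro mult_left_mono) auto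
  finally show "r \<le> c" by simp
qed

lemma cstar_mnorm_nonneg:
  assumes "x \<in> carrier_mat n m"
  shows "0 \<le> cstar_mnorm x"
  unfolding cstar_mnorm_def
  by (rule cSup_upper2[OF _ _ cstar_mnorm_set_bdd[OF assms], of "module_norm (x *\<^sub>v 0\<^sub>v m)"])
    (use assms in force)+

lemma cstar_mnorm_le_sum:
  assumes "x \<in> carrier_mat n m"
  shows "cstar_mnorm x \<le> (\<Sum>i<n. \<Sum>j<m. norm (x $$ (i, j)))"
  using assms by (intro cstar_mnorm_le module_norm_mult_le_sum sum_nonneg) auto

lemma module_norm_unit_vec: "module_norm (unit_vec n i :: 'a::unital_cstar_algebra vec) \<le> 1"
proof -
  have "mod_ip (unit_vec n i) (unit_vec n i :: 'a vec) = (\<Sum>j<n. if j = i then 1 else 0)"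
    unfolding mod_ip_def by (intro sum.cong) (auto simp: unit_vec_def)
  then show ?thesis by (auto simp: module_norm_mod_ip sum.delta)
qed

lemma norm_entry_le_cstar_mnorm:
  assumes "x \<in> carrier_mat n m" "i < n" "j < m"
  shows "norm (x $$ (i, j)) \<le> cstar_mnorm x"
proof -
  have "x *\<^sub>v unit_vec m j \<in> carrier_vec n" using assms by simp
  have "(x *\<^sub>v unit_vec m j) $ i = (\<Sum>k<m. x $$ (i, k) * (unit_vec m j $ k))"
    using index_mat_vec_sum[OF assms(1) _ assms(2), of "unit_vec m j"] by simp
  also have "\<dots> = (\<Sum>k<m. if k = j then x $$ (i, k) else 0)"
    by (intro sum.cong) (auto simp: unit_vec_def)
  also have "\<dots> = x $$ (i, j)" using assms by simp
  finally have "norm (x $$ (i, j)) \<le> module_norm (x *\<^sub>v unit_vec m j)"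
    using norm_entry_le_module_norm[of i "x *\<^sub>v unit_vec m j"] assms by simp
  also have "\<dots> \<le> cstar_mnorm x * module_norm (unit_vec m j :: 'a vec)"
    using assms by (intro cstar_mnorm_apply) auto
  also have "\<dots> \<le> cstar_mnorm x * 1"
    using assms by (intro mult_left_mono module_norm_unit_vec cstar_mnorm_nonneg)
  finally show ?thesis by simp
qed

lemma cstar_mnorm_zero [simp]: "cstar_mnorm (0\<^sub>m n m :: 'a::unital_cstar_algebra mat) = 0"
  using cstar_mnorm_le_sum[of "0\<^sub>m n m :: 'a mat" n m] cstar_mnorm_nonneg[of "0\<^sub>m n m :: 'a mat" n m]
  by simp

lemma cstar_mnorm_eq_0_iff:
  assumes "x \<in> carrier_mat n m"
  shows "cstar_mnorm x = 0 \<longleftrightarrow> x = 0\<^sub>m n m"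
proof
  assume "cstar_mnorm x = 0"
  then show "x = 0\<^sub>m n m"
    using assms norm_entry_le_cstar_mnorm[OF assms] by (intro eq_matI) fastforce+
qed simp

lemma cstar_mnorm_triangle:
  assumes x: "x \<in> carrier_mat n m" and y: "y \<in> carrier_mat n m"
  shows "cstar_mnorm (x + y) \<le> cstar_mnorm x + cstar_mnorm y"
proof (rule cstar_mnorm_le)
  fix v :: "'a vec" assume v: "v \<in> carrier_vec m"
  have "module_norm ((x + y) *\<^sub>v v) = module_norm (x *\<^sub>v v + y *\<^sub>v v)"
    using x y v by (simp add: add_mult_distrib_mat_vec)
  also have "\<dots> \<le> module_norm (x *\<^sub>v v) + module_norm (y *\<^sub>v v)"
    using x y by (intro module_norm_triangle) auto
  also have "\<dots> \<le> (cstar_mnorm x + cstar_mnorm y) * module_norm v"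
    using cstar_mnorm_apply[OF x v] cstar_mnorm_apply[OF y v] by (simp add: distrib_right)
  finally show "module_norm ((x + y) *\<^sub>v v) \<le> (cstar_mnorm x + cstar_mnorm y) * module_norm v" .
qed (use x y cstar_mnorm_nonneg in \<open>auto intro: add_nonneg_nonneg\<close>)

lemma cstar_mnorm_mult:
  assumes x: "x \<in> carrier_mat n m" and y: "y \<in> carrier_mat m p"
  shows "cstar_mnorm (x * y) \<le> cstar_mnorm x * cstar_mnorm y"
proof (rule cstar_mnorm_le)
  fix v :: "'a vec" assume v: "v \<in> carrier_vec p"
  have "module_norm ((x * y) *\<^sub>v v) = module_norm (x *\<^sub>v (y *\<^sub>v v))"
    using x y v by simp
  also have "\<dots> \<le> cstar_mnorm x * module_norm (y *\<^sub>v v)"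
    using x y v by (intro cstar_mnorm_apply) auto
  also have "\<dots> \<le> cstar_mnorm x * (cstar_mnorm y * module_norm v)"
    using x y v by (intro mult_left_mono cstar_mnorm_apply cstar_mnorm_nonneg) auto
  finally show "module_norm ((x * y) *\<^sub>v v) \<le> cstar_mnorm x * cstar_mnorm y * module_norm v"
    by (simp add: mult.assoc)
qed (use x y cstar_mnorm_nonneg in \<open>auto intro: mult_nonneg_nonneg\<close>)

lemma cstar_mnorm_scaleC:
  assumes x: "x \<in> carrier_mat n m"
  shows "cstar_mnorm (map_mat (scaleC c) x) = cmod c * cstar_mnorm x"
proof -
  have le: "cstar_mnorm (map_mat (scaleC c) x) \<le> cmod c * cstar_mnorm x"
    if x: "x \<in> carrier_mat n m" for x :: "'a mat" and c
  proof (rule cstar_mnorm_le)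
    fix v :: "'a vec" assume v: "v \<in> carrier_vec m"
    have "map_mat (scaleC c) x *\<^sub>v v = map_vec (scaleC c) (x *\<^sub>v v)"
      by (rule eq_vecI)
        (use x v in \<open>auto simp: index_mat_vec_sum[of _ n m] mult_scaleC_left scaleC_sum_right
          simp del: index_mult_mat_vec\<close>)
    then show "module_norm (map_mat (scaleC c) x *\<^sub>v v) \<le> cmod c * cstar_mnorm x * module_norm v"
      using cstar_mnorm_apply[OF x v] by (simp add: module_norm_scaleC mult.assoc mult_left_mono)
  qed (use x cstar_mnorm_nonneg[OF x] in auto)
  show ?thesis
  proof (cases "c = 0")
    case True
    have "map_mat (scaleC 0) x = 0\<^sub>m n m" using x by (intro eq_matI) auto
    then show ?thesis using True by simp
  next
    case False
    have "map_mat (scaleC (1 / c)) (map_mat (scaleC c) x) = x"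
      using x False by (intro eq_matI) (auto simp: scaleC_scaleC)
    then have "cstar_mnorm x \<le> cmod (1 / c) * cstar_mnorm (map_mat (scaleC c) x)"
      using le[of "map_mat (scaleC c) x" "1 / c"] x by simp
    then have "cmod c * cstar_mnorm x \<le> cstar_mnorm (map_mat (scaleC c) x)"
      using False by (simp add: norm_divide field_simps)
    with le[OF x] show ?thesis by (simp add: order_antisym)
  qed
qed

lemma cstar_mnorm_uminus:
  assumes x: "x \<in> carrier_mat n m"
  shows "cstar_mnorm (- x) = cstar_mnorm x"
proof -
  have "- x = map_mat (scaleC (- 1)) x"
    using x by (intro eq_matI) (auto simp: scaleC_minus_left)
  then show ?thesis using cstar_mnorm_scaleC[OF x, of "- 1"] by simp
qed

lemma cstar_mnorm_minus_commute:
  assumes "x \<in> carrier_mat n m" "y \<in> carrier_mat n m"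
  shows "cstar_mnorm (x - y) = cstar_mnorm (y - x)"
proof -
  have "x - y = - (y - x)" using assms by (intro eq_matI) auto
  then show ?thesis using cstar_mnorm_uminus[of "y - x" n m] minus_carrier_mat[OF assms(1)] by simp
qed

lemma cstar_mnorm_triangle_minus:
  assumes "x \<in> carrier_mat n m" "y \<in> carrier_mat n m" "z \<in> carrier_mat n m"
  shows "cstar_mnorm (x - z) \<le> cstar_mnorm (x - y) + cstar_mnorm (y - z)"
proof -
  have "x - z = (x - y) + (y - z)" using assms by (intro eq_matI) auto
  then show ?thesis using cstar_mnorm_triangle[of "x - y" n m "y - z"] minus_carrier_mat[OF assms(2)] minus_carrier_mat[OF assms(3)] by simp
qed

lemma cstar_mnorm_le_minus:
  assumes "x \<in> carrier_mat n m" "y \<in> carrier_mat n m"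
  shows "cstar_mnorm x \<le> cstar_mnorm y + cstar_mnorm (x - y)"
proof -
  have "x = y + (x - y)" using assms by (intro eq_matI) auto
  then show ?thesis using cstar_mnorm_triangle[of y n m "x - y"] minus_carrier_mat[OF assms(2)] assms by simp
qed

definition mat_star :: "'a::unital_cstar_algebra mat \<Rightarrow> 'a mat" where
  "mat_star x = mat (dim_col x) (dim_row x) (\<lambda>(i, j). star (x $$ (j, i)))"

lemma mat_star_carrier [simp, intro]: "x \<in> carrier_mat n m \<Longrightarrow> mat_star x \<in> carrier_mat m n"
  by (auto simp: mat_star_def)

lemma mat_star_dim [simp]: "dim_row (mat_star x) = dim_col x" "dim_col (mat_star x) = dim_row x"
  by (auto simp: mat_star_def)

lemma mat_star_index [simp]: "i < dim_col x \<Longrightarrow> j < dim_row x \<Longrightarrow> mat_star x $$ (i, j) = star (x $$ (j, i))"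
  by (auto simp: mat_star_def)

lemma mat_star_mat_star [simp]: "mat_star (mat_star x) = x"
  by (intro eq_matI) (auto simp: star_star)

lemma mat_star_mult:
  assumes "x \<in> carrier_mat n m" "y \<in> carrier_mat m p"
  shows "mat_star (x * y) = mat_star y * mat_star x"
  by (rule eq_matI)
    (use assms in \<open>auto simp: index_mat_mult_sum[OF assms]
       index_mat_mult_sum[OF mat_star_carrier[OF assms(2)] mat_star_carrier[OF assms(1)]]
       star_sum star_mult simp del: index_mult_mat(1)\<close>)

lemma mat_star_one [simp]: "mat_star (1\<^sub>m n) = 1\<^sub>m n"
  by (intro eq_matI) auto

lemma mat_star_scaleC: "mat_star (map_mat (scaleC c) x) = map_mat (scaleC (cnj c)) (mat_star x)"
  by (intro eq_matI) (auto simp: star_scaleC)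

lemma mod_ip_mat_star:
  assumes x: "x \<in> carrier_mat n m" and v: "v \<in> carrier_vec m" and w: "w \<in> carrier_vec n"
  shows "mod_ip (x *\<^sub>v v) w = mod_ip v (mat_star x *\<^sub>v w)"
proof -
  have "mod_ip (x *\<^sub>v v) w = (\<Sum>i<n. \<Sum>j<m. star (v $ j) * star (x $$ (i, j)) * w $ i)"
    using x by (simp add: mod_ip_def index_mat_vec_sum[OF x v] star_sum star_mult sum_distrib_right
        del: index_mult_mat_vec)
  also have "\<dots> = (\<Sum>j<m. \<Sum>i<n. star (v $ j) * star (x $$ (i, j)) * w $ i)"
    by (rule sum.swap)
  also have "\<dots> = mod_ip v (mat_star x *\<^sub>v w)"
    using x v by (simp add: mod_ip_def index_mat_vec_sum[OF mat_star_carrier[OF x] w]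
        sum_distrib_left mult.assoc del: index_mult_mat_vec)
  finally show ?thesis .
qed

lemma cstar_mnorm_star [simp]:
  assumes "x \<in> carrier_mat n m"
  shows "cstar_mnorm (mat_star x) = cstar_mnorm x"
proof -
  have le: "cstar_mnorm (mat_star x) \<le> cstar_mnorm x" if x: "x \<in> carrier_mat n m" for x :: "'a mat" and n m
  proof (rule cstar_mnorm_le)
    fix w :: "'a vec" assume w: "w \<in> carrier_vec n"
    let ?u = "mat_star x *\<^sub>v w"
    have u: "?u \<in> carrier_vec m" using x w by (metis mat_star_carrier mult_mat_vec_carrier)
    have "(module_norm ?u)\<^sup>2 = norm (mod_ip (x *\<^sub>v ?u) w)"
      by (simp add: module_norm_square mod_ip_mat_star[OF x u w])
    also have "\<dots> \<le> module_norm (x *\<^sub>v ?u) * module_norm w"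
      by (rule mod_ip_cauchy_schwarz[of _ n]) (use x w in auto)
    also have "\<dots> \<le> cstar_mnorm x * module_norm ?u * module_norm w"
      by (intro mult_right_mono cstar_mnorm_apply[OF x u]) auto
    finally have "module_norm ?u * module_norm ?u \<le> (cstar_mnorm x * module_norm w) * module_norm ?u"
      by (simp add: power2_eq_square mult_ac)
    then show "module_norm ?u \<le> cstar_mnorm x * module_norm w"
      using cstar_mnorm_nonneg[OF x]
      by (cases "module_norm ?u = 0") (auto simp: mult_le_cancel_right less_le)
  qed (use x cstar_mnorm_nonneg in auto)
  show ?thesis using le[OF assms] le[OF mat_star_carrier[OF assms]] by simp
qed

lemma cstar_mnorm_identity:
  assumes x: "x \<in> carrier_mat n m"
  shows "cstar_mnorm (mat_star x * x) = (cstar_mnorm x)\<^sup>2"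
proof (rule antisym)
  show "cstar_mnorm (mat_star x * x) \<le> (cstar_mnorm x)\<^sup>2"
    using cstar_mnorm_mult[OF mat_star_carrier[OF x] x] x by (simp add: power2_eq_square)
  let ?c = "cstar_mnorm (mat_star x * x)"
  have xx: "mat_star x * x \<in> carrier_mat m m" using x by (meson mat_star_carrier mult_carrier_mat)
  have c0: "0 \<le> ?c" using cstar_mnorm_nonneg[OF xx] .
  have "cstar_mnorm x \<le> sqrt ?c"
  proof (rule cstar_mnorm_le[OF x])
    fix v :: "'a vec" assume v: "v \<in> carrier_vec m"
    have "(module_norm (x *\<^sub>v v))\<^sup>2 = norm (mod_ip v (mat_star x *\<^sub>v (x *\<^sub>v v)))"
      using x v by (simp add: module_norm_square mod_ip_mat_star[OF x v, of "x *\<^sub>v v"])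
    also have "mat_star x *\<^sub>v (x *\<^sub>v v) = (mat_star x * x) *\<^sub>v v"
      using x v assoc_mult_mat_vec[OF mat_star_carrier[OF x] x v] by simp
    also have "norm (mod_ip v ((mat_star x * x) *\<^sub>v v)) \<le> module_norm v * module_norm ((mat_star x * x) *\<^sub>v v)"
      by (rule mod_ip_cauchy_schwarz[of _ m]) (use x v in auto)
    also have "\<dots> \<le> module_norm v * (?c * module_norm v)"
      by (intro mult_left_mono cstar_mnorm_apply[OF xx v]) auto
    also have "\<dots> = (sqrt ?c * module_norm v)\<^sup>2"
      using c0 by (simp add: power_mult_distrib power2_eq_square)
    finally show "module_norm (x *\<^sub>v v) \<le> sqrt ?c * module_norm v"
      by (rule power2_le_imp_le) (use c0 in simp)
  qed (use c0 in simp)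
  then have "(cstar_mnorm x)\<^sup>2 \<le> (sqrt ?c)\<^sup>2"
    using cstar_mnorm_nonneg[OF x] by (intro power_mono)
  then show "(cstar_mnorm x)\<^sup>2 \<le> ?c" using c0 by simp
qed

lemma cstar_mnorm_identity':
  assumes x: "x \<in> carrier_mat n m"
  shows "cstar_mnorm (x * mat_star x) = (cstar_mnorm x)\<^sup>2"
  using cstar_mnorm_identity[OF mat_star_carrier[OF x]] x by simp

lemma cstar_mnorm_one [simp]:
  assumes "0 < n"
  shows "cstar_mnorm (1\<^sub>m n :: 'a::unital_cstar_algebra mat) = 1"
proof -
  have "cstar_mnorm (1\<^sub>m n :: 'a mat) \<le> 1"
    by (rule cstar_mnorm_le[of _ n n]) auto
  moreover have "1 \<le> cstar_mnorm (1\<^sub>m n :: 'a mat)"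
    using norm_entry_le_cstar_mnorm[of "1\<^sub>m n :: 'a mat" n n 0 0] assms by simp
  ultimately show ?thesis by simp
qed

lemma cstar_mnorm_1_1: "cstar_mnorm (mat 1 1 (\<lambda>_. a)) = norm (a::'a::unital_cstar_algebra)"
proof (rule antisym)
  show "cstar_mnorm (mat 1 1 (\<lambda>_. a)) \<le> norm a"
    using cstar_mnorm_le_sum[of "mat 1 1 (\<lambda>_. a)" 1 1] by simp
  show "norm a \<le> cstar_mnorm (mat 1 1 (\<lambda>_. a))"
    using norm_entry_le_cstar_mnorm[of "mat 1 1 (\<lambda>_. a)" 1 1 0 0] by simp
qed

text \<open>Homomorphisms are contractive: an a-priori bound on the powers of a self-adjoint matrix
  improves to constant \<open>1\<close>.\<close>

definition msq :: "'a::unital_cstar_algebra mat \<Rightarrow> 'a mat" where "msq x = x * x"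

lemma msq_iterate_carrier:
  "x \<in> carrier_mat n n \<Longrightarrow> (msq ^^ k) x \<in> carrier_mat n n"
  by (induction k) (auto simp: msq_def)

lemma msq_iterate_star:
  "x \<in> carrier_mat n n \<Longrightarrow> mat_star x = x \<Longrightarrow> mat_star ((msq ^^ k) x) = (msq ^^ k) x"
  by (induction k) (auto simp: msq_def mat_star_mult[OF msq_iterate_carrier msq_iterate_carrier])

lemma cstar_mnorm_msq_iterate:
  assumes "x \<in> carrier_mat n n" "mat_star x = x"
  shows "cstar_mnorm ((msq ^^ k) x) = cstar_mnorm x ^ (2 ^ k)"
proof (induction k)
  case (Suc k)
  have "cstar_mnorm ((msq ^^ Suc k) x) = (cstar_mnorm ((msq ^^ k) x))\<^sup>2"
    using cstar_mnorm_identity[OF msq_iterate_carrier[OF assms(1)], of k] msq_iterate_star[OF assms, of k]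
    by (simp add: msq_def)
  then show ?case using Suc by (simp add: power2_eq_square mult_2 power_add)
qed simp

lemma selfadjoint_norm_le_of_squares:
  assumes h: "h \<in> carrier_mat n n" "mat_star h = h" and b: "0 \<le> b"
    and "\<And>k. cstar_mnorm ((msq ^^ k) h) \<le> C * b ^ (2 ^ k)"
  shows "cstar_mnorm h \<le> b"
  using le_of_iterated_squares[OF cstar_mnorm_nonneg[OF h(1)] b, of C]
    assms(4)[unfolded cstar_mnorm_msq_iterate[OF h]] by blast

lemma mat_star_four_block:
  assumes "A \<in> carrier_mat n1 m1" "B \<in> carrier_mat n1 m2" "C \<in> carrier_mat n2 m1" "D \<in> carrier_mat n2 m2"
  shows "mat_star (four_block_mat A B C D) = four_block_mat (mat_star A) (mat_star C) (mat_star B) (mat_star D)"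
  by (rule eq_matI) (use assms in auto)

lemma mat_star_zero [simp]: "mat_star (0\<^sub>m n m) = 0\<^sub>m m n"
  by (rule eq_matI) auto

abbreviation diag_sum :: "'a::zero mat \<Rightarrow> 'a mat \<Rightarrow> 'a mat" where
  "diag_sum x y \<equiv> four_block_mat x (0\<^sub>m (dim_row x) (dim_col y)) (0\<^sub>m (dim_row y) (dim_col x)) y"

lemma diag_sum_mult:
  assumes "x \<in> carrier_mat n n" "y \<in> carrier_mat m m" "x' \<in> carrier_mat n n" "y' \<in> carrier_mat m m"
  shows "diag_sum x y * diag_sum x' y' = diag_sum (x * x') (y * (y' :: 'a::semiring_0 mat))"
  using assms by (subst mult_four_block_mat[of _ n n _ m _ m _ _ n _ m]) auto

lemma sum_lessThan_add:
  fixes b :: nat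
  shows "(\<Sum>i<a + b. f i) = (\<Sum>i<a. f i) + (\<Sum>i<b. f (a + i) :: 'a::comm_monoid_add)"
  by (induction b) (simp_all add: add.assoc)

lemma module_norm_append:
  "module_norm (v @\<^sub>v w) \<le> module_norm v + module_norm w"
  "module_norm v \<le> module_norm (v @\<^sub>v w)"
  "module_norm w \<le> module_norm (v @\<^sub>v w)"
proof -
  have ip: "mod_ip (v @\<^sub>v w) (v @\<^sub>v w) = mod_ip v v + mod_ip w w"
    by (simp add: mod_ip_def sum_lessThan_add)
  have "norm (mod_ip v v + mod_ip w w) \<le> (module_norm v + module_norm w)\<^sup>2"
    using norm_triangle_ineq[of "mod_ip v v" "mod_ip w w"]
    by (simp add: power2_sum module_norm_square add_increasing2)
  then have "(module_norm (v @\<^sub>v w))\<^sup>2 \<le> (module_norm v + module_norm w)\<^sup>2"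
    unfolding module_norm_square[of "v @\<^sub>v w"] ip .
  then show "module_norm (v @\<^sub>v w) \<le> module_norm v + module_norm w"
    by (rule power2_le_imp_le) (simp add: add_nonneg_nonneg)
  show "module_norm v \<le> module_norm (v @\<^sub>v w)" "module_norm w \<le> module_norm (v @\<^sub>v w)"
    by (auto simp: module_norm_mod_ip ip intro!: cpos_norm_mono cpos_mod_ip)
qed

lemma cstar_mnorm_block_le:
  assumes x: "x \<in> carrier_mat n1 m1" and y: "y \<in> carrier_mat n2 m2"
  shows "cstar_mnorm (diag_sum x y) \<le> cstar_mnorm x + cstar_mnorm y"
    and "cstar_mnorm x \<le> cstar_mnorm (diag_sum x y)"
    and "cstar_mnorm y \<le> cstar_mnorm (diag_sum x y)"
proof -
  have split: "\<exists>v w. u = v @\<^sub>v w \<and> v \<in> carrier_vec m1 \<and> w \<in> carrier_vec m2" if "u \<in> carrier_vec (m1 + m2)" for u :: "'a vec"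
    using that by (intro exI[of _ "vec_first u m1"] exI[of _ "vec_last u m2"]) auto
  have app: "diag_sum x y *\<^sub>v (v @\<^sub>v w) = (x *\<^sub>v v) @\<^sub>v (y *\<^sub>v w)"
    if "v \<in> carrier_vec m1" "w \<in> carrier_vec m2" for v w
    using x y that by (subst four_block_mat_mult_vec[of _ n1 m1 _ m2 _ n2]) auto
  have d: "diag_sum x y \<in> carrier_mat (n1 + n2) (m1 + m2)" using x y by auto
  have d0: "0 \<le> cstar_mnorm (diag_sum x y)" by (rule cstar_mnorm_nonneg[OF d])
  show "cstar_mnorm (diag_sum x y) \<le> cstar_mnorm x + cstar_mnorm y"
  proof (rule cstar_mnorm_le[OF d])
    fix u :: "'a vec" assume "u \<in> carrier_vec (m1 + m2)"
    then obtain v w where u: "u = v @\<^sub>v w" "v \<in> carrier_vec m1" "w \<in> carrier_vec m2" using split by blast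
    have "module_norm (diag_sum x y *\<^sub>v u) \<le> module_norm (x *\<^sub>v v) + module_norm (y *\<^sub>v w)"
      unfolding u(1) app[OF u(2,3)] by (rule module_norm_append)
    also have "\<dots> \<le> cstar_mnorm x * module_norm v + cstar_mnorm y * module_norm w"
      using x y u by (intro add_mono cstar_mnorm_apply)
    also have "\<dots> \<le> cstar_mnorm x * module_norm u + cstar_mnorm y * module_norm u"
      unfolding u(1) using x y
      by (intro add_mono mult_left_mono module_norm_append cstar_mnorm_nonneg)
    finally show "module_norm (diag_sum x y *\<^sub>v u) \<le> (cstar_mnorm x + cstar_mnorm y) * module_norm u"
      by (simp add: distrib_right)
  qed (use x y cstar_mnorm_nonneg in \<open>auto intro: add_nonneg_nonneg\<close>)
  show "cstar_mnorm x \<le> cstar_mnorm (diag_sum x y)"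
  proof (rule cstar_mnorm_le[OF x d0])
    fix v :: "'a vec" assume v: "v \<in> carrier_vec m1"
    have "module_norm (x *\<^sub>v v) \<le> module_norm (diag_sum x y *\<^sub>v (v @\<^sub>v 0\<^sub>v m2))"
      using v by (simp add: app module_norm_append)
    also have "\<dots> \<le> cstar_mnorm (diag_sum x y) * module_norm (v @\<^sub>v (0\<^sub>v m2 :: 'a vec))"
      using v by (intro cstar_mnorm_apply[OF d]) auto
    also have "module_norm (v @\<^sub>v (0\<^sub>v m2 :: 'a vec)) \<le> module_norm v"
      using module_norm_append(1)[of v "0\<^sub>v m2"] by simp
    finally show "module_norm (x *\<^sub>v v) \<le> cstar_mnorm (diag_sum x y) * module_norm v"
      using d0 by (simp add: mult_left_mono)
  qed
  show "cstar_mnorm y \<le> cstar_mnorm (diag_sum x y)"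
  proof (rule cstar_mnorm_le[OF y d0])
    fix v :: "'a vec" assume v: "v \<in> carrier_vec m2"
    have "module_norm (y *\<^sub>v v) \<le> module_norm (diag_sum x y *\<^sub>v (0\<^sub>v m1 @\<^sub>v v))"
      using v by (simp add: app module_norm_append)
    also have "\<dots> \<le> cstar_mnorm (diag_sum x y) * module_norm ((0\<^sub>v m1 :: 'a vec) @\<^sub>v v)"
      using v by (intro cstar_mnorm_apply[OF d]) auto
    also have "module_norm ((0\<^sub>v m1 :: 'a vec) @\<^sub>v v) \<le> module_norm v"
      using module_norm_append(1)[of "0\<^sub>v m1" v] by simp
    finally show "module_norm (y *\<^sub>v v) \<le> cstar_mnorm (diag_sum x y) * module_norm v"
      using d0 by (simp add: mult_left_mono)
  qed
qed

lemma msq_iterate_diag_sum: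
  assumes "x \<in> carrier_mat n n" "y \<in> carrier_mat m m"
  shows "(msq ^^ k) (diag_sum x y) = diag_sum ((msq ^^ k) x) ((msq ^^ k) y)"
proof (induction k)
  case (Suc k)
  then show ?case using msq_iterate_carrier[OF assms(1), of k] msq_iterate_carrier[OF assms(2), of k]
    by (simp only: funpow.simps comp_def msq_def[of "diag_sum _ _"] diag_sum_mult)
      (simp add: msq_def)
qed simp

text \<open>An operator on a direct sum of Hilbert modules is not visibly bounded by the maximum of its
blocks, since \<open>\<langle>x v, x v\<rangle> \<le> \<parallel>x\<parallel>\<^sup>2 \<langle>v, v\<rangle>\<close> is an inequality in the algebra.  The bound by the sum of the blocks
is elementary, and powers improve it.\<close>

lemma cstar_mnorm_diag_sum:
  assumes x: "x \<in> carrier_mat n n" and y: "y \<in> carrier_mat m m"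
  shows "cstar_mnorm (diag_sum x y) = max (cstar_mnorm x) (cstar_mnorm y)"
proof (rule antisym)
  show "max (cstar_mnorm x) (cstar_mnorm y) \<le> cstar_mnorm (diag_sum x y)"
    using cstar_mnorm_block_le[OF x y] by simp
  let ?b = "max (cstar_mnorm x) (cstar_mnorm y)"
  let ?h = "mat_star x * x" and ?g = "mat_star y * y"
  have h: "?h \<in> carrier_mat n n" "mat_star ?h = ?h" and g: "?g \<in> carrier_mat m m" "mat_star ?g = ?g"
    using x y by (auto simp: mat_star_mult[OF mat_star_carrier[OF x] x] mat_star_mult[OF mat_star_carrier[OF y] y])
  have b: "0 \<le> ?b" using cstar_mnorm_nonneg[OF x] by simp
  have "mat_star (diag_sum x y) = diag_sum (mat_star x) (mat_star y)"
    using x y by (subst mat_star_four_block[of _ n n _ m _ m]) auto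
  then have sq: "mat_star (diag_sum x y) * diag_sum x y = diag_sum ?h ?g"
    using diag_sum_mult[OF mat_star_carrier[OF x] mat_star_carrier[OF y] x y] x y by simp
  have "cstar_mnorm (diag_sum ?h ?g) \<le> ?b\<^sup>2"
  proof (rule selfadjoint_norm_le_of_squares[where C = 2])
    show "diag_sum ?h ?g \<in> carrier_mat (n + m) (n + m)" using h g by auto
    show "mat_star (diag_sum ?h ?g) = diag_sum ?h ?g"
      using h g x y by (subst mat_star_four_block[of _ n n _ m _ m]) auto
    fix k
    have "cstar_mnorm ((msq ^^ k) (diag_sum ?h ?g)) \<le> cstar_mnorm ((msq ^^ k) ?h) + cstar_mnorm ((msq ^^ k) ?g)"
      unfolding msq_iterate_diag_sum[OF h(1) g(1)]
      using msq_iterate_carrier[OF h(1)] msq_iterate_carrier[OF g(1)] by (rule cstar_mnorm_block_le)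
    also have "\<dots> = (cstar_mnorm x)\<^sup>2 ^ (2 ^ k) + (cstar_mnorm y)\<^sup>2 ^ (2 ^ k)"
      using x y by (simp add: cstar_mnorm_msq_iterate[OF h] cstar_mnorm_msq_iterate[OF g] cstar_mnorm_identity)
    also have "\<dots> \<le> ?b\<^sup>2 ^ (2 ^ k) + ?b\<^sup>2 ^ (2 ^ k)"
      using cstar_mnorm_nonneg[OF x] cstar_mnorm_nonneg[OF y] by (intro add_mono power_mono) auto
    finally show "cstar_mnorm ((msq ^^ k) (diag_sum ?h ?g)) \<le> 2 * ?b\<^sup>2 ^ (2 ^ k)" by simp
  qed simp
  then have "(cstar_mnorm (diag_sum x y))\<^sup>2 \<le> ?b\<^sup>2"
    using cstar_mnorm_identity[OF four_block_carrier_mat[OF x y], of "0\<^sub>m (dim_row x) (dim_col y)"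
        "0\<^sub>m (dim_row y) (dim_col x)"] unfolding sq by simp
  then show "cstar_mnorm (diag_sum x y) \<le> ?b" using b by (rule power2_le_imp_le)
qed

definition scalar_mat :: "complex mat \<Rightarrow> 'a::unital_cstar_algebra mat" where
  "scalar_mat \<alpha> = map_mat (\<lambda>c. c *\<^sub>C 1) \<alpha>"

lemma scalar_mat_carrier [simp, intro]: "\<alpha> \<in> carrier_mat n m \<Longrightarrow> scalar_mat \<alpha> \<in> carrier_mat n m"
  by (simp add: scalar_mat_def)

lemma scalar_mat_index [simp]:
  "i < dim_row \<alpha> \<Longrightarrow> j < dim_col \<alpha> \<Longrightarrow> scalar_mat \<alpha> $$ (i, j) = \<alpha> $$ (i, j) *\<^sub>C 1"
  by (simp add: scalar_mat_def)

lemma scalar_mat_mult: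
  assumes "\<alpha> \<in> carrier_mat n m" "\<beta> \<in> carrier_mat m p"
  shows "scalar_mat (\<alpha> * \<beta>) = (scalar_mat \<alpha> * scalar_mat \<beta> :: 'a::unital_cstar_algebra mat)"
  by (rule eq_matI)
    (use assms in \<open>auto simp: index_mat_mult_sum[OF assms] scalar_mat_def
       index_mat_mult_sum[of _ n m _ p] scaleC_sum_left mult_scaleC_left scaleC_scaleC
       simp del: index_mult_mat(1)\<close>)

lemma scalar_mat_star: "scalar_mat (mat_star \<alpha>) = mat_star (scalar_mat \<alpha>)"
  by (rule eq_matI) (auto simp: scalar_mat_def star_scaleC star_complex_def)

lemma msq_iterate_scalar_mat:
  "\<alpha> \<in> carrier_mat n n \<Longrightarrow> (msq ^^ k) (scalar_mat \<alpha>) = scalar_mat ((msq ^^ k) \<alpha>)"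
  by (induction k) (auto simp: msq_def scalar_mat_mult[OF msq_iterate_carrier msq_iterate_carrier])

text \<open>Scalar matrices act on the columns over the algebra as they act on complex columns, because
\<open>\<alpha> \<mapsto> \<alpha> \<otimes> 1\<close> is a homomorphism; the entries give the crude bound \<open>n\<^sup>2\<close>.\<close>

lemma cstar_mnorm_scalar_mat:
  assumes a: "\<alpha> \<in> carrier_mat n n"
  shows "cstar_mnorm (scalar_mat \<alpha> :: 'a::unital_cstar_algebra mat) \<le> cstar_mnorm \<alpha>"
proof -
  have bound: "cstar_mnorm (scalar_mat \<beta> :: 'a mat) \<le> (real n * real n) * cstar_mnorm \<beta>"
    if "\<beta> \<in> carrier_mat n n" for \<beta>
  proof -
    have "cstar_mnorm (scalar_mat \<beta> :: 'a mat) \<le> (\<Sum>i<n. \<Sum>j<n. norm ((scalar_mat \<beta> :: 'a mat) $$ (i, j)))"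
      using that by (intro cstar_mnorm_le_sum) auto
    also have "\<dots> \<le> (\<Sum>i<n. \<Sum>j<n. cstar_mnorm \<beta>)"
      using that by (intro sum_mono) (auto simp: scalar_mat_def norm_scaleC intro: norm_entry_le_cstar_mnorm)
    finally show ?thesis by simp
  qed
  let ?h = "mat_star \<alpha> * \<alpha>"
  have h: "?h \<in> carrier_mat n n" "mat_star ?h = ?h"
    using a by (auto simp: mat_star_mult[OF mat_star_carrier[OF a] a])
  have "cstar_mnorm (scalar_mat ?h :: 'a mat) \<le> (cstar_mnorm \<alpha>)\<^sup>2"
  proof (rule selfadjoint_norm_le_of_squares[where C = "real n * real n"])
    show "scalar_mat ?h \<in> carrier_mat n n" using h by auto
    show "mat_star (scalar_mat ?h) = scalar_mat ?h" using h(2) by (simp flip: scalar_mat_star)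
    fix k
    show "cstar_mnorm ((msq ^^ k) (scalar_mat ?h :: 'a mat)) \<le> real n * real n * (cstar_mnorm \<alpha>)\<^sup>2 ^ (2 ^ k)"
      using bound[OF msq_iterate_carrier[OF h(1), of k]] cstar_mnorm_msq_iterate[OF h, of k]
        cstar_mnorm_identity[OF a] by (simp add: msq_iterate_scalar_mat[OF h(1)])
  qed simp
  also have "(scalar_mat ?h :: 'a mat) = mat_star (scalar_mat \<alpha>) * scalar_mat \<alpha>"
    using a by (simp add: scalar_mat_mult[of _ n n] scalar_mat_star)
  finally have "(cstar_mnorm (scalar_mat \<alpha> :: 'a mat))\<^sup>2 \<le> (cstar_mnorm \<alpha>)\<^sup>2"
    using cstar_mnorm_identity[of "scalar_mat \<alpha> :: 'a mat" n n] a by simp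
  then show ?thesis using cstar_mnorm_nonneg[OF a] by (rule power2_le_imp_le)
qed

lemma scalar_conj_eq_mult:
  assumes a: "\<alpha> \<in> carrier_mat n n" and x: "x \<in> carrier_mat n n" and b: "\<beta> \<in> carrier_mat n n"
  shows "scalar_conj \<alpha> x \<beta> = scalar_mat \<alpha> * x * scalar_mat \<beta>"
proof (rule eq_matI)
  fix i j assume "i < dim_row (scalar_mat \<alpha> * x * scalar_mat \<beta>)" "j < dim_col (scalar_mat \<alpha> * x * scalar_mat \<beta>)"
  then have ij: "i < n" "j < n" using a b by (auto simp: scalar_mat_def)
  have ax: "scalar_mat \<alpha> * x \<in> carrier_mat n n"
    by (rule mult_carrier_mat[OF scalar_mat_carrier[OF a] x])
  have "(scalar_mat \<alpha> * x * scalar_mat \<beta>) $$ (i, j)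
      = (\<Sum>l<n. (\<Sum>k<n. (\<alpha> $$ (i, k) *\<^sub>C 1) * x $$ (k, l)) * (\<beta> $$ (l, j) *\<^sub>C 1))"
    unfolding index_mat_mult_sum[OF ax scalar_mat_carrier[OF b] ij]
    using a b x ij
    by (intro sum.cong arg_cong2[of _ _ _ _ "(*)"] refl)
      (auto simp: index_mat_mult_sum[OF scalar_mat_carrier[OF a] x] simp del: index_mult_mat(1))
  also have "\<dots> = (\<Sum>l<n. \<Sum>k<n. (\<alpha> $$ (i, k) * \<beta> $$ (l, j)) *\<^sub>C x $$ (k, l))"
    by (simp add: sum_distrib_right mult_scaleC_left mult_scaleC_right scaleC_scaleC scaleC_sum_right
        mult.commute[of "\<beta> $$ _"])
  also have "\<dots> = (\<Sum>k<n. \<Sum>l<n. (\<alpha> $$ (i, k) * \<beta> $$ (l, j)) *\<^sub>C x $$ (k, l))"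
    by (rule sum.swap)
  also have "\<dots> = scalar_conj \<alpha> x \<beta> $$ (i, j)" using a b x ij by (simp add: scalar_conj_def)
  finally show "scalar_conj \<alpha> x \<beta> $$ (i, j) = (scalar_mat \<alpha> * x * scalar_mat \<beta>) $$ (i, j)" by simp
qed (use a b in \<open>auto simp: scalar_conj_def scalar_mat_def\<close>)

lemma opspace_structure_cstar_mnorm: "opspace_structure (cstar_mnorm :: 'a::unital_cstar_algebra mat \<Rightarrow> real)"
  unfolding opspace_structure_def
proof (intro conjI allI ballI impI)
  fix n :: nat and x :: "'a mat" and \<alpha> \<beta> :: "complex mat"
  assume x: "x \<in> carrier_mat n n" and a: "\<alpha> \<in> carrier_mat n n" and b: "\<beta> \<in> carrier_mat n n"
  have "cstar_mnorm (scalar_conj \<alpha> x \<beta>) \<le> cstar_mnorm (scalar_mat \<alpha> * x) * cstar_mnorm (scalar_mat \<beta> :: 'a mat)"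
    unfolding scalar_conj_eq_mult[OF a x b]
    by (intro cstar_mnorm_mult[OF mult_carrier_mat[OF scalar_mat_carrier[OF a] x] scalar_mat_carrier[OF b]])
  also have "\<dots> \<le> (cstar_mnorm (scalar_mat \<alpha> :: 'a mat) * cstar_mnorm x) * cstar_mnorm (scalar_mat \<beta> :: 'a mat)"
    by (intro mult_right_mono cstar_mnorm_mult[OF scalar_mat_carrier[OF a] x]
        cstar_mnorm_nonneg[OF scalar_mat_carrier[OF b]])
  also have "\<dots> \<le> (cstar_mnorm \<alpha> * cstar_mnorm x) * cstar_mnorm \<beta>"
    using cstar_mnorm_nonneg[OF x] cstar_mnorm_nonneg[OF a] cstar_mnorm_nonneg[OF b]
      cstar_mnorm_nonneg[OF scalar_mat_carrier[OF a], where 'a='a]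
      cstar_mnorm_nonneg[OF scalar_mat_carrier[OF b], where 'a='a]
    by (intro mult_mono cstar_mnorm_scalar_mat[OF a] cstar_mnorm_scalar_mat[OF b] mult_nonneg_nonneg order_refl) auto
  finally show "cstar_mnorm (scalar_conj \<alpha> x \<beta>) \<le> cstar_mnorm \<alpha> * cstar_mnorm x * cstar_mnorm \<beta>" .
next
  fix n m :: nat and x y :: "'a mat"
  assume x: "x \<in> carrier_mat n n" and y: "y \<in> carrier_mat m m"
  show "cstar_mnorm (four_block_mat x (0\<^sub>m n m) (0\<^sub>m m n) y) = max (cstar_mnorm x) (cstar_mnorm y)"
    using cstar_mnorm_diag_sum[OF x y] x y by simp
qed (auto simp: cstar_mnorm_1_1[simplified] cstar_mnorm_nonneg cstar_mnorm_eq_0_iff cstar_mnorm_scaleC cstar_mnorm_triangle)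

section \<open>Bounded sequences of matrices\<close>

lemma map_mat_scaleC_carrier: "x \<in> carrier_mat n m \<Longrightarrow> map_mat (scaleC c) x \<in> carrier_mat n m"
  by simp

lemma cstar_mnorm_entries_tendsto:
  assumes "\<And>k. X k \<in> carrier_mat n m" "L \<in> carrier_mat n m"
    and "\<And>i j. i < n \<Longrightarrow> j < m \<Longrightarrow> (\<lambda>k. X k $$ (i, j)) \<longlonglongrightarrow> L $$ (i, j)"
  shows "(\<lambda>k. cstar_mnorm (X k - L)) \<longlonglongrightarrow> 0"
proof (rule tendsto_sandwich[of "\<lambda>_. 0"])
  show "\<forall>\<^sub>F k in sequentially. 0 \<le> cstar_mnorm (X k - L)"
    by (intro always_eventually allI cstar_mnorm_nonneg[OF minus_carrier_mat[OF assms(2)]])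
  show "\<forall>\<^sub>F k in sequentially. cstar_mnorm (X k - L) \<le> (\<Sum>i<n. \<Sum>j<m. norm (X k $$ (i, j) - L $$ (i, j)))"
  proof (intro always_eventually allI)
    fix k
    have "cstar_mnorm (X k - L) \<le> (\<Sum>i<n. \<Sum>j<m. norm ((X k - L) $$ (i, j)))"
      by (rule cstar_mnorm_le_sum[OF minus_carrier_mat[OF assms(2)]])
    also have "\<dots> = (\<Sum>i<n. \<Sum>j<m. norm (X k $$ (i, j) - L $$ (i, j)))"
      using assms(2) by (intro sum.cong) auto
    finally show "cstar_mnorm (X k - L) \<le> (\<Sum>i<n. \<Sum>j<m. norm (X k $$ (i, j) - L $$ (i, j)))" .
  qed
  show "(\<lambda>k. \<Sum>i<n. \<Sum>j<m. norm (X k $$ (i, j) - L $$ (i, j))) \<longlonglongrightarrow> 0"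
    by (intro tendsto_null_sum tendsto_norm_zero LIM_zero assms(3)) auto
qed simp

definition bounded_matseq :: "(nat \<Rightarrow> 'a::unital_cstar_algebra mat) \<Rightarrow> bool" where
  "bounded_matseq f \<longleftrightarrow> (\<forall>n. f n \<in> carrier_mat (Suc n) (Suc n)) \<and> (\<exists>b. \<forall>n. cstar_mnorm (f n) \<le> b)"

lemma bounded_matseqI:
  "(\<And>n. f n \<in> carrier_mat (Suc n) (Suc n)) \<Longrightarrow> (\<And>n. cstar_mnorm (f n) \<le> b) \<Longrightarrow> bounded_matseq f"
  by (auto simp: bounded_matseq_def)

text \<open>All matrix algebras over \<open>A\<close> sit in one C*-algebra, the bounded sequences whose \<open>n\<close>-th term is a
matrix of size \<open>n + 1\<close>.  As a type in the class of C*-algebras it makes the results on positivity and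
unitaries available for matrices, whose size is a term and not a type.\<close>

typedef (overloaded) 'a matseq = "{f :: nat \<Rightarrow> 'a::unital_cstar_algebra mat. bounded_matseq f}"
  by (rule exI[of _ "\<lambda>n. 0\<^sub>m (Suc n) (Suc n)"]) (auto intro!: bounded_matseqI)

setup_lifting type_definition_matseq

lemma matseq_carrier [simp]: "Rep_matseq x n \<in> carrier_mat (Suc n) (Suc n)"
  using Rep_matseq[of x] by (auto simp: bounded_matseq_def)

lemma matseq_bdd: "bdd_above (range (\<lambda>n. cstar_mnorm (Rep_matseq x n)))"
  using Rep_matseq[of x] by (auto simp: bounded_matseq_def intro: bdd_aboveI)

lemma matseq_eqI: "(\<And>n. Rep_matseq x n = Rep_matseq y n) \<Longrightarrow> x = y"
  by (metis Rep_matseq_inject ext)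

lemma bounded_matseq_carrier: "bounded_matseq f \<Longrightarrow> f n \<in> carrier_mat (Suc n) (Suc n)"
  by (simp add: bounded_matseq_def)

lemma bounded_matseq_add:
  assumes "bounded_matseq f" "bounded_matseq g"
  shows "bounded_matseq (\<lambda>n. f n + g n)"
proof -
  obtain b c where "\<forall>n. cstar_mnorm (f n) \<le> b" "\<forall>n. cstar_mnorm (g n) \<le> c"
    using assms by (auto simp: bounded_matseq_def)
  then show ?thesis using assms
    by (intro bounded_matseqI[where b = "b + c"])
      (auto intro: order_trans[OF cstar_mnorm_triangle[OF bounded_matseq_carrier bounded_matseq_carrier] add_mono]
        simp: bounded_matseq_carrier)
qed

lemma bounded_matseq_uminus:
  assumes "bounded_matseq f"
  shows "bounded_matseq (\<lambda>n. - f n)"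
proof -
  obtain b where "\<forall>n. cstar_mnorm (f n) \<le> b" using assms by (auto simp: bounded_matseq_def)
  then show ?thesis using assms bounded_matseq_carrier[OF assms]
    by (intro bounded_matseqI[where b = b]) (auto simp: cstar_mnorm_uminus[OF bounded_matseq_carrier])
qed

lemma bounded_matseq_mult:
  assumes "bounded_matseq f" "bounded_matseq g"
  shows "bounded_matseq (\<lambda>n. f n * g n)"
proof -
  obtain b c where bc: "\<forall>n. cstar_mnorm (f n) \<le> b" "\<forall>n. cstar_mnorm (g n) \<le> c"
    using assms by (auto simp: bounded_matseq_def)
  have c: "f n \<in> carrier_mat (Suc n) (Suc n)" "g n \<in> carrier_mat (Suc n) (Suc n)" for n
    using assms by (auto simp: bounded_matseq_carrier)
  have "cstar_mnorm (f n * g n) \<le> b * c" for n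
  proof -
    have "cstar_mnorm (f n * g n) \<le> cstar_mnorm (f n) * cstar_mnorm (g n)"
      using c by (rule cstar_mnorm_mult)
    also have "\<dots> \<le> b * c"
      using bc cstar_mnorm_nonneg[OF c(1)] cstar_mnorm_nonneg[OF c(2)]
      by (intro mult_mono) (auto intro: order_trans)
    finally show ?thesis .
  qed
  then show ?thesis using c by (intro bounded_matseqI) (auto intro: mult_carrier_mat)
qed

lemma bounded_matseq_scaleC:
  assumes "bounded_matseq f"
  shows "bounded_matseq (\<lambda>n. map_mat (scaleC c) (f n))"
proof -
  obtain b where "\<forall>n. cstar_mnorm (f n) \<le> b" using assms by (auto simp: bounded_matseq_def)
  then show ?thesis using bounded_matseq_carrier[OF assms]
    by (intro bounded_matseqI[where b = "cmod c * b"]) (auto simp: cstar_mnorm_scaleC[OF bounded_matseq_carrier[OF assms]] mult_left_mono)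
qed

lemma bounded_matseq_star:
  assumes "bounded_matseq f"
  shows "bounded_matseq (\<lambda>n. mat_star (f n))"
proof -
  obtain b where "\<forall>n. cstar_mnorm (f n) \<le> b" using assms by (auto simp: bounded_matseq_def)
  then show ?thesis using bounded_matseq_carrier[OF assms]
    by (intro bounded_matseqI[where b = b]) (auto simp: cstar_mnorm_star[OF bounded_matseq_carrier[OF assms]])
qed

lift_definition matseq_scaleC :: "complex \<Rightarrow> 'a::unital_cstar_algebra matseq \<Rightarrow> 'a matseq"
  is "\<lambda>c f n. map_mat (scaleC c) (f n)"
  by (rule bounded_matseq_scaleC)

instantiation matseq :: (unital_cstar_algebra) "{zero, one, plus, minus, uminus, times, scaleR}"
begin

lift_definition zero_matseq :: "'a matseq" is "\<lambda>n. 0\<^sub>m (Suc n) (Suc n)"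
  by (auto intro!: bounded_matseqI)
lift_definition one_matseq :: "'a matseq" is "\<lambda>n. 1\<^sub>m (Suc n)"
  by (auto intro!: bounded_matseqI)
lift_definition plus_matseq :: "'a matseq \<Rightarrow> 'a matseq \<Rightarrow> 'a matseq" is "\<lambda>f g n. f n + g n"
  by (rule bounded_matseq_add)
lift_definition uminus_matseq :: "'a matseq \<Rightarrow> 'a matseq" is "\<lambda>f n. - f n"
  by (rule bounded_matseq_uminus)
definition minus_matseq :: "'a matseq \<Rightarrow> 'a matseq \<Rightarrow> 'a matseq" where
  "minus_matseq x y = x + - y"
lift_definition times_matseq :: "'a matseq \<Rightarrow> 'a matseq \<Rightarrow> 'a matseq" is "\<lambda>f g n. f n * g n"
  by (rule bounded_matseq_mult)
definition scaleR_matseq :: "real \<Rightarrow> 'a matseq \<Rightarrow> 'a matseq" where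
  "scaleR_matseq r = matseq_scaleC (complex_of_real r)"

instance ..

end

definition matseq_norm :: "'a::unital_cstar_algebra matseq \<Rightarrow> real" where
  "matseq_norm x = (SUP n. cstar_mnorm (Rep_matseq x n))"

lemma matseq_norm_le: "(\<And>n. cstar_mnorm (Rep_matseq x n) \<le> c) \<Longrightarrow> matseq_norm x \<le> c"
  unfolding matseq_norm_def by (rule cSUP_least) auto

lemma matseq_component_le: "cstar_mnorm (Rep_matseq x n) \<le> matseq_norm x"
  unfolding matseq_norm_def by (rule cSUP_upper[OF _ matseq_bdd]) auto

lemmas matseq_rep = zero_matseq.rep_eq one_matseq.rep_eq plus_matseq.rep_eq uminus_matseq.rep_eq
  times_matseq.rep_eq matseq_scaleC.rep_eq

lemma matseq_minus_rep: "Rep_matseq (x - y) n = Rep_matseq x n - Rep_matseq y n"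
  unfolding minus_matseq_def matseq_rep
  by (rule eq_matI) (use matseq_carrier[of x n] matseq_carrier[of y n] in \<open>auto simp del: matseq_carrier\<close>)

lemma matseq_scaleR_rep: "Rep_matseq (r *\<^sub>R x) n = map_mat (scaleC (complex_of_real r)) (Rep_matseq x n)"
  by (simp add: scaleR_matseq_def matseq_rep)

lemma matseq_dim [simp]: "dim_row (Rep_matseq x n) = Suc n" "dim_col (Rep_matseq x n) = Suc n"
  using matseq_carrier[of x n] by (auto simp del: matseq_carrier)

lemma matseq_norm_nonneg: "0 \<le> matseq_norm (x :: 'a::unital_cstar_algebra matseq)"
  using matseq_component_le[of x 0] cstar_mnorm_nonneg[OF matseq_carrier, of x 0] by simp

lemma matseq_scaleC_left:
  fixes x y :: "'a::unital_cstar_algebra matseq"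
  shows "matseq_scaleC p x * y = matseq_scaleC p (x * y)"
    by (intro matseq_eqI eq_matI)
      (auto simp: matseq_rep index_mat_mult_sum[OF matseq_carrier matseq_carrier] scaleC_sum_right
        index_mat_mult_sum[OF map_mat_scaleC_carrier[OF matseq_carrier] matseq_carrier] mult_scaleC_left
        scaleC_add_right simp del: index_mult_mat(1))

lemma matseq_scaleC_right:
  fixes x y :: "'a::unital_cstar_algebra matseq"
  shows "x * matseq_scaleC p y = matseq_scaleC p (x * y)"
    by (intro matseq_eqI eq_matI)
      (auto simp: matseq_rep index_mat_mult_sum[OF matseq_carrier matseq_carrier] scaleC_sum_right
        index_mat_mult_sum[OF matseq_carrier map_mat_scaleC_carrier[OF matseq_carrier]] mult_scaleC_right
        scaleC_add_right simp del: index_mult_mat(1))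

lemma norm_matseq_scaleC:
  fixes x y :: "'a::unital_cstar_algebra matseq"
  shows "matseq_norm (matseq_scaleC p x) = cmod p * matseq_norm x"
  proof (rule antisym)
    show "matseq_norm (matseq_scaleC p x) \<le> cmod p * matseq_norm x"
      by (rule matseq_norm_le)
        (simp add: matseq_rep cstar_mnorm_scaleC[OF matseq_carrier] mult_left_mono matseq_component_le)
    show "cmod p * matseq_norm x \<le> matseq_norm (matseq_scaleC p x)"
    proof (cases "p = 0")
      case False
      have "matseq_norm x \<le> matseq_norm (matseq_scaleC p x) / cmod p"
      proof (rule matseq_norm_le)
        show "cstar_mnorm (Rep_matseq x n) \<le> matseq_norm (matseq_scaleC p x) / cmod p" for n
          using matseq_component_le[of "matseq_scaleC p x" n] False
          by (simp add: matseq_rep cstar_mnorm_scaleC[OF matseq_carrier] field_simps)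
      qed
      then show ?thesis using False by (simp add: field_simps)
    qed (simp add: matseq_norm_nonneg)
  qed

instantiation matseq :: (unital_cstar_algebra) real_normed_algebra_1
begin

definition norm_matseq :: "'a matseq \<Rightarrow> real" where
  "norm_matseq = matseq_norm"
definition dist_matseq :: "'a matseq \<Rightarrow> 'a matseq \<Rightarrow> real" where
  "dist_matseq x y = norm (x - y)"
definition sgn_matseq :: "'a matseq \<Rightarrow> 'a matseq" where
  "sgn_matseq x = x /\<^sub>R norm x"
definition uniformity_matseq :: "('a matseq \<times> 'a matseq) filter" where
  "uniformity_matseq = (INF e\<in>{0 <..}. principal {(x, y). dist x y < e})"
definition open_matseq :: "'a matseq set \<Rightarrow> bool" where
  "open_matseq S = (\<forall>x\<in>S. \<forall>\<^sub>F (x', y) in uniformity. x' = x \<longrightarrow> y \<in> S)"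

instance
proof
  have matseq_norm_le: "(\<And>n. cstar_mnorm (Rep_matseq x n) \<le> c) \<Longrightarrow> norm x \<le> c"
    and matseq_component_le: "cstar_mnorm (Rep_matseq x n) \<le> norm x"
    and matseq_norm_nonneg: "0 \<le> norm x"
    and norm_matseq_scaleC: "norm (matseq_scaleC p x) = cmod p * norm x" for x :: "'a matseq" and n c p
    unfolding norm_matseq_def
    by (fact matseq_norm_le matseq_component_le matseq_norm_nonneg norm_matseq_scaleC)+
  fix a b c x y z :: "'a matseq" and r s :: real
  show "a + b + c = a + (b + c)"
    by (rule matseq_eqI) (simp add: matseq_rep assoc_add_mat[OF matseq_carrier matseq_carrier matseq_carrier])
  show "a + b = b + a"
    by (rule matseq_eqI) (simp add: matseq_rep comm_add_mat[OF matseq_carrier matseq_carrier])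
  show "0 + a = a"
    by (rule matseq_eqI) (simp add: matseq_rep left_add_zero_mat[OF matseq_carrier])
  show "- a + a = 0"
    by (rule matseq_eqI) (simp add: matseq_rep uminus_l_inv_mat[OF matseq_carrier])
  show "a - b = a + - b" by (simp add: minus_matseq_def)
  show "r *\<^sub>R (x + y) = r *\<^sub>R x + r *\<^sub>R y"
    by (intro matseq_eqI eq_matI) (auto simp: matseq_rep matseq_scaleR_rep scaleC_add_right)
  show "(r + s) *\<^sub>R x = r *\<^sub>R x + s *\<^sub>R x"
    by (intro matseq_eqI eq_matI) (auto simp: matseq_rep matseq_scaleR_rep scaleC_add_left)
  show "r *\<^sub>R s *\<^sub>R x = (r * s) *\<^sub>R x"
    by (intro matseq_eqI eq_matI) (auto simp: matseq_rep matseq_scaleR_rep scaleC_scaleC)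
  show "1 *\<^sub>R x = x"
    by (intro matseq_eqI eq_matI) (auto simp: matseq_scaleR_rep)
  show "a * b * c = a * (b * c)"
    by (rule matseq_eqI) (simp add: matseq_rep assoc_mult_mat[OF matseq_carrier matseq_carrier matseq_carrier])
  show "(a + b) * c = a * c + b * c"
    by (rule matseq_eqI) (simp add: matseq_rep add_mult_distrib_mat[OF matseq_carrier matseq_carrier matseq_carrier])
  show "a * (b + c) = a * b + a * c"
    by (rule matseq_eqI) (simp add: matseq_rep mult_add_distrib_mat[OF matseq_carrier matseq_carrier matseq_carrier])
  show "1 * a = a"
    by (rule matseq_eqI) (simp add: matseq_rep left_mult_one_mat[OF matseq_carrier])
  show "a * 1 = a"
    by (rule matseq_eqI) (simp add: matseq_rep right_mult_one_mat[OF matseq_carrier])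
  show "(0::'a matseq) \<noteq> 1"
  proof
    assume "(0::'a matseq) = 1"
    then have "Rep_matseq (0::'a matseq) 0 $$ (0, 0) = Rep_matseq (1::'a matseq) 0 $$ (0, 0)" by simp
    then show False by (simp add: matseq_rep)
  qed
  show "r *\<^sub>R x * y = r *\<^sub>R (x * y)" "x * r *\<^sub>R y = r *\<^sub>R (x * y)"
    unfolding scaleR_matseq_def by (rule matseq_scaleC_left, rule matseq_scaleC_right)
  show "dist x y = norm (x - y)" by (simp add: dist_matseq_def)
  show "sgn x = x /\<^sub>R norm x" by (simp add: sgn_matseq_def)
  show "uniformity = (INF e\<in>{0 <..}. principal {(x :: 'a matseq, y). dist x y < e})"
    by (simp add: uniformity_matseq_def)
  show "open S \<longleftrightarrow> (\<forall>x\<in>S. \<forall>\<^sub>F (x', y) in uniformity. x' = x \<longrightarrow> y \<in> S)" for S :: "'a matseq set"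
    by (simp add: open_matseq_def)
  show "norm x = 0 \<longleftrightarrow> x = 0"
  proof
    assume "norm x = 0"
    then have "cstar_mnorm (Rep_matseq x n) = 0" for n
      using matseq_component_le[of x n] cstar_mnorm_nonneg[OF matseq_carrier, of x n] by simp
    then show "x = 0"
      by (intro matseq_eqI) (simp add: matseq_rep cstar_mnorm_eq_0_iff[OF matseq_carrier])
  next
    assume "x = 0"
    then show "norm x = 0" by (simp add: norm_matseq_def matseq_norm_def matseq_rep)
  qed
  show "norm (x + y) \<le> norm x + norm y"
  proof (rule matseq_norm_le)
    show "cstar_mnorm (Rep_matseq (x + y) n) \<le> norm x + norm y" for n
      using cstar_mnorm_triangle[OF matseq_carrier matseq_carrier, of x n y]
        matseq_component_le[of x n] matseq_component_le[of y n] by (simp add: matseq_rep)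
  qed
  show "norm (r *\<^sub>R x) = \<bar>r\<bar> * norm x" by (simp add: scaleR_matseq_def norm_matseq_scaleC)
  show "norm (x * y) \<le> norm x * norm y"
  proof (rule matseq_norm_le)
    fix n
    have "cstar_mnorm (Rep_matseq (x * y) n) \<le> cstar_mnorm (Rep_matseq x n) * cstar_mnorm (Rep_matseq y n)"
      using cstar_mnorm_mult[OF matseq_carrier matseq_carrier, of x n y] by (simp add: matseq_rep)
    also have "\<dots> \<le> norm x * norm y"
      by (intro mult_mono matseq_component_le matseq_norm_nonneg cstar_mnorm_nonneg[OF matseq_carrier])
    finally show "cstar_mnorm (Rep_matseq (x * y) n) \<le> norm x * norm y" .
  qed
  show "norm (1::'a matseq) = 1" by (simp add: norm_matseq_def matseq_norm_def matseq_rep)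
qed

end

lemmas norm_matseq_le = matseq_norm_le[folded norm_matseq_def]
lemmas component_le_norm_matseq = matseq_component_le[folded norm_matseq_def]
lemmas norm_matseq_nonneg = matseq_norm_nonneg[folded norm_matseq_def]
lemmas norm_matseq_scaleC_eq = norm_matseq_scaleC[folded norm_matseq_def]

instantiation matseq :: (unital_cstar_algebra) unital_cstar_algebra
begin

definition scaleC_matseq :: "complex \<Rightarrow> 'a matseq \<Rightarrow> 'a matseq" where
  "scaleC_matseq = matseq_scaleC"
lift_definition star_matseq :: "'a matseq \<Rightarrow> 'a matseq" is "\<lambda>f n. mat_star (f n)"
  by (rule bounded_matseq_star)

instance
proof
  fix x y :: "'a matseq" and r :: real and p q :: complex
  note matseq_rep = matseq_rep star_matseq.rep_eq
  show "p *\<^sub>C (x + y) = p *\<^sub>C x + p *\<^sub>C y"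
    by (intro matseq_eqI eq_matI) (auto simp: scaleC_matseq_def matseq_rep scaleC_add_right)
  show "(p + q) *\<^sub>C x = p *\<^sub>C x + q *\<^sub>C x"
    by (intro matseq_eqI eq_matI) (auto simp: scaleC_matseq_def matseq_rep scaleC_add_left)
  show "p *\<^sub>C q *\<^sub>C x = (p * q) *\<^sub>C x"
    by (intro matseq_eqI eq_matI) (auto simp: scaleC_matseq_def matseq_rep scaleC_scaleC)
  show "complex_of_real r *\<^sub>C x = r *\<^sub>R x" by (simp add: scaleR_matseq_def scaleC_matseq_def)
  show "p *\<^sub>C x * y = p *\<^sub>C (x * y)" by (simp add: scaleC_matseq_def matseq_scaleC_left)
  show "x * p *\<^sub>C y = p *\<^sub>C (x * y)" by (simp add: scaleC_matseq_def matseq_scaleC_right)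
  show "norm (p *\<^sub>C x) = cmod p * norm x" by (simp add: scaleC_matseq_def norm_matseq_scaleC_eq)
  show "star (x + y) = star x + star y"
    by (intro matseq_eqI eq_matI) (auto simp: scaleC_matseq_def matseq_rep star_add)
  show "star (p *\<^sub>C x) = cnj p *\<^sub>C star x"
    by (intro matseq_eqI eq_matI) (auto simp: scaleC_matseq_def matseq_rep star_scaleC)
  show "star (x * y) = star y * star x"
    by (intro matseq_eqI) (simp add: scaleC_matseq_def matseq_rep mat_star_mult[OF matseq_carrier matseq_carrier])
  show "star (star x) = x"
    by (intro matseq_eqI) (simp add: scaleC_matseq_def matseq_rep)
  have cid: "cstar_mnorm (Rep_matseq (star x * x) n) = (cstar_mnorm (Rep_matseq x n))\<^sup>2" for n
    by (simp add: scaleC_matseq_def matseq_rep cstar_mnorm_identity[OF matseq_carrier])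
  show "norm (star x * x) = (norm x)\<^sup>2"
  proof (rule antisym)
    show "norm (star x * x) \<le> (norm x)\<^sup>2"
      by (rule norm_matseq_le)
        (auto simp: cid intro!: power_mono component_le_norm_matseq cstar_mnorm_nonneg[OF matseq_carrier])
    have "norm x \<le> sqrt (norm (star x * x))"
    proof (rule norm_matseq_le)
      show "cstar_mnorm (Rep_matseq x n) \<le> sqrt (norm (star x * x))" for n
        using component_le_norm_matseq[of "star x * x" n] by (simp add: cid real_le_rsqrt)
    qed
    then have "(norm x)\<^sup>2 \<le> (sqrt (norm (star x * x)))\<^sup>2"
      by (intro power_mono norm_matseq_nonneg)
    then show "(norm x)\<^sup>2 \<le> norm (star x * x)" by (simp add: norm_matseq_nonneg)
  qed
next
  fix X :: "nat \<Rightarrow> 'a matseq"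
  assume C: "Cauchy X"
  have tri: "norm a \<le> norm b + norm (a - b)" for a b :: "'a matseq"
  proof (rule norm_matseq_le)
    show "cstar_mnorm (Rep_matseq a n) \<le> norm b + norm (a - b)" for n
      using cstar_mnorm_le_minus[OF matseq_carrier matseq_carrier, of a n b]
        component_le_norm_matseq[of b n] component_le_norm_matseq[of "a - b" n] by (simp add: matseq_minus_rep)
  qed
  have ent: "norm (Rep_matseq a n $$ (i, j) - Rep_matseq b n $$ (i, j)) \<le> dist a b" if "i < Suc n" "j < Suc n"
    for a b :: "'a matseq" and n i j
  proof -
    have "norm ((Rep_matseq a n - Rep_matseq b n) $$ (i, j)) \<le> cstar_mnorm (Rep_matseq a n - Rep_matseq b n)"
      by (rule norm_entry_le_cstar_mnorm[OF minus_carrier_mat[OF matseq_carrier] that])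
    also have "\<dots> \<le> dist a b"
      using component_le_norm_matseq[of "a - b" n] by (simp add: matseq_minus_rep dist_matseq_def)
    finally show ?thesis using that by simp
  qed
  have "convergent (\<lambda>k. Rep_matseq (X k) n $$ (i, j))" if ij: "i < Suc n" "j < Suc n" for n i j
  proof (rule Cauchy_convergent, rule metric_CauchyI)
    fix e :: real assume "0 < e"
    then obtain M where M: "\<forall>m\<ge>M. \<forall>k\<ge>M. dist (X m) (X k) < e" using C by (meson metric_CauchyD)
    then show "\<exists>M. \<forall>m\<ge>M. \<forall>k\<ge>M. dist (Rep_matseq (X m) n $$ (i, j)) (Rep_matseq (X k) n $$ (i, j)) < e"
      unfolding dist_norm[of "_ $$ _"]
      by (intro exI[of _ M] allI impI) (meson ent[OF ij] le_less_trans)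
  qed
  then have lim: "(\<lambda>k. Rep_matseq (X k) n $$ (i, j)) \<longlonglongrightarrow> lim (\<lambda>k. Rep_matseq (X k) n $$ (i, j))"
    if "i < Suc n" "j < Suc n" for n i j
    using that by (simp add: convergent_LIMSEQ_iff)
  define L where "L n = mat (Suc n) (Suc n) (\<lambda>(i, j). lim (\<lambda>k. Rep_matseq (X k) n $$ (i, j)))" for n
  have Lc: "L n \<in> carrier_mat (Suc n) (Suc n)" for n by (simp add: L_def)
  have comp: "(\<lambda>k. cstar_mnorm (Rep_matseq (X k) n - L n)) \<longlonglongrightarrow> 0" for n
    by (rule cstar_mnorm_entries_tendsto[OF matseq_carrier Lc]) (use lim in \<open>auto simp: L_def\<close>)
  have unif: "\<exists>M. \<forall>k\<ge>M. \<forall>n. cstar_mnorm (Rep_matseq (X k) n - L n) \<le> e" if e: "e > 0" for e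
  proof -
    obtain M where M: "\<forall>m\<ge>M. \<forall>k\<ge>M. dist (X m) (X k) < e" using C e by (meson metric_CauchyD)
    have "cstar_mnorm (Rep_matseq (X k) n - L n) \<le> e" if "k \<ge> M" for k n
    proof (rule field_le_epsilon)
      fix d :: real assume "0 < d"
      then have "\<forall>\<^sub>F m in sequentially. cstar_mnorm (Rep_matseq (X m) n - L n) < d"
        by (rule order_tendstoD(2)[OF comp])
      then obtain M' where "\<forall>m\<ge>M'. cstar_mnorm (Rep_matseq (X m) n - L n) < d"
        by (auto simp: eventually_sequentially)
      then have m: "max M M' \<ge> M" "cstar_mnorm (Rep_matseq (X (max M M')) n - L n) < d" by auto
      define m where "m = max M M'"
      note m = m[folded m_def]
      have "cstar_mnorm (Rep_matseq (X k) n - L n)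
        \<le> cstar_mnorm (Rep_matseq (X k) n - Rep_matseq (X m) n) + cstar_mnorm (Rep_matseq (X m) n - L n)"
        by (rule cstar_mnorm_triangle_minus[OF matseq_carrier matseq_carrier Lc])
      also have "cstar_mnorm (Rep_matseq (X k) n - Rep_matseq (X m) n) \<le> e"
        using M that m(1) component_le_norm_matseq[of "X k - X m" n]
        by (force simp: matseq_minus_rep dist_matseq_def)
      finally show "cstar_mnorm (Rep_matseq (X k) n - L n) \<le> e + d" using m by simp
    qed
    then show ?thesis by blast
  qed
  have "bounded_matseq L"
  proof -
    obtain M where M: "\<forall>n. cstar_mnorm (Rep_matseq (X M) n - L n) \<le> 1" using unif[of 1] by auto
    have "cstar_mnorm (L n) \<le> norm (X M) + 1" for n
      using cstar_mnorm_le_minus[OF Lc matseq_carrier, of n "X M"] M[rule_format, of n]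
        cstar_mnorm_minus_commute[OF Lc matseq_carrier, of n "X M"] component_le_norm_matseq[of "X M" n] by simp
    then show ?thesis by (intro bounded_matseqI Lc)
  qed
  then have RL: "Rep_matseq (Abs_matseq L) n = L n" for n by (simp add: Abs_matseq_inverse)
  have "X \<longlonglongrightarrow> Abs_matseq L"
  proof (rule metric_LIMSEQ_I)
    fix e :: real assume "0 < e"
    then obtain M where "\<forall>k\<ge>M. \<forall>n. cstar_mnorm (Rep_matseq (X k) n - L n) \<le> e / 2" using unif[of "e/2"] by auto
    then have "dist (X k) (Abs_matseq L) \<le> e / 2" if "k \<ge> M" for k
      unfolding dist_matseq_def using that by (intro norm_matseq_le) (simp add: matseq_minus_rep RL)
    then show "\<exists>M. \<forall>k\<ge>M. dist (X k) (Abs_matseq L) < e"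
      using \<open>0 < e\<close> by (intro exI[of _ M]) force
  qed
  then show "convergent X" by (auto simp: convergent_def)
qed

end

lemma matseq_star_rep: "Rep_matseq (star x) n = mat_star (Rep_matseq x n)"
  by (simp add: star_matseq.rep_eq)

lemma matseq_scaleC_rep: "Rep_matseq (c *\<^sub>C x) n = map_mat (scaleC c) (Rep_matseq x n)"
  by (simp add: scaleC_matseq_def matseq_scaleC.rep_eq)

text \<open>Filling up with identities, and not with zeros, keeps unitaries unitary.\<close>

definition matseq_at :: "nat \<Rightarrow> 'a::unital_cstar_algebra mat \<Rightarrow> 'a matseq" where
  "matseq_at n x = Abs_matseq (\<lambda>m. if m = n then x else 1\<^sub>m (Suc m))"

lemma matseq_at_rep:
  assumes "x \<in> carrier_mat (Suc n) (Suc n)"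
  shows "Rep_matseq (matseq_at n x) m = (if m = n then x else 1\<^sub>m (Suc m))"
proof -
  have "bounded_matseq (\<lambda>m. if m = n then x else 1\<^sub>m (Suc m))"
    by (rule bounded_matseqI[where b = "max (cstar_mnorm x) 1"]) (use assms in auto)
  then show ?thesis by (simp add: matseq_at_def Abs_matseq_inverse)
qed

lemma norm_matseq_at:
  assumes "x \<in> carrier_mat (Suc n) (Suc n)" "cstar_mnorm x \<le> 1"
  shows "norm (matseq_at n x) \<le> 1"
  by (rule norm_matseq_le) (auto simp: matseq_at_rep[OF assms(1)] assms(2))

section \<open>Almost isometric maps preserve unitaries up to a small error\<close>

definition scaleC_linear :: "('a::unital_cstar_algebra \<Rightarrow> 'b::unital_cstar_algebra) \<Rightarrow> bool" where
  "scaleC_linear T \<longleftrightarrow> (\<forall>x y. T (x + y) = T x + T y) \<and> (\<forall>c x. T (c *\<^sub>C x) = c *\<^sub>C T x)"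

lemma scaleC_linearD:
  assumes "scaleC_linear T"
  shows "T (x + y) = T x + T y" "T (c *\<^sub>C x) = c *\<^sub>C T x" "T 0 = 0" "T (- x) = - T x" "T (x - y) = T x - T y"
proof -
  show add: "T (x + y) = T x + T y" for x y using assms by (simp add: scaleC_linear_def)
  show sc: "T (c *\<^sub>C x) = c *\<^sub>C T x" for c x using assms by (simp add: scaleC_linear_def)
  show "T 0 = 0" using sc[of 0 0] by simp
  show m: "T (- x) = - T x" for x using sc[of "- 1" x] by (simp add: scaleC_minus_left)
  show "T (x - y) = T x - T y" using add[of x "- y"] m by simp
qed

lemma map_mat_linear:
  assumes "scaleC_linear T" "x \<in> carrier_mat n m" "y \<in> carrier_mat n m"
  shows "map_mat T (x + y) = map_mat T x + map_mat T y"
    and "map_mat T (x - y) = map_mat T x - map_mat T y"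
    and "map_mat T (map_mat (scaleC c) x) = map_mat (scaleC c) (map_mat T x)"
    and "map_mat T (- x) = - map_mat T x"
  using assms by (auto intro!: eq_matI simp: scaleC_linearD)

lemma map_mat_zero: "scaleC_linear T \<Longrightarrow> map_mat T (0\<^sub>m n m) = 0\<^sub>m n m"
  by (rule eq_matI) (auto simp: scaleC_linearD)

lemma map_mat_four_block:
  assumes "A \<in> carrier_mat n1 m1" "B \<in> carrier_mat n1 m2" "C \<in> carrier_mat n2 m1" "D \<in> carrier_mat n2 m2"
  shows "map_mat T (four_block_mat A B C D)
    = four_block_mat (map_mat T A) (map_mat T B) (map_mat T C) (map_mat T D)"
  by (rule eq_matI) (use assms in auto)

definition cb_le :: "('a::unital_cstar_algebra \<Rightarrow> 'b::unital_cstar_algebra) \<Rightarrow> real \<Rightarrow> bool" where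
  "cb_le T c \<longleftrightarrow> scaleC_linear T \<and> 0 \<le> c \<and>
    (\<forall>n>0. \<forall>x\<in>carrier_mat n n. cstar_mnorm (map_mat T x) \<le> c * cstar_mnorm x)"

lemma cb_leD:
  assumes "cb_le T c"
  shows "scaleC_linear T" "0 \<le> c"
    "0 < n \<Longrightarrow> x \<in> carrier_mat n n \<Longrightarrow> cstar_mnorm (map_mat T x) \<le> c * cstar_mnorm x"
  using assms by (auto simp: cb_le_def)

lemma cb_le_norm:
  assumes "cb_le T c"
  shows "norm (T x) \<le> c * norm x"
proof -
  have "map_mat T (mat 1 1 (\<lambda>_. x)) = mat 1 1 (\<lambda>_. T x)" by (rule eq_matI) auto
  then show ?thesis
    using cb_leD(3)[OF assms, of 1 "mat 1 1 (\<lambda>_. x)"] cstar_mnorm_1_1[of x] cstar_mnorm_1_1[of "T x"] by simp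
qed

text \<open>Left multiplication by \<open>b\<close> is multiplication by the diagonal matrix with entries \<open>b\<close>; that its norm is
at most \<open>\<parallel>b\<parallel>\<close> is \<open>b\<^sup>* b \<le> \<parallel>b\<parallel>\<^sup>2\<close> summed over the coordinates.\<close>

lemma cb_le_left_mult:
  assumes T: "cb_le T c"
  shows "cb_le (\<lambda>x. b * T x) (norm b * c)"
  unfolding cb_le_def
proof (intro conjI allI impI ballI)
  show "scaleC_linear (\<lambda>x. b * T x)"
    using cb_leD(1)[OF T] by (simp add: scaleC_linear_def distrib_left mult_scaleC_right)
  show "0 \<le> norm b * c" using cb_leD(2)[OF T] by simp
  fix n :: nat and x :: "'a mat" assume n: "0 < n" and x: "x \<in> carrier_mat n n"
  let ?d = "mat n n (\<lambda>(i, j). if i = j then b else 0)"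
  have d: "?d \<in> carrier_mat n n" by simp
  have "map_mat (\<lambda>x. b * T x) x = ?d * map_mat T x"
  proof (rule eq_matI)
    fix i j assume "i < dim_row (?d * map_mat T x)" "j < dim_col (?d * map_mat T x)"
    then have ij: "i < n" "j < n" using x by auto
    have "(?d * map_mat T x) $$ (i, j) = (\<Sum>k<n. ?d $$ (i, k) * map_mat T x $$ (k, j))"
      by (rule index_mat_mult_sum[OF d _ ij]) (use x in simp)
    also have "\<dots> = (\<Sum>k<n. if k = i then b * T (x $$ (k, j)) else 0)"
      using ij x by (intro sum.cong) auto
    finally show "map_mat (\<lambda>x. b * T x) x $$ (i, j) = (?d * map_mat T x) $$ (i, j)"
      using ij x by simp
  qed (use x in auto)
  moreover have "cstar_mnorm ?d \<le> norm b"
  proof (rule cstar_mnorm_le[OF d])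
    fix v :: "'b vec" assume v: "v \<in> carrier_vec n"
    have dv: "(?d *\<^sub>v v) $ i = b * v $ i" if "i < n" for i
    proof -
      have "(?d *\<^sub>v v) $ i = (\<Sum>j<n. ?d $$ (i, j) * v $ j)" by (rule index_mat_vec_sum[OF d v that])
      also have "\<dots> = (\<Sum>j<n. if j = i then b * v $ j else 0)"
        using that by (intro sum.cong) auto
      finally show ?thesis using that by simp
    qed
    have "cpos (of_real (norm (star b * b)) - star b * b)"
      by (rule cpos_norm_minus) (simp add: star_mult star_star)
    then have "cpos ((\<Sum>i<n. star (v $ i) * (of_real ((norm b)\<^sup>2) - star b * b) * v $ i))"
      by (intro cpos_sum cpos_conj) (simp add: cstar_identity)
    also have "(\<Sum>i<n. star (v $ i) * (of_real ((norm b)\<^sup>2) - star b * b) * v $ i)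
       = (norm b)\<^sup>2 *\<^sub>R mod_ip v v - mod_ip (?d *\<^sub>v v) (?d *\<^sub>v v)"
      using v by (simp add: mod_ip_def dv algebra_simps sum_subtractf scaleR_sum_right of_real_def star_mult
          del: index_mult_mat_vec)
    finally have "norm (mod_ip (?d *\<^sub>v v) (?d *\<^sub>v v)) \<le> norm ((norm b)\<^sup>2 *\<^sub>R mod_ip v v)"
      by (intro cpos_norm_mono cpos_mod_ip)
    then have "(module_norm (?d *\<^sub>v v))\<^sup>2 \<le> (norm b * module_norm v)\<^sup>2"
      by (simp add: module_norm_square power_mult_distrib)
    then show "module_norm (?d *\<^sub>v v) \<le> norm b * module_norm v" by (rule power2_le_imp_le) simp
  qed simp
  ultimately have "cstar_mnorm (map_mat (\<lambda>x. b * T x) x) \<le> norm b * cstar_mnorm (map_mat T x)"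
    using cstar_mnorm_mult[OF d, of "map_mat T x" n] x cstar_mnorm_nonneg[of "map_mat T x" n n]
    by (auto intro: order_trans mult_right_mono)
  also have "\<dots> \<le> norm b * (c * cstar_mnorm x)"
    by (intro mult_left_mono cb_leD(3)[OF T n x]) simp
  finally show "cstar_mnorm (map_mat (\<lambda>x. b * T x) x) \<le> norm b * c * cstar_mnorm x" by (simp add: mult.assoc)
qed

lemma cb_le_compose:
  assumes "cb_le T c" "cb_le S d"
  shows "cb_le (\<lambda>x. S (T x)) (d * c)"
  unfolding cb_le_def
proof (intro conjI allI impI ballI)
  show "scaleC_linear (\<lambda>x. S (T x))"
    using cb_leD(1)[OF assms(1)] cb_leD(1)[OF assms(2)] by (simp add: scaleC_linear_def)
  show "0 \<le> d * c" using cb_leD(2)[OF assms(1)] cb_leD(2)[OF assms(2)] by simp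
  fix n :: nat and x :: "'a mat" assume n: "0 < n" and x: "x \<in> carrier_mat n n"
  have "map_mat (\<lambda>x. S (T x)) x = map_mat S (map_mat T x)" by (rule eq_matI) auto
  also have "cstar_mnorm \<dots> \<le> d * cstar_mnorm (map_mat T x)"
    using x by (intro cb_leD(3)[OF assms(2) n]) auto
  also have "\<dots> \<le> d * (c * cstar_mnorm x)"
    by (intro mult_left_mono cb_leD(3)[OF assms(1) n x] cb_leD(2)[OF assms(2)])
  finally show "cstar_mnorm (map_mat (\<lambda>x. S (T x)) x) \<le> d * c * cstar_mnorm x" by (simp add: mult.assoc)
qed

lemma map_mat_star_conj: "map_mat (\<lambda>x. star (T (star x))) x = mat_star (map_mat T (mat_star x))"
  by (rule eq_matI) auto

lemma cb_le_star_conj: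
  assumes "cb_le T c"
  shows "cb_le (\<lambda>x. star (T (star x))) c"
  unfolding cb_le_def
proof (intro conjI allI impI ballI)
  show "scaleC_linear (\<lambda>x. star (T (star x)))"
    using cb_leD(1)[OF assms] by (simp add: scaleC_linear_def star_add star_scaleC)
  show "0 \<le> c" using cb_leD(2)[OF assms] .
  fix n :: nat and x :: "'a mat" assume n: "0 < n" and x: "x \<in> carrier_mat n n"
  have "map_mat T (mat_star x) \<in> carrier_mat n n" using x by auto
  then show "cstar_mnorm (map_mat (\<lambda>x. star (T (star x))) x) \<le> c * cstar_mnorm x"
    unfolding map_mat_star_conj
    using cb_leD(3)[OF assms n mat_star_carrier[OF x]] cstar_mnorm_star[OF x]
    by (simp add: cstar_mnorm_star[of _ n n])
qed

definition matseq_map :: "('a::unital_cstar_algebra \<Rightarrow> 'b::unital_cstar_algebra) \<Rightarrow> 'a matseq \<Rightarrow> 'b matseq" where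
  "matseq_map T x = Abs_matseq (\<lambda>n. map_mat T (Rep_matseq x n))"

lemma matseq_map_rep:
  assumes "cb_le T c"
  shows "Rep_matseq (matseq_map T x) n = map_mat T (Rep_matseq x n)"
proof -
  have "bounded_matseq (\<lambda>n. map_mat T (Rep_matseq x n))"
  proof (rule bounded_matseqI)
    fix n
    have "cstar_mnorm (map_mat T (Rep_matseq x n)) \<le> c * cstar_mnorm (Rep_matseq x n)"
      by (rule cb_leD(3)[OF assms _ matseq_carrier]) simp
    also have "\<dots> \<le> c * norm x"
      by (intro mult_left_mono component_le_norm_matseq cb_leD(2)[OF assms])
    finally show "cstar_mnorm (map_mat T (Rep_matseq x n)) \<le> c * norm x" .
  qed auto
  then show ?thesis by (simp add: matseq_map_def Abs_matseq_inverse)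
qed

lemma matseq_map_linear:
  assumes "cb_le T c"
  shows "scaleC_linear (matseq_map T)"
  unfolding scaleC_linear_def
  by (auto intro!: matseq_eqI
      simp: matseq_map_rep[OF assms] matseq_rep matseq_scaleC_rep map_mat_linear[OF cb_leD(1)[OF assms] matseq_carrier matseq_carrier])

lemma matseq_map_norm:
  assumes "cb_le T c"
  shows "norm (matseq_map T x) \<le> c * norm x"
proof (rule norm_matseq_le)
  fix n
  have "cstar_mnorm (Rep_matseq (matseq_map T x) n) \<le> c * cstar_mnorm (Rep_matseq x n)"
    unfolding matseq_map_rep[OF assms] by (rule cb_leD(3)[OF assms _ matseq_carrier]) simp
  also have "\<dots> \<le> c * norm x"
    by (intro mult_left_mono component_le_norm_matseq cb_leD(2)[OF assms])
  finally show "cstar_mnorm (Rep_matseq (matseq_map T x) n) \<le> c * norm x" .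
qed

lemma cstar_mnorm_row:
  assumes x: "x \<in> carrier_mat n n" and y: "y \<in> carrier_mat n n"
  shows "(cstar_mnorm (four_block_mat x y (0\<^sub>m n n) (0\<^sub>m n n)))\<^sup>2 = cstar_mnorm (x * mat_star x + y * mat_star y)"
proof -
  let ?X = "four_block_mat x y (0\<^sub>m n n) (0\<^sub>m n n)"
  let ?z = "x * mat_star x + y * mat_star y"
  have X: "?X \<in> carrier_mat (n + n) (n + n)" using x by auto
  have z: "?z \<in> carrier_mat n n" using x y by (meson add_carrier_mat mat_star_carrier mult_carrier_mat)
  have "?X * mat_star ?X = four_block_mat ?z (0\<^sub>m n n) (0\<^sub>m n n) (0\<^sub>m n n)"
    unfolding mat_star_four_block[OF x y zero_carrier_mat zero_carrier_mat]
    using x y mat_star_carrier[OF x] mat_star_carrier[OF y]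
    by (subst mult_four_block_mat[of _ n n _ n _ n _ _ n _ n]) auto
  then have "(cstar_mnorm ?X)\<^sup>2 = cstar_mnorm (diag_sum ?z (0\<^sub>m n n))"
    using cstar_mnorm_identity'[OF X] y by simp
  also have "\<dots> = cstar_mnorm ?z"
    by (subst cstar_mnorm_diag_sum[OF z zero_carrier_mat]) (simp add: cstar_mnorm_nonneg[OF z])
  finally show ?thesis .
qed

text \<open>The row \<open>(x, y)\<close>, padded to a square matrix, turns a bound at the next matrix level into one on
\<open>x x\<^sup>* + y y\<^sup>*\<close>.\<close>

lemma cb_le_row:
  assumes T: "cb_le T c" and n: "0 < n" and x: "x \<in> carrier_mat n n" and y: "y \<in> carrier_mat n n"
  shows "cstar_mnorm (map_mat T x * mat_star (map_mat T x) + map_mat T y * mat_star (map_mat T y))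
    \<le> c\<^sup>2 * cstar_mnorm (x * mat_star x + y * mat_star y)"
proof -
  let ?X = "four_block_mat x y (0\<^sub>m n n) (0\<^sub>m n n)"
  have X: "?X \<in> carrier_mat (n + n) (n + n)" using x by auto
  have "map_mat T ?X = four_block_mat (map_mat T x) (map_mat T y) (0\<^sub>m n n) (0\<^sub>m n n)"
    by (simp add: map_mat_four_block[OF x y zero_carrier_mat zero_carrier_mat] map_mat_zero[OF cb_leD(1)[OF T]])
  then have "(cstar_mnorm (map_mat T ?X))\<^sup>2
      = cstar_mnorm (map_mat T x * mat_star (map_mat T x) + map_mat T y * mat_star (map_mat T y))"
    using x y by (simp add: cstar_mnorm_row)
  moreover have "(cstar_mnorm (map_mat T ?X))\<^sup>2 \<le> (c * cstar_mnorm ?X)\<^sup>2"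
    using n X by (intro power_mono cb_leD(3)[OF T _ X] cstar_mnorm_nonneg[of _ "n + n" "n + n"]) auto
  ultimately show ?thesis by (simp add: power_mult_distrib cstar_mnorm_row[OF x y])
qed

text \<open>A coisometry \<open>u\<close> is recognized by its rows: \<open>\<parallel>(u, y)\<parallel>\<^sup>2 = 1 + \<parallel>y\<parallel>\<^sup>2\<close> for all \<open>y\<close>.  If \<open>a = T u\<close> falls short of
being one, with defect \<open>h = 1 - a a\<^sup>*\<close> of norm \<open>N\<close>, then \<open>b = h / N\<close> lives where \<open>a a\<^sup>*\<close> is small, so the row
\<open>(a, b)\<close> is too short: its square norm is at most \<open>2 - N\<close>.  Going back by \<open>R\<close>, which increases norms by a
factor \<open>L\<close> at most, gives \<open>2 \<le> L\<^sup>2 (2 - N)\<close>.\<close>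

lemma almost_coisometry:
  fixes T :: "'a::unital_cstar_algebra \<Rightarrow> 'b::unital_cstar_algebra"
  assumes T: "\<And>x. norm (T x) \<le> norm x" and L: "0 < L"
    and row: "\<And>x y. norm (R x * star (R x) + R y * star (R y)) \<le> L\<^sup>2 * norm (x * star x + y * star y)"
    and TR: "\<And>y. T (R y) = y" and RT: "R (T u) = u" and u: "u * star u = 1"
  shows "norm (1 - T u * star (T u)) \<le> 2 * (1 - 1 / L\<^sup>2)"
proof -
  define a where "a = T u"
  define h where "h = 1 - a * star a"
  define N where "N = norm h"
  have pos: "cpos (x * star x)" for x :: "'c::unital_cstar_algebra"
    using cpos_star_mult_self[of "star x"] by (simp add: star_star)
  have "(norm u)\<^sup>2 = 1" using cstar_identity'[of u] u by simp
  then have nu: "norm u = 1" using power2_eq_iff_nonneg[of "norm u" 1] by simp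
  have na: "norm a \<le> 1" using T[of u] nu by (simp add: a_def)
  then have naa: "norm (a * star a) \<le> 1" by (simp add: cstar_identity' power_le_one)
  have R: "1 + (norm (R b))\<^sup>2 \<le> L\<^sup>2 * norm (a * star a + b * star b)" for b
  proof -
    have "1 + (norm (R b))\<^sup>2 \<le> norm (1 + R b * star (R b))"
      using norm_one_plus_cpos[OF pos[of "R b"]] by (simp add: cstar_identity')
    also have "\<dots> \<le> L\<^sup>2 * norm (a * star a + b * star b)"
      using row[of a b] by (simp add: a_def RT u)
    finally show ?thesis .
  qed
  have "cpos ((of_real (norm (a * star a)) - a * star a) + of_real (1 - norm (a * star a)))"
    using naa by (intro cpos_add cpos_norm_minus cpos_of_real) (auto simp: star_mult star_star)
  then have h: "cpos h" by (simp add: h_def)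
  have sh: "star h = h" using h by (rule cpos_selfadjoint)
  have "N \<le> norm (1::'b)"
    unfolding N_def using h by (rule cpos_norm_mono) (simp add: h_def pos)
  then have N1: "N \<le> 1" by simp
  have L1: "1 \<le> L\<^sup>2"
  proof -
    have "1 \<le> 1 + (norm (R 0))\<^sup>2" by simp
    also have "\<dots> \<le> L\<^sup>2 * norm (a * star a)" using R[of 0] by simp
    also have "\<dots> \<le> L\<^sup>2 * 1" using naa by (intro mult_left_mono) auto
    finally show ?thesis by simp
  qed
  have "N \<le> 2 * (1 - 1 / L\<^sup>2)"
  proof (cases "N = 0")
    case True
    then show ?thesis using L1 by (simp add: divide_le_eq)
  next
    case False
    then have N: "0 < N" by (simp add: N_def)
    \<comment> \<open>the normalized defect: it lives where \<open>a\<close> is small, so it adds little to the norm of the row in \<open>B\<close>, yet \<open>R b\<close> has norm at least \<open>1\<close>\<close>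
    define b where "b = (1 / N) *\<^sub>R h"
    have nb: "norm b = 1" using N by (simp add: b_def N_def)
    have "1 \<le> norm (R b)" using T[of "R b"] by (simp add: TR nb)
    then have "2 \<le> 1 + (norm (R b))\<^sup>2" by (simp add: one_le_power)
    also note R
    also have "norm (a * star a + b * star b) \<le> 2 - N"
    proof (rule cpos_norm_le)
      show "cpos (a * star a + b * star b)" by (intro cpos_add pos)
      have g: "cpos (of_real N - h)" unfolding N_def by (rule cpos_norm_minus[OF sh])
      \<comment> \<open>the concave function \<open>2 - N - (1 - t + t\<^sup>2 / N\<^sup>2)\<close> on \<open>[0, N]\<close>, written with nonnegative terms\<close>
      have "of_real (2 - N) - (a * star a + b * star b)
          = ((1 - N) / N) *\<^sub>R (of_real N - h) + (1 / (N * N)) *\<^sub>R (h * (of_real N - h))"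
      proof -
        have "a * star a = 1 - h" by (simp add: h_def)
        moreover have "b * star b = (1 / (N * N)) *\<^sub>R (h * h)" by (simp add: b_def sh)
        moreover have "((1 - N) / N) *\<^sub>R (of_real N - h) = of_real (1 - N) - (1 / N) *\<^sub>R h + h"
        proof -
          have "((1 - N) / N) *\<^sub>R (of_real N :: 'b) = of_real (1 - N)"
            using N by (simp add: scaleR_conv_of_real flip: of_real_mult)
          moreover have "((1 - N) / N) *\<^sub>R h = (1 / N) *\<^sub>R h - h"
            using N by (simp add: diff_divide_distrib scaleR_diff_left)
          ultimately show ?thesis by (simp add: scaleR_diff_right)
        qed
        moreover have "(1 / (N * N)) *\<^sub>R (h * (of_real N - h)) = (1 / N) *\<^sub>R h - (1 / (N * N)) *\<^sub>R (h * h)"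
          using N by (simp add: of_real_def scaleR_diff_right right_diff_distrib)
        ultimately show ?thesis by simp
      qed
      also have "cpos \<dots>"
      proof (intro cpos_add cpos_scaleR cpos_mult g h)
        show "h * (of_real N - h) = (of_real N - h) * h" by (simp add: algebra_simps of_real_def)
      qed (use N N1 in auto)
      finally show "cpos (of_real (2 - N) - (a * star a + b * star b))" .
    qed (use N1 in simp)
    finally have "2 \<le> L\<^sup>2 * (2 - N)" using L by (simp add: mult_left_mono)
    then show ?thesis using L by (simp add: field_simps)
  qed
  then show ?thesis by (simp add: N_def h_def a_def)
qed

lemma cstar_mnorm_upper_right:
  assumes "A \<in> carrier_mat n1 m1" "B \<in> carrier_mat n1 m2" "C \<in> carrier_mat n2 m1" "D \<in> carrier_mat n2 m2"
  shows "cstar_mnorm B \<le> cstar_mnorm (four_block_mat A B C D)"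
proof (rule cstar_mnorm_le[OF assms(2)])
  let ?X = "four_block_mat A B C D"
  have X: "?X \<in> carrier_mat (n1 + n2) (m1 + m2)" using assms by auto
  show "0 \<le> cstar_mnorm ?X" by (rule cstar_mnorm_nonneg[OF X])
  fix v :: "'a vec" assume v: "v \<in> carrier_vec m2"
  let ?u = "(0\<^sub>v m1 :: 'a vec) @\<^sub>v v"
  have u: "?u \<in> carrier_vec (m1 + m2)" using v by auto
  have z: "A *\<^sub>v 0\<^sub>v m1 = 0\<^sub>v n1" "C *\<^sub>v 0\<^sub>v m1 = 0\<^sub>v n2"
    by (rule eq_vecI; use assms in \<open>simp add: index_mat_vec_sum del: index_mult_mat_vec\<close>)+
  have "?X *\<^sub>v ?u = (B *\<^sub>v v) @\<^sub>v (D *\<^sub>v v)"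
    using assms v by (subst four_block_mat_mult_vec[of _ n1 m1 _ m2 _ n2]) (auto simp: z)
  then have "module_norm (B *\<^sub>v v) \<le> module_norm (?X *\<^sub>v ?u)"
    by (simp add: module_norm_append)
  also have "\<dots> \<le> cstar_mnorm ?X * module_norm ?u" by (rule cstar_mnorm_apply[OF X u])
  also have "module_norm ?u \<le> module_norm v"
    using module_norm_append(1)[of "0\<^sub>v m1" v] by simp
  finally show "module_norm (B *\<^sub>v v) \<le> cstar_mnorm ?X * module_norm v"
    using cstar_mnorm_nonneg[OF X] by (simp add: mult_left_mono)
qed

text \<open>A cb-isomorphism with \<open>\<parallel>T\<parallel> \<parallel>T\<^sup>-\<^sup>1\<parallel> \<le> L\<close>, scaled so that \<open>T\<close> is completely contractive.\<close>

locale near_isometry =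
  fixes T :: "'a::unital_cstar_algebra \<Rightarrow> 'b::unital_cstar_algebra" and R :: "'b \<Rightarrow> 'a" and L :: real
  assumes T: "cb_le T 1" and R: "cb_le R L" and TR: "T (R y) = y" and RT: "R (T x) = x" and L0: "0 < L"
begin

definition eta :: real where "eta = 2 * (1 - 1 / L\<^sup>2)"

lemma star_conj: "near_isometry (\<lambda>x. star (T (star x))) (\<lambda>x. star (R (star x))) L"
  by unfold_locales (use cb_le_star_conj[OF T] cb_le_star_conj[OF R] in \<open>auto simp: star_star TR RT L0\<close>)

lemma matseq_coisometry:
  assumes u: "u * star u = 1"
  shows "norm (1 - matseq_map T u * star (matseq_map T u)) \<le> eta"
  unfolding eta_def
proof (rule almost_coisometry[where R = "matseq_map R"])
  show "norm (matseq_map T x) \<le> norm x" for x using matseq_map_norm[OF T, of x] by simp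
  show "norm (matseq_map R x * star (matseq_map R x) + matseq_map R y * star (matseq_map R y))
      \<le> L\<^sup>2 * norm (x * star x + y * star y)" for x y
  proof (rule norm_matseq_le)
    fix n
    have "cstar_mnorm (Rep_matseq (matseq_map R x * star (matseq_map R x) + matseq_map R y * star (matseq_map R y)) n)
      \<le> L\<^sup>2 * cstar_mnorm (Rep_matseq (x * star x + y * star y) n)"
      unfolding matseq_rep matseq_star_rep matseq_map_rep[OF R]
      by (rule cb_le_row[OF R _ matseq_carrier matseq_carrier]) simp
    also have "\<dots> \<le> L\<^sup>2 * norm (x * star x + y * star y)"
      by (intro mult_left_mono component_le_norm_matseq) simp
    finally show "cstar_mnorm (Rep_matseq (matseq_map R x * star (matseq_map R x) + matseq_map R y * star (matseq_map R y)) n)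
      \<le> L\<^sup>2 * norm (x * star x + y * star y)" .
  qed
  have "map_mat T (map_mat R z) = z" "map_mat R (map_mat T w) = w" for z w
    by (rule eq_matI; simp add: TR RT)+
  then show "matseq_map T (matseq_map R y) = y" "matseq_map R (matseq_map T x) = x" for y x
    by (auto intro!: matseq_eqI simp: matseq_map_rep[OF T] matseq_map_rep[OF R])
qed (use L0 u in auto)

lemma mat_coisometry:
  assumes n: "0 < n" and u: "u \<in> carrier_mat n n" "u * mat_star u = 1\<^sub>m n"
  shows "cstar_mnorm (1\<^sub>m n - map_mat T u * mat_star (map_mat T u)) \<le> eta"
proof -
  obtain k where k: "n = Suc k" using n by (cases n) auto
  note rep = matseq_at_rep[OF u(1)[unfolded k]]
  have "matseq_at k u * star (matseq_at k u) = 1"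
    by (rule matseq_eqI) (use u in \<open>auto simp: matseq_rep matseq_star_rep rep k\<close>)
  then have "norm (1 - matseq_map T (matseq_at k u) * star (matseq_map T (matseq_at k u))) \<le> eta"
    by (rule matseq_coisometry)
  then show ?thesis
    using component_le_norm_matseq[of "1 - matseq_map T (matseq_at k u) * star (matseq_map T (matseq_at k u))" k]
    by (simp add: matseq_minus_rep matseq_rep matseq_star_rep matseq_map_rep[OF T] rep k)
qed

text \<open>The statement for \<open>T u (T u)\<^sup>*\<close>, applied to the map \<open>x \<mapsto> (T x\<^sup>*)\<^sup>*\<close>.\<close>

lemma matseq_isometry:
  assumes u: "star u * u = 1"
  shows "norm (1 - star (matseq_map T u) * matseq_map T u) \<le> eta"
proof -
  interpret S: near_isometry "\<lambda>x. star (T (star x))" "\<lambda>x. star (R (star x))" L by (rule star_conj)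
  have "matseq_map (\<lambda>x. star (T (star x))) (star u) = star (matseq_map T u)"
    by (rule matseq_eqI)
      (simp add: matseq_map_rep[OF S.T] matseq_map_rep[OF T] matseq_star_rep map_mat_star_conj)
  then show ?thesis
    using S.matseq_coisometry[of "star u"] u by (simp add: star_star S.eta_def eta_def)
qed

end

section \<open>Almost multiplicativity\<close>

lemma cb_le_mono: "cb_le T c \<Longrightarrow> c \<le> d \<Longrightarrow> cb_le T d"
  unfolding cb_le_def
  by (meson cstar_mnorm_nonneg mult_right_mono order_trans)

lemma cb_le_id: "cb_le (\<lambda>x. x) 1"
proof -
  have "map_mat (\<lambda>x. x) x = x" for x :: "'a mat" by (rule eq_matI) auto
  then show ?thesis by (auto simp: cb_le_def scaleC_linear_def)
qed

lemma linear_bound_of_unitaries: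
  fixes f :: "'a::unital_cstar_algebra \<Rightarrow> 'b::unital_cstar_algebra"
  assumes f: "scaleC_linear f" and x: "norm x \<le> 1"
    and c: "\<And>u. star u * u = 1 \<Longrightarrow> u * star u = 1 \<Longrightarrow> norm (f u) \<le> c"
  shows "norm (f x) \<le> 2 * c"
proof -
  obtain u1 u2 u3 u4 where xu: "x = (1/2) *\<^sub>C (u1 + u2 + \<i> *\<^sub>C (u3 + u4))"
    and u: "\<And>u. u \<in> {u1, u2, u3, u4} \<Longrightarrow> star u * u = 1 \<and> u * star u = 1"
    using contraction_unitary_parts[OF x] by metis
  have "norm (f x) = (1/2) * norm (f u1 + f u2 + \<i> *\<^sub>C (f u3 + f u4))"
    by (simp add: xu scaleC_linearD[OF f] norm_scaleC norm_divide)
  also have "norm (f u1 + f u2 + \<i> *\<^sub>C (f u3 + f u4)) \<le> norm (f u1) + norm (f u2) + (norm (f u3) + norm (f u4))"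
    using norm_triangle_ineq[of "f u1 + f u2" "\<i> *\<^sub>C (f u3 + f u4)"] norm_triangle_ineq[of "f u1" "f u2"]
      norm_triangle_ineq[of "f u3" "f u4"] by (simp add: norm_scaleC)
  also have "\<dots> \<le> c + c + (c + c)" by (intro add_mono c) (use u in auto)
  finally show ?thesis by simp
qed

lemma map_mat_scaleC_mult_star:
  assumes "x \<in> carrier_mat n m" "y \<in> carrier_mat p m"
  shows "map_mat (scaleC c) x * mat_star (map_mat (scaleC c) y)
    = map_mat (scaleC (c * cnj c)) (x * mat_star y)"
proof -
  have y: "mat_star y \<in> carrier_mat m p" and cx: "map_mat (scaleC c) x \<in> carrier_mat n m"
    and cy: "map_mat (scaleC (cnj c)) (mat_star y) \<in> carrier_mat m p" using assms by auto
  show ?thesis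
    unfolding mat_star_scaleC
    by (rule eq_matI)
      (use assms in \<open>auto simp: index_mat_mult_sum[OF cx cy] index_mat_mult_sum[OF assms(1) y]
        mult_scaleC_left mult_scaleC_right scaleC_scaleC scaleC_sum_right mult.commute[of c] simp del: index_mult_mat(1)\<close>)
qed

lemma scaleC_half_two: "(1 / 2) *\<^sub>C (2::'a::unital_cstar_algebra) = 1"
proof -
  have "complex_of_real (1 / 2) *\<^sub>C (2::'a) = (1 / 2) *\<^sub>R of_real 2"
    unfolding scaleC_of_real by simp
  also have "\<dots> = of_real (1 / 2 * 2)" by (metis of_real_mult scaleR_conv_of_real)
  finally show ?thesis by simp
qed

lemma two_minus_four_block:
  fixes A :: "'a::ring_1 mat"
  assumes "A \<in> carrier_mat n n" "B \<in> carrier_mat n n" "C \<in> carrier_mat n n" "D \<in> carrier_mat n n"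
  shows "1\<^sub>m (n + n) + 1\<^sub>m (n + n) - four_block_mat A B C D
    = four_block_mat (1\<^sub>m n + 1\<^sub>m n - A) (- B) (- C) (1\<^sub>m n + 1\<^sub>m n - D)"
  by (rule eq_matI) (use assms in auto)

context near_isometry
begin

lemma mat_coisometry_twice:
  assumes n: "0 < n" and u: "u \<in> carrier_mat n n" "u * mat_star u = 1\<^sub>m n + 1\<^sub>m n"
  shows "cstar_mnorm (1\<^sub>m n + 1\<^sub>m n - map_mat T u * mat_star (map_mat T u)) \<le> 2 * eta"
proof -
  define c where "c = complex_of_real (1 / sqrt 2)"
  have cc: "c * cnj c = 1 / 2"
  proof -
    have "c * cnj c = complex_of_real ((1 / sqrt 2) * (1 / sqrt 2))"
      unfolding c_def complex_cnj_complex_of_real of_real_mult ..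
    then show ?thesis by simp
  qed
  let ?v = "map_mat (scaleC c) u"
  have v: "?v \<in> carrier_mat n n" using u by simp
  have "?v * mat_star ?v = 1\<^sub>m n"
    unfolding map_mat_scaleC_mult_star[OF u(1) u(1)] u(2) cc
    by (rule eq_matI) (auto simp: scaleC_half_two)
  from mat_coisometry[OF n v this]
  have "cstar_mnorm (1\<^sub>m n - map_mat (scaleC (1 / 2)) (map_mat T u * mat_star (map_mat T u))) \<le> eta"
    using u(1) by (simp add: map_mat_linear(3)[OF cb_leD(1)[OF T] u(1) u(1)] map_mat_scaleC_mult_star[of _ n n _ n] cc)
  moreover have "1\<^sub>m n - map_mat (scaleC (1 / 2)) (map_mat T u * mat_star (map_mat T u))
      = map_mat (scaleC (1/2)) (1\<^sub>m n + 1\<^sub>m n - map_mat T u * mat_star (map_mat T u))"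
    by (rule eq_matI) (use u in \<open>auto simp: scaleC_diff_right scaleC_half_two\<close>)
  moreover have "1\<^sub>m n + 1\<^sub>m n - map_mat T u * mat_star (map_mat T u) \<in> carrier_mat n n"
    using u by auto
  ultimately show ?thesis by (simp add: cstar_mnorm_scaleC norm_divide)
qed

text \<open>For unitaries \<open>u, v, w\<close> the matrix with rows \<open>(w, u)\<close> and \<open>(- v, v w\<^sup>* u)\<close> is a multiple of
  a unitary.  That its rows stay almost orthogonal under \<open>T\<close> is the ternary relation between
  \<open>T u\<close>, \<open>T v\<close>, \<open>T w\<close>.\<close>

lemma mat_ternary:
  assumes n: "0 < n" and c: "u \<in> carrier_mat n n" "v \<in> carrier_mat n n" "w \<in> carrier_mat n n"
    and u: "u * mat_star u = 1\<^sub>m n" and v: "v * mat_star v = 1\<^sub>m n"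
    and w: "w * mat_star w = 1\<^sub>m n" "mat_star w * w = 1\<^sub>m n"
  shows "cstar_mnorm (map_mat T u * mat_star (map_mat T (v * mat_star w * u))
      - map_mat T w * mat_star (map_mat T v)) \<le> 2 * eta"
proof -
  define z where "z = v * mat_star w * u"
  note sc = mat_star_carrier[OF c(1)] mat_star_carrier[OF c(2)] mat_star_carrier[OF c(3)]
  have z: "z \<in> carrier_mat n n" unfolding z_def by (rule mult_carrier_mat[OF mult_carrier_mat[OF c(2) sc(3)] c(1)])
  have sz: "mat_star z = mat_star u * (w * mat_star v)"
    unfolding z_def mat_star_mult[OF mult_carrier_mat[OF c(2) sc(3)] c(1)] mat_star_mult[OF c(2) sc(3)] by simp
  have szc: "mat_star z \<in> carrier_mat n n" using z by auto
  have wv: "w * mat_star v \<in> carrier_mat n n" by (rule mult_carrier_mat[OF c(3) sc(2)])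
  have uz: "u * mat_star z = w * mat_star v"
    unfolding sz assoc_mult_mat[OF c(1) sc(1) wv, symmetric] u using wv by (rule left_mult_one_mat)
  have "mat_star (u * mat_star z) = mat_star (w * mat_star v)" unfolding uz ..
  then have zu: "z * mat_star u = v * mat_star w"
    unfolding mat_star_mult[OF c(1) szc] mat_star_mult[OF c(3) sc(2)] by simp
  have "z * mat_star z = (z * mat_star u) * (w * mat_star v)"
    unfolding sz by (rule assoc_mult_mat[OF z sc(1) wv, symmetric])
  also have "\<dots> = v * (mat_star w * (w * mat_star v))"
    unfolding zu by (rule assoc_mult_mat[OF c(2) sc(3) wv])
  also have "mat_star w * (w * mat_star v) = mat_star v"
    unfolding assoc_mult_mat[OF sc(3) c(3) sc(2), symmetric] w(2) using sc(2) by (rule left_mult_one_mat)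
  also have "v * mat_star v = 1\<^sub>m n" by (rule v)
  finally have zz: "z * mat_star z = 1\<^sub>m n" .
  have sneg: "mat_star (- y) = - mat_star y" if "y \<in> carrier_mat n n" for y :: "'c::unital_cstar_algebra mat"
    by (rule eq_matI) (use that in auto)
  have mneg: "x * (- y) = - (x * y)" "(- x) * y = - (x * y)"
    if "x \<in> carrier_mat n n" "y \<in> carrier_mat n n" for x y :: "'c::unital_cstar_algebra mat"
    using that by auto
  \<comment> \<open>orthogonal rows, because \<open>u z\<^sup>* = w v\<^sup>*\<close>: \<open>?W\<close> is \<open>sqrt 2\<close> times a unitary\<close>
  let ?W = "four_block_mat w u (- v) z"
  have W: "?W \<in> carrier_mat (n + n) (n + n)" using c z by auto
  have mv: "- v \<in> carrier_mat n n" using c by simp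
  have prod: "four_block_mat w' u' (- v') z' * mat_star (four_block_mat w' u' (- v') z')
     = four_block_mat (w' * mat_star w' + u' * mat_star u') (u' * mat_star z' - w' * mat_star v')
        (z' * mat_star u' - v' * mat_star w') (v' * mat_star v' + z' * mat_star z')"
    if cc: "w' \<in> carrier_mat n n" "u' \<in> carrier_mat n n" "v' \<in> carrier_mat n n" "z' \<in> carrier_mat n n"
    for w' u' v' z' :: "'c::unital_cstar_algebra mat"
  proof -
    have mv': "- v' \<in> carrier_mat n n" using cc by simp
    have s: "mat_star w' \<in> carrier_mat n n" "mat_star u' \<in> carrier_mat n n" "mat_star v' \<in> carrier_mat n n"
      "mat_star z' \<in> carrier_mat n n" "mat_star (- v') \<in> carrier_mat n n" using cc by auto
    have p: "w' * mat_star v' \<in> carrier_mat n n" "v' * mat_star w' \<in> carrier_mat n n"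
      "u' * mat_star z' \<in> carrier_mat n n" "z' * mat_star u' \<in> carrier_mat n n"
      "v' * mat_star v' \<in> carrier_mat n n"
      using mult_carrier_mat[OF cc(1) s(3)] mult_carrier_mat[OF cc(3) s(1)] mult_carrier_mat[OF cc(2) s(4)]
        mult_carrier_mat[OF cc(4) s(2)] mult_carrier_mat[OF cc(3) s(3)] by auto
    have ng: "- p + q = q - p" "q + - p = q - p" "- (- p) = p"
      if "p \<in> carrier_mat n n" "q \<in> carrier_mat n n" for p q :: "'c mat"
      using that by (auto intro!: eq_matI)
    have vv: "- v' * - mat_star v' = v' * mat_star v'"
      unfolding mneg(2)[OF cc(3) uminus_carrier_iff_mat[THEN iffD2, OF s(3)]] mneg(1)[OF cc(3) s(3)] ng(3)[OF p(5) p(5)] ..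
    show ?thesis
      unfolding mat_star_four_block[OF cc(1,2) mv' cc(4)] mult_four_block_mat[OF cc(1,2) mv' cc(4) s(1,5,2,4)]
      unfolding sneg[OF cc(3)] vv mneg(1)[OF cc(1) s(3)] mneg(2)[OF cc(3) s(1)] ng(1)[OF p(1,3)] ng(1)[OF p(2,4)] ..
  qed
  have "?W * mat_star ?W = four_block_mat (1\<^sub>m n + 1\<^sub>m n) (0\<^sub>m n n) (0\<^sub>m n n) (1\<^sub>m n + 1\<^sub>m n)"
    unfolding prod[OF c(3,1,2) z] u v w zz uz zu using wv mult_carrier_mat[OF c(2) sc(3)] by auto
  also have "\<dots> = 1\<^sub>m (n + n) + 1\<^sub>m (n + n)" by (rule eq_matI) auto
  finally have WW: "?W * mat_star ?W = 1\<^sub>m (n + n) + 1\<^sub>m (n + n)" .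
  have nn: "0 < n + n" using n by simp
  note lin = cb_leD(1)[OF T]
  define u' v' w' z' where d: "u' = map_mat T u" "v' = map_mat T v" "w' = map_mat T w" "z' = map_mat T z"
  have dc: "w' \<in> carrier_mat n n" "u' \<in> carrier_mat n n" "v' \<in> carrier_mat n n" "z' \<in> carrier_mat n n"
    using c z by (auto simp: d)
  have TW: "map_mat T ?W = four_block_mat w' u' (- v') z'"
    unfolding map_mat_four_block[OF c(3,1) mv z] map_mat_linear(4)[OF lin c(2) c(2)] d ..
  define E where "E = u' * mat_star z' - w' * mat_star v'"
  have pc: "w' * mat_star v' \<in> carrier_mat n n" "w' * mat_star w' + u' * mat_star u' \<in> carrier_mat n n"
    "z' * mat_star u' - v' * mat_star w' \<in> carrier_mat n n" "v' * mat_star v' + z' * mat_star z' \<in> carrier_mat n n"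
    using mult_carrier_mat[OF _ mat_star_carrier] dc
    by (blast intro: minus_carrier_mat add_carrier_mat)+
  have E: "E \<in> carrier_mat n n" unfolding E_def by (rule minus_carrier_mat[OF pc(1)])
  have eq: "1\<^sub>m (n + n) + 1\<^sub>m (n + n) - map_mat T ?W * mat_star (map_mat T ?W)
     = four_block_mat (1\<^sub>m n + 1\<^sub>m n - (w' * mat_star w' + u' * mat_star u')) (- E)
        (- (z' * mat_star u' - v' * mat_star w')) (1\<^sub>m n + 1\<^sub>m n - (v' * mat_star v' + z' * mat_star z'))"
    unfolding TW prod[OF dc] E_def[symmetric]
    by (rule two_minus_four_block[OF pc(2) E pc(3,4)])
  have "cstar_mnorm (- E) \<le> cstar_mnorm (1\<^sub>m (n + n) + 1\<^sub>m (n + n) - map_mat T ?W * mat_star (map_mat T ?W))"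
    unfolding eq using pc E
    by (intro cstar_mnorm_upper_right[of _ n n _ n _ n]) (auto intro!: minus_carrier_mat)
  also have "\<dots> \<le> 2 * eta" by (rule mat_coisometry_twice[OF nn W WW])
  finally show ?thesis using cstar_mnorm_uminus[OF E] by (simp add: E_def d z_def)
qed

lemma matseq_ternary:
  assumes "u * star u = 1" "v * star v = 1" "w * star w = 1" "star w * w = 1"
  shows "norm (matseq_map T u * star (matseq_map T (v * star w * u)) - matseq_map T w * star (matseq_map T v)) \<le> 2 * eta"
proof (rule norm_matseq_le)
  fix n
  have unit: "Rep_matseq x n * Rep_matseq y n = 1\<^sub>m (Suc n)" if "x * y = 1" for x y :: "'a matseq"
    using arg_cong[OF that, of "\<lambda>x. Rep_matseq x n"] by (simp add: matseq_rep)
  show "cstar_mnorm (Rep_matseq (matseq_map T u * star (matseq_map T (v * star w * u)) - matseq_map T w * star (matseq_map T v)) n) \<le> 2 * eta"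
    unfolding matseq_rep matseq_minus_rep matseq_star_rep matseq_map_rep[OF T]
    by (rule mat_ternary) (use unit[OF assms(1)] unit[OF assms(2)] unit[OF assms(3)] unit[OF assms(4)]
        in \<open>auto simp: matseq_star_rep\<close>)
qed

text \<open>The twist by \<open>T 1\<close>, which is almost unitary, plays the role of making \<open>T\<close> unital: \<open>S\<close> is almost
multiplicative and \<open>R'\<close> is almost inverse to it.\<close>

definition S :: "'a \<Rightarrow> 'b" where "S x = star (T 1) * T x"
definition R' :: "'b \<Rightarrow> 'a" where "R' y = R (T 1 * y)"

lemma norm_T1: "norm (T 1) \<le> 1" using cb_le_norm[OF T, of 1] by simp

lemma S_cb: "cb_le S 1"
proof -
  have "cb_le S (norm (star (T 1)) * 1)" unfolding S_def[abs_def] by (rule cb_le_left_mult[OF T])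
  then show ?thesis by (rule cb_le_mono) (use norm_T1 in simp)
qed

lemma R'_cb: "cb_le R' L"
proof -
  have "cb_le (\<lambda>y. R (T 1 * y)) (L * (norm (T 1) * 1))"
    by (rule cb_le_compose[OF cb_le_left_mult[OF cb_le_id] R])
  then show ?thesis unfolding R'_def[abs_def]
    by (rule cb_le_mono) (use norm_T1 L0 in \<open>simp add: mult_left_le\<close>)
qed

lemma map_mat_S:
  assumes x: "x \<in> carrier_mat n n"
  shows "map_mat S x = mat_star (map_mat T (1\<^sub>m n)) * map_mat T x"
proof (rule eq_matI)
  let ?d = "mat_star (map_mat T (1\<^sub>m n))"
  have d: "?d \<in> carrier_mat n n" by auto
  fix i j assume "i < dim_row (?d * map_mat T x)" "j < dim_col (?d * map_mat T x)"
  then have ij: "i < n" "j < n" using x by auto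
  have "(?d * map_mat T x) $$ (i, j) = (\<Sum>k<n. ?d $$ (i, k) * map_mat T x $$ (k, j))"
    by (rule index_mat_mult_sum[OF d _ ij]) (use x in simp)
  also have "\<dots> = (\<Sum>k<n. if k = i then star (T 1) * T (x $$ (k, j)) else 0)"
    using ij x by (intro sum.cong) (auto simp: scaleC_linearD[OF cb_leD(1)[OF T]])
  finally show "map_mat S x $$ (i, j) = (?d * map_mat T x) $$ (i, j)"
    using ij x by (simp add: S_def)
qed (use x in auto)

lemma matseq_map_S: "matseq_map S x = star (matseq_map T 1) * matseq_map T x"
  by (rule matseq_eqI)
    (simp add: matseq_map_rep[OF S_cb] matseq_map_rep[OF T] matseq_rep matseq_star_rep map_mat_S[OF matseq_carrier])

lemma S_near_inverse:
  assumes n: "0 < n" and y: "y \<in> carrier_mat n n"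
  shows "cstar_mnorm (map_mat S (map_mat R' y) - y) \<le> eta * cstar_mnorm y"
proof -
  let ?b = "1 - star (T 1) * T 1"
  have b: "norm ?b \<le> eta"
  proof -
    let ?M = "matseq_map T 1"
    have "norm (1 - star ?M * ?M) \<le> eta" by (rule matseq_isometry) simp
    then have "cstar_mnorm (Rep_matseq (1 - star ?M * ?M) 0) \<le> eta"
      using component_le_norm_matseq[of "1 - star ?M * ?M" 0] by simp
    moreover have "Rep_matseq (1 - star ?M * ?M) 0 = mat 1 1 (\<lambda>_. ?b)"
      unfolding matseq_rep matseq_minus_rep matseq_star_rep matseq_map_rep[OF T]
      by (rule eq_matI) (auto simp: scalar_prod_def)
    ultimately show ?thesis using cstar_mnorm_1_1[of ?b] by simp
  qed
  have "map_mat S (map_mat R' y) - y = - map_mat (\<lambda>y. ?b * y) y"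
    by (rule eq_matI) (auto simp: S_def R'_def TR algebra_simps)
  moreover have "cstar_mnorm (map_mat (\<lambda>y. ?b * y) y) \<le> norm ?b * 1 * cstar_mnorm y"
    by (rule cb_leD(3)[OF cb_le_left_mult[OF cb_le_id] n y])
  ultimately show ?thesis
    using mult_right_mono[OF b cstar_mnorm_nonneg[OF y]]
      cstar_mnorm_uminus[of "map_mat (\<lambda>y. ?b * y) y" n n] y by simp
qed

text \<open>In the ternary relation with \<open>w = 1\<close>, multiply by \<open>(T u)\<^sup>*\<close> on the left, where \<open>(T u)\<^sup>* T u\<close> is almost \<open>1\<close>.
One \<open>eta\<close> is lost there and two in the relation.\<close>

lemma matseq_multiplicative_unitaries:
  assumes u: "star u * u = 1" "u * star u = 1" and v: "star v * v = 1" "v * star v = 1"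
  shows "norm (matseq_map S (v * u) - matseq_map S v * matseq_map S u) \<le> 3 * eta"
proof -
  define a where "a = matseq_map T 1"
  let ?M = "matseq_map T"
  have le1: "norm (?M x) \<le> 1" if "norm x \<le> 1" for x using matseq_map_norm[OF T, of x] that by simp
  have nu: "norm x = 1" if "star x * x = 1" for x :: "'a matseq"
  proof -
    have "(norm x)\<^sup>2 = 1" using cstar_identity[of x] that by simp
    then show ?thesis using power2_eq_iff_nonneg[of "norm x" 1] by simp
  qed
  have na: "norm a \<le> 1" unfolding a_def by (rule le1) simp
  have nMu: "norm (?M u) \<le> 1" by (rule le1) (simp add: nu[OF u(1)])
  have "norm (v * u) \<le> 1" using norm_mult_ineq[of v u] by (simp add: nu[OF u(1)] nu[OF v(1)])
  then have nvu: "norm (?M (v * u)) \<le> 1" by (rule le1)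
  have t: "norm (?M u * star (?M (v * u)) - a * star (?M v)) \<le> 2 * eta"
    using matseq_ternary[of u v 1] u v by (simp add: a_def)
  have i: "norm (1 - star (?M u) * ?M u) \<le> eta" by (rule matseq_isometry[OF u(1)])
  have "star (?M (v * u)) - star (?M u) * (a * star (?M v))
     = (1 - star (?M u) * ?M u) * star (?M (v * u)) + star (?M u) * (?M u * star (?M (v * u)) - a * star (?M v))"
    by (simp add: algebra_simps)
  also have "norm \<dots> \<le> eta * 1 + 1 * (2 * eta)"
    by (intro order_trans[OF norm_triangle_ineq] add_mono order_trans[OF norm_mult_ineq] mult_mono)
      (use i t nvu nMu order_trans[OF norm_ge_zero i] in auto)
  finally have "norm (star (star (?M (v * u)) - star (?M u) * (a * star (?M v)))) \<le> 3 * eta"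
    by simp
  then have T3: "norm (?M (v * u) - ?M v * star a * ?M u) \<le> 3 * eta"
    by (simp add: star_diff star_mult star_star mult.assoc)
  have "matseq_map S (v * u) - matseq_map S v * matseq_map S u = star a * (?M (v * u) - ?M v * star a * ?M u)"
    by (simp add: matseq_map_S a_def algebra_simps)
  also have "norm \<dots> \<le> 1 * (3 * eta)"
    by (intro order_trans[OF norm_mult_ineq] mult_mono) (use na T3 in auto)
  finally show ?thesis by simp
qed

text \<open>Passing from unitaries to contractions costs a factor \<open>2\<close> in each variable.\<close>

lemma matseq_multiplicative:
  assumes x: "norm x \<le> 1" and y: "norm y \<le> 1"
  shows "norm (matseq_map S (x * y) - matseq_map S x * matseq_map S y) \<le> 12 * eta"
proof -
  note lin = scaleC_linearD[OF matseq_map_linear[OF S_cb]]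
  have 1: "norm (matseq_map S (v * y) - matseq_map S v * matseq_map S y) \<le> 2 * (3 * eta)"
    if v: "star v * v = 1" "v * star v = 1" for v
  proof (rule linear_bound_of_unitaries[of "\<lambda>y. matseq_map S (v * y) - matseq_map S v * matseq_map S y", OF _ y])
    show "scaleC_linear (\<lambda>y. matseq_map S (v * y) - matseq_map S v * matseq_map S y)"
      by (simp add: scaleC_linear_def lin distrib_left mult_scaleC_right scaleC_diff_right)
  qed (rule matseq_multiplicative_unitaries[OF _ _ v])
  have "norm (matseq_map S (x * y) - matseq_map S x * matseq_map S y) \<le> 2 * (2 * (3 * eta))"
  proof (rule linear_bound_of_unitaries[of "\<lambda>x. matseq_map S (x * y) - matseq_map S x * matseq_map S y", OF _ x])
    show "scaleC_linear (\<lambda>x. matseq_map S (x * y) - matseq_map S x * matseq_map S y)"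
      by (simp add: scaleC_linear_def lin distrib_right mult_scaleC_left scaleC_diff_right)
  qed (rule 1)
  then show ?thesis by simp
qed

lemma S_multiplicative:
  assumes n: "0 < n" and x: "x \<in> carrier_mat n n" "cstar_mnorm x \<le> 1" and y: "y \<in> carrier_mat n n" "cstar_mnorm y \<le> 1"
  shows "cstar_mnorm (map_mat S (x * y) - map_mat S x * map_mat S y) \<le> 12 * eta"
proof -
  obtain k where k: "n = Suc k" using n by (cases n) auto
  let ?x = "matseq_at k x" and ?y = "matseq_at k y"
  have "norm (matseq_map S (?x * ?y) - matseq_map S ?x * matseq_map S ?y) \<le> 12 * eta"
    using x y by (intro matseq_multiplicative norm_matseq_at) (auto simp: k)
  then show ?thesis
    using component_le_norm_matseq[of "matseq_map S (?x * ?y) - matseq_map S ?x * matseq_map S ?y" k] x y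
    by (simp add: matseq_minus_rep matseq_rep matseq_map_rep[OF S_cb] matseq_at_rep k)
qed

end

section \<open>The maximal operator space structure\<close>

lemma opspace_structureD:
  assumes N: "opspace_structure N"
  shows "N (mat 1 1 (\<lambda>_. a)) = norm a"
    and "0 < n \<Longrightarrow> x \<in> carrier_mat n n \<Longrightarrow> 0 \<le> N x"
    and "0 < n \<Longrightarrow> x \<in> carrier_mat n n \<Longrightarrow> N x = 0 \<longleftrightarrow> x = 0\<^sub>m n n"
    and "0 < n \<Longrightarrow> x \<in> carrier_mat n n \<Longrightarrow> N (map_mat (scaleC c) x) = cmod c * N x"
    and "0 < n \<Longrightarrow> x \<in> carrier_mat n n \<Longrightarrow> y \<in> carrier_mat n n \<Longrightarrow> N (x + y) \<le> N x + N y"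
    and "0 < n \<Longrightarrow> x \<in> carrier_mat n n \<Longrightarrow> \<alpha> \<in> carrier_mat n n \<Longrightarrow> \<beta> \<in> carrier_mat n n
      \<Longrightarrow> N (scalar_conj \<alpha> x \<beta>) \<le> cstar_mnorm \<alpha> * N x * cstar_mnorm \<beta>"
    and "0 < n \<Longrightarrow> x \<in> carrier_mat n n \<Longrightarrow> 0 < m \<Longrightarrow> y \<in> carrier_mat m m
      \<Longrightarrow> N (four_block_mat x (0\<^sub>m n m) (0\<^sub>m m n) y) = max (N x) (N y)"
  using N unfolding opspace_structure_def by blast+

lemma opspace_zero:
  assumes "opspace_structure N" "0 < n"
  shows "N (0\<^sub>m n n) = 0"
  using opspace_structureD(3)[OF assms, of "0\<^sub>m n n"] by simp

lemma opspace_scalar_mult: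
  assumes N: "opspace_structure N" and n: "0 < n" and x: "x \<in> carrier_mat n n"
    and a: "\<alpha> \<in> carrier_mat n n" "cstar_mnorm \<alpha> \<le> 1" and b: "\<beta> \<in> carrier_mat n n" "cstar_mnorm \<beta> \<le> 1"
  shows "N (scalar_mat \<alpha> * x * scalar_mat \<beta>) \<le> N x"
proof -
  have "N (scalar_mat \<alpha> * x * scalar_mat \<beta>) \<le> cstar_mnorm \<alpha> * N x * cstar_mnorm \<beta>"
    using opspace_structureD(6)[OF N n x a(1) b(1)] by (simp add: scalar_conj_eq_mult[OF a(1) x b(1)])
  also have "\<dots> \<le> 1 * N x * 1"
    using opspace_structureD(2)[OF N n x] cstar_mnorm_nonneg[OF a(1)] cstar_mnorm_nonneg[OF b(1)] a b
    by (intro mult_mono) auto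
  finally show ?thesis by simp
qed

lemma scalar_mat_dim [simp]: "dim_row (scalar_mat \<alpha>) = dim_row \<alpha>" "dim_col (scalar_mat \<alpha>) = dim_col \<alpha>"
  by (simp_all add: scalar_mat_def)

lemma scalar_conj_index:
  assumes "\<alpha> \<in> carrier_mat n n" "x \<in> carrier_mat n n" "\<beta> \<in> carrier_mat n n" "i < n" "j < n"
  shows "scalar_conj \<alpha> x \<beta> $$ (i, j) = (\<Sum>k<n. \<Sum>l<n. (\<alpha> $$ (i, k) * \<beta> $$ (l, j)) *\<^sub>C x $$ (k, l))"
  using assms by (simp add: scalar_conj_def)

lemma scalar_mat_one: "scalar_mat (1\<^sub>m n) = (1\<^sub>m n :: 'a::unital_cstar_algebra mat)"
  by (rule eq_matI) auto

definition pad_to :: "nat \<Rightarrow> 'a::zero mat \<Rightarrow> 'a mat" where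
  "pad_to M x = mat M M (\<lambda>(i, j). if i < dim_row x \<and> j < dim_col x then x $$ (i, j) else 0)"

lemma pad_to_carrier [simp]: "pad_to M x \<in> carrier_mat M M"
  by (simp add: pad_to_def)

lemma pad_to_dim [simp]: "dim_row (pad_to M x) = M" "dim_col (pad_to M x) = M"
  by (auto simp: pad_to_def)

lemma pad_to_index [simp]:
  "i < M \<Longrightarrow> j < M \<Longrightarrow> pad_to M x $$ (i, j) = (if i < dim_row x \<and> j < dim_col x then x $$ (i, j) else 0)"
  by (simp add: pad_to_def)

lemma pad_square_eq_pad_to: "pad_square x = pad_to (max (dim_row x) (dim_col x)) x"
  by (simp add: pad_square_def pad_to_def Let_def)

lemma opspace_pad_to:
  assumes N: "opspace_structure N" and x: "x \<in> carrier_mat n n" and n: "0 < n" "n \<le> M"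
  shows "N (pad_to M x) = N x"
proof (cases "n = M")
  case True
  then have "pad_to M x = x" using x by (intro eq_matI) auto
  then show ?thesis by simp
next
  case False
  then have m: "0 < M - n" using n by simp
  have "pad_to M x = four_block_mat x (0\<^sub>m n (M - n)) (0\<^sub>m (M - n) n) (0\<^sub>m (M - n) (M - n))"
    by (rule eq_matI) (use x n in auto)
  also have "N \<dots> = max (N x) (N (0\<^sub>m (M - n) (M - n)))"
    by (rule opspace_structureD(7)[OF N n(1) x m zero_carrier_mat])
  finally show ?thesis using opspace_zero[OF N m] opspace_structureD(2)[OF N n(1) x] by simp
qed

lemma opspace_pad_square:
  assumes N: "opspace_structure N" and x: "x \<in> carrier_mat r c" and r: "0 < r" "r \<le> M" "c \<le> M"
  shows "N (pad_to M x) = N (pad_square x)"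
proof -
  have "pad_to M x = pad_to M (pad_square x)"
    by (rule eq_matI) (use x r in \<open>auto simp: pad_square_eq_pad_to\<close>)
  moreover have "N (pad_to M (pad_square x)) = N (pad_square x)"
    by (rule opspace_pad_to[OF N, of _ "max r c"]) (use x r in \<open>auto simp: pad_square_eq_pad_to\<close>)
  ultimately show ?thesis by simp
qed

definition coord_proj :: "nat \<Rightarrow> nat \<Rightarrow> complex mat" where
  "coord_proj M r = mat M M (\<lambda>(i, j). if i = j \<and> i < r then 1 else 0)"

lemma coord_proj_carrier [simp]: "coord_proj M r \<in> carrier_mat M M"
  by (simp add: coord_proj_def)

lemma coord_proj_dim [simp]: "dim_row (coord_proj M r) = M" "dim_col (coord_proj M r) = M"
  by (simp_all add: coord_proj_def)

lemma coord_proj_index [simp]: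
  "i < M \<Longrightarrow> j < M \<Longrightarrow> coord_proj M r $$ (i, j) = (if i = j \<and> i < r then 1 else 0)"
  by (simp add: coord_proj_def)

lemma cstar_mnorm_coord_proj: "cstar_mnorm (coord_proj M r) \<le> 1"
proof (rule cstar_mnorm_le[OF coord_proj_carrier])
  fix v :: "complex vec" assume v: "v \<in> carrier_vec M"
  have pv: "(coord_proj M r *\<^sub>v v) $ i = (if i < r then v $ i else 0)" if "i < M" for i
  proof -
    have "(coord_proj M r *\<^sub>v v) $ i = (\<Sum>j<M. coord_proj M r $$ (i, j) * v $ j)"
      by (rule index_mat_vec_sum[OF coord_proj_carrier v that])
    also have "\<dots> = (\<Sum>j<M. if j = i then (if i < r then v $ i else 0) else 0)"
      using that by (intro sum.cong) auto
    finally show ?thesis using that by simp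
  qed
  have "mod_ip v v - mod_ip (coord_proj M r *\<^sub>v v) (coord_proj M r *\<^sub>v v)
     = (\<Sum>i<M. star (if i < r then 0 else v $ i) * (if i < r then 0 else v $ i))"
    using v unfolding mod_ip_def
    by (auto simp: pv sum_subtractf[symmetric] simp del: index_mult_mat_vec intro!: sum.cong)
  then have "cpos (mod_ip v v - mod_ip (coord_proj M r *\<^sub>v v) (coord_proj M r *\<^sub>v v))"
    by (auto intro!: cpos_sum cpos_star_mult_self)
  then have "norm (mod_ip (coord_proj M r *\<^sub>v v) (coord_proj M r *\<^sub>v v)) \<le> norm (mod_ip v v)"
    by (intro cpos_norm_mono cpos_mod_ip)
  then show "module_norm (coord_proj M r *\<^sub>v v) \<le> 1 * module_norm v"
    by (simp add: module_norm_mod_ip)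
qed simp

lemma opspace_truncate:
  assumes N: "opspace_structure N" and X: "X \<in> carrier_mat M M" and r: "0 < r" "r \<le> M" "0 < c" "c \<le> M"
  shows "N (pad_square (mat r c (\<lambda>(i, j). X $$ (i, j)))) \<le> N X"
proof -
  let ?x = "mat r c (\<lambda>(i, j). X $$ (i, j))"
  have M: "0 < M" using r by simp
  have "pad_to M ?x = scalar_conj (coord_proj M r) X (coord_proj M c)"
  proof (rule eq_matI)
    fix i j assume "i < dim_row (scalar_conj (coord_proj M r) X (coord_proj M c))"
      "j < dim_col (scalar_conj (coord_proj M r) X (coord_proj M c))"
    then have ij: "i < M" "j < M" by (auto simp: scalar_conj_def)
    have "scalar_conj (coord_proj M r) X (coord_proj M c) $$ (i, j)
       = (\<Sum>k<M. \<Sum>l<M. if l = j then (if k = i \<and> i < r \<and> j < c then X $$ (k, l) else 0) else 0)"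
      unfolding scalar_conj_index[OF coord_proj_carrier X coord_proj_carrier ij]
      by (intro sum.cong refl) (use ij in auto)
    also have "\<dots> = (\<Sum>k<M. if k = i then (if i < r \<and> j < c then X $$ (i, j) else 0) else 0)"
      using ij by (intro sum.cong) auto
    also have "\<dots> = pad_to M ?x $$ (i, j)" using ij by simp
    finally show "pad_to M ?x $$ (i, j) = scalar_conj (coord_proj M r) X (coord_proj M c) $$ (i, j)" by simp
  qed (auto simp: scalar_conj_def)
  then have "N (pad_to M ?x) \<le> cstar_mnorm (coord_proj M r) * N X * cstar_mnorm (coord_proj M c)"
    using opspace_structureD(6)[OF N M X coord_proj_carrier coord_proj_carrier] by simp
  also have "\<dots> \<le> 1 * N X * 1"
    using opspace_structureD(2)[OF N M X] cstar_mnorm_nonneg[OF coord_proj_carrier]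
    by (intro mult_mono cstar_mnorm_coord_proj) auto
  finally show ?thesis using opspace_pad_square[OF N, of ?x r c M] r by simp
qed

lemma opspace_norm_sum:
  assumes N: "opspace_structure N" and n: "0 < n" and I: "finite I"
  shows "N (mat n n (\<lambda>p. \<Sum>k\<in>I. f k p)) \<le> (\<Sum>k\<in>I. N (mat n n (f k)))"
  using I
proof induction
  case empty
  have "mat n n (\<lambda>p. 0) = 0\<^sub>m n n" by (rule eq_matI) auto
  then show ?case unfolding sum.empty using opspace_zero[OF N n] by (metis order_refl)
next
  case (insert k I)
  have "mat n n (\<lambda>p. \<Sum>k\<in>insert k I. f k p) = mat n n (f k) + mat n n (\<lambda>p. \<Sum>k\<in>I. f k p)"
    using insert by (intro eq_matI) auto
  then have "N (mat n n (\<lambda>p. \<Sum>k\<in>insert k I. f k p)) \<le> N (mat n n (f k)) + N (mat n n (\<lambda>p. \<Sum>k\<in>I. f k p))"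
    using opspace_structureD(5)[OF N n, of "mat n n (f k)"] by simp
  then show ?case using insert by simp
qed

definition mat_unit :: "nat \<Rightarrow> nat \<Rightarrow> nat \<Rightarrow> complex mat" where
  "mat_unit n i j = mat n n (\<lambda>p. if p = (i, j) then 1 else 0)"

lemma mat_unit_carrier [simp]: "mat_unit n i j \<in> carrier_mat n n"
  by (simp add: mat_unit_def)

lemma cstar_mnorm_mat_unit: "cstar_mnorm (mat_unit n i j) \<le> 1"
proof -
  have "cstar_mnorm (mat_unit n i j) \<le> (\<Sum>k<n. \<Sum>l<n. norm (mat_unit n i j $$ (k, l)))"
    by (rule cstar_mnorm_le_sum[OF mat_unit_carrier])
  also have "\<dots> = (\<Sum>k<n. \<Sum>l<n. if l = j then (if k = i then 1 else 0) else 0)"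
    by (intro sum.cong) (auto simp: mat_unit_def)
  also have "\<dots> = (\<Sum>k<n. if k = i then (if j < n then 1 else 0) else 0)"
    by (intro sum.cong) (auto simp: sum.delta)
  also have "\<dots> \<le> 1" by (simp add: sum.delta)
  finally show ?thesis .
qed

text \<open>A matrix with a single entry \<open>a\<close> arises from \<open>diag (a, 0)\<close> by scalar matrices of norm one, so all
operator space structures give it the norm \<open>\<parallel>a\<parallel>\<close>.  Hence the supremum that defines the maximal
structure is finite.\<close>

lemma opspace_le_sum:
  assumes N: "opspace_structure N" and n: "0 < n" and x: "x \<in> carrier_mat n n"
  shows "N x \<le> (\<Sum>i<n. \<Sum>j<n. norm (x $$ (i, j)))"
proof -
  have single: "N (mat n n (\<lambda>p. if p = (k, l) then a else 0)) \<le> norm a" if kl: "k < n" "l < n" for k l a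
  proof -
    let ?d = "pad_to n (mat 1 1 (\<lambda>_. a))"
    have "mat n n (\<lambda>p. if p = (k, l) then a else 0) = scalar_conj (mat_unit n k 0) ?d (mat_unit n 0 l)"
    proof (rule eq_matI)
      fix i j assume "i < dim_row (scalar_conj (mat_unit n k 0) ?d (mat_unit n 0 l))"
        "j < dim_col (scalar_conj (mat_unit n k 0) ?d (mat_unit n 0 l))"
      then have ij: "i < n" "j < n" by (auto simp: scalar_conj_def mat_unit_def)
      have "scalar_conj (mat_unit n k 0) ?d (mat_unit n 0 l) $$ (i, j)
         = (\<Sum>k'<n. \<Sum>l'<n. if l' = 0 then (if k' = 0 then (if (i, j) = (k, l) then a else 0) else 0) else 0)"
        unfolding scalar_conj_index[OF mat_unit_carrier pad_to_carrier mat_unit_carrier ij]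
        by (intro sum.cong refl) (use ij in \<open>auto simp: mat_unit_def\<close>)
      also have "\<dots> = (if (i, j) = (k, l) then a else 0)" using n by (simp add: sum.delta)
      finally show "mat n n (\<lambda>p. if p = (k, l) then a else 0) $$ (i, j)
        = scalar_conj (mat_unit n k 0) ?d (mat_unit n 0 l) $$ (i, j)" using ij by simp
    qed (auto simp: scalar_conj_def mat_unit_def)
    then have "N (mat n n (\<lambda>p. if p = (k, l) then a else 0))
       \<le> cstar_mnorm (mat_unit n k 0) * N ?d * cstar_mnorm (mat_unit n 0 l)"
      using opspace_structureD(6)[OF N n pad_to_carrier mat_unit_carrier mat_unit_carrier] by simp
    also have "\<dots> \<le> 1 * N ?d * 1"
      using opspace_structureD(2)[OF N n pad_to_carrier] cstar_mnorm_nonneg[OF mat_unit_carrier]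
      by (intro mult_mono cstar_mnorm_mat_unit) auto
    also have "N ?d = norm a"
      using opspace_pad_to[OF N, of "mat 1 1 (\<lambda>_. a)" 1 n] n opspace_structureD(1)[OF N, of a] by simp
    finally show ?thesis by simp
  qed
  have "x = mat n n (\<lambda>p. \<Sum>k\<in>{..<n}\<times>{..<n}. if p = k then x $$ k else 0)"
    using x by (intro eq_matI) (auto simp: sum.delta)
  then have "N x \<le> (\<Sum>k\<in>{..<n}\<times>{..<n}. N (mat n n (\<lambda>p. if p = k then x $$ k else 0)))"
    using opspace_norm_sum[OF N n, of "{..<n}\<times>{..<n}" "\<lambda>k p. if p = k then x $$ k else 0"] by simp
  also have "\<dots> \<le> (\<Sum>k\<in>{..<n}\<times>{..<n}. norm (x $$ k))"
    by (intro sum_mono) (use single in auto)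
  finally show ?thesis by (simp add: sum.cartesian_product)
qed

lemma max_mnorm_upper:
  assumes N: "opspace_structure N" and n: "0 < n" and x: "x \<in> carrier_mat n n"
  shows "N x \<le> max_mnorm x"
  unfolding max_mnorm_def
  by (rule cSup_upper) (use N opspace_le_sum[OF _ n x] in \<open>auto intro!: bdd_aboveI\<close>)

lemma max_mnorm_least:
  assumes "\<And>N. opspace_structure N \<Longrightarrow> N x \<le> c"
  shows "max_mnorm x \<le> c"
  unfolding max_mnorm_def
  by (rule cSup_least) (use assms opspace_structure_cstar_mnorm in auto)

lemma opspace_structure_max_mnorm:
  "opspace_structure (max_mnorm :: 'a::unital_cstar_algebra mat \<Rightarrow> real)"
  unfolding opspace_structure_def
proof (intro conjI allI impI ballI)
  fix a :: 'a
  show "max_mnorm (mat 1 1 (\<lambda>_. a)) = norm a"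
  proof (rule antisym)
    show "max_mnorm (mat 1 1 (\<lambda>_. a)) \<le> norm a"
      by (rule max_mnorm_least) (metis opspace_structureD(1) order_refl)
    show "norm a \<le> max_mnorm (mat 1 1 (\<lambda>_. a))"
      using max_mnorm_upper[OF opspace_structure_cstar_mnorm, of 1 "mat 1 1 (\<lambda>_. a)"]
        cstar_mnorm_1_1[of a] by simp
  qed
next
  fix n :: nat and x :: "'a mat" assume n: "0 < n" and x: "x \<in> carrier_mat n n"
  note up = max_mnorm_upper[OF _ n x]
  show nn: "0 \<le> max_mnorm x"
    using up[OF opspace_structure_cstar_mnorm] cstar_mnorm_nonneg[OF x] by simp
  show "max_mnorm x = 0 \<longleftrightarrow> x = 0\<^sub>m n n"
  proof
    assume "max_mnorm x = 0"
    then have "cstar_mnorm x = 0"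
      using up[OF opspace_structure_cstar_mnorm] cstar_mnorm_nonneg[OF x] by simp
    then show "x = 0\<^sub>m n n" using cstar_mnorm_eq_0_iff[OF x] by simp
  next
    assume "x = 0\<^sub>m n n"
    then have "max_mnorm x \<le> 0" by (intro max_mnorm_least) (metis opspace_zero[OF _ n] order_refl)
    with nn show "max_mnorm x = 0" by simp
  qed
  have sc: "max_mnorm (map_mat (scaleC c) x) \<le> cmod c * max_mnorm x" if x: "x \<in> carrier_mat n n" for c and x :: "'a mat"
  proof (rule max_mnorm_least)
    fix N :: "'a mat \<Rightarrow> real" assume N: "opspace_structure N"
    show "N (map_mat (scaleC c) x) \<le> cmod c * max_mnorm x"
      unfolding opspace_structureD(4)[OF N n x] by (intro mult_left_mono max_mnorm_upper[OF N n x]) simp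
  qed
  show "max_mnorm (map_mat (scaleC c) x) = cmod c * max_mnorm x" for c
  proof (rule antisym[OF sc[OF x]])
    show "cmod c * max_mnorm x \<le> max_mnorm (map_mat (scaleC c) x)"
    proof (cases "c = 0")
      case True
      have cx: "map_mat (scaleC c) x \<in> carrier_mat n n" using x by simp
      show ?thesis
        using max_mnorm_upper[OF opspace_structure_cstar_mnorm n cx] cstar_mnorm_nonneg[OF cx] True by simp
    next
      case False
      have "map_mat (scaleC (1 / c)) (map_mat (scaleC c) x) = x"
        using x False by (intro eq_matI) (auto simp: scaleC_scaleC)
      then have "max_mnorm x \<le> cmod (1 / c) * max_mnorm (map_mat (scaleC c) x)"
        using sc[of "map_mat (scaleC c) x" "1 / c"] x by simp
      then show ?thesis using False by (simp add: norm_divide field_simps)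
    qed
  qed
  show "max_mnorm (x + y) \<le> max_mnorm x + max_mnorm y" if y: "y \<in> carrier_mat n n" for y
  proof (rule max_mnorm_least)
    show "N (x + y) \<le> max_mnorm x + max_mnorm y" if N: "opspace_structure N" for N
      using opspace_structureD(5)[OF N n x y] up[OF N] max_mnorm_upper[OF N n y] by simp
  qed
  show "max_mnorm (scalar_conj \<alpha> x \<beta>) \<le> cstar_mnorm \<alpha> * max_mnorm x * cstar_mnorm \<beta>"
    if a: "\<alpha> \<in> carrier_mat n n" and b: "\<beta> \<in> carrier_mat n n" for \<alpha> \<beta>
  proof (rule max_mnorm_least)
    fix N :: "'a mat \<Rightarrow> real" assume N: "opspace_structure N"
    have "N (scalar_conj \<alpha> x \<beta>) \<le> cstar_mnorm \<alpha> * N x * cstar_mnorm \<beta>"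
      by (rule opspace_structureD(6)[OF N n x a b])
    also have "\<dots> \<le> cstar_mnorm \<alpha> * max_mnorm x * cstar_mnorm \<beta>"
      by (intro mult_right_mono mult_left_mono up[OF N] cstar_mnorm_nonneg[OF a] cstar_mnorm_nonneg[OF b])
    finally show "N (scalar_conj \<alpha> x \<beta>) \<le> cstar_mnorm \<alpha> * max_mnorm x * cstar_mnorm \<beta>" .
  qed
  show "max_mnorm (four_block_mat x (0\<^sub>m n m) (0\<^sub>m m n) y) = max (max_mnorm x) (max_mnorm y)"
    if m: "0 < m" and y: "y \<in> carrier_mat m m" for m y
  proof (rule antisym)
    note bl = opspace_structureD(7)[OF _ n x m y]
    have nm: "0 < n + m" using n by simp
    note ub = max_mnorm_upper[OF _ nm four_block_carrier_mat[OF x y]]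
    show "max_mnorm (four_block_mat x (0\<^sub>m n m) (0\<^sub>m m n) y) \<le> max (max_mnorm x) (max_mnorm y)"
    proof (rule max_mnorm_least)
      fix N :: "'a mat \<Rightarrow> real" assume N: "opspace_structure N"
      show "N (four_block_mat x (0\<^sub>m n m) (0\<^sub>m m n) y) \<le> max (max_mnorm x) (max_mnorm y)"
        unfolding bl[OF N] by (intro max.mono up[OF N] max_mnorm_upper[OF N m y])
    qed
    have "max_mnorm x \<le> max_mnorm (four_block_mat x (0\<^sub>m n m) (0\<^sub>m m n) y)"
    proof (rule max_mnorm_least)
      fix N :: "'a mat \<Rightarrow> real" assume N: "opspace_structure N"
      show "N x \<le> max_mnorm (four_block_mat x (0\<^sub>m n m) (0\<^sub>m m n) y)"
        using ub[OF N, of "0\<^sub>m n m" "0\<^sub>m m n"] unfolding bl[OF N] by simp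
    qed
    moreover have "max_mnorm y \<le> max_mnorm (four_block_mat x (0\<^sub>m n m) (0\<^sub>m m n) y)"
    proof (rule max_mnorm_least)
      fix N :: "'a mat \<Rightarrow> real" assume N: "opspace_structure N"
      show "N y \<le> max_mnorm (four_block_mat x (0\<^sub>m n m) (0\<^sub>m m n) y)"
        using ub[OF N, of "0\<^sub>m n m" "0\<^sub>m m n"] unfolding bl[OF N] by simp
    qed
    ultimately show "max (max_mnorm x) (max_mnorm y) \<le> max_mnorm (four_block_mat x (0\<^sub>m n m) (0\<^sub>m m n) y)" by simp
  qed
qed

text \<open>Contractions between the maximal structures are complete contractions: otherwise the structure
  on the target could be pulled back to enlarge that of the source.\<close>

lemma max_mnorm_contraction:
  fixes \<phi> :: "'a::unital_cstar_algebra \<Rightarrow> 'b::unital_cstar_algebra"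
  assumes lin: "scaleC_linear \<phi>" and con: "\<And>x. norm (\<phi> x) \<le> norm x" and n: "0 < n" and x: "x \<in> carrier_mat n n"
  shows "max_mnorm (map_mat \<phi> x) \<le> max_mnorm x"
proof (rule max_mnorm_least)
  fix N :: "'b mat \<Rightarrow> real" assume N: "opspace_structure N"
  note C = opspace_structure_cstar_mnorm
  define N' where "N' x = max (cstar_mnorm x) (N (map_mat \<phi> x))" for x
  have "opspace_structure N'"
    unfolding opspace_structure_def
  proof (intro conjI allI impI ballI)
    fix a :: 'a
    have "map_mat \<phi> (mat 1 1 (\<lambda>_. a)) = mat 1 1 (\<lambda>_. \<phi> a)" by (rule eq_matI) auto
    then show "N' (mat 1 1 (\<lambda>_. a)) = norm a"
      using opspace_structureD(1)[OF N, of "\<phi> a"] opspace_structureD(1)[OF C, of a] con[of a]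
      by (simp add: N'_def)
  next
    fix n :: nat and x :: "'a mat" assume n: "0 < n" and x: "x \<in> carrier_mat n n"
    have px: "map_mat \<phi> x \<in> carrier_mat n n" using x by simp
    show "0 \<le> N' x" using opspace_structureD(2)[OF C n x] by (simp add: N'_def)
    have "N (map_mat \<phi> (0\<^sub>m n n)) = 0" using opspace_zero[OF N n] by (simp add: map_mat_zero[OF lin])
    then show "N' x = 0 \<longleftrightarrow> x = 0\<^sub>m n n"
      using opspace_structureD(2,3)[OF C n x] opspace_structureD(2)[OF N n px]
      by (auto simp: N'_def max_def split: if_splits)
    show "N' (map_mat (scaleC c) x) = cmod c * N' x" for c
      using opspace_structureD(4)[OF C n x, of c] opspace_structureD(4)[OF N n px, of c]
      by (simp add: N'_def map_mat_linear(3)[OF lin x x] max_mult_distrib_left)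
    show "N' (x + y) \<le> N' x + N' y" if y: "y \<in> carrier_mat n n" for y
      using opspace_structureD(5)[OF C n x y] opspace_structureD(5)[OF N n px, of "map_mat \<phi> y"] y
      by (auto simp: N'_def map_mat_linear(1)[OF lin x y] max_def)
    show "N' (scalar_conj \<alpha> x \<beta>) \<le> cstar_mnorm \<alpha> * N' x * cstar_mnorm \<beta>"
      if a: "\<alpha> \<in> carrier_mat n n" and b: "\<beta> \<in> carrier_mat n n" for \<alpha> \<beta>
    proof -
      have sum: "\<phi> (sum f A) = (\<Sum>k\<in>A. \<phi> (f k))" for f :: "nat \<Rightarrow> 'a" and A
        by (induction A rule: infinite_finite_induct) (auto simp: scaleC_linearD[OF lin])
      have eq: "map_mat \<phi> (scalar_conj \<alpha> x \<beta>) = scalar_conj \<alpha> (map_mat \<phi> x) \<beta>"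
        by (rule eq_matI) (use x a b in \<open>auto simp: scalar_conj_def sum scaleC_linearD[OF lin]\<close>)
      have nn: "0 \<le> cstar_mnorm \<alpha>" "0 \<le> cstar_mnorm \<beta>"
        using cstar_mnorm_nonneg[OF a] cstar_mnorm_nonneg[OF b] by auto
      have "cstar_mnorm \<alpha> * cstar_mnorm x * cstar_mnorm \<beta> \<le> cstar_mnorm \<alpha> * N' x * cstar_mnorm \<beta>"
        "cstar_mnorm \<alpha> * N (map_mat \<phi> x) * cstar_mnorm \<beta> \<le> cstar_mnorm \<alpha> * N' x * cstar_mnorm \<beta>"
        using nn by (auto simp: N'_def intro!: mult_left_mono mult_right_mono)
      then show ?thesis
        using opspace_structureD(6)[OF C n x a b] opspace_structureD(6)[OF N n px a b]
        unfolding N'_def[of "scalar_conj \<alpha> x \<beta>"] eq by simp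
    qed
    show "N' (four_block_mat x (0\<^sub>m n m) (0\<^sub>m m n) y) = max (N' x) (N' y)"
      if m: "0 < m" and y: "y \<in> carrier_mat m m" for m y
      using opspace_structureD(7)[OF C n x m y] opspace_structureD(7)[OF N n px m, of "map_mat \<phi> y"] y
      by (simp add: N'_def map_mat_four_block[OF x zero_carrier_mat zero_carrier_mat y] map_mat_zero[OF lin]
          max.assoc max.left_commute)
  qed
  then have "N' x \<le> max_mnorm x" by (rule max_mnorm_upper[OF _ n x])
  then show "N (map_mat \<phi> x) \<le> max_mnorm x" by (simp add: N'_def)
qed

section \<open>Algebraic tensor powers\<close>

lemma lookup_fscale [simp]: "Poly_Mapping.lookup (fscale c f) k = c * Poly_Mapping.lookup f k"
  by (simp add: fscale_def Poly_Mapping.map.rep_eq when_def)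

lemma fscale_single [simp]: "fscale c (Poly_Mapping.single k d) = Poly_Mapping.single k (c * d)"
  by (rule poly_mapping_eqI) (simp add: lookup_single when_def)

interpretation free_module: Modules.module fscale
  by unfold_locales (auto intro!: poly_mapping_eqI simp: lookup_add algebra_simps)

abbreviation homog :: "nat \<Rightarrow> 'a free \<Rightarrow> bool" where
  "homog l f \<equiv> f \<in> points (free_space l)"

lemma homog_iff: "homog l f \<longleftrightarrow> (\<forall>as\<in>Poly_Mapping.keys f. length as = l)"
  by (simp add: free_space_def)

lemma homog_zero [simp]: "homog l 0" by (simp add: homog_iff)

lemma homog_single: "length as = l \<Longrightarrow> homog l (Poly_Mapping.single as c)"
  by (simp add: homog_iff)

lemma homog_add: "homog l f \<Longrightarrow> homog l g \<Longrightarrow> homog l (f + g)"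
  unfolding homog_iff using Poly_Mapping.keys_add[of f g] by blast

lemma homog_sum: "(\<And>i. i \<in> I \<Longrightarrow> homog l (f i)) \<Longrightarrow> homog l (sum f I)"
  by (induction I rule: infinite_finite_induct) (auto intro: homog_add)

lemma homog_fscale: "homog l f \<Longrightarrow> homog l (fscale c f)"
  unfolding homog_iff by (auto simp: in_keys_iff)

lemma homog_diff: "homog l f \<Longrightarrow> homog l g \<Longrightarrow> homog l (f - g)"
  using homog_add[of f l "fscale (- 1) g"] homog_fscale[of g l "- 1"] by simp

lemma free_eq_sum_single:
  assumes "finite A" "Poly_Mapping.keys f \<subseteq> A"
  shows "f = (\<Sum>as\<in>A. Poly_Mapping.single as (Poly_Mapping.lookup f as))"
proof (rule poly_mapping_eqI)
  fix k
  have "Poly_Mapping.lookup (\<Sum>as\<in>A. Poly_Mapping.single as (Poly_Mapping.lookup f as)) k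
      = (\<Sum>as\<in>A. if as = k then Poly_Mapping.lookup f as else 0)"
    by (simp add: lookup_sum lookup_single when_def)
  also have "\<dots> = Poly_Mapping.lookup f k"
    using assms by (auto simp: sum.delta in_keys_iff subset_iff)
  finally show "Poly_Mapping.lookup f k = Poly_Mapping.lookup (\<Sum>as\<in>A. Poly_Mapping.single as (Poly_Mapping.lookup f as)) k" ..
qed

text \<open>Sums over the support may be extended to any finite superset of it, which makes them additive.\<close>

lemma keys_sum_superset:
  fixes \<phi> :: "'a list \<Rightarrow> complex \<Rightarrow> 'b::comm_monoid_add"
  assumes "finite A" "Poly_Mapping.keys f \<subseteq> A" "\<And>k. \<phi> k 0 = 0"
  shows "(\<Sum>as\<in>Poly_Mapping.keys f. \<phi> as (Poly_Mapping.lookup f as)) = (\<Sum>as\<in>A. \<phi> as (Poly_Mapping.lookup f as))"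
  by (rule sum.mono_neutral_left) (use assms in \<open>auto simp: in_keys_iff\<close>)

lemma keys_sum_add:
  fixes \<phi> :: "'a list \<Rightarrow> complex \<Rightarrow> 'b::comm_monoid_add"
  assumes "\<And>k. \<phi> k 0 = 0" "\<And>k c d. \<phi> k (c + d) = \<phi> k c + \<phi> k d"
  shows "(\<Sum>as\<in>Poly_Mapping.keys (f + g). \<phi> as (Poly_Mapping.lookup (f + g) as))
    = (\<Sum>as\<in>Poly_Mapping.keys f. \<phi> as (Poly_Mapping.lookup f as)) + (\<Sum>as\<in>Poly_Mapping.keys g. \<phi> as (Poly_Mapping.lookup g as))"
proof -
  let ?A = "Poly_Mapping.keys f \<union> Poly_Mapping.keys g"
  have A: "finite ?A" by simp
  note sup = keys_sum_superset[of ?A _ \<phi>, OF A _ assms(1)]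
  show ?thesis
    unfolding sup[OF Poly_Mapping.keys_add] sup[of f, OF Un_upper1] sup[of g, OF Un_upper2]
    by (simp add: lookup_add assms(2) sum.distrib)
qed

lemma keys_fscale_subset: "Poly_Mapping.keys (fscale c f) \<subseteq> Poly_Mapping.keys f"
  by (auto simp: in_keys_iff)

text \<open>Prefixing a letter is the recursion step for tensor products with one more factor.\<close>

definition prep :: "'a \<Rightarrow> 'a free \<Rightarrow> 'a free" where
  "prep a f = (\<Sum>as\<in>Poly_Mapping.keys f. Poly_Mapping.single (a # as) (Poly_Mapping.lookup f as))"

lemma prep_add: "prep a (f + g) = prep a f + prep a g"
  unfolding prep_def by (rule keys_sum_add) (auto simp: single_add)

lemma prep_zero [simp]: "prep a 0 = 0" by (simp add: prep_def)

lemma prep_single [simp]: "prep a (Poly_Mapping.single as c) = Poly_Mapping.single (a # as) c"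
  by (simp add: prep_def)

lemma prep_fscale: "prep a (fscale c f) = fscale c (prep a f)"
  unfolding prep_def
  by (subst keys_sum_superset[OF _ keys_fscale_subset]) (auto simp: free_module.scale_sum_right)

lemma prep_uminus: "prep a (- f) = - prep a f"
  using prep_fscale[of a "- 1" f] by simp

lemma prep_diff: "prep a (f - g) = prep a f - prep a g"
  using prep_add[of a f "- g"] by (simp add: prep_uminus)

lemma prep_sum: "prep a (sum f I) = (\<Sum>i\<in>I. prep a (f i))"
  by (induction I rule: infinite_finite_induct) (auto simp: prep_add)

lemma homog_prep: "homog l f \<Longrightarrow> homog (Suc l) (prep a f)"
  unfolding prep_def by (intro homog_sum homog_single) (auto simp: homog_iff)

lemma free_product_map_add: "free_product_map (f + g) = free_product_map f + free_product_map g"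
  unfolding free_product_map_def by (rule keys_sum_add) (auto simp: scaleC_add_left)

lemma free_product_map_fscale: "free_product_map (fscale c f) = c *\<^sub>C free_product_map f"
  unfolding free_product_map_def
  by (subst keys_sum_superset[OF _ keys_fscale_subset, where \<phi> = "\<lambda>as d. d *\<^sub>C prod_list as"])
    (auto simp: scaleC_sum_right scaleC_scaleC)

lemma free_product_map_single [simp]: "free_product_map (Poly_Mapping.single as c) = c *\<^sub>C prod_list as"
  by (simp add: free_product_map_def)

lemma free_product_map_zero [simp]: "free_product_map 0 = 0"
  by (simp add: free_product_map_def)

lemma free_product_map_diff: "free_product_map (f - g) = free_product_map f - free_product_map g"
  using free_product_map_add[of f "fscale (- 1) g"] free_product_map_fscale[of "- 1" g]
  by (simp add: scaleC_minus_left)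

lemma free_product_map_sum: "free_product_map (sum f I) = (\<Sum>i\<in>I. free_product_map (f i))"
  by (induction I rule: infinite_finite_induct) (auto simp: free_product_map_add)

lemma free_product_map_prep: "free_product_map (prep a f) = a * free_product_map f"
  by (simp add: prep_def free_product_map_sum)
    (simp add: free_product_map_def sum_distrib_left mult_scaleC_right)

text \<open>Equality of the classes in the tensor power.\<close>

definition teq :: "nat \<Rightarrow> 'a::unital_cstar_algebra free \<Rightarrow> 'a free \<Rightarrow> bool" where
  "teq l f g \<longleftrightarrow> f - g \<in> multilinear_null l"

lemma null_zero [simp]: "0 \<in> multilinear_null l"
  and null_add: "f \<in> multilinear_null l \<Longrightarrow> g \<in> multilinear_null l \<Longrightarrow> f + g \<in> multilinear_null l"
  and null_fscale: "f \<in> multilinear_null l \<Longrightarrow> fscale c f \<in> multilinear_null l"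
  and null_uminus: "f \<in> multilinear_null l \<Longrightarrow> - f \<in> multilinear_null l"
  and null_base: "f \<in> multilinear_relators l \<Longrightarrow> f \<in> multilinear_null l"
  unfolding multilinear_null_def
  by (auto intro: free_module.span_zero free_module.span_add free_module.span_scale
      free_module.span_neg free_module.span_base)

lemma teq_refl [simp]: "teq l f f" by (simp add: teq_def)

lemma teq_sym: "teq l f g \<Longrightarrow> teq l g f"
  unfolding teq_def using null_uminus[of "f - g" l] by simp

lemma teq_trans [trans]: "teq l f g \<Longrightarrow> teq l g h \<Longrightarrow> teq l f h"
  unfolding teq_def using null_add[of "f - g" l "g - h"] by simp

lemma teq_add: "teq l f f' \<Longrightarrow> teq l g g' \<Longrightarrow> teq l (f + g) (f' + g')"
  unfolding teq_def using null_add[of "f - f'" l "g - g'"] by (simp add: algebra_simps)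

lemma teq_fscale: "teq l f f' \<Longrightarrow> teq l (fscale c f) (fscale c f')"
  unfolding teq_def using null_fscale[of "f - f'" l c] by (simp add: free_module.scale_right_diff_distrib)

lemma teq_sum: "(\<And>i. i \<in> I \<Longrightarrow> teq l (f i) (g i)) \<Longrightarrow> teq l (sum f I) (sum g I)"
  by (induction I rule: infinite_finite_induct) (auto intro: teq_add)

lemma teq_prep:
  assumes "teq l f g"
  shows "teq (Suc l) (prep a f) (prep a g)"
proof -
  have "prep a h \<in> multilinear_null (Suc l)" if "h \<in> multilinear_null l" for h
    using that unfolding multilinear_null_def[of l]
  proof (induction rule: free_module.span_induct_alt)
    case base
    then show ?case by simp
  next
    case (step c r h)
    have "prep a r \<in> multilinear_relators (Suc l)"
      using step(1) unfolding multilinear_relators_def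
    proof (elim UnE CollectE exE conjE)
      fix us vs b d
      assume r: "r = Poly_Mapping.single (us @ [b + d] @ vs) 1 - Poly_Mapping.single (us @ [b] @ vs) 1
          - Poly_Mapping.single (us @ [d] @ vs) 1" and len: "length us + 1 + length vs = l"
      show "prep a r \<in> {Poly_Mapping.single (us @ [a + b] @ vs) 1 - Poly_Mapping.single (us @ [a] @ vs) 1
        - Poly_Mapping.single (us @ [b] @ vs) 1 |us vs a b. length us + 1 + length vs = Suc l} \<union>
        {Poly_Mapping.single (us @ [c *\<^sub>C a] @ vs) 1 - Poly_Mapping.single (us @ [a] @ vs) c
        |us vs a c. length us + 1 + length vs = Suc l}"
        by (rule UnI1, rule CollectI, rule exI[of _ "a # us"], rule exI[of _ vs], rule exI[of _ b], rule exI[of _ d])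
          (use len in \<open>simp add: r prep_diff\<close>)
    next
      fix us vs b d
      assume r: "r = Poly_Mapping.single (us @ [d *\<^sub>C b] @ vs) 1 - Poly_Mapping.single (us @ [b] @ vs) d"
        and len: "length us + 1 + length vs = l"
      show "prep a r \<in> {Poly_Mapping.single (us @ [a + b] @ vs) 1 - Poly_Mapping.single (us @ [a] @ vs) 1
        - Poly_Mapping.single (us @ [b] @ vs) 1 |us vs a b. length us + 1 + length vs = Suc l} \<union>
        {Poly_Mapping.single (us @ [c *\<^sub>C a] @ vs) 1 - Poly_Mapping.single (us @ [a] @ vs) c
        |us vs a c. length us + 1 + length vs = Suc l}"
        by (rule UnI2, rule CollectI, rule exI[of _ "a # us"], rule exI[of _ vs], rule exI[of _ b], rule exI[of _ d])
          (use len in \<open>simp add: r prep_diff\<close>)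
    qed
    then show ?case using step(2)
      by (simp add: prep_add prep_fscale null_add null_fscale null_base)
  qed
  then show ?thesis using assms by (simp add: teq_def prep_diff[symmetric])
qed

lemma teq_prep_add:
  assumes "homog l f"
  shows "teq (Suc l) (prep (a + b) f) (prep a f + prep b f)"
proof -
  have "teq (Suc l) (Poly_Mapping.single ((a + b) # as) c) (Poly_Mapping.single (a # as) c + Poly_Mapping.single (b # as) c)"
    if "as \<in> Poly_Mapping.keys f" for as c
  proof -
    have "Poly_Mapping.single ([] @ [a + b] @ as) 1 - Poly_Mapping.single ([] @ [a] @ as) 1
        - Poly_Mapping.single ([] @ [b] @ as) (1::complex) \<in> multilinear_relators (Suc l)"
      unfolding multilinear_relators_def
      by (rule UnI1, rule CollectI, rule exI[of _ "[]"], rule exI[of _ as], rule exI[of _ a], rule exI[of _ b])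
        (use that assms in \<open>simp add: homog_iff\<close>)
    from null_fscale[OF null_base[OF this], of c] show ?thesis
      by (simp add: teq_def free_module.scale_right_diff_distrib free_module.scale_right_distrib diff_diff_eq)
  qed
  then show ?thesis unfolding prep_def sum.distrib[symmetric] by (intro teq_sum)
qed

lemma teq_prep_scaleC:
  assumes "homog l f"
  shows "teq (Suc l) (prep (c *\<^sub>C a) f) (fscale c (prep a f))"
proof -
  have "teq (Suc l) (Poly_Mapping.single ((c *\<^sub>C a) # as) d) (fscale c (Poly_Mapping.single (a # as) d))"
    if "as \<in> Poly_Mapping.keys f" for as d
  proof -
    have "Poly_Mapping.single ([] @ [c *\<^sub>C a] @ as) 1 - Poly_Mapping.single ([] @ [a] @ as) c
        \<in> multilinear_relators (Suc l)"
      unfolding multilinear_relators_def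
      by (rule UnI2, rule CollectI, rule exI[of _ "[]"], rule exI[of _ as], rule exI[of _ a], rule exI[of _ c])
        (use that assms in \<open>simp add: homog_iff\<close>)
    from null_fscale[OF null_base[OF this], of d] show ?thesis
      by (simp add: teq_def free_module.scale_right_diff_distrib mult.commute)
  qed
  then show ?thesis unfolding prep_def free_module.scale_sum_right by (intro teq_sum)
qed

lemma teq_prep_zero: "homog l f \<Longrightarrow> teq (Suc l) (prep 0 f) 0"
  using teq_prep_scaleC[of f l 0 0] by simp

lemma teq_prep_sum:
  assumes "homog l f"
  shows "teq (Suc l) (prep (\<Sum>i\<in>I. g i) f) (\<Sum>i\<in>I. prep (g i) f)"
proof (induction I rule: infinite_finite_induct)
  case (insert i I)
  then show ?case using teq_trans[OF teq_prep_add[OF assms] teq_add[OF teq_refl insert.IH]] by simp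
qed (auto simp: teq_prep_zero[OF assms])

lemma free_product_map_null:
  assumes "f \<in> multilinear_null l"
  shows "free_product_map f = 0"
  using assms unfolding multilinear_null_def
proof (induction rule: free_module.span_induct_alt)
  case (step c r h)
  have "free_product_map r = 0"
    using step(1) unfolding multilinear_relators_def
    by (auto simp: free_product_map_diff distrib_left distrib_right mult_scaleC_left mult_scaleC_right scaleC_add_right)
  then show ?case using step(2) by (simp add: free_product_map_add free_product_map_fscale)
qed simp

lemma free_product_map_teq: "teq l f g \<Longrightarrow> free_product_map f = free_product_map g"
  using free_product_map_null[of "f - g" l] by (simp add: teq_def free_product_map_diff)

text \<open>The entries of a tensor product of matrices by recursion on the number of factors, instead of as
sums over index paths.\<close>

fun path_tensor :: "'a mat list \<Rightarrow> nat list \<Rightarrow> nat \<Rightarrow> nat \<Rightarrow> 'a free" where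
  "path_tensor [] rs i j = (if i = j then Poly_Mapping.single [] 1 else 0)"
| "path_tensor (x # xs) rs i j = (\<Sum>k<rs ! 1. prep (x $$ (i, k)) (path_tensor xs (tl rs) k j))"

definition index_paths :: "nat list \<Rightarrow> nat \<Rightarrow> nat \<Rightarrow> nat \<Rightarrow> nat list set" where
  "index_paths rs l i j = {ks. length ks = l + 1 \<and> ks ! 0 = i \<and> ks ! l = j \<and> (\<forall>p\<le>l. ks ! p < rs ! p)}"

lemma finite_index_paths:
  assumes "length rs = l + 1"
  shows "finite (index_paths rs l i j)"
proof (rule finite_subset)
  show "index_paths rs l i j \<subseteq> {ks. set ks \<subseteq> {..<Suc (Max (set rs))} \<and> length ks = l + 1}"
  proof
    fix ks assume ks: "ks \<in> index_paths rs l i j"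
    have "k < Suc (Max (set rs))" if kks: "k \<in> set ks" for k
    proof -
      obtain p where p: "p < length ks" "k = ks ! p" using kks by (metis in_set_conv_nth)
      then have "k < rs ! p" using ks by (auto simp: index_paths_def)
      also have "rs ! p \<le> Max (set rs)" using p ks assms by (intro Max_ge) (auto simp: index_paths_def)
      finally show ?thesis by simp
    qed
    then show "ks \<in> {ks. set ks \<subseteq> {..<Suc (Max (set rs))} \<and> length ks = l + 1}"
      using ks by (auto simp: index_paths_def)
  qed
  show "finite {ks. set ks \<subseteq> {..<Suc (Max (set rs))} \<and> length ks = l + 1}"
    by (rule finite_lists_length_eq) simp
qed

lemma path_tensor_eq_sum:
  assumes "length rs = length xs + 1" "i < rs ! 0"
  shows "(\<Sum>ks\<in>index_paths rs (length xs) i j.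
      Poly_Mapping.single (map (\<lambda>p. (xs ! p) $$ (ks ! p, ks ! (p + 1))) [0..<length xs]) 1) = path_tensor xs rs i j"
  using assms
proof (induction xs arbitrary: rs i)
  case Nil
  have "index_paths rs 0 i j = (if i = j then {[i]} else {})"
    using Nil by (auto simp: index_paths_def length_Suc_conv)
  then show ?case by simp
next
  case (Cons x xs)
  let ?l = "length xs"
  obtain r rs' where rs: "rs = r # rs'" "length rs' = ?l + 1" using Cons.prems by (cases rs) auto
  have "index_paths rs (Suc ?l) i j = (\<lambda>(k, ks). i # ks) ` (SIGMA k:{..<rs' ! 0}. index_paths rs' ?l k j)"
    (is "?L = ?R")
  proof
    show "?L \<subseteq> ?R"
    proof
      fix ks assume ks: "ks \<in> ?L"
      then obtain ks' where ks': "ks = i # ks'" "length ks' = ?l + 1"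
        by (cases ks) (auto simp: index_paths_def)
      have b: "\<forall>p\<le>Suc ?l. ks ! p < rs ! p" and last: "ks ! Suc ?l = j" using ks by (auto simp: index_paths_def)
      have "ks' ! p < rs' ! p" if "p \<le> ?l" for p using b[rule_format, of "Suc p"] that ks' rs by simp
      then have "ks' \<in> index_paths rs' ?l (ks' ! 0) j" "ks' ! 0 < rs' ! 0"
        using ks' last by (auto simp: index_paths_def)
      then show "ks \<in> ?R" using ks' by force
    qed
    show "?R \<subseteq> ?L"
    proof
      fix ks assume "ks \<in> ?R"
      then obtain ks' k where k: "ks = i # ks'" "ks' \<in> index_paths rs' ?l k j" by auto
      have "ks ! p < rs ! p" if "p \<le> Suc ?l" for p
        using that k Cons.prems rs by (cases p) (auto simp: index_paths_def)
      then show "ks \<in> ?L" using k by (auto simp: index_paths_def)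
    qed
  qed
  moreover have "inj_on (\<lambda>(k, ks). i # ks) (SIGMA k:{..<rs' ! 0}. index_paths rs' ?l k j)"
    by (auto simp: inj_on_def index_paths_def)
  moreover have "map (\<lambda>p. ((x # xs) ! p) $$ ((i # ks) ! p, (i # ks) ! (p + 1))) [0..<Suc ?l]
     = x $$ (i, ks ! 0) # map (\<lambda>p. (xs ! p) $$ (ks ! p, ks ! (p + 1))) [0..<?l]" for ks
    by (simp add: upt_conv_Cons map_Suc_upt[symmetric] del: upt_Suc)
  ultimately have "(\<Sum>ks\<in>index_paths rs (length (x # xs)) i j.
      Poly_Mapping.single (map (\<lambda>p. ((x # xs) ! p) $$ (ks ! p, ks ! (p + 1))) [0..<length (x # xs)]) 1)
    = (\<Sum>(k, ks)\<in>(SIGMA k:{..<rs' ! 0}. index_paths rs' ?l k j).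
        Poly_Mapping.single (x $$ (i, ks ! 0) # map (\<lambda>p. (xs ! p) $$ (ks ! p, ks ! (p + 1))) [0..<?l]) 1)"
    by (simp add: sum.reindex case_prod_unfold del: upt_Suc)
  also have "\<dots> = (\<Sum>k<rs' ! 0. \<Sum>ks\<in>index_paths rs' ?l k j.
        Poly_Mapping.single (x $$ (i, ks ! 0) # map (\<lambda>p. (xs ! p) $$ (ks ! p, ks ! (p + 1))) [0..<?l]) 1)"
    using finite_index_paths[OF rs(2)] by (subst sum.Sigma) auto
  also have "\<dots> = (\<Sum>k<rs' ! 0. prep (x $$ (i, k)) (\<Sum>ks\<in>index_paths rs' ?l k j.
        Poly_Mapping.single (map (\<lambda>p. (xs ! p) $$ (ks ! p, ks ! (p + 1))) [0..<?l]) 1))"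
    by (simp add: prep_sum) (auto simp: index_paths_def intro!: sum.cong)
  also have "\<dots> = (\<Sum>k<rs' ! 0. prep (x $$ (i, k)) (path_tensor xs rs' k j))"
    using Cons.IH[OF rs(2)] by (intro sum.cong) auto
  finally show ?case using rs by simp
qed

abbreviation tclass :: "nat \<Rightarrow> 'a::unital_cstar_algebra free \<Rightarrow> 'a free set" where
  "tclass l \<equiv> vcoset (free_space l) (multilinear_null l)"

lemma vcoset_tclass: "vcoset (free_space l) (multilinear_null l) f = {f + m |m. m \<in> multilinear_null l}"
  by (simp add: vcoset_def free_space_def)

lemma in_tclass_iff: "g \<in> tclass l f \<longleftrightarrow> teq l g f"
proof -
  have "g \<in> tclass l f \<longleftrightarrow> (\<exists>m. g = f + m \<and> m \<in> multilinear_null l)" by (auto simp: vcoset_tclass)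
  also have "\<dots> \<longleftrightarrow> teq l g f" unfolding teq_def
    by (auto intro: exI[of _ "g - f"])
  finally show ?thesis .
qed

lemma tclass_eq_iff: "tclass l f = tclass l g \<longleftrightarrow> teq l f g"
proof
  assume "tclass l f = tclass l g"
  then have "f \<in> tclass l g" using in_tclass_iff[of f l f] by simp
  then show "teq l f g" by (simp add: in_tclass_iff)
next
  assume t: "teq l f g"
  show "tclass l f = tclass l g"
    by (rule Set.set_eqI) (use t in \<open>auto simp: in_tclass_iff intro: teq_trans teq_sym\<close>)
qed

lemma tensor_prod_eq_path_tensor:
  assumes "length rs = length xs + 1"
  shows "tensor_prod xs rs = mat (rs ! 0) (rs ! length xs) (\<lambda>(i, j). tclass (length xs) (path_tensor xs rs i j))"
  by (rule eq_matI)
    (auto simp: tensor_prod_def Let_def path_tensor_eq_sum[OF assms, unfolded index_paths_def, simplified]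
      path_tensor_eq_sum[OF assms, unfolded index_paths_def])

text \<open>Factorizations are best compared when all factors are square of one size; rectangular ones are
reached by padding, and recovered by truncating the first and the last factor.\<close>

fun sq_tensor :: "nat \<Rightarrow> 'a mat list \<Rightarrow> nat \<Rightarrow> nat \<Rightarrow> 'a free" where
  "sq_tensor M [] i j = (if i = j then Poly_Mapping.single [] 1 else 0)"
| "sq_tensor M (x # xs) i j = (\<Sum>k<M. prep (x $$ (i, k)) (sq_tensor M xs k j))"

lemma homog_sq_tensor: "homog (length xs) (sq_tensor M xs i j)"
  by (induction xs arbitrary: i) (auto intro!: homog_sum homog_prep homog_single)

lemma path_tensor_replicate: "sq_tensor M xs i j = path_tensor xs (replicate (Suc (length xs)) M) i j"
  by (induction xs arbitrary: i) (auto simp: nth_Cons')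

text \<open>The additional index paths run through an entry \<open>0\<close>, and a tensor with a factor \<open>0\<close> vanishes in the
tensor power.\<close>

lemma path_tensor_pad:
  assumes "length rs = length xs + 1" "\<forall>p<length xs. xs ! p \<in> carrier_mat (rs ! p) (rs ! (p + 1))"
    and "\<forall>p\<le>length xs. rs ! p \<le> M" "i < rs ! 0"
  shows "teq (length xs) (path_tensor xs rs i j) (sq_tensor M (map (pad_to M) xs) i j)"
  using assms
proof (induction xs arbitrary: rs i)
  case (Cons x xs)
  obtain r rs' where rs: "rs = r # rs'" "length rs' = length xs + 1" using Cons.prems by (cases rs) auto
  have xr: "x \<in> carrier_mat r (rs' ! 0)" using Cons.prems(2)[rule_format, of 0] rs by simp
  have r: "rs' ! 0 \<le> M" "r \<le> M" "i < r"
    using Cons.prems(3)[rule_format, of 1] Cons.prems(3)[rule_format, of 0] Cons.prems(4) rs by auto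
  have "\<forall>p<length xs. xs ! p \<in> carrier_mat (rs' ! p) (rs' ! (p + 1))"
    using Cons.prems(2) rs by auto
  moreover have "\<forall>p\<le>length xs. rs' ! p \<le> M"
    using Cons.prems(3) rs by auto
  ultimately have IH: "teq (length xs) (path_tensor xs rs' k j) (sq_tensor M (map (pad_to M) xs) k j)"
    if "k < rs' ! 0" for k
    using Cons.IH[OF rs(2)] that by blast
  let ?f = "\<lambda>k. prep (pad_to M x $$ (i, k)) (sq_tensor M (map (pad_to M) xs) k j)"
  have "teq (Suc (length xs)) (\<Sum>k<rs' ! 0. prep (x $$ (i, k)) (path_tensor xs rs' k j)) (\<Sum>k<rs' ! 0. ?f k)"
    using xr r by (intro teq_sum) (auto intro!: teq_prep IH)
  moreover have "teq (Suc (length xs)) (\<Sum>k\<in>{rs' ! 0..<M}. ?f k) (\<Sum>k\<in>{rs' ! 0..<M}. 0)"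
    using xr r by (intro teq_sum) (auto intro!: teq_prep_zero homog_sq_tensor[where xs = "map (pad_to M) xs", simplified])
  ultimately have "teq (Suc (length xs)) ((\<Sum>k<rs' ! 0. prep (x $$ (i, k)) (path_tensor xs rs' k j)) + 0)
      ((\<Sum>k<rs' ! 0. ?f k) + (\<Sum>k\<in>{rs' ! 0..<M}. ?f k))"
    by (intro teq_add) (auto intro: teq_sym)
  also have "(\<Sum>k<rs' ! 0. ?f k) + (\<Sum>k\<in>{rs' ! 0..<M}. ?f k) = (\<Sum>k<M. ?f k)"
    using r(1) by (simp add: lessThan_atLeast0 sum.atLeastLessThan_concat)
  finally show ?case using rs by simp
qed simp

lemma path_tensor_truncate:
  assumes "length rs = length xs + 1" "\<And>p. 0 < p \<Longrightarrow> p < length xs \<Longrightarrow> rs ! p = M" "rs ! length xs = n"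
    and "i < rs ! 0" "j < n" "n \<le> M" "xs \<noteq> []"
  shows "path_tensor (map (\<lambda>p. mat (rs ! p) (rs ! (p + 1)) (\<lambda>q. (xs ! p) $$ q)) [0..<length xs]) rs i j
    = sq_tensor M xs i j"
  using assms
proof (induction xs arbitrary: rs i)
  case (Cons x xs)
  obtain r rs' where rs: "rs = r # rs'" "length rs' = length xs + 1" using Cons.prems by (cases rs) auto
  let ?ys = "map (\<lambda>p. mat (rs' ! p) (rs' ! (p + 1)) (\<lambda>q. (xs ! p) $$ q)) [0..<length xs]"
  have l: "map (\<lambda>p. mat (rs ! p) (rs ! (p + 1)) (\<lambda>q. ((x # xs) ! p) $$ q)) [0..<length (x # xs)]
    = mat r (rs' ! 0) (\<lambda>q. x $$ q) # ?ys"
    using rs by (simp add: upt_conv_Cons map_Suc_upt[symmetric] del: upt_Suc)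
  have L: "path_tensor (map (\<lambda>p. mat (rs ! p) (rs ! (p + 1)) (\<lambda>q. ((x # xs) ! p) $$ q)) [0..<length (x # xs)]) rs i j
    = (\<Sum>k<rs' ! 0. prep (x $$ (i, k)) (path_tensor ?ys rs' k j))"
    unfolding l using Cons.prems(4) rs by simp
  show ?case
  proof (cases xs)
    case Nil
    then have "rs' ! 0 = n" using Cons.prems(3) rs by simp
    moreover have "(\<Sum>k<m. prep (x $$ (i, k)) (if k = j then Poly_Mapping.single [] 1 else 0))
      = prep (x $$ (i, j)) (Poly_Mapping.single [] 1)" if "j < m" for m
    proof -
      have "(\<Sum>k<m. prep (x $$ (i, k)) (if k = j then Poly_Mapping.single [] 1 else 0))
        = (\<Sum>k<m. if k = j then prep (x $$ (i, k)) (Poly_Mapping.single [] 1) else 0)"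
        by (intro sum.cong) auto
      then show ?thesis using that by simp
    qed
    ultimately show ?thesis unfolding L using Cons.prems(5,6) Nil by simp
  next
    case (Cons y ys)
    have "rs' ! 0 = M" using Cons.prems(2)[of 1] rs Cons by simp
    moreover have "path_tensor ?ys rs' k j = sq_tensor M xs k j" if "k < rs' ! 0" for k
    proof (rule Cons.IH)
      show "rs' ! p = M" if "0 < p" "p < length xs" for p
        using Cons.prems(2)[of "Suc p"] rs that by simp
    qed (use rs Cons.prems that Cons in auto)
    ultimately show ?thesis unfolding L by (auto intro!: sum.cong)
  qed
qed simp

section \<open>The unit ball of the Haagerup norm\<close>

definition mat_prod :: "nat \<Rightarrow> 'a::semiring_1 mat list \<Rightarrow> 'a mat" where
  "mat_prod M xs = foldr (*) xs (1\<^sub>m M)"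

lemma mat_prod_simps [simp]: "mat_prod M [] = 1\<^sub>m M" "mat_prod M (x # xs) = x * mat_prod M xs"
  by (simp_all add: mat_prod_def)

lemma mat_prod_carrier:
  "(\<And>x. x \<in> set xs \<Longrightarrow> x \<in> carrier_mat M M) \<Longrightarrow> mat_prod M xs \<in> carrier_mat M M"
  by (induction xs) (auto intro: mult_carrier_mat)

lemma free_product_map_sq_tensor:
  assumes "\<And>x. x \<in> set xs \<Longrightarrow> x \<in> carrier_mat M M" "i < M" "j < M"
  shows "free_product_map (sq_tensor M xs i j) = mat_prod M xs $$ (i, j)"
  using assms
proof (induction xs arbitrary: i)
  case (Cons x xs)
  have x: "x \<in> carrier_mat M M" and p: "mat_prod M xs \<in> carrier_mat M M"
    using Cons.prems(1) by (auto intro: mat_prod_carrier)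
  have "free_product_map (sq_tensor M (x # xs) i j) = (\<Sum>k<M. x $$ (i, k) * mat_prod M xs $$ (k, j))"
    using Cons by (simp add: free_product_map_sum free_product_map_prep)
  also have "\<dots> = mat_prod M (x # xs) $$ (i, j)"
    using index_mat_mult_sum[OF x p Cons.prems(2,3)] by simp
  finally show ?case .
qed simp

text \<open>Scalar matrices pass through the tensor signs, here out of the first factor.\<close>

lemma sq_tensor_left_scalar:
  assumes x: "x \<in> carrier_mat M M" and a: "\<alpha> \<in> carrier_mat M M" and i: "i < M"
  shows "teq (Suc (length xs)) (sq_tensor M (scalar_mat \<alpha> * x # xs) i j)
    (\<Sum>k<M. fscale (\<alpha> $$ (i, k)) (sq_tensor M (x # xs) k j))"
proof -
  note h = homog_sq_tensor[where xs = xs and M = M and j = j]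
  have "teq (Suc (length xs)) (prep ((scalar_mat \<alpha> * x) $$ (i, m)) (sq_tensor M xs m j))
      (\<Sum>k<M. fscale (\<alpha> $$ (i, k)) (prep (x $$ (k, m)) (sq_tensor M xs m j)))" if m: "m < M" for m
  proof -
    have "(scalar_mat \<alpha> * x) $$ (i, m) = (\<Sum>k<M. \<alpha> $$ (i, k) *\<^sub>C x $$ (k, m))"
      unfolding index_mat_mult_sum[OF scalar_mat_carrier[OF a] x i m]
      by (intro sum.cong refl) (use a i in \<open>simp add: mult_scaleC_left\<close>)
    then have "teq (Suc (length xs)) (prep ((scalar_mat \<alpha> * x) $$ (i, m)) (sq_tensor M xs m j))
       (\<Sum>k<M. prep (\<alpha> $$ (i, k) *\<^sub>C x $$ (k, m)) (sq_tensor M xs m j))"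
      using teq_prep_sum[OF h] by simp
    also have "teq (Suc (length xs)) \<dots> (\<Sum>k<M. fscale (\<alpha> $$ (i, k)) (prep (x $$ (k, m)) (sq_tensor M xs m j)))"
      by (intro teq_sum teq_prep_scaleC h)
    finally show ?thesis .
  qed
  then have "teq (Suc (length xs)) (sq_tensor M (scalar_mat \<alpha> * x # xs) i j)
      (\<Sum>m<M. \<Sum>k<M. fscale (\<alpha> $$ (i, k)) (prep (x $$ (k, m)) (sq_tensor M xs m j)))"
    unfolding sq_tensor.simps by (intro teq_sum) auto
  also have "(\<Sum>m<M. \<Sum>k<M. fscale (\<alpha> $$ (i, k)) (prep (x $$ (k, m)) (sq_tensor M xs m j)))
      = (\<Sum>k<M. fscale (\<alpha> $$ (i, k)) (sq_tensor M (x # xs) k j))"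
    by (subst sum.swap) (simp add: free_module.scale_sum_right)
  finally show ?thesis .
qed

lemma sq_tensor_right_scalar:
  assumes x: "x \<in> carrier_mat M M" and b: "\<beta> \<in> carrier_mat M M" and ij: "i < M" "j < M"
  shows "teq (Suc (length ys)) (sq_tensor M (ys @ [x * scalar_mat \<beta>]) i j)
    (\<Sum>k<M. fscale (\<beta> $$ (k, j)) (sq_tensor M (ys @ [x]) i k))"
  using ij(1)
proof (induction ys arbitrary: i)
  case Nil
  have one: "sq_tensor M [z] i j = prep (z $$ (i, j)) (Poly_Mapping.single [] 1)" if "j < M" for z :: "'a mat" and j
  proof -
    have "sq_tensor M [z] i j = (\<Sum>k<M. if k = j then prep (z $$ (i, j)) (Poly_Mapping.single [] 1) else 0)"
      unfolding sq_tensor.simps by (intro sum.cong refl) auto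
    also have "\<dots> = prep (z $$ (i, j)) (Poly_Mapping.single [] 1)" using that by (simp add: sum.delta)
    finally show ?thesis .
  qed
  have h: "homog 0 (Poly_Mapping.single [] 1 :: 'a free)" by (simp add: homog_single)
  have "(x * scalar_mat \<beta>) $$ (i, j) = (\<Sum>k<M. \<beta> $$ (k, j) *\<^sub>C x $$ (i, k))"
    unfolding index_mat_mult_sum[OF x scalar_mat_carrier[OF b] Nil ij(2)]
    by (intro sum.cong refl) (use b ij in \<open>simp add: mult_scaleC_right\<close>)
  then have "teq (Suc 0) (sq_tensor M [x * scalar_mat \<beta>] i j)
      (\<Sum>k<M. prep (\<beta> $$ (k, j) *\<^sub>C x $$ (i, k)) (Poly_Mapping.single [] 1))"
    unfolding one[OF ij(2)] using teq_prep_sum[OF h] by simp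
  also have "teq (Suc 0) \<dots> (\<Sum>k<M. fscale (\<beta> $$ (k, j)) (prep (x $$ (i, k)) (Poly_Mapping.single [] 1)))"
    by (intro teq_sum teq_prep_scaleC h)
  also have "\<dots> = (\<Sum>k<M. fscale (\<beta> $$ (k, j)) (sq_tensor M [x] i k))"
    by (intro sum.cong refl) (simp add: one del: sq_tensor.simps)
  finally show ?case by simp
next
  case (Cons y ys)
  have "teq (Suc (Suc (length ys))) (sq_tensor M ((y # ys) @ [x * scalar_mat \<beta>]) i j)
      (\<Sum>m<M. prep (y $$ (i, m)) (\<Sum>k<M. fscale (\<beta> $$ (k, j)) (sq_tensor M (ys @ [x]) m k)))"
    using Cons.IH by (auto intro!: teq_sum teq_prep)
  also have "\<dots> = (\<Sum>k<M. fscale (\<beta> $$ (k, j)) (sq_tensor M ((y # ys) @ [x]) i k))"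
    by (simp add: prep_sum prep_fscale free_module.scale_sum_right) (rule sum.swap)
  finally show ?case by simp
qed

lemma sq_tensor_pad:
  assumes "\<And>x. x \<in> set xs \<Longrightarrow> x \<in> carrier_mat M M" "M \<le> M'" "i < M"
  shows "teq (length xs) (sq_tensor M xs i j) (sq_tensor M' (map (pad_to M') xs) i j)"
  unfolding path_tensor_replicate[of M]
  by (rule path_tensor_pad) (use assms in \<open>auto simp: nth_Cons' simp del: replicate_Suc\<close>)

text \<open>An index path that changes between the blocks meets an entry \<open>0\<close> of some factor.\<close>

lemma sq_tensor_diag:
  assumes "length xs = length ys" "\<And>x. x \<in> set xs \<Longrightarrow> x \<in> carrier_mat M M"
    "\<And>y. y \<in> set ys \<Longrightarrow> y \<in> carrier_mat M M"
  shows "i < M \<Longrightarrow> j < M \<Longrightarrow> teq (length xs) (sq_tensor (M + M) (map2 diag_sum xs ys) i j) (sq_tensor M xs i j)"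
    and "i < M \<Longrightarrow> j < M \<Longrightarrow> teq (length xs) (sq_tensor (M + M) (map2 diag_sum xs ys) (M + i) (M + j)) (sq_tensor M ys i j)"
    and "i < M \<Longrightarrow> j < M \<Longrightarrow> teq (length xs) (sq_tensor (M + M) (map2 diag_sum xs ys) i (M + j)) 0"
    and "i < M \<Longrightarrow> j < M \<Longrightarrow> teq (length xs) (sq_tensor (M + M) (map2 diag_sum xs ys) (M + i) j) 0"
proof -
  have "\<forall>i j. i < M \<longrightarrow> j < M \<longrightarrow>
      teq (length xs) (sq_tensor (M + M) (map2 diag_sum xs ys) i j) (sq_tensor M xs i j)
    \<and> teq (length xs) (sq_tensor (M + M) (map2 diag_sum xs ys) (M + i) (M + j)) (sq_tensor M ys i j)
    \<and> teq (length xs) (sq_tensor (M + M) (map2 diag_sum xs ys) i (M + j)) 0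
    \<and> teq (length xs) (sq_tensor (M + M) (map2 diag_sum xs ys) (M + i) j) 0"
    using assms
  proof (induction xs ys rule: list_induct2)
    case (Cons x xs y ys)
    let ?zs = "map2 diag_sum xs ys"
    let ?l = "length xs"
    have x: "x \<in> carrier_mat M M" and y: "y \<in> carrier_mat M M" using Cons.prems by auto
    have h: "homog ?l (sq_tensor (M + M) ?zs k j)" for k j
      using homog_sq_tensor[where xs = ?zs] Cons.hyps by simp
    have IH: "i < M \<Longrightarrow> j < M \<Longrightarrow> teq ?l (sq_tensor (M + M) ?zs i j) (sq_tensor M xs i j)"
      "i < M \<Longrightarrow> j < M \<Longrightarrow> teq ?l (sq_tensor (M + M) ?zs (M + i) (M + j)) (sq_tensor M ys i j)"
      "i < M \<Longrightarrow> j < M \<Longrightarrow> teq ?l (sq_tensor (M + M) ?zs i (M + j)) 0"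
      "i < M \<Longrightarrow> j < M \<Longrightarrow> teq ?l (sq_tensor (M + M) ?zs (M + i) j) 0" for i j
      using Cons.IH Cons.prems by auto
    have top: "teq (Suc ?l) (sq_tensor (M + M) (diag_sum x y # ?zs) i j)
        (\<Sum>k<M. prep (x $$ (i, k)) (sq_tensor (M + M) ?zs k j))" if i: "i < M" for i j
    proof -
      have "teq (Suc ?l) ((\<Sum>k<M. prep (diag_sum x y $$ (i, k)) (sq_tensor (M + M) ?zs k j))
          + (\<Sum>k<M. prep (diag_sum x y $$ (i, M + k)) (sq_tensor (M + M) ?zs (M + k) j)))
        ((\<Sum>k<M. prep (x $$ (i, k)) (sq_tensor (M + M) ?zs k j)) + (\<Sum>k<M. 0))"
        using x y i by (intro teq_add teq_sum) (auto intro!: teq_prep_zero h)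
      then show ?thesis by (simp add: sum_lessThan_add)
    qed
    have bot: "teq (Suc ?l) (sq_tensor (M + M) (diag_sum x y # ?zs) (M + i) j)
        (\<Sum>k<M. prep (y $$ (i, k)) (sq_tensor (M + M) ?zs (M + k) j))" if i: "i < M" for i j
    proof -
      have "teq (Suc ?l) ((\<Sum>k<M. prep (diag_sum x y $$ (M + i, k)) (sq_tensor (M + M) ?zs k j))
          + (\<Sum>k<M. prep (diag_sum x y $$ (M + i, M + k)) (sq_tensor (M + M) ?zs (M + k) j)))
        ((\<Sum>k<M. 0) + (\<Sum>k<M. prep (y $$ (i, k)) (sq_tensor (M + M) ?zs (M + k) j)))"
        using x y i by (intro teq_add teq_sum) (auto intro!: teq_prep_zero h)
      then show ?thesis by (simp add: sum_lessThan_add)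
    qed
    have z: "teq (Suc ?l) (\<Sum>k<M. prep (w k) (f k)) 0" if "\<And>k. k < M \<Longrightarrow> teq ?l (f k) 0" for w and f :: "nat \<Rightarrow> 'a free"
    proof -
      have "teq (Suc ?l) (\<Sum>k<M. prep (w k) (f k)) (\<Sum>k<M. prep (w k) 0)"
        using that by (intro teq_sum teq_prep) auto
      then show ?thesis by simp
    qed
    show ?case
    proof (intro allI impI conjI)
      fix i j assume i: "i < M" and j: "j < M"
      have "teq (Suc ?l) (\<Sum>k<M. prep (x $$ (i, k)) (sq_tensor (M + M) ?zs k j)) (sq_tensor M (x # xs) i j)"
        using j by (auto intro!: teq_sum teq_prep IH)
      then show "teq (length (x # xs)) (sq_tensor (M + M) (map2 diag_sum (x # xs) (y # ys)) i j) (sq_tensor M (x # xs) i j)"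
        using teq_trans[OF top[OF i]] by simp
      have "teq (Suc ?l) (\<Sum>k<M. prep (y $$ (i, k)) (sq_tensor (M + M) ?zs (M + k) (M + j))) (sq_tensor M (y # ys) i j)"
        using j by (auto intro!: teq_sum teq_prep IH)
      then show "teq (length (x # xs)) (sq_tensor (M + M) (map2 diag_sum (x # xs) (y # ys)) (M + i) (M + j)) (sq_tensor M (y # ys) i j)"
        using teq_trans[OF bot[OF i]] by simp
      show "teq (length (x # xs)) (sq_tensor (M + M) (map2 diag_sum (x # xs) (y # ys)) i (M + j)) 0"
        using teq_trans[OF top[OF i] z[OF IH(3)[OF _ j]]] by simp
      show "teq (length (x # xs)) (sq_tensor (M + M) (map2 diag_sum (x # xs) (y # ys)) (M + i) j) 0"
        using teq_trans[OF bot[OF i] z[OF IH(4)[OF _ j]]] by simp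
    qed
  qed auto
  then show "i < M \<Longrightarrow> j < M \<Longrightarrow> teq (length xs) (sq_tensor (M + M) (map2 diag_sum xs ys) i j) (sq_tensor M xs i j)"
    and "i < M \<Longrightarrow> j < M \<Longrightarrow> teq (length xs) (sq_tensor (M + M) (map2 diag_sum xs ys) (M + i) (M + j)) (sq_tensor M ys i j)"
    and "i < M \<Longrightarrow> j < M \<Longrightarrow> teq (length xs) (sq_tensor (M + M) (map2 diag_sum xs ys) i (M + j)) 0"
    and "i < M \<Longrightarrow> j < M \<Longrightarrow> teq (length xs) (sq_tensor (M + M) (map2 diag_sum xs ys) (M + i) j) 0"
    by auto
qed

lemma sq_tensor_scale:
  assumes "length ts = length xs" "\<And>x. x \<in> set xs \<Longrightarrow> x \<in> carrier_mat M M" "i < M"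
  shows "teq (length xs) (sq_tensor M (map2 (\<lambda>t. map_mat (scaleC t)) ts xs) i j)
    (fscale (prod_list ts) (sq_tensor M xs i j))"
  using assms
proof (induction ts xs arbitrary: i rule: list_induct2)
  case (Cons t ts x xs)
  let ?zs = "map2 (\<lambda>t. map_mat (scaleC t)) ts xs"
  have x: "x \<in> carrier_mat M M" using Cons.prems by simp
  have "teq (Suc (length xs)) (prep (map_mat (scaleC t) x $$ (i, k)) (sq_tensor M ?zs k j))
      (fscale (t * prod_list ts) (prep (x $$ (i, k)) (sq_tensor M xs k j)))" if k: "k < M" for k
  proof -
    have "teq (Suc (length xs)) (prep (map_mat (scaleC t) x $$ (i, k)) (sq_tensor M ?zs k j))
       (prep (t *\<^sub>C x $$ (i, k)) (fscale (prod_list ts) (sq_tensor M xs k j)))"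
    proof -
      have "map_mat (scaleC t) x $$ (i, k) = t *\<^sub>C x $$ (i, k)" using x Cons.prems(2) k by simp
      moreover have "teq (length xs) (sq_tensor M ?zs k j) (fscale (prod_list ts) (sq_tensor M xs k j))"
        using Cons.IH[OF _ k] Cons.prems(1) by simp
      ultimately show ?thesis by (simp add: teq_prep)
    qed
    also have "teq (Suc (length xs)) \<dots> (fscale t (prep (x $$ (i, k)) (fscale (prod_list ts) (sq_tensor M xs k j))))"
      by (intro teq_prep_scaleC homog_fscale homog_sq_tensor)
    finally show ?thesis by (simp add: prep_fscale)
  qed
  then show ?case
    by (auto simp: free_module.scale_sum_right intro!: teq_sum)
qed auto

text \<open>The elements with a factorization into matrices of norm at most \<open>1\<close>.  The factors may be larger than
\<open>F\<close>, which is then the upper left corner of their product; this makes room for the operations below.\<close>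

definition haagerup_ball :: "('a::unital_cstar_algebra mat \<Rightarrow> real) \<Rightarrow> nat \<Rightarrow> nat \<Rightarrow> (nat \<Rightarrow> nat \<Rightarrow> 'a free) \<Rightarrow> bool" where
  "haagerup_ball N l n F \<longleftrightarrow> (\<exists>M xs. n \<le> M \<and> length xs = l \<and>
    (\<forall>x\<in>set xs. x \<in> carrier_mat M M \<and> N x \<le> 1) \<and> (\<forall>i<n. \<forall>j<n. teq l (F i j) (sq_tensor M xs i j)))"

lemma haagerup_ball_teq:
  assumes "haagerup_ball N l n F" "\<And>i j. i < n \<Longrightarrow> j < n \<Longrightarrow> teq l (G i j) (F i j)"
  shows "haagerup_ball N l n G"
proof -
  obtain M xs where xs: "n \<le> M" "length xs = l" "\<forall>x\<in>set xs. x \<in> carrier_mat M M \<and> N x \<le> 1"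
    "\<forall>i<n. \<forall>j<n. teq l (F i j) (sq_tensor M xs i j)" using assms(1) unfolding haagerup_ball_def by blast
  moreover have "\<forall>i<n. \<forall>j<n. teq l (G i j) (sq_tensor M xs i j)"
    using xs(4) assms(2) teq_trans by blast
  ultimately show ?thesis unfolding haagerup_ball_def by blast
qed

lemma haagerup_ball_large:
  assumes N: "opspace_structure N" and n: "0 < n" and F: "haagerup_ball N l n F"
  obtains M0 where "\<And>M. M0 \<le> M \<Longrightarrow> \<exists>xs. n \<le> M \<and> length xs = l \<and>
    (\<forall>x\<in>set xs. x \<in> carrier_mat M M \<and> N x \<le> 1) \<and> (\<forall>i<n. \<forall>j<n. teq l (F i j) (sq_tensor M xs i j))"
proof -
  obtain M xs where xs: "n \<le> M" "length xs = l" "\<forall>x\<in>set xs. x \<in> carrier_mat M M \<and> N x \<le> 1"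
    "\<forall>i<n. \<forall>j<n. teq l (F i j) (sq_tensor M xs i j)" using F unfolding haagerup_ball_def by blast
  show thesis
  proof (rule that[of M], rule exI[of _ "map (pad_to _) xs"], intro conjI)
    fix M' assume M': "M \<le> M'"
    show "n \<le> M'" using xs(1) M' by simp
    show "length (map (pad_to M') xs) = l" using xs(2) by simp
    show "\<forall>x\<in>set (map (pad_to M') xs). x \<in> carrier_mat M' M' \<and> N x \<le> 1"
      using xs M' n by (auto simp: opspace_pad_to[OF N, of _ M])
    show "\<forall>i<n. \<forall>j<n. teq l (F i j) (sq_tensor M' (map (pad_to M') xs) i j)"
    proof (intro allI impI)
      fix i j assume ij: "i < n" "j < n"
      have "teq l (sq_tensor M xs i j) (sq_tensor M' (map (pad_to M') xs) i j)"
        using sq_tensor_pad[of xs M M' i j] xs M' ij by auto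
      then show "teq l (F i j) (sq_tensor M' (map (pad_to M') xs) i j)"
        using xs(4) ij teq_trans by blast
    qed
  qed
qed

text \<open>The scalar matrices are absorbed by the first and the last factor.\<close>

lemma sq_tensor_scalar_conj:
  assumes N: "opspace_structure N" and M: "0 < M" and l: "0 < length xs"
    and xs: "\<forall>x\<in>set xs. x \<in> carrier_mat M M \<and> N x \<le> 1"
    and a: "\<alpha> \<in> carrier_mat M M" "cstar_mnorm \<alpha> \<le> 1" and b: "\<beta> \<in> carrier_mat M M" "cstar_mnorm \<beta> \<le> 1"
  shows "\<exists>ys. length ys = length xs \<and> (\<forall>x\<in>set ys. x \<in> carrier_mat M M \<and> N x \<le> 1) \<and>
    (\<forall>i<M. \<forall>j<M. teq (length xs) (sq_tensor M ys i j)
      (\<Sum>k<M. \<Sum>m<M. fscale (\<alpha> $$ (i, k) * \<beta> $$ (m, j)) (sq_tensor M xs k m)))"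
proof -
  obtain x us where us: "xs = x # us" using l by (cases xs) auto
  define ys where "ys = scalar_mat \<alpha> * x # us"
  have x: "x \<in> carrier_mat M M" "N x \<le> 1" using xs us by auto
  have one: "1\<^sub>m M \<in> carrier_mat M M" "cstar_mnorm (1\<^sub>m M :: complex mat) \<le> 1" using M by auto
  have ax: "scalar_mat \<alpha> * x \<in> carrier_mat M M" by (rule mult_carrier_mat[OF scalar_mat_carrier[OF a(1)] x(1)])
  have "N (scalar_mat \<alpha> * x * scalar_mat (1\<^sub>m M)) \<le> N x"
    by (rule opspace_scalar_mult[OF N M x(1) a one])
  then have nax: "N (scalar_mat \<alpha> * x) \<le> 1"
    using x ax by (simp add: scalar_mat_one)
  have ys: "length ys = length xs" "\<forall>x\<in>set ys. x \<in> carrier_mat M M \<and> N x \<le> 1"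
    using xs us ax nax by (auto simp: ys_def)
  have yteq: "teq (length xs) (sq_tensor M ys i j) (\<Sum>k<M. fscale (\<alpha> $$ (i, k)) (sq_tensor M xs k j))"
    if "i < M" for i j
    using sq_tensor_left_scalar[OF x(1) a(1) that, of us j] unfolding ys_def us by simp
  obtain vs y where vs: "ys = vs @ [y]" using ys(1) l by (cases ys rule: rev_cases) auto
  define zs where "zs = vs @ [y * scalar_mat \<beta>]"
  have y: "y \<in> carrier_mat M M" "N y \<le> 1" using ys(2) vs by auto
  have yb: "y * scalar_mat \<beta> \<in> carrier_mat M M" by (rule mult_carrier_mat[OF y(1) scalar_mat_carrier[OF b(1)]])
  have "N (scalar_mat (1\<^sub>m M) * y * scalar_mat \<beta>) \<le> N y"
    by (rule opspace_scalar_mult[OF N M y(1) one b])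
  then have nyb: "N (y * scalar_mat \<beta>) \<le> 1"
    using y by (simp add: scalar_mat_one)
  have zs: "length zs = length xs" "\<forall>x\<in>set zs. x \<in> carrier_mat M M \<and> N x \<le> 1"
    using ys vs yb nyb by (auto simp: zs_def)
  have len: "Suc (length vs) = length xs" using ys(1) vs by simp
  have "teq (length xs) (sq_tensor M zs i j)
      (\<Sum>k<M. \<Sum>m<M. fscale (\<alpha> $$ (i, k) * \<beta> $$ (m, j)) (sq_tensor M xs k m))" if ij: "i < M" "j < M" for i j
  proof -
    have "teq (length xs) (sq_tensor M zs i j) (\<Sum>m<M. fscale (\<beta> $$ (m, j)) (sq_tensor M ys i m))"
      using sq_tensor_right_scalar[OF y(1) b(1) ij, of vs] by (simp add: zs_def vs len)
    also have "teq (length xs) \<dots> (\<Sum>m<M. fscale (\<beta> $$ (m, j)) (\<Sum>k<M. fscale (\<alpha> $$ (i, k)) (sq_tensor M xs k m)))"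
      by (intro teq_sum teq_fscale yteq ij)
    also have "\<dots> = (\<Sum>m<M. \<Sum>k<M. fscale (\<alpha> $$ (i, k) * \<beta> $$ (m, j)) (sq_tensor M xs k m))"
      by (simp add: free_module.scale_sum_right mult.commute)
    also have "\<dots> = (\<Sum>k<M. \<Sum>m<M. fscale (\<alpha> $$ (i, k) * \<beta> $$ (m, j)) (sq_tensor M xs k m))"
      by (rule sum.swap)
    finally show ?thesis .
  qed
  then show ?thesis using zs by blast
qed

section \<open>Operations on the unit ball\<close>

lemma sum_double_delta:
  fixes i j M :: nat
  assumes "i < M" "j < M"
  shows "(\<Sum>k<M. \<Sum>m<M. fscale ((if k = i then a else 0) * (if m = j then b else 0)) (T k m)) = fscale (a * b) (T i j)"
proof -
  have "(\<Sum>k<M. \<Sum>m<M. fscale ((if k = i then a else 0) * (if m = j then b else 0)) (T k m))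
      = (\<Sum>k<M. \<Sum>m<M. if m = j then (if k = i then fscale (a * b) (T i j) else 0) else 0)"
    by (intro sum.cong refl) auto
  also have "\<dots> = (\<Sum>k<M. if k = i then fscale (a * b) (T i j) else 0)"
    using assms by (intro sum.cong refl, subst sum.delta) auto
  also have "\<dots> = fscale (a * b) (T i j)" using assms by (simp add: sum.delta)
  finally show ?thesis .
qed

lemma haagerup_ball_unit:
  assumes N: "opspace_structure N" and l: "0 < l" and n: "0 < n" and F: "haagerup_ball N l n F"
    and ij: "i0 < n" "j0 < n"
  shows "haagerup_ball N l n' (\<lambda>i j. if i = k0 \<and> j = m0 then F i0 j0 else 0)"
proof -
  obtain M0 where M0: "\<And>M. M0 \<le> M \<Longrightarrow> \<exists>xs. n \<le> M \<and> length xs = l \<and>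
    (\<forall>x\<in>set xs. x \<in> carrier_mat M M \<and> N x \<le> 1) \<and> (\<forall>i<n. \<forall>j<n. teq l (F i j) (sq_tensor M xs i j))"
    using haagerup_ball_large[OF N n F] by metis
  define M where "M = max M0 n'"
  obtain xs where xs: "n \<le> M" "length xs = l" "\<forall>x\<in>set xs. x \<in> carrier_mat M M \<and> N x \<le> 1"
    "\<forall>i<n. \<forall>j<n. teq l (F i j) (sq_tensor M xs i j)" using M0[of M] by (auto simp: M_def)
  have M: "0 < M" using n xs(1) by simp
  have lx: "0 < length xs" using l xs by simp
  obtain ys where ys: "length ys = length xs" "\<forall>x\<in>set ys. x \<in> carrier_mat M M \<and> N x \<le> 1"
    "\<forall>i<M. \<forall>j<M. teq (length xs) (sq_tensor M ys i j)
      (\<Sum>k<M. \<Sum>m<M. fscale (mat_unit M k0 i0 $$ (i, k) * mat_unit M j0 m0 $$ (m, j)) (sq_tensor M xs k m))"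
    using sq_tensor_scalar_conj[OF N M lx xs(3) mat_unit_carrier[of M k0 i0] cstar_mnorm_mat_unit
      mat_unit_carrier[of M j0 m0] cstar_mnorm_mat_unit] by blast
  have i0: "i0 < M" "j0 < M" using ij xs(1) by auto
  have "teq l (if i = k0 \<and> j = m0 then F i0 j0 else 0) (sq_tensor M ys i j)" if "i < n'" "j < n'" for i j
  proof -
    have iM: "i < M" "j < M" using that by (auto simp: M_def)
    have "(\<Sum>k<M. \<Sum>m<M. fscale (mat_unit M k0 i0 $$ (i, k) * mat_unit M j0 m0 $$ (m, j)) (sq_tensor M xs k m))
      = (\<Sum>k<M. \<Sum>m<M. fscale ((if k = i0 then (if i = k0 then 1 else 0) else 0) * (if m = j0 then (if j = m0 then 1 else 0) else 0)) (sq_tensor M xs k m))"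
      by (intro sum.cong refl) (use iM in \<open>auto simp: mat_unit_def\<close>)
    also have "\<dots> = fscale ((if i = k0 then 1 else 0) * (if j = m0 then 1 else 0)) (sq_tensor M xs i0 j0)"
      by (rule sum_double_delta[OF i0])
    finally have "teq l (sq_tensor M ys i j) (fscale ((if i = k0 then 1 else 0) * (if j = m0 then 1 else 0)) (sq_tensor M xs i0 j0))"
      using ys(3)[rule_format, OF iM] xs(2) by simp
    moreover have "teq l (F i0 j0) (sq_tensor M xs i0 j0)" using xs(4) ij by blast
    ultimately show ?thesis
      by (cases "i = k0 \<and> j = m0") (auto intro: teq_sym teq_trans[OF _ teq_sym])
  qed
  then show ?thesis unfolding haagerup_ball_def
    using ys(1,2) xs(2) by (intro exI[of _ M] exI[of _ ys]) (auto simp: M_def)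
qed

lemma haagerup_ball_fscale:
  assumes N: "opspace_structure N" and l: "0 < l" and n: "0 < n" and F: "haagerup_ball N l n F"
    and c: "cmod c \<le> 1"
  shows "haagerup_ball N l n (\<lambda>i j. fscale c (F i j))"
proof -
  obtain M xs where xs: "n \<le> M" "length xs = l" "\<forall>x\<in>set xs. x \<in> carrier_mat M M \<and> N x \<le> 1"
    "\<forall>i<n. \<forall>j<n. teq l (F i j) (sq_tensor M xs i j)" using F unfolding haagerup_ball_def by blast
  have M: "0 < M" using n xs(1) by simp
  let ?a = "map_mat (scaleC c) (1\<^sub>m M) :: complex mat"
  have a: "?a \<in> carrier_mat M M" "cstar_mnorm ?a \<le> 1"
    using M c by (auto simp: cstar_mnorm_scaleC[of "1\<^sub>m M" M M])
  have one: "1\<^sub>m M \<in> carrier_mat M M" "cstar_mnorm (1\<^sub>m M :: complex mat) \<le> 1" using M by auto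
  have lx: "0 < length xs" using l xs by simp
  obtain ys where ys: "length ys = length xs" "\<forall>x\<in>set ys. x \<in> carrier_mat M M \<and> N x \<le> 1"
    "\<forall>i<M. \<forall>j<M. teq (length xs) (sq_tensor M ys i j)
      (\<Sum>k<M. \<Sum>m<M. fscale (?a $$ (i, k) * 1\<^sub>m M $$ (m, j)) (sq_tensor M xs k m))"
    using sq_tensor_scalar_conj[OF N M lx xs(3) a one] by blast
  have "teq l (fscale c (F i j)) (sq_tensor M ys i j)" if ij: "i < n" "j < n" for i j
  proof -
    have iM: "i < M" "j < M" using ij xs(1) by auto
    have "(\<Sum>k<M. \<Sum>m<M. fscale (?a $$ (i, k) * 1\<^sub>m M $$ (m, j)) (sq_tensor M xs k m))
      = (\<Sum>k<M. \<Sum>m<M. fscale ((if k = i then c else 0) * (if m = j then 1 else 0)) (sq_tensor M xs k m))"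
      by (intro sum.cong refl) (use iM in \<open>auto simp: scaleC_complex_def\<close>)
    also have "\<dots> = fscale (c * 1) (sq_tensor M xs i j)" by (rule sum_double_delta[OF iM])
    finally have "teq l (sq_tensor M ys i j) (fscale c (sq_tensor M xs i j))"
      using ys(3)[rule_format, OF iM] xs(2) by simp
    moreover have "teq l (fscale c (F i j)) (fscale c (sq_tensor M xs i j))"
      using xs(4) ij by (intro teq_fscale) auto
    ultimately show ?thesis by (meson teq_sym teq_trans)
  qed
  then show ?thesis unfolding haagerup_ball_def
    using ys(1,2) xs(1,2) by (intro exI[of _ M] exI[of _ ys]) auto
qed

text \<open>The element \<open>s F + t G\<close> is the corner of \<open>\<alpha> (F \<oplus> G) \<alpha>\<^sup>*\<close> for the row \<open>\<alpha> = (sqrt s, sqrt t)\<close>, which has norm \<open>1\<close>,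
and direct sums stay in the unit ball by taking direct sums of the factors.  Arranged like this, the
argument is the same for every number of factors, even for one.\<close>

lemma haagerup_ball_convex:
  assumes N: "opspace_structure N" and l: "0 < l" and n: "0 < n"
    and F: "haagerup_ball N l n F" and G: "haagerup_ball N l n G"
    and st: "0 \<le> s" "0 \<le> t" "s + t = 1"
  shows "haagerup_ball N l n (\<lambda>i j. fscale (complex_of_real s) (F i j) + fscale (complex_of_real t) (G i j))"
proof -
  obtain M1 where M1: "\<And>M. M1 \<le> M \<Longrightarrow> \<exists>xs. n \<le> M \<and> length xs = l \<and>
    (\<forall>x\<in>set xs. x \<in> carrier_mat M M \<and> N x \<le> 1) \<and> (\<forall>i<n. \<forall>j<n. teq l (F i j) (sq_tensor M xs i j))"
    using haagerup_ball_large[OF N n F] by metis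
  obtain M2 where M2: "\<And>M. M2 \<le> M \<Longrightarrow> \<exists>xs. n \<le> M \<and> length xs = l \<and>
    (\<forall>x\<in>set xs. x \<in> carrier_mat M M \<and> N x \<le> 1) \<and> (\<forall>i<n. \<forall>j<n. teq l (G i j) (sq_tensor M xs i j))"
    using haagerup_ball_large[OF N n G] by metis
  define M where "M = max M1 M2"
  obtain xs where xs: "n \<le> M" "length xs = l" "\<forall>x\<in>set xs. x \<in> carrier_mat M M \<and> N x \<le> 1"
    "\<forall>i<n. \<forall>j<n. teq l (F i j) (sq_tensor M xs i j)" using M1[of M] by (auto simp: M_def)
  obtain ys where ys: "length ys = l" "\<forall>x\<in>set ys. x \<in> carrier_mat M M \<and> N x \<le> 1"
    "\<forall>i<n. \<forall>j<n. teq l (G i j) (sq_tensor M ys i j)" using M2[of M] by (auto simp: M_def)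
  have M: "0 < M" using n xs(1) by simp
  define zs where "zs = map2 diag_sum xs ys"
  have zs: "length zs = l" "\<forall>x\<in>set zs. x \<in> carrier_mat (M + M) (M + M) \<and> N x \<le> 1"
  proof -
    show "length zs = l" using xs ys by (simp add: zs_def)
    show "\<forall>x\<in>set zs. x \<in> carrier_mat (M + M) (M + M) \<and> N x \<le> 1"
    proof
      fix z assume "z \<in> set zs"
      then obtain x y where xy: "x \<in> set xs" "y \<in> set ys" "z = diag_sum x y"
        by (auto simp: zs_def dest: set_zip_leftD set_zip_rightD)
      then have x: "x \<in> carrier_mat M M" "N x \<le> 1" and y: "y \<in> carrier_mat M M" "N y \<le> 1" using xs ys by auto
      then show "z \<in> carrier_mat (M + M) (M + M) \<and> N z \<le> 1"
        using opspace_structureD(7)[OF N M x(1) M y(1)] xy(3) by auto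
    qed
  qed
  define p q where "p = complex_of_real (sqrt s)" and "q = complex_of_real (sqrt t)"
  have pp: "p * p = complex_of_real s" "q * q = complex_of_real t"
    using st by (simp_all add: p_def q_def flip: of_real_mult)
  let ?P = "map_mat (scaleC p) (1\<^sub>m M) :: complex mat" and ?Q = "map_mat (scaleC q) (1\<^sub>m M) :: complex mat"
  let ?a = "four_block_mat ?P ?Q (0\<^sub>m M M) (0\<^sub>m M M)"
  have PQ: "?P \<in> carrier_mat M M" "?Q \<in> carrier_mat M M" by auto
  have a: "?a \<in> carrier_mat (M + M) (M + M)" by auto
  have na: "cstar_mnorm ?a \<le> 1"
  proof (rule power2_le_imp_le)
    have "(cstar_mnorm ?a)\<^sup>2 = cstar_mnorm (?P * mat_star ?P + ?Q * mat_star ?Q)"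
      by (rule cstar_mnorm_row[OF PQ])
    also have "?P * mat_star ?P + ?Q * mat_star ?Q = 1\<^sub>m M"
    proof -
      have "p * cnj p + q * cnj q = complex_of_real (s + t)"
        using pp by (simp add: p_def q_def)
      then show ?thesis
        unfolding map_mat_scaleC_mult_star[OF one_carrier_mat one_carrier_mat] mat_star_one
        by (intro eq_matI) (auto simp: scaleC_complex_def st)
    qed
    finally show "(cstar_mnorm ?a)\<^sup>2 \<le> 1\<^sup>2" using M by simp
  qed simp
  have b: "mat_star ?a \<in> carrier_mat (M + M) (M + M)" "cstar_mnorm (mat_star ?a) \<le> 1"
    using mat_star_carrier[OF a] cstar_mnorm_star[OF a] na by auto
  have MM: "0 < M + M" "0 < length zs" using M l zs by auto
  obtain ws where ws: "length ws = length zs" "\<forall>x\<in>set ws. x \<in> carrier_mat (M + M) (M + M) \<and> N x \<le> 1"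
    "\<forall>i<M + M. \<forall>j<M + M. teq (length zs) (sq_tensor (M + M) ws i j)
      (\<Sum>k<M + M. \<Sum>m<M + M. fscale (?a $$ (i, k) * mat_star ?a $$ (m, j)) (sq_tensor (M + M) zs k m))"
    using sq_tensor_scalar_conj[OF N MM zs(2) a na b] by blast
  have "teq l (fscale (complex_of_real s) (F i j) + fscale (complex_of_real t) (G i j)) (sq_tensor (M + M) ws i j)"
    if ij: "i < n" "j < n" for i j
  proof -
    have iM: "i < M" "j < M" using ij xs(1) by auto
    let ?T = "sq_tensor (M + M) zs"
    have cc: "cnj p = p" "cnj q = q" by (simp_all add: p_def q_def)
    have ai: "?a $$ (i, k) = (if k = i then p else 0)" "?a $$ (i, M + k) = (if k = i then q else 0)"
      "mat_star ?a $$ (k, j) = (if k = j then p else 0)" "mat_star ?a $$ (M + k, j) = (if k = j then q else 0)"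
      if "k < M" for k
      using that iM cc by (auto simp: scaleC_complex_def star_complex_def)
    have "(\<Sum>k<M + M. \<Sum>m<M + M. fscale (?a $$ (i, k) * mat_star ?a $$ (m, j)) (?T k m))
      = ((\<Sum>k<M. \<Sum>m<M. fscale (?a $$ (i, k) * mat_star ?a $$ (m, j)) (?T k m))
         + (\<Sum>k<M. \<Sum>m<M. fscale (?a $$ (i, k) * mat_star ?a $$ (M + m, j)) (?T k (M + m))))
        + ((\<Sum>k<M. \<Sum>m<M. fscale (?a $$ (i, M + k) * mat_star ?a $$ (m, j)) (?T (M + k) m))
         + (\<Sum>k<M. \<Sum>m<M. fscale (?a $$ (i, M + k) * mat_star ?a $$ (M + m, j)) (?T (M + k) (M + m))))"
      by (simp only: sum_lessThan_add sum.distrib add_ac)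
    also have "\<dots> = (fscale (p * p) (?T i j) + fscale (p * q) (?T i (M + j)))
        + (fscale (q * p) (?T (M + i) j) + fscale (q * q) (?T (M + i) (M + j)))"
    proof -
      have dd: "(\<Sum>k<M. \<Sum>m<M. fscale (f k * g m) (T' k m)) = fscale (c * d) (T' i j)"
        if "\<And>k. k < M \<Longrightarrow> f k = (if k = i then c else 0)" "\<And>k. k < M \<Longrightarrow> g k = (if k = j then d else 0)"
        for f g c d and T' :: "nat \<Rightarrow> nat \<Rightarrow> 'a free"
        unfolding sum_double_delta[OF iM, of c d T', symmetric]
        by (intro sum.cong refl) (simp add: that)
      show ?thesis
        by (intro arg_cong2[of _ _ _ _ "(+)"]; rule dd; fact ai)
    qed
    finally have "teq l (sq_tensor (M + M) ws i j) ((fscale (p * p) (?T i j) + fscale (p * q) (?T i (M + j)))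
        + (fscale (q * p) (?T (M + i) j) + fscale (q * q) (?T (M + i) (M + j))))"
      using ws(3)[rule_format, of i j] iM zs(1) by simp
    also have "teq l \<dots> ((fscale (p * p) (F i j) + fscale (p * q) 0) + (fscale (q * p) 0 + fscale (q * q) (G i j)))"
    proof -
      have len: "length xs = length ys" using xs ys by simp
      note d = sq_tensor_diag[OF len, of M i j, folded zs_def, unfolded xs(2)]
      have "teq l (?T i j) (F i j)" "teq l (?T (M + i) (M + j)) (G i j)"
        "teq l (?T i (M + j)) 0" "teq l (?T (M + i) j) 0"
        using d iM xs(3) ys(2) teq_trans[OF _ teq_sym[OF xs(4)[rule_format, OF ij]]]
          teq_trans[OF _ teq_sym[OF ys(3)[rule_format, OF ij]]] by auto
      then show ?thesis by (intro teq_add teq_fscale)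
    qed
    finally show ?thesis by (simp add: pp teq_sym)
  qed
  then show ?thesis unfolding haagerup_ball_def
    using ws(1,2) zs(1) xs(1) by (intro exI[of _ "M + M"] exI[of _ ws]) auto
qed

lemma haagerup_ball_word:
  assumes N: "opspace_structure N" and as: "length as = l"
  obtains b where "0 < b" "haagerup_ball N l 1 (\<lambda>i j. fscale (complex_of_real (1 / b)) (Poly_Mapping.single as 1))"
proof -
  define c where "c = 1 + (\<Sum>a\<leftarrow>as. norm a)"
  have nn: "0 \<le> (\<Sum>a\<leftarrow>as. norm a)" by (rule sum_list_nonneg) auto
  then have c: "0 < c" by (simp add: c_def)
  define xs where "xs = map (\<lambda>a. mat 1 1 (\<lambda>_. a)) as"
  define ts where "ts = replicate l (complex_of_real (1 / c))"
  define ys where "ys = map2 (\<lambda>t. map_mat (scaleC t)) ts xs"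
  have xs: "length ts = length xs" "\<And>x. x \<in> set xs \<Longrightarrow> x \<in> carrier_mat 1 1"
    using as by (auto simp: ts_def xs_def)
  have st: "sq_tensor 1 xs 0 0 = Poly_Mapping.single as 1"
    unfolding xs_def by (induction as) auto
  have "prod_list ts = complex_of_real ((1 / c) ^ l)" by (simp add: ts_def)
  then have t: "teq l (sq_tensor 1 ys 0 0) (fscale (complex_of_real (1 / (c ^ l))) (Poly_Mapping.single as 1))"
    using sq_tensor_scale[OF xs, of 0 0] as st by (simp add: ys_def xs_def power_one_over)
  define t where "t = complex_of_real (1 / c)"
  have ys_eq: "ys = map (\<lambda>a. map_mat (scaleC t) (mat 1 1 (\<lambda>_. a))) as"
    using as by (simp add: ys_def ts_def xs_def zip_replicate1 comp_def t_def)
  have y: "x \<in> carrier_mat 1 1 \<and> N x \<le> 1" if xys: "x \<in> set ys" for x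
  proof -
    obtain a where x: "x = map_mat (scaleC t) (mat 1 1 (\<lambda>_. a))" "a \<in> set as"
      using xys unfolding ys_eq by auto
    have "norm a \<le> (\<Sum>a\<leftarrow>as. norm a)" using x(2) by (intro member_le_sum_list) auto
    then have "norm a \<le> c" by (simp add: c_def)
    then have "N x \<le> 1"
      using opspace_structureD(4)[OF N, of 1 "mat 1 1 (\<lambda>_. a)" t] opspace_structureD(1)[OF N, of a] c x
      by (simp add: norm_divide t_def)
    then show ?thesis using x(1) by simp
  qed
  have "haagerup_ball N l 1 (\<lambda>i j. fscale (complex_of_real (1 / (c ^ l))) (Poly_Mapping.single as 1))"
    unfolding haagerup_ball_def
    using t y as by (intro exI[of _ 1] exI[of _ ys]) (auto simp: ys_def ts_def xs_def intro: teq_sym)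
  then show thesis using that[of "c ^ l"] c by simp
qed

text \<open>The gauge of the unit ball: \<open>F\<close> lies in its multiple by \<open>c\<close>.\<close>

definition haagerup_absorbs :: "('a::unital_cstar_algebra mat \<Rightarrow> real) \<Rightarrow> nat \<Rightarrow> nat \<Rightarrow> real \<Rightarrow> (nat \<Rightarrow> nat \<Rightarrow> 'a free) \<Rightarrow> bool" where
  "haagerup_absorbs N l n c F \<longleftrightarrow> 0 < c \<and> haagerup_ball N l n (\<lambda>i j. fscale (complex_of_real (1 / c)) (F i j))"

lemma haagerup_absorbs_teq:
  assumes "haagerup_absorbs N l n c F" "\<And>i j. i < n \<Longrightarrow> j < n \<Longrightarrow> teq l (G i j) (F i j)"
  shows "haagerup_absorbs N l n c G"
  using assms unfolding haagerup_absorbs_def by (auto intro: haagerup_ball_teq teq_fscale)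

lemma haagerup_absorbs_add:
  assumes N: "opspace_structure N" "0 < l" "0 < n"
    and F: "haagerup_absorbs N l n a F" and G: "haagerup_absorbs N l n b G"
  shows "haagerup_absorbs N l n (a + b) (\<lambda>i j. F i j + G i j)"
proof -
  have ab: "0 < a" "0 < b" using F G by (auto simp: haagerup_absorbs_def)
  have "haagerup_ball N l n (\<lambda>i j. fscale (complex_of_real (a / (a + b))) (fscale (complex_of_real (1 / a)) (F i j))
      + fscale (complex_of_real (b / (a + b))) (fscale (complex_of_real (1 / b)) (G i j)))"
    using F G ab by (intro haagerup_ball_convex[OF N]) (auto simp: haagerup_absorbs_def simp flip: add_divide_distrib)
  moreover have "complex_of_real (a / (a + b)) * complex_of_real (1 / a) = complex_of_real (1 / (a + b))"
    "complex_of_real (b / (a + b)) * complex_of_real (1 / b) = complex_of_real (1 / (a + b))"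
    using ab by (simp_all flip: of_real_mult del: of_real_divide)
  ultimately show ?thesis
    using ab by (simp add: haagerup_absorbs_def free_module.scale_right_distrib del: of_real_divide)
qed

lemma haagerup_absorbs_fscale:
  assumes N: "opspace_structure N" "0 < l" "0 < n"
    and F: "haagerup_absorbs N l n a F" and d: "0 < d" "cmod c * a \<le> d"
  shows "haagerup_absorbs N l n d (\<lambda>i j. fscale c (F i j))"
proof -
  have a: "0 < a" using F by (auto simp: haagerup_absorbs_def)
  have "haagerup_ball N l n (\<lambda>i j. fscale (c * complex_of_real (a / d)) (fscale (complex_of_real (1 / a)) (F i j)))"
    using F a d by (intro haagerup_ball_fscale[OF N, of _ "c * complex_of_real (a / d)"])
      (auto simp: haagerup_absorbs_def norm_mult norm_divide simp del: of_real_divide)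
  moreover have "c * complex_of_real (a / d) * complex_of_real (1 / a) = complex_of_real (1 / d) * c"
    using a d by (simp add: field_simps)
  ultimately show ?thesis using d by (simp add: haagerup_absorbs_def del: of_real_divide)
qed

lemma haagerup_absorbs_unit:
  assumes N: "opspace_structure N" "0 < l" "0 < n"
    and F: "haagerup_absorbs N l n a F" and ij: "i0 < n" "j0 < n"
  shows "haagerup_absorbs N l n' a (\<lambda>i j. if i = k0 \<and> j = m0 then F i0 j0 else 0)"
proof -
  have "haagerup_ball N l n' (\<lambda>i j. if i = k0 \<and> j = m0 then fscale (complex_of_real (1 / a)) (F i0 j0) else 0)"
    using F ij by (intro haagerup_ball_unit[OF N]) (auto simp: haagerup_absorbs_def)
  moreover have "(if i = k0 \<and> j = m0 then fscale (complex_of_real (1 / a)) (F i0 j0) else 0)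
     = fscale (complex_of_real (1 / a)) (if i = k0 \<and> j = m0 then F i0 j0 else 0)" for i j by simp
  ultimately show ?thesis using F by (simp add: haagerup_absorbs_def)
qed

lemma haagerup_absorbs_sum:
  assumes N: "opspace_structure N" "0 < l" "0 < n" and I: "finite I" "I \<noteq> {}"
    and F: "\<And>k. k \<in> I \<Longrightarrow> haagerup_absorbs N l n (a k) (F k)"
  shows "haagerup_absorbs N l n (\<Sum>k\<in>I. a k) (\<lambda>i j. \<Sum>k\<in>I. F k i j)"
  using I F
proof (induction rule: finite_ne_induct)
  case (insert k I)
  then show ?case using haagerup_absorbs_add[OF N, of "a k" "F k" "sum a I" "\<lambda>i j. \<Sum>k\<in>I. F k i j"] by simp
qed simp

text \<open>A matrix is the sum of its one-entry parts, and each of these is as large as the entry.\<close>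

lemma haagerup_absorbs_entries:
  assumes N: "opspace_structure N" "0 < l" "0 < n"
    and F: "\<And>i j. i < n \<Longrightarrow> j < n \<Longrightarrow> haagerup_absorbs N l 1 (a i j) (\<lambda>_ _. F i j)"
  shows "haagerup_absorbs N l n (\<Sum>i<n. \<Sum>j<n. a i j) F"
proof -
  have "haagerup_absorbs N l n (\<Sum>k\<in>{..<n}\<times>{..<n}. a (fst k) (snd k))
      (\<lambda>i j. \<Sum>k\<in>{..<n}\<times>{..<n}. if i = fst k \<and> j = snd k then F (fst k) (snd k) else 0)"
  proof (rule haagerup_absorbs_sum[OF N])
    show "{..<n}\<times>{..<n} \<noteq> {}" using N(3) by auto
    fix k assume "k \<in> {..<n}\<times>{..<n}"
    then show "haagerup_absorbs N l n (a (fst k) (snd k)) (\<lambda>i j. if i = fst k \<and> j = snd k then F (fst k) (snd k) else 0)"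
      using haagerup_absorbs_unit[OF N(1,2) _ F, of "fst k" "snd k" 0 0] by auto
  qed simp
  moreover have "(\<Sum>k\<in>{..<n}\<times>{..<n}. if i = fst k \<and> j = snd k then F (fst k) (snd k) else 0) = F i j"
    if "i < n" "j < n" for i j
  proof -
    have "(\<Sum>k\<in>{..<n}\<times>{..<n}. if i = fst k \<and> j = snd k then F (fst k) (snd k) else 0)
      = (\<Sum>k\<in>{..<n}\<times>{..<n}. if k = (i, j) then F i j else 0)"
      by (intro sum.cong) auto
    then show ?thesis using that by (simp add: sum.delta)
  qed
  ultimately show ?thesis
    by (simp add: sum.cartesian_product case_prod_unfold haagerup_absorbs_teq)
qed

lemma haagerup_absorbs_exists:
  assumes N: "opspace_structure N" "0 < l" "0 < n" and F: "\<And>i j. i < n \<Longrightarrow> j < n \<Longrightarrow> homog l (F i j)"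
  obtains c where "haagerup_absorbs N l n c F"
proof -
  have one: "(0::nat) < 1" by simp
  have word: "\<exists>c. haagerup_absorbs N l 1 c (\<lambda>_ _. Poly_Mapping.single as d)" if as: "length as = l" for as d
  proof -
    obtain b where b: "haagerup_absorbs N l 1 b (\<lambda>_ _. Poly_Mapping.single as 1)"
      using haagerup_ball_word[OF N(1) as] by (auto simp: haagerup_absorbs_def)
    then have "haagerup_absorbs N l 1 (cmod d * b + 1) (\<lambda>_ _. fscale d (Poly_Mapping.single as 1))"
      by (intro haagerup_absorbs_fscale[OF N(1,2) one b]) (auto simp: haagerup_absorbs_def intro: add_nonneg_pos)
    then show ?thesis by auto
  qed
  have el: "\<exists>c. haagerup_absorbs N l 1 c (\<lambda>_ _. f)" if f: "homog l f" for f
  proof (cases "f = 0")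
    case True
    have "length (replicate l (0::'a)) = l" by simp
    from word[OF this, of 0] show ?thesis by (simp add: True)
  next
    case False
    have "\<forall>as\<in>Poly_Mapping.keys f. \<exists>c. haagerup_absorbs N l 1 c (\<lambda>_ _. Poly_Mapping.single as (Poly_Mapping.lookup f as))"
      using f word by (auto simp: homog_iff)
    then obtain c where "\<forall>as\<in>Poly_Mapping.keys f. haagerup_absorbs N l 1 (c as) (\<lambda>_ _. Poly_Mapping.single as (Poly_Mapping.lookup f as))"
      by metis
    then have "haagerup_absorbs N l 1 (sum c (Poly_Mapping.keys f))
        (\<lambda>_ _. \<Sum>as\<in>Poly_Mapping.keys f. Poly_Mapping.single as (Poly_Mapping.lookup f as))"
      using False by (intro haagerup_absorbs_sum[OF N(1,2) one]) auto
    then show ?thesis using free_eq_sum_single[of "Poly_Mapping.keys f" f] by auto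
  qed
  then have "\<forall>i j. \<exists>c. i < n \<and> j < n \<longrightarrow> haagerup_absorbs N l 1 c (\<lambda>_ _. F i j)" using F by blast
  then obtain a where "\<And>i j. i < n \<and> j < n \<longrightarrow> haagerup_absorbs N l 1 (a i j) (\<lambda>_ _. F i j)" by metis
  then show thesis using that haagerup_absorbs_entries[OF N, of a F] by blast
qed

section \<open>The Haagerup norm as the gauge of its unit ball\<close>

definition haagerup_factor_norms :: "('a::unital_cstar_algebra mat \<Rightarrow> real) \<Rightarrow> nat \<Rightarrow> 'a free set mat \<Rightarrow> real set" where
  "haagerup_factor_norms N l u = {(\<Prod>p<l. N (pad_square (xs ! p))) |xs rs.
    length xs = l \<and> length rs = l + 1 \<and> (\<forall>p\<le>l. 0 < rs ! p) \<and>
    (\<forall>p<l. xs ! p \<in> carrier_mat (rs ! p) (rs ! (p + 1))) \<and> u = tensor_prod xs rs}"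

lemma haagerup_mnorm_eq_Inf: "haagerup_mnorm N l u = Inf (haagerup_factor_norms N l u)"
  by (simp add: haagerup_mnorm_def haagerup_factor_norms_def)

lemma opspace_pad_square_nonneg:
  assumes "opspace_structure N" "x \<in> carrier_mat r c" "0 < r"
  shows "0 \<le> N (pad_square x)"
  by (rule opspace_structureD(2)[OF assms(1), of "max r c"]) (use assms in \<open>auto simp: pad_square_eq_pad_to\<close>)

lemma haagerup_factor_norms_nonneg:
  assumes N: "opspace_structure N" and r: "r \<in> haagerup_factor_norms N l u"
  shows "0 \<le> r"
proof -
  obtain xs rs where xs: "r = (\<Prod>p<l. N (pad_square (xs ! p)))" "\<forall>p\<le>l. 0 < rs ! p"
    "\<forall>p<l. xs ! p \<in> carrier_mat (rs ! p) (rs ! (p + 1))"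
    using r unfolding haagerup_factor_norms_def by blast
  show ?thesis unfolding xs(1)
    by (intro prod_nonneg) (use xs opspace_pad_square_nonneg[OF N] in auto)
qed

abbreviation tensor_mat :: "nat \<Rightarrow> nat \<Rightarrow> (nat \<Rightarrow> nat \<Rightarrow> 'a::unital_cstar_algebra free) \<Rightarrow> 'a free set mat" where
  "tensor_mat l n F \<equiv> mat n n (\<lambda>(i, j). tclass l (F i j))"

text \<open>Truncate the first factor to \<open>n\<close> rows and the last to \<open>n\<close> columns; the scalar \<open>c\<close> goes into the first.\<close>

lemma haagerup_factor_norm_of_absorbs:
  assumes N: "opspace_structure N" and l: "0 < l" and n: "0 < n" and F: "haagerup_absorbs N l n c F"
  shows "\<exists>r\<in>haagerup_factor_norms N l (tensor_mat l n F). r \<le> c"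
proof -
  have c: "0 < c" using F by (simp add: haagerup_absorbs_def)
  obtain M xs where xs: "n \<le> M" "length xs = l" "\<forall>x\<in>set xs. x \<in> carrier_mat M M \<and> N x \<le> 1"
    "\<forall>i<n. \<forall>j<n. teq l (fscale (complex_of_real (1 / c)) (F i j)) (sq_tensor M xs i j)"
    using F unfolding haagerup_absorbs_def haagerup_ball_def by blast
  have M: "0 < M" using n xs(1) by simp
  define cs where "cs = c # replicate (l - 1) 1"
  define ts where "ts = map complex_of_real cs"
  have len: "length cs = l" "length ts = length xs" using l xs by (auto simp: cs_def ts_def)
  have cs: "prod_list cs = c" "\<And>p. p < l \<Longrightarrow> 0 \<le> cs ! p" using c by (auto simp: cs_def nth_Cons')
  have pts: "prod_list ts = complex_of_real c" by (simp add: ts_def cs_def)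
  define ys where "ys = map2 (\<lambda>t. map_mat (scaleC t)) ts xs"
  have ys: "length ys = l" using len xs by (simp add: ys_def)
  have yp: "ys ! p \<in> carrier_mat M M" "N (ys ! p) \<le> cs ! p" if p: "p < l" for p
  proof -
    have x: "xs ! p \<in> carrier_mat M M" "N (xs ! p) \<le> 1" using xs(2,3) p by auto
    have "ys ! p = map_mat (scaleC (ts ! p)) (xs ! p)" using p len xs by (simp add: ys_def)
    moreover have "ts ! p = complex_of_real (cs ! p)" using p len by (simp add: ts_def)
    ultimately show "ys ! p \<in> carrier_mat M M" "N (ys ! p) \<le> cs ! p"
      using x opspace_structureD(4)[OF N M x(1)] cs(2)[OF p] by (auto simp: mult_left_le)
  qed
  have Fy: "teq l (F i j) (sq_tensor M ys i j)" if ij: "i < n" "j < n" for i j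
  proof -
    have "F i j = fscale (complex_of_real c) (fscale (complex_of_real (1 / c)) (F i j))"
      using c by simp
    also have "teq l \<dots> (fscale (complex_of_real c) (sq_tensor M xs i j))"
      using xs(4) ij by (intro teq_fscale) blast
    also have "teq l \<dots> (sq_tensor M ys i j)"
      using sq_tensor_scale[OF len(2), of M i j] xs ij by (auto simp: ys_def pts intro: teq_sym)
    finally show ?thesis .
  qed
  define rs where "rs = n # replicate (l - 1) M @ [n]"
  have rs: "length rs = length ys + 1" "rs ! 0 = n" "rs ! l = n" using l ys by (auto simp: rs_def nth_append nth_Cons')
  have rsM: "rs ! p = M" if "0 < p" "p < l" for p using that by (auto simp: rs_def nth_append nth_Cons')
  have rs_pos: "0 < rs ! p" "rs ! p \<le> M" if "p \<le> l" for p
    using that rs rsM[of p] n M xs(1) by (cases "p = 0"; cases "p = l"; auto)+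
  define zs where "zs = map (\<lambda>p. mat (rs ! p) (rs ! (p + 1)) (\<lambda>q. (ys ! p) $$ q)) [0..<length ys]"
  have zs: "length zs = l" "\<And>p. p < l \<Longrightarrow> zs ! p = mat (rs ! p) (rs ! (p + 1)) (\<lambda>(i, j). (ys ! p) $$ (i, j))"
    using ys by (auto simp: zs_def)
  have "tensor_prod zs rs = mat (rs ! 0) (rs ! length zs) (\<lambda>(i, j). tclass (length zs) (path_tensor zs rs i j))"
    by (rule tensor_prod_eq_path_tensor) (use rs ys zs in simp)
  also have "\<dots> = tensor_mat l n F"
  proof (rule eq_matI)
    fix i j assume "i < dim_row (tensor_mat l n F)" "j < dim_col (tensor_mat l n F)"
    then have ij: "i < n" "j < n" by auto
    have "path_tensor zs rs i j = sq_tensor M ys i j"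
      unfolding zs_def by (rule path_tensor_truncate) (use rs rsM ys xs(1) ij l in auto)
    then show "mat (rs ! 0) (rs ! length zs) (\<lambda>(i, j). tclass (length zs) (path_tensor zs rs i j)) $$ (i, j)
        = tensor_mat l n F $$ (i, j)"
      using ij rs zs Fy[OF ij] by (simp add: tclass_eq_iff teq_sym)
  qed (use rs zs in auto)
  finally have eq: "tensor_mat l n F = tensor_prod zs rs" ..
  have "(\<Prod>p<l. N (pad_square (zs ! p))) \<le> (\<Prod>p<l. cs ! p)"
  proof (rule prod_mono)
    fix p assume "p \<in> {..<l}"
    then have p: "p < l" "p \<le> l" "p + 1 \<le> l" by auto
    have "N (pad_square (zs ! p)) \<le> N (ys ! p)"
      unfolding zs(2)[OF p(1)] by (rule opspace_truncate[OF N yp(1)[OF p(1)]]) (use rs_pos p in auto)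
    moreover have "0 \<le> N (pad_square (zs ! p))"
      unfolding zs(2)[OF p(1)] by (rule opspace_pad_square_nonneg[OF N]) (use rs_pos p in auto)
    ultimately show "0 \<le> N (pad_square (zs ! p)) \<and> N (pad_square (zs ! p)) \<le> cs ! p"
      using yp(2)[OF p(1)] by simp
  qed
  also have "\<dots> = c" using cs(1) len(1) by (simp add: prod.list_conv_set_nth lessThan_atLeast0)
  finally have "(\<Prod>p<l. N (pad_square (zs ! p))) \<le> c" .
  moreover have "(\<Prod>p<l. N (pad_square (zs ! p))) \<in> haagerup_factor_norms N l (tensor_mat l n F)"
    unfolding haagerup_factor_norms_def mem_Collect_eq
  proof (rule exI[of _ zs], rule exI[of _ rs], intro conjI refl allI impI)
    show "length zs = l" "length rs = l + 1" using zs rs ys by auto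
    show "tensor_mat l n F = tensor_prod zs rs" by (rule eq)
    show "0 < rs ! p" if "p \<le> l" for p by (rule rs_pos(1)[OF that])
    show "zs ! p \<in> carrier_mat (rs ! p) (rs ! (p + 1))" if "p < l" for p using zs(2)[OF that] by simp
  qed
  ultimately show ?thesis by blast
qed

text \<open>Pad all factors to a common size and normalize each of them.  A factor of norm \<open>0\<close> vanishes, and is
consistently written as \<open>0\<close> times itself.\<close>

lemma haagerup_absorbs_of_factor_norm:
  assumes N: "opspace_structure N" and l: "0 < l" and n: "0 < n"
    and r: "r \<in> haagerup_factor_norms N l (tensor_mat l n F)" "r < c"
  shows "haagerup_absorbs N l n c F"
proof -
  have c: "0 < c" using haagerup_factor_norms_nonneg[OF N r(1)] r(2) by simp
  obtain xs rs where xs: "r = (\<Prod>p<l. N (pad_square (xs ! p)))" "length xs = l" "length rs = l + 1" "\<forall>p\<le>l. 0 < rs ! p"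
    "\<forall>p<l. xs ! p \<in> carrier_mat (rs ! p) (rs ! (p + 1))" "tensor_mat l n F = tensor_prod xs rs"
    using r unfolding haagerup_factor_norms_def by blast
  have tp: "tensor_prod xs rs = mat (rs ! 0) (rs ! l) (\<lambda>(i, j). tclass l (path_tensor xs rs i j))"
    using tensor_prod_eq_path_tensor[of rs xs] xs(2,3) by simp
  have rn: "rs ! 0 = n" "rs ! l = n"
    using arg_cong[OF xs(6), of dim_row] arg_cong[OF xs(6), of dim_col] tp by auto
  define M where "M = Max (set rs)"
  have rM: "rs ! p \<le> M" if "p \<le> l" for p using that xs(3) by (auto simp: M_def)
  have nM: "n \<le> M" using rM[of 0] rn by simp
  have M: "0 < M" using n nM by simp
  define ys where "ys = map (pad_to M) xs"
  have Fy: "teq l (F i j) (sq_tensor M ys i j)" if ij: "i < n" "j < n" for i j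
  proof -
    have "tensor_mat l n F $$ (i, j) = tensor_prod xs rs $$ (i, j)" using xs(6) by simp
    then have "teq l (F i j) (path_tensor xs rs i j)" using ij rn by (simp add: tp tclass_eq_iff)
    also have "teq l \<dots> (sq_tensor M ys i j)"
      using path_tensor_pad[of rs xs M i j] xs rM ij rn by (simp add: ys_def)
    finally show ?thesis .
  qed
  define \<nu> where "\<nu> p = N (pad_square (xs ! p))" for p
  have nu: "0 \<le> \<nu> p" "N (ys ! p) = \<nu> p" if p: "p < l" for p
  proof -
    have x: "xs ! p \<in> carrier_mat (rs ! p) (rs ! (p + 1))" "0 < rs ! p" using xs p by auto
    show "0 \<le> \<nu> p" unfolding \<nu>_def by (rule opspace_pad_square_nonneg[OF N x])
    show "N (ys ! p) = \<nu> p"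
      using opspace_pad_square[OF N x, of M] rM[of p] rM[of "p + 1"] p xs(2) by (simp add: ys_def \<nu>_def)
  qed
  have yc: "ys ! p \<in> carrier_mat M M" if "p < l" for p using that xs(2) by (simp add: ys_def)
  define zs where "zs = map (\<lambda>p. map_mat (scaleC (complex_of_real (if \<nu> p = 0 then 0 else 1 / \<nu> p))) (ys ! p)) [0..<l]"
  define ts where "ts = map (\<lambda>p. complex_of_real (\<nu> p)) [0..<l]"
  have lz: "length zs = l" by (simp add: zs_def)
  have zp: "zs ! p \<in> carrier_mat M M" "N (zs ! p) \<le> 1" if p: "p < l" for p
  proof -
    show "zs ! p \<in> carrier_mat M M" using p yc by (simp add: zs_def)
    show "N (zs ! p) \<le> 1"
      using p nu[OF p] opspace_structureD(4)[OF N M yc[OF p]] by (simp add: zs_def norm_divide)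
  qed
  have "ys = map2 (\<lambda>t. map_mat (scaleC t)) ts zs"
  proof (rule nth_equalityI)
    show "length ys = length (map2 (\<lambda>t. map_mat (scaleC t)) ts zs)" by (simp add: ys_def xs(2) ts_def zs_def)
    fix p assume "p < length ys"
    then have p: "p < l" by (simp add: ys_def xs(2))
    have "ys ! p = map_mat (scaleC (complex_of_real (\<nu> p))) (map_mat (scaleC (complex_of_real (if \<nu> p = 0 then 0 else 1 / \<nu> p))) (ys ! p))"
    proof (cases "\<nu> p = 0")
      case True
      then have "ys ! p = 0\<^sub>m M M" using nu(2)[OF p] opspace_structureD(3)[OF N M yc[OF p]] by simp
      then show ?thesis by (intro eq_matI) (auto simp: True)
    next
      case False
      then show ?thesis by (intro eq_matI) (auto simp: scaleC_scaleC)
    qed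
    also have "\<dots> = map2 (\<lambda>t. map_mat (scaleC t)) ts zs ! p" using p by (simp add: ts_def zs_def)
    finally show "ys ! p = map2 (\<lambda>t. map_mat (scaleC t)) ts zs ! p" .
  qed
  moreover have "prod_list ts = complex_of_real r"
    by (simp add: ts_def xs(1) \<nu>_def prod.list_conv_set_nth lessThan_atLeast0)
  ultimately have yz: "teq l (sq_tensor M ys i j) (fscale (complex_of_real r) (sq_tensor M zs i j))" if "i < n" for i j
    using sq_tensor_scale[of ts zs M i j] zp lz that nM by (auto simp: ts_def in_set_conv_nth)
  have ball: "haagerup_ball N l n (\<lambda>i j. sq_tensor M zs i j)"
    unfolding haagerup_ball_def
    using lz zp nM by (intro exI[of _ M] exI[of _ zs]) (auto simp: in_set_conv_nth)
  have "cmod (complex_of_real (r / c)) \<le> 1"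
    using r(2) c haagerup_factor_norms_nonneg[OF N r(1)] by (simp add: norm_divide)
  from haagerup_ball_fscale[OF N l n ball this]
  have "haagerup_ball N l n (\<lambda>i j. fscale (complex_of_real (1 / c)) (F i j))"
  proof (rule haagerup_ball_teq)
    fix i j assume ij: "i < n" "j < n"
    have "teq l (fscale (complex_of_real (1 / c)) (F i j)) (fscale (complex_of_real (1 / c)) (fscale (complex_of_real r) (sq_tensor M zs i j)))"
      by (rule teq_fscale[OF teq_trans[OF Fy[OF ij] yz[OF ij(1)]]])
    then show "teq l (fscale (complex_of_real (1 / c)) (F i j)) (fscale (complex_of_real (r / c)) (sq_tensor M zs i j))"
      by (simp add: mult.commute)
  qed
  then show ?thesis using c by (simp add: haagerup_absorbs_def)
qed

definition hnorm :: "('a::unital_cstar_algebra mat \<Rightarrow> real) \<Rightarrow> nat \<Rightarrow> nat \<Rightarrow> (nat \<Rightarrow> nat \<Rightarrow> 'a free) \<Rightarrow> real" where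
  "hnorm N l n F = haagerup_mnorm N l (tensor_mat l n F)"

abbreviation homog_mat :: "nat \<Rightarrow> nat \<Rightarrow> (nat \<Rightarrow> nat \<Rightarrow> 'a free) \<Rightarrow> bool" where
  "homog_mat l n F \<equiv> (\<forall>i<n. \<forall>j<n. homog l (F i j))"

lemma hnorm_le:
  assumes N: "opspace_structure N" "0 < l" "0 < n" and F: "haagerup_absorbs N l n c F"
  shows "hnorm N l n F \<le> c"
proof -
  obtain r where "r \<in> haagerup_factor_norms N l (tensor_mat l n F)" "r \<le> c"
    using haagerup_factor_norm_of_absorbs[OF N F] by blast
  moreover have "bdd_below (haagerup_factor_norms N l (tensor_mat l n F))"
    by (rule bdd_belowI[of _ 0]) (rule haagerup_factor_norms_nonneg[OF N(1)])
  ultimately show ?thesis unfolding hnorm_def haagerup_mnorm_eq_Inf by (meson cInf_lower order_trans)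
qed

lemma haagerup_factor_norms_nonempty:
  assumes N: "opspace_structure N" "0 < l" "0 < n" and F: "homog_mat l n F"
  shows "haagerup_factor_norms N l (tensor_mat l n F) \<noteq> {}"
proof -
  obtain c where "haagerup_absorbs N l n c F" using haagerup_absorbs_exists[OF N, of F] F by blast
  then show ?thesis using haagerup_factor_norm_of_absorbs[OF N] by blast
qed

lemma hnorm_less:
  assumes N: "opspace_structure N" "0 < l" "0 < n" and F: "homog_mat l n F" and c: "hnorm N l n F < c"
  shows "haagerup_absorbs N l n c F"
proof -
  obtain r where "r \<in> haagerup_factor_norms N l (tensor_mat l n F)" "r < c"
    using cInf_lessD[OF haagerup_factor_norms_nonempty[OF N F]] c unfolding hnorm_def haagerup_mnorm_eq_Inf by blast
  then show ?thesis by (rule haagerup_absorbs_of_factor_norm[OF N])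
qed

lemma hnorm_nonneg:
  assumes N: "opspace_structure N" "0 < l" "0 < n" and F: "homog_mat l n F"
  shows "0 \<le> hnorm N l n F"
  unfolding hnorm_def haagerup_mnorm_eq_Inf
  by (rule cInf_greatest[OF haagerup_factor_norms_nonempty[OF N F] haagerup_factor_norms_nonneg[OF N(1)]])

lemma hnorm_triangle:
  assumes N: "opspace_structure N" "0 < l" "0 < n" and F: "homog_mat l n F" and G: "homog_mat l n G"
  shows "hnorm N l n (\<lambda>i j. F i j + G i j) \<le> hnorm N l n F + hnorm N l n G"
proof (rule field_le_epsilon)
  fix e :: real assume e: "0 < e"
  have "haagerup_absorbs N l n ((hnorm N l n F + e / 2) + (hnorm N l n G + e / 2)) (\<lambda>i j. F i j + G i j)"
    by (intro haagerup_absorbs_add[OF N] hnorm_less[OF N F] hnorm_less[OF N G]) (use e in auto)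
  from hnorm_le[OF N this] show "hnorm N l n (\<lambda>i j. F i j + G i j) \<le> hnorm N l n F + hnorm N l n G + e"
    by simp
qed

lemma hnorm_fscale:
  assumes N: "opspace_structure N" "0 < l" "0 < n" and F: "homog_mat l n F"
  shows "hnorm N l n (\<lambda>i j. fscale c (F i j)) \<le> cmod c * hnorm N l n F"
proof (rule field_le_epsilon)
  fix e :: real assume e: "0 < e"
  define a where "a = hnorm N l n F + e / (cmod c + 1)"
  have e': "0 < e / (cmod c + 1)" using e by (simp add: add_nonneg_pos)
  have "haagerup_absorbs N l n a F" unfolding a_def by (rule hnorm_less[OF N F]) (use e' in simp)
  moreover have d: "0 < cmod c * hnorm N l n F + e" using e hnorm_nonneg[OF N F] by (simp add: add_nonneg_pos)
  moreover have "cmod c * a \<le> cmod c * hnorm N l n F + e"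
  proof -
    have "cmod c * (e / (cmod c + 1)) \<le> (cmod c + 1) * (e / (cmod c + 1))"
      using e' by (intro mult_right_mono) auto
    also have "\<dots> = e" by (simp add: add_nonneg_eq_0_iff)
    finally show ?thesis by (simp add: a_def distrib_left)
  qed
  ultimately have "haagerup_absorbs N l n (cmod c * hnorm N l n F + e) (\<lambda>i j. fscale c (F i j))"
    by (intro haagerup_absorbs_fscale[OF N])
  then show "hnorm N l n (\<lambda>i j. fscale c (F i j)) \<le> cmod c * hnorm N l n F + e" by (rule hnorm_le[OF N])
qed

lemma hnorm_uminus:
  assumes N: "opspace_structure N" "0 < l" "0 < n" and F: "homog_mat l n F"
  shows "hnorm N l n (\<lambda>i j. - F i j) = hnorm N l n F"
proof (rule antisym)
  show "hnorm N l n (\<lambda>i j. - F i j) \<le> hnorm N l n F" using hnorm_fscale[OF N F, of "- 1"] by simp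
  have "homog_mat l n (\<lambda>i j. - F i j)" using F homog_fscale[of _ l "- 1"] by auto
  from hnorm_fscale[OF N this, of "- 1"] show "hnorm N l n F \<le> hnorm N l n (\<lambda>i j. - F i j)" by simp
qed

lemma homog_mat_diff: "homog_mat l n F \<Longrightarrow> homog_mat l n G \<Longrightarrow> homog_mat l n (\<lambda>i j. F i j - G i j)"
  by (simp add: homog_diff)

lemma hnorm_minus_commute:
  assumes N: "opspace_structure N" "0 < l" "0 < n" and F: "homog_mat l n F" and G: "homog_mat l n G"
  shows "hnorm N l n (\<lambda>i j. F i j - G i j) = hnorm N l n (\<lambda>i j. G i j - F i j)"
  using hnorm_uminus[OF N homog_mat_diff[OF F G]] by simp

lemma hnorm_triangle_minus:
  assumes N: "opspace_structure N" "0 < l" "0 < n" and F: "homog_mat l n F" and G: "homog_mat l n G" and H: "homog_mat l n H"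
  shows "hnorm N l n (\<lambda>i j. F i j - H i j) \<le> hnorm N l n (\<lambda>i j. F i j - G i j) + hnorm N l n (\<lambda>i j. G i j - H i j)"
  using hnorm_triangle[OF N homog_mat_diff[OF F G] homog_mat_diff[OF G H]] by simp

lemma hnorm_le_minus:
  assumes N: "opspace_structure N" "0 < l" "0 < n" and F: "homog_mat l n F" and G: "homog_mat l n G"
  shows "hnorm N l n F \<le> hnorm N l n G + hnorm N l n (\<lambda>i j. F i j - G i j)"
  using hnorm_triangle[OF N G homog_mat_diff[OF F G]] by simp

lemma hnorm_entry:
  assumes N: "opspace_structure N" "0 < l" "0 < n" and F: "homog_mat l n F" and ij: "i < n" "j < n"
  shows "hnorm N l 1 (\<lambda>_ _. F i j) \<le> hnorm N l n F"
proof (rule field_le_epsilon)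
  fix e :: real assume e: "0 < e"
  have "haagerup_absorbs N l n (hnorm N l n F + e) F" by (rule hnorm_less[OF N F]) (use e in simp)
  from haagerup_absorbs_unit[OF N this ij, of 1 0 0]
  have "haagerup_absorbs N l 1 (hnorm N l n F + e) (\<lambda>_ _. F i j)" by (rule haagerup_absorbs_teq) simp
  then show "hnorm N l 1 (\<lambda>_ _. F i j) \<le> hnorm N l n F + e" using N by (intro hnorm_le) auto
qed

lemma hnorm_le_sum:
  assumes N: "opspace_structure N" "0 < l" "0 < n" and F: "homog_mat l n F"
  shows "hnorm N l n F \<le> (\<Sum>i<n. \<Sum>j<n. hnorm N l 1 (\<lambda>_ _. F i j))"
proof (rule field_le_epsilon)
  fix e :: real assume e: "0 < e"
  define d where "d = e / (real n * real n)"
  have d: "0 < d" using e N by (simp add: d_def)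
  have one: "(0::nat) < 1" by simp
  have "haagerup_absorbs N l n (\<Sum>i<n. \<Sum>j<n. hnorm N l 1 (\<lambda>_ _. F i j) + d) F"
    by (intro haagerup_absorbs_entries[OF N] hnorm_less[OF N(1,2) one]) (use F d in auto)
  from hnorm_le[OF N this] show "hnorm N l n F \<le> (\<Sum>i<n. \<Sum>j<n. hnorm N l 1 (\<lambda>_ _. F i j)) + e"
    using N by (simp add: sum.distrib d_def)
qed

lemma cstar_mnorm_mat_prod:
  assumes M: "0 < M" and xs: "\<And>x. x \<in> set xs \<Longrightarrow> x \<in> carrier_mat M M \<and> cstar_mnorm x \<le> 1"
  shows "cstar_mnorm (mat_prod M xs) \<le> 1"
  using xs
proof (induction xs)
  case Nil
  then show ?case using M by simp
next
  case (Cons x xs)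
  have p: "mat_prod M xs \<in> carrier_mat M M" using Cons.prems by (intro mat_prod_carrier) auto
  have x: "x \<in> carrier_mat M M" "cstar_mnorm x \<le> 1" using Cons.prems by auto
  have "cstar_mnorm (x * mat_prod M xs) \<le> cstar_mnorm x * cstar_mnorm (mat_prod M xs)"
    by (rule cstar_mnorm_mult[OF x(1) p])
  also have "\<dots> \<le> 1 * 1"
    using x cstar_mnorm_nonneg[OF p] Cons by (intro mult_mono) auto
  finally show ?case by simp
qed

abbreviation product_mat :: "nat \<Rightarrow> (nat \<Rightarrow> nat \<Rightarrow> 'a::unital_cstar_algebra free) \<Rightarrow> 'a mat" where
  "product_mat n F \<equiv> mat n n (\<lambda>(i, j). free_product_map (F i j))"

lemma cstar_mnorm_corner:
  assumes "X \<in> carrier_mat M M" "0 < n" "n \<le> M"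
  shows "cstar_mnorm (mat n n (\<lambda>(i, j). X $$ (i, j))) \<le> cstar_mnorm X"
proof -
  have "pad_square (mat n n (\<lambda>(i, j). X $$ (i, j))) = mat n n (\<lambda>(i, j). X $$ (i, j))"
    by (rule eq_matI) (auto simp: pad_square_eq_pad_to)
  then show ?thesis using opspace_truncate[OF opspace_structure_cstar_mnorm assms(1,2,3,2,3)] by simp
qed

text \<open>The product of an element of the unit ball is the corner of a product of contractions.\<close>

lemma haagerup_absorbs_factors:
  assumes n: "0 < n" and F: "haagerup_absorbs max_mnorm l n c F"
  obtains M xs where "n \<le> M" "length xs = l" "\<And>x. x \<in> set xs \<Longrightarrow> x \<in> carrier_mat M M \<and> max_mnorm x \<le> 1 \<and> cstar_mnorm x \<le> 1"
    "product_mat n F = map_mat (scaleC (complex_of_real c)) (mat n n (\<lambda>(i, j). mat_prod M xs $$ (i, j)))"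
proof -
  have c: "0 < c" using F by (simp add: haagerup_absorbs_def)
  obtain M xs where xs: "n \<le> M" "length xs = l" "\<forall>x\<in>set xs. x \<in> carrier_mat M M \<and> max_mnorm x \<le> 1"
    "\<forall>i<n. \<forall>j<n. teq l (fscale (complex_of_real (1 / c)) (F i j)) (sq_tensor M xs i j)"
    using F unfolding haagerup_absorbs_def haagerup_ball_def by blast
  have M: "0 < M" using n xs(1) by simp
  show thesis
  proof (rule that[OF xs(1,2)])
    show "x \<in> carrier_mat M M \<and> max_mnorm x \<le> 1 \<and> cstar_mnorm x \<le> 1" if "x \<in> set xs" for x
      using xs(3) that max_mnorm_upper[OF opspace_structure_cstar_mnorm M, of x] by force
    show "product_mat n F = map_mat (scaleC (complex_of_real c)) (mat n n (\<lambda>(i, j). mat_prod M xs $$ (i, j)))"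
    proof (rule eq_matI)
      fix i j assume "i < dim_row (map_mat (scaleC (complex_of_real c)) (mat n n (\<lambda>(i, j). mat_prod M xs $$ (i, j))))"
        "j < dim_col (map_mat (scaleC (complex_of_real c)) (mat n n (\<lambda>(i, j). mat_prod M xs $$ (i, j))))"
      then have ij: "i < n" "j < n" by auto
      have "complex_of_real (1 / c) *\<^sub>C free_product_map (F i j) = free_product_map (sq_tensor M xs i j)"
        using free_product_map_teq xs(4) ij by (metis free_product_map_fscale)
      also have "\<dots> = mat_prod M xs $$ (i, j)"
        using xs ij by (intro free_product_map_sq_tensor) auto
      finally have "complex_of_real c *\<^sub>C complex_of_real (1 / c) *\<^sub>C free_product_map (F i j)
          = complex_of_real c *\<^sub>C (mat_prod M xs $$ (i, j))" by simp
      then show "product_mat n F $$ (i, j)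
        = map_mat (scaleC (complex_of_real c)) (mat n n (\<lambda>(i, j). mat_prod M xs $$ (i, j))) $$ (i, j)"
        using ij c by (simp add: scaleC_scaleC)
    qed auto
  qed
qed

text \<open>The maximal structure dominates the C*-norm, for which products of contractions are contractions.\<close>

lemma product_mat_contraction:
  assumes N: "0 < l" "0 < n" and F: "homog_mat l n F"
  shows "cstar_mnorm (product_mat n F) \<le> hnorm max_mnorm l n F"
proof (rule field_le_epsilon)
  fix e :: real assume e: "0 < e"
  let ?c = "hnorm max_mnorm l n F + e"
  have F': "haagerup_absorbs max_mnorm l n ?c F"
    by (rule hnorm_less[OF opspace_structure_max_mnorm N F]) (use e in simp)
  then have c: "0 < ?c" by (simp add: haagerup_absorbs_def)
  obtain M xs where xs: "n \<le> M" "length xs = l" "\<And>x. x \<in> set xs \<Longrightarrow> x \<in> carrier_mat M M \<and> max_mnorm x \<le> 1 \<and> cstar_mnorm x \<le> 1"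
    "product_mat n F = map_mat (scaleC (complex_of_real ?c)) (mat n n (\<lambda>(i, j). mat_prod M xs $$ (i, j)))"
    using haagerup_absorbs_factors[OF N(2) F'] by metis
  have M: "0 < M" using N xs(1) by simp
  have p: "mat_prod M xs \<in> carrier_mat M M" using xs(3) by (intro mat_prod_carrier) auto
  have "cstar_mnorm (product_mat n F) = ?c * cstar_mnorm (mat n n (\<lambda>(i, j). mat_prod M xs $$ (i, j)))"
    unfolding xs(4) using c by (subst cstar_mnorm_scaleC[of _ n n]) (auto simp del: of_real_add)
  also have "\<dots> \<le> ?c * 1"
  proof (rule mult_left_mono)
    show "cstar_mnorm (mat n n (\<lambda>(i, j). mat_prod M xs $$ (i, j))) \<le> 1"
      using cstar_mnorm_corner[OF p N(2) xs(1)] cstar_mnorm_mat_prod[OF M, of xs] xs(3) by force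
  qed (use c in simp)
  finally show "cstar_mnorm (product_mat n F) \<le> ?c" by simp
qed

section \<open>The completed tensor power and its quotient by the kernel\<close>

lemma zero_less_one_nat: "(0::nat) < 1" by simp

text \<open>The objects in the definition of length are built from classes of classes.  In this locale each
stage is described by the sequences of free tensors that represent its points: \<open>X\<close> is the algebraic
tensor power, \<open>Y\<close> its completion, and \<open>Z\<close> the quotient of \<open>Y\<close> by the kernel of the product map.\<close>

locale haagerup_length =
  fixes A :: "'a::unital_cstar_algebra itself" and l :: nat
  assumes l: "0 < l"
begin

definition X :: "'a free set opspace" where
  "X = cvspace.extend (tensor_space l) (opspace.fields (haagerup_mnorm max_mnorm l))"

abbreviation hn :: "nat \<Rightarrow> (nat \<Rightarrow> nat \<Rightarrow> 'a free) \<Rightarrow> real" where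
  "hn \<equiv> hnorm max_mnorm l"

definition nu :: "'a free \<Rightarrow> real" where "nu f = hn 1 (\<lambda>_ _. f)"

lemmas N = opspace_structure_max_mnorm[where 'a = 'a]
lemmas Nl = N l
lemmas N1 = N l zero_less_one_nat

lemma haagerup_power_eq: "haagerup_power max_mnorm l = completion X"
  by (simp add: haagerup_power_def X_def)

lemma X_sel: "points X = tclass l ` points (free_space l)" "mnorm X = haagerup_mnorm max_mnorm l"
  "vadd X = (\<lambda>C D. {c + d |c d. c \<in> C \<and> d \<in> D})"
  "vscale X = (\<lambda>z C. \<Union>c\<in>C. tclass l (fscale z c))"
  by (simp_all add: X_def cvspace.defs opspace.defs tensor_space_def vquotient_def free_space_def)

lemma X_vadd: "vadd X (tclass l f) (tclass l g) = tclass l (f + g)"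
proof (rule Set.set_eqI)
  fix h
  have "h \<in> vadd X (tclass l f) (tclass l g) \<longleftrightarrow> (\<exists>c d. h = c + d \<and> teq l c f \<and> teq l d g)"
    by (simp add: X_sel in_tclass_iff)
  also have "\<dots> \<longleftrightarrow> teq l h (f + g)"
  proof
    assume "\<exists>c d. h = c + d \<and> teq l c f \<and> teq l d g"
    then show "teq l h (f + g)" using teq_add by blast
  next
    assume "teq l h (f + g)"
    then have "teq l (h - g) f" by (simp add: teq_def algebra_simps)
    then show "\<exists>c d. h = c + d \<and> teq l c f \<and> teq l d g"
      by (intro exI[of _ "h - g"] exI[of _ g]) simp
  qed
  finally show "h \<in> vadd X (tclass l f) (tclass l g) \<longleftrightarrow> h \<in> tclass l (f + g)" by (simp add: in_tclass_iff)
qed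

lemma X_vscale: "vscale X z (tclass l f) = tclass l (fscale z f)"
proof -
  have "tclass l (fscale z c) = tclass l (fscale z f)" if "c \<in> tclass l f" for c
    using that by (simp add: in_tclass_iff tclass_eq_iff teq_fscale)
  moreover have "f \<in> tclass l f" by (simp add: in_tclass_iff)
  ultimately show ?thesis unfolding X_sel by blast
qed

lemma X_mnorm: "mnorm X (tensor_mat l n F) = hn n F"
  by (simp add: X_sel hnorm_def)

lemma X_vdist: "vdist X (tclass l f) (tclass l g) = nu (f - g)"
proof -
  have "vdist X (tclass l f) (tclass l g) = mnorm X (tensor_mat l 1 (\<lambda>_ _. f - g))"
    by (simp add: vdist_def X_vadd X_vscale case_prod_unfold)
  then show ?thesis by (simp only: X_mnorm nu_def)
qed

lemma nu_facts:
  assumes "homog l f" "homog l g" "homog l h"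
  shows "0 \<le> nu f" "nu (f - g) = nu (g - f)" "nu (f - h) \<le> nu (f - g) + nu (g - h)"
    "nu (f + g) \<le> nu f + nu g" "nu (fscale c f) \<le> cmod c * nu f" "norm (free_product_map f) \<le> nu f" "nu 0 = 0"
proof -
  show "0 \<le> nu f" unfolding nu_def by (rule hnorm_nonneg[OF N1]) (simp add: assms)
  show "nu (f - g) = nu (g - f)" unfolding nu_def by (rule hnorm_minus_commute[OF N1]) (simp_all add: assms)
  show "nu (f - h) \<le> nu (f - g) + nu (g - h)"
    unfolding nu_def by (rule hnorm_triangle_minus[OF N1]) (simp_all add: assms)
  show "nu (f + g) \<le> nu f + nu g" unfolding nu_def by (rule hnorm_triangle[OF N1]) (simp_all add: assms)
  show "nu (fscale c f) \<le> cmod c * nu f" unfolding nu_def by (rule hnorm_fscale[OF N1]) (simp add: assms)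
  have "product_mat 1 (\<lambda>_ _. f) = mat 1 1 (\<lambda>_. free_product_map f)" by (rule eq_matI) auto
  then show "norm (free_product_map f) \<le> nu f"
    using product_mat_contraction[OF l zero_less_one_nat, of "\<lambda>_ _. f"] assms cstar_mnorm_1_1[of "free_product_map f"]
    by (simp add: nu_def)
  have "nu (fscale 0 f) \<le> cmod 0 * nu f"
    unfolding nu_def by (rule hnorm_fscale[OF N1]) (simp add: assms)
  moreover have "0 \<le> nu 0" unfolding nu_def by (rule hnorm_nonneg[OF N1]) simp
  ultimately show "nu 0 = 0" by simp
qed

definition CS :: "(nat \<Rightarrow> 'a free) set" where
  "CS = {f. (\<forall>k. homog l (f k)) \<and> (\<forall>e>0. \<exists>K. \<forall>m\<ge>K. \<forall>n\<ge>K. nu (f m - f n) < e)}"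

text \<open>A sequence of free tensors represents a sequence in the tensor power (\<open>cls\<close>) and, if it is Cauchy,
a point of the completion (\<open>J\<close>).\<close>

definition cls :: "(nat \<Rightarrow> 'a free) \<Rightarrow> nat \<Rightarrow> 'a free set" where
  "cls f = (\<lambda>k. tclass l (f k))"

definition J :: "(nat \<Rightarrow> 'a free) \<Rightarrow> (nat \<Rightarrow> 'a free set) set" where
  "J f = cauchy_rel X `` {cls f}"

definition near :: "(nat \<Rightarrow> 'a free) \<Rightarrow> (nat \<Rightarrow> 'a free) \<Rightarrow> bool" where
  "near f g \<longleftrightarrow> (\<lambda>k. nu (f k - g k)) \<longlonglongrightarrow> 0"

lemma CS_homog: "f \<in> CS \<Longrightarrow> homog l (f k)" by (simp add: CS_def)

lemma cls_cauchy_iff: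
  assumes "\<And>k. homog l (f k)"
  shows "cls f \<in> cauchy_seqs X \<longleftrightarrow> f \<in> CS"
  using assms by (auto simp: cauchy_seqs_def CS_def cls_def X_vdist X_sel(1))

lemma cauchy_seqs_eq: "cauchy_seqs X = cls ` CS"
proof
  show "cls ` CS \<subseteq> cauchy_seqs X" using cls_cauchy_iff CS_homog by blast
  show "cauchy_seqs X \<subseteq> cls ` CS"
  proof
    fix s assume s: "s \<in> cauchy_seqs X"
    then have "\<forall>k. s k \<in> tclass l ` points (free_space l)"
      by (auto simp: cauchy_seqs_def X_sel(1))
    then have "\<forall>k. \<exists>f. homog l f \<and> s k = tclass l f" by blast
    then obtain f where f: "\<And>k. homog l (f k)" "\<And>k. s k = tclass l (f k)" by metis
    then have "s = cls f" by (auto simp: cls_def)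
    then show "s \<in> cls ` CS" using s f cls_cauchy_iff by blast
  qed
qed

lemma cauchy_rel_iff:
  assumes "f \<in> CS" "g \<in> CS"
  shows "(cls f, cls g) \<in> cauchy_rel X \<longleftrightarrow> near f g"
proof -
  have "cls f \<in> cauchy_seqs X" "cls g \<in> cauchy_seqs X" using assms cauchy_seqs_eq by blast+
  then show ?thesis by (simp add: cauchy_rel_def near_def) (simp add: cls_def X_vdist)
qed

lemma in_J_iff:
  assumes "f \<in> CS"
  shows "s \<in> J f \<longleftrightarrow> (\<exists>g\<in>CS. s = cls g \<and> near f g)"
proof
  assume "s \<in> J f"
  then have r: "(cls f, s) \<in> cauchy_rel X" by (simp add: J_def)
  then have "s \<in> cls ` CS" using cauchy_seqs_eq by (auto simp: cauchy_rel_def)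
  then obtain g where "g \<in> CS" "s = cls g" by blast
  then show "\<exists>g\<in>CS. s = cls g \<and> near f g" using r cauchy_rel_iff[OF assms] by blast
next
  assume "\<exists>g\<in>CS. s = cls g \<and> near f g"
  then show "s \<in> J f" using cauchy_rel_iff[OF assms] by (auto simp: J_def)
qed

lemma near_refl: "f \<in> CS \<Longrightarrow> near f f"
  using nu_facts(7)[OF homog_zero homog_zero homog_zero] by (simp add: near_def)

lemma near_sym: "f \<in> CS \<Longrightarrow> g \<in> CS \<Longrightarrow> near f g \<Longrightarrow> near g f"
  unfolding near_def using nu_facts(2)[OF CS_homog CS_homog homog_zero, of f g] by simp

lemma near_trans:
  assumes "f \<in> CS" "g \<in> CS" "h \<in> CS" "near f g" "near g h"
  shows "near f h"
  unfolding near_def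
proof (rule tendsto_sandwich[of "\<lambda>_. 0"])
  note H = CS_homog[OF assms(1)] CS_homog[OF assms(2)] CS_homog[OF assms(3)]
  show "\<forall>\<^sub>F k in sequentially. 0 \<le> nu (f k - h k)"
    by (intro always_eventually allI nu_facts(1)[OF homog_diff[OF H(1,3)] homog_zero homog_zero])
  show "\<forall>\<^sub>F k in sequentially. nu (f k - h k) \<le> nu (f k - g k) + nu (g k - h k)"
    by (intro always_eventually allI nu_facts(3)[OF H])
  show "(\<lambda>k. nu (f k - g k) + nu (g k - h k)) \<longlonglongrightarrow> 0"
    using tendsto_add[OF assms(4)[unfolded near_def] assms(5)[unfolded near_def]] by simp
qed simp

lemma J_eq:
  assumes "f \<in> CS" "g \<in> CS" "near f g"
  shows "J f = J g"
proof (rule Set.set_eqI)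
  fix s
  show "s \<in> J f \<longleftrightarrow> s \<in> J g"
    using in_J_iff[OF assms(1)] in_J_iff[OF assms(2)] near_trans near_sym assms by metis
qed

lemma CS_add:
  assumes "f \<in> CS" "g \<in> CS"
  shows "(\<lambda>k. f k + g k) \<in> CS"
  unfolding CS_def mem_Collect_eq
proof (intro conjI allI impI)
  note H = CS_homog[OF assms(1)] CS_homog[OF assms(2)]
  show "homog l (f k + g k)" for k by (intro homog_add H)
  fix e :: real assume "0 < e"
  then have "0 < e / 2" by simp
  then obtain K1 K2 where K: "\<forall>m\<ge>K1. \<forall>n\<ge>K1. nu (f m - f n) < e / 2" "\<forall>m\<ge>K2. \<forall>n\<ge>K2. nu (g m - g n) < e / 2"
    using assms unfolding CS_def by blast
  have "nu ((f m + g m) - (f n + g n)) < e" if "m \<ge> max K1 K2" "n \<ge> max K1 K2" for m n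
  proof -
    have "nu ((f m + g m) - (f n + g n)) = nu ((f m - f n) + (g m - g n))" by (simp add: algebra_simps)
    also have "\<dots> \<le> nu (f m - f n) + nu (g m - g n)"
      by (rule nu_facts(4)[OF homog_diff[OF H(1) H(1)] homog_diff[OF H(2) H(2)] homog_zero])
    also have "\<dots> < e" using K(1)[rule_format, of m n] K(2)[rule_format, of m n] that by simp
    finally show ?thesis .
  qed
  then show "\<exists>K. \<forall>m\<ge>K. \<forall>n\<ge>K. nu ((f m + g m) - (f n + g n)) < e" by blast
qed

lemma CS_fscale:
  assumes "f \<in> CS"
  shows "(\<lambda>k. fscale z (f k)) \<in> CS"
  unfolding CS_def mem_Collect_eq
proof (intro conjI allI impI)
  note H = CS_homog[OF assms]
  show "homog l (fscale z (f k))" for k by (intro homog_fscale H)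
  fix e :: real assume e: "0 < e"
  have z: "0 < cmod z + 1" by (simp add: add_nonneg_pos)
  then have "0 < e / (cmod z + 1)" using e by simp
  then obtain K where K: "\<forall>m\<ge>K. \<forall>n\<ge>K. nu (f m - f n) < e / (cmod z + 1)"
    using assms unfolding CS_def by blast
  have "nu (fscale z (f m) - fscale z (f n)) < e" if "m \<ge> K" "n \<ge> K" for m n
  proof -
    have "nu (fscale z (f m) - fscale z (f n)) = nu (fscale z (f m - f n))"
      by (simp add: free_module.scale_right_diff_distrib)
    also have "\<dots> \<le> cmod z * nu (f m - f n)"
      by (rule nu_facts(5)[OF homog_diff[OF H H] homog_zero homog_zero])
    also have "\<dots> \<le> (cmod z + 1) * nu (f m - f n)"
      by (intro mult_right_mono nu_facts(1)[OF homog_diff[OF H H] homog_zero homog_zero]) simp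
    also have "\<dots> < e" using K[rule_format, OF that] z by (simp add: field_simps)
    finally show ?thesis .
  qed
  then show "\<exists>K. \<forall>m\<ge>K. \<forall>n\<ge>K. nu (fscale z (f m) - fscale z (f n)) < e" by blast
qed

lemma CS_diff: "f \<in> CS \<Longrightarrow> g \<in> CS \<Longrightarrow> (\<lambda>k. f k - g k) \<in> CS"
  using CS_add[of f "\<lambda>k. fscale (- 1) (g k)"] CS_fscale[of g "- 1"] by simp

abbreviation Y :: "(nat \<Rightarrow> 'a free set) set opspace" where "Y \<equiv> completion X"

lemma Y_points: "points Y = J ` CS"
  by (auto simp: completion_def quotient_def J_def cauchy_seqs_eq)

lemma cls_in_J: "f \<in> CS \<Longrightarrow> cls f \<in> J f"
  using in_J_iff near_refl by blast

lemma Y_vadd: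
  assumes f: "f \<in> CS" and g: "g \<in> CS"
  shows "vadd Y (J f) (J g) = J (\<lambda>k. f k + g k)"
proof -
  have "cauchy_rel X `` {\<lambda>k. vadd X (s k) (t k)} = J (\<lambda>k. f k + g k)" if st: "s \<in> J f" "t \<in> J g" for s t
  proof -
    obtain f' g' where f': "f' \<in> CS" "s = cls f'" "near f f'" and g': "g' \<in> CS" "t = cls g'" "near g g'"
      using st in_J_iff f g by metis
    have "(\<lambda>k. vadd X (s k) (t k)) = cls (\<lambda>k. f' k + g' k)"
      by (simp add: f' g' cls_def X_vadd)
    then have "cauchy_rel X `` {\<lambda>k. vadd X (s k) (t k)} = J (\<lambda>k. f' k + g' k)" by (simp add: J_def)
    also have "\<dots> = J (\<lambda>k. f k + g k)"
    proof (rule J_eq[OF CS_add[OF f'(1) g'(1)] CS_add[OF f g]])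
      show "near (\<lambda>k. f' k + g' k) (\<lambda>k. f k + g k)"
        unfolding near_def
      proof (rule tendsto_sandwich[of "\<lambda>_. 0"])
        note H = CS_homog[OF f'(1)] CS_homog[OF g'(1)] CS_homog[OF f] CS_homog[OF g]
        show "\<forall>\<^sub>F k in sequentially. 0 \<le> nu ((f' k + g' k) - (f k + g k))"
          by (intro always_eventually allI nu_facts(1)[OF homog_diff[OF homog_add[OF H(1,2)] homog_add[OF H(3,4)]] homog_zero homog_zero])
        show "\<forall>\<^sub>F k in sequentially. nu ((f' k + g' k) - (f k + g k)) \<le> nu (f' k - f k) + nu (g' k - g k)"
        proof (intro always_eventually allI)
          show "nu ((f' k + g' k) - (f k + g k)) \<le> nu (f' k - f k) + nu (g' k - g k)" for k
            using nu_facts(4)[OF homog_diff[OF H(1,3)] homog_diff[OF H(2,4)] homog_zero, of k k k k] by (simp add: algebra_simps)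
        qed
        show "(\<lambda>k. nu (f' k - f k) + nu (g' k - g k)) \<longlonglongrightarrow> 0"
          using tendsto_add[OF near_sym[OF f f'(1,3), unfolded near_def] near_sym[OF g g'(1,3), unfolded near_def]] by simp
      qed simp
    qed
    finally show ?thesis .
  qed
  moreover have "vadd Y (J f) (J g) = (\<Union>s\<in>J f. \<Union>t\<in>J g. cauchy_rel X `` {\<lambda>k. vadd X (s k) (t k)})"
    by (auto simp: completion_def)
  ultimately show ?thesis using cls_in_J[OF f] cls_in_J[OF g] by blast
qed

lemma Y_vscale:
  assumes f: "f \<in> CS"
  shows "vscale Y z (J f) = J (\<lambda>k. fscale z (f k))"
proof -
  have "cauchy_rel X `` {\<lambda>k. vscale X z (s k)} = J (\<lambda>k. fscale z (f k))" if s: "s \<in> J f" for s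
  proof -
    obtain f' where f': "f' \<in> CS" "s = cls f'" "near f f'" using s in_J_iff f by metis
    have "(\<lambda>k. vscale X z (s k)) = cls (\<lambda>k. fscale z (f' k))"
      by (simp add: f' cls_def X_vscale)
    then have "cauchy_rel X `` {\<lambda>k. vscale X z (s k)} = J (\<lambda>k. fscale z (f' k))" by (simp add: J_def)
    also have "\<dots> = J (\<lambda>k. fscale z (f k))"
    proof (rule J_eq[OF CS_fscale[OF f'(1)] CS_fscale[OF f]])
      show "near (\<lambda>k. fscale z (f' k)) (\<lambda>k. fscale z (f k))"
        unfolding near_def
      proof (rule tendsto_sandwich[of "\<lambda>_. 0"])
        note H = CS_homog[OF f'(1)] CS_homog[OF f]
        show "\<forall>\<^sub>F k in sequentially. 0 \<le> nu (fscale z (f' k) - fscale z (f k))"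
          by (intro always_eventually allI nu_facts(1)[OF homog_diff[OF homog_fscale[OF H(1)] homog_fscale[OF H(2)]] homog_zero homog_zero])
        show "\<forall>\<^sub>F k in sequentially. nu (fscale z (f' k) - fscale z (f k)) \<le> cmod z * nu (f' k - f k)"
        proof (intro always_eventually allI)
          show "nu (fscale z (f' k) - fscale z (f k)) \<le> cmod z * nu (f' k - f k)" for k
            using nu_facts(5)[OF homog_diff[OF H] homog_zero homog_zero, of z k k]
            by (simp add: free_module.scale_right_diff_distrib)
        qed
        show "(\<lambda>k. cmod z * nu (f' k - f k)) \<longlonglongrightarrow> 0"
          using tendsto_mult_right_zero[OF near_sym[OF f f'(1,3), unfolded near_def]] by simp
      qed simp
    qed
    finally show ?thesis .
  qed
  moreover have "vscale Y z (J f) = (\<Union>s\<in>J f. cauchy_rel X `` {\<lambda>k. vscale X z (s k)})"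
    by (auto simp: completion_def)
  ultimately show ?thesis using cls_in_J[OF f] by blast
qed

text \<open>The product map on the completion.\<close>

definition plim :: "(nat \<Rightarrow> 'a free) \<Rightarrow> 'a" where "plim f = lim (\<lambda>k. free_product_map (f k))"

lemma plim_tendsto:
  assumes "f \<in> CS"
  shows "(\<lambda>k. free_product_map (f k)) \<longlonglongrightarrow> plim f"
proof -
  note H = CS_homog[OF assms]
  have "Cauchy (\<lambda>k. free_product_map (f k))"
  proof (rule CauchyI)
    fix e :: real assume "0 < e"
    then obtain K where K: "\<forall>m\<ge>K. \<forall>n\<ge>K. nu (f m - f n) < e" using assms unfolding CS_def by blast
    have "norm (free_product_map (f m) - free_product_map (f n)) < e" if "m \<ge> K" "n \<ge> K" for m n
      using nu_facts(6)[OF homog_diff[OF H H] homog_zero homog_zero, of m n] K[rule_format, OF that]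
      by (simp add: free_product_map_diff)
    then show "\<exists>K. \<forall>m\<ge>K. \<forall>n\<ge>K. norm (free_product_map (f m) - free_product_map (f n)) < e" by blast
  qed
  then show ?thesis unfolding plim_def by (simp add: Cauchy_convergent_iff convergent_LIMSEQ_iff)
qed

lemma plim_eqI: "(\<lambda>k. free_product_map (f k)) \<longlonglongrightarrow> a \<Longrightarrow> plim f = a"
  unfolding plim_def by (rule limI)

lemma plim_add: "f \<in> CS \<Longrightarrow> g \<in> CS \<Longrightarrow> plim (\<lambda>k. f k + g k) = plim f + plim g"
  by (rule plim_eqI) (simp add: free_product_map_add tendsto_add plim_tendsto)

lemma tendsto_scaleC:
  assumes "u \<longlonglongrightarrow> (a::'b::unital_cstar_algebra)"
  shows "(\<lambda>k. z *\<^sub>C u k) \<longlonglongrightarrow> z *\<^sub>C a"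
proof -
  have "(\<lambda>k. norm (z *\<^sub>C u k - z *\<^sub>C a)) \<longlonglongrightarrow> 0"
    using tendsto_mult_right_zero[OF tendsto_norm_zero[OF LIM_zero[OF assms]], of "cmod z"]
    by (simp add: norm_scaleC flip: scaleC_diff_right)
  then show ?thesis by (metis LIM_zero_cancel tendsto_norm_zero_cancel)
qed

lemma plim_fscale: "f \<in> CS \<Longrightarrow> plim (\<lambda>k. fscale z (f k)) = z *\<^sub>C plim f"
  by (rule plim_eqI) (simp add: free_product_map_fscale tendsto_scaleC plim_tendsto)

lemma plim_diff: "f \<in> CS \<Longrightarrow> g \<in> CS \<Longrightarrow> plim (\<lambda>k. f k - g k) = plim f - plim g"
  by (rule plim_eqI) (simp add: free_product_map_diff tendsto_diff plim_tendsto)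

lemma plim_near:
  assumes "f \<in> CS" "g \<in> CS" "near f g"
  shows "plim f = plim g"
proof -
  have "(\<lambda>k. norm (free_product_map (f k) - free_product_map (g k))) \<longlonglongrightarrow> 0"
  proof (rule tendsto_sandwich[of "\<lambda>_. 0"])
    show "\<forall>\<^sub>F k in sequentially. norm (free_product_map (f k) - free_product_map (g k)) \<le> nu (f k - g k)"
      using nu_facts(6)[OF homog_diff[OF CS_homog[OF assms(1)] CS_homog[OF assms(2)]] homog_zero homog_zero]
      by (intro always_eventually allI) (simp add: free_product_map_diff)
    show "(\<lambda>k. nu (f k - g k)) \<longlonglongrightarrow> 0" using assms(3) by (simp add: near_def)
  qed auto
  then have "(\<lambda>k. free_product_map (f k) - free_product_map (g k)) \<longlonglongrightarrow> 0" by (rule tendsto_norm_zero_cancel)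
  then have "plim (\<lambda>k. f k - g k) = 0" by (intro plim_eqI) (simp add: free_product_map_diff)
  then show ?thesis using plim_diff[OF assms(1,2)] by simp
qed

lemma tensor_product_map_tclass: "tensor_product_map (tclass l f) = free_product_map f"
proof -
  have "free_product_map ` tclass l f = {free_product_map f}"
    using free_product_map_teq by (force simp: in_tclass_iff)
  then show ?thesis by (simp add: tensor_product_map_def)
qed

lemma product_map_J:
  assumes "f \<in> CS"
  shows "product_map (J f) = plim f"
proof -
  have "lim (\<lambda>k. tensor_product_map (s k)) = plim f" if s: "s \<in> J f" for s
  proof -
    obtain g where g: "g \<in> CS" "s = cls g" "near f g" using s in_J_iff assms by metis
    then have "lim (\<lambda>k. tensor_product_map (s k)) = plim g"
      by (simp add: cls_def tensor_product_map_tclass plim_def)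
    then show ?thesis using plim_near[OF assms g(1,3)] by simp
  qed
  then have "(\<lambda>s. lim (\<lambda>k. tensor_product_map (s k))) ` J f = {plim f}" using cls_in_J[OF assms] by force
  then show ?thesis by (simp add: product_map_def)
qed

text \<open>The norm of a matrix is at most the sum of the norms of its entries, so entrywise convergence
suffices throughout.\<close>

lemma hn_diff_le:
  assumes n: "0 < n" and F: "homog_mat l n F" and G: "homog_mat l n G"
  shows "\<bar>hn n F - hn n G\<bar> \<le> (\<Sum>i<n. \<Sum>j<n. nu (F i j - G i j))"
proof -
  have "hn n (\<lambda>i j. F i j - G i j) \<le> (\<Sum>i<n. \<Sum>j<n. nu (F i j - G i j))"
    unfolding nu_def by (rule hnorm_le_sum[OF Nl n homog_mat_diff[OF F G]])
  then show ?thesis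
    using hnorm_le_minus[OF Nl n F G] hnorm_le_minus[OF Nl n G F] hnorm_minus_commute[OF Nl n F G] by linarith
qed

lemma hn_convergent:
  assumes n: "0 < n" and F: "\<And>i j. i < n \<Longrightarrow> j < n \<Longrightarrow> F i j \<in> CS"
  shows "convergent (\<lambda>k. hn n (\<lambda>i j. F i j k))"
proof (rule Cauchy_convergent, rule metric_CauchyI)
  fix e :: real assume e: "0 < e"
  define d where "d = e / (real n * real n)"
  have d: "0 < d" using e n by (simp add: d_def)
  have "\<exists>K. \<forall>m\<ge>K. \<forall>k\<ge>K. nu (F i j m - F i j k) < d" if "i < n" "j < n" for i j
    using F[OF that] d unfolding CS_def by blast
  then obtain K where K: "\<And>i j m k. i < n \<Longrightarrow> j < n \<Longrightarrow> m \<ge> K i j \<Longrightarrow> k \<ge> K i j \<Longrightarrow> nu (F i j m - F i j k) < d"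
    by metis
  define K0 where "K0 = (\<Sum>i<n. \<Sum>j<n. K i j)"
  have K0: "K i j \<le> K0" if "i < n" "j < n" for i j
  proof -
    have "K i j \<le> (\<Sum>j<n. K i j)" using that by (intro member_le_sum) auto
    also have "\<dots> \<le> K0" unfolding K0_def by (rule member_le_sum[of i "{..<n}" "\<lambda>i. \<Sum>j<n. K i j"]) (use that in simp_all)
    finally show ?thesis .
  qed
  have "dist (hn n (\<lambda>i j. F i j m)) (hn n (\<lambda>i j. F i j k)) < e" if mk: "m \<ge> K0" "k \<ge> K0" for m k
  proof -
    have "dist (hn n (\<lambda>i j. F i j m)) (hn n (\<lambda>i j. F i j k)) \<le> (\<Sum>i<n. \<Sum>j<n. nu (F i j m - F i j k))"
      unfolding dist_real_def by (rule hn_diff_le[OF n]) (use CS_homog[OF F] in auto)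
    also have "\<dots> < (\<Sum>i<n. \<Sum>j<n. d)"
    proof (rule sum_strict_mono)
      fix i assume i: "i \<in> {..<n}"
      show "(\<Sum>j<n. nu (F i j m - F i j k)) < (\<Sum>j<n. d)"
      proof (rule sum_strict_mono)
        fix j assume j: "j \<in> {..<n}"
        have "K i j \<le> m" "K i j \<le> k" using K0[of i j] i j mk by auto
        then show "nu (F i j m - F i j k) < d" using K[of i j m k] i j by simp
      qed (use n in auto)
    qed (use n in auto)
    also have "\<dots> = e" using n by (simp add: d_def)
    finally show ?thesis .
  qed
  then show "\<exists>K. \<forall>m\<ge>K. \<forall>k\<ge>K. dist (hn n (\<lambda>i j. F i j m)) (hn n (\<lambda>i j. F i j k)) < e" by blast
qed

text \<open>The chosen representatives of the entries differ from the given ones by null sequences.\<close>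

lemma Y_mnorm:
  assumes n: "0 < n" and F: "\<And>i j. i < n \<Longrightarrow> j < n \<Longrightarrow> F i j \<in> CS"
  shows "(\<lambda>k. hn n (\<lambda>i j. F i j k)) \<longlonglongrightarrow> mnorm Y (mat n n (\<lambda>(i, j). J (F i j)))"
proof -
  have "\<exists>g\<in>CS. (SOME s. s \<in> J (F i j)) = cls g \<and> near (F i j) g" if "i < n" "j < n" for i j
  proof -
    have "(SOME s. s \<in> J (F i j)) \<in> J (F i j)"
      by (rule someI[of "\<lambda>s. s \<in> J (F i j)", OF cls_in_J[OF F[OF that]]])
    then show ?thesis using in_J_iff[OF F[OF that]] by blast
  qed
  then obtain G where G: "\<And>i j. i < n \<Longrightarrow> j < n \<Longrightarrow> G i j \<in> CS"
    "\<And>i j. i < n \<Longrightarrow> j < n \<Longrightarrow> (SOME s. s \<in> J (F i j)) = cls (G i j)"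
    "\<And>i j. i < n \<Longrightarrow> j < n \<Longrightarrow> near (F i j) (G i j)" by metis
  have "map_mat (\<lambda>C. (SOME s. s \<in> C) k) (mat n n (\<lambda>(i, j). J (F i j))) = tensor_mat l n (\<lambda>i j. G i j k)" for k
    by (rule eq_matI) (auto simp: G(2) cls_def)
  then have Ym: "mnorm Y (mat n n (\<lambda>(i, j). J (F i j))) = lim (\<lambda>k. hn n (\<lambda>i j. G i j k))"
    by (simp add: completion_def X_mnorm)
  obtain L where L: "(\<lambda>k. hn n (\<lambda>i j. F i j k)) \<longlonglongrightarrow> L" using hn_convergent[of n F] n F by (auto simp: convergent_def)
  have "(\<lambda>k. hn n (\<lambda>i j. G i j k) - hn n (\<lambda>i j. F i j k)) \<longlonglongrightarrow> 0"
  proof (rule tendsto_rabs_zero_cancel, rule tendsto_sandwich[of "\<lambda>_. 0"])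
    show "\<forall>\<^sub>F k in sequentially. \<bar>hn n (\<lambda>i j. G i j k) - hn n (\<lambda>i j. F i j k)\<bar> \<le> (\<Sum>i<n. \<Sum>j<n. nu (G i j k - F i j k))"
      by (intro always_eventually allI hn_diff_le[OF n]) (use CS_homog[OF F] CS_homog[OF G(1)] in auto)
    show "(\<lambda>k. \<Sum>i<n. \<Sum>j<n. nu (G i j k - F i j k)) \<longlonglongrightarrow> 0"
      by (intro tendsto_null_sum) (use near_sym[OF F G(1) G(3)] in \<open>auto simp: near_def\<close>)
  qed auto
  from tendsto_add[OF this L] have "(\<lambda>k. hn n (\<lambda>i j. G i j k)) \<longlonglongrightarrow> L" by simp
  then have "lim (\<lambda>k. hn n (\<lambda>i j. G i j k)) = L" by (rule limI)
  then show ?thesis using L Ym by simp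
qed

text \<open>The cosets of the kernel are the fibres of the product map, so a point of the quotient is
determined by its image in the algebra.\<close>

definition Fib :: "'a \<Rightarrow> (nat \<Rightarrow> 'a free set) set set" where
  "Fib a = J ` {f \<in> CS. plim f = a}"

definition Z :: "(nat \<Rightarrow> 'a free set) set set opspace" where "Z = length_space l"

lemma Z_eq: "Z = quotient_opspace Y (product_kernel l)"
  by (simp add: Z_def length_space_def haagerup_power_eq)

lemma kernel_eq: "product_kernel l = J ` {f \<in> CS. plim f = 0}"
  by (auto simp: product_kernel_def haagerup_power_eq Y_points product_map_J)

lemma vcoset_kernel:
  assumes "f \<in> CS"
  shows "vcoset Y (product_kernel l) (J f) = Fib (plim f)"
proof
  show "vcoset Y (product_kernel l) (J f) \<subseteq> Fib (plim f)"
    using assms by (auto simp: vcoset_def kernel_eq Fib_def Y_vadd plim_add CS_add)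
  show "Fib (plim f) \<subseteq> vcoset Y (product_kernel l) (J f)"
  proof
    fix C assume "C \<in> Fib (plim f)"
    then obtain g where g: "g \<in> CS" "plim g = plim f" "C = J g" by (auto simp: Fib_def)
    have "C = vadd Y (J f) (J (\<lambda>k. g k - f k))"
      using g assms by (simp add: Y_vadd CS_diff)
    moreover have "J (\<lambda>k. g k - f k) \<in> product_kernel l"
      using g assms by (auto simp: kernel_eq plim_diff CS_diff)
    ultimately show "C \<in> vcoset Y (product_kernel l) (J f)" by (auto simp: vcoset_def)
  qed
qed

lemma Z_sel: "points Z = (\<lambda>f. Fib (plim f)) ` CS"
  "vadd Z = (\<lambda>C D. {vadd Y c d |c d. c \<in> C \<and> d \<in> D})"
  "vscale Z = (\<lambda>z C. \<Union>c\<in>C. vcoset Y (product_kernel l) (vscale Y z c))"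
  "mnorm Z = (\<lambda>x. Inf {mnorm Y y |y. y \<in> carrier_mat (dim_row x) (dim_col x) \<and>
      (\<forall>i<dim_row x. \<forall>j<dim_col x. y $$ (i, j) \<in> x $$ (i, j))})"
proof -
  have "points Z = vcoset Y (product_kernel l) ` points Y"
    by (simp add: Z_eq quotient_opspace_def cvspace.defs opspace.defs vquotient_def)
  also have "\<dots> = (\<lambda>f. vcoset Y (product_kernel l) (J f)) ` CS" by (simp add: Y_points image_image)
  also have "\<dots> = (\<lambda>f. Fib (plim f)) ` CS" by (rule image_cong[OF refl vcoset_kernel])
  finally show "points Z = (\<lambda>f. Fib (plim f)) ` CS" .
qed (simp_all add: Z_eq quotient_opspace_def cvspace.defs opspace.defs vquotient_def)

lemma Fib_nonempty: "f \<in> CS \<Longrightarrow> J f \<in> Fib (plim f)"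
  by (auto simp: Fib_def)

lemma induced_Fib:
  assumes "f \<in> CS"
  shows "induced_product_map (Fib (plim f)) = plim f"
proof -
  have "product_map ` Fib (plim f) = {plim f}"
    using assms by (force simp: Fib_def product_map_J)
  then show ?thesis by (simp add: induced_product_map_def)
qed

lemma Z_vadd:
  assumes f: "f \<in> CS" and g: "g \<in> CS"
  shows "vadd Z (Fib (plim f)) (Fib (plim g)) = Fib (plim f + plim g)"
proof
  show "vadd Z (Fib (plim f)) (Fib (plim g)) \<subseteq> Fib (plim f + plim g)"
  proof
    fix C assume "C \<in> vadd Z (Fib (plim f)) (Fib (plim g))"
    then obtain u v where "u \<in> CS" "plim u = plim f" "v \<in> CS" "plim v = plim g" "C = vadd Y (J u) (J v)"
      by (auto simp: Z_sel Fib_def)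
    then show "C \<in> Fib (plim f + plim g)"
      unfolding Fib_def by (auto simp: Y_vadd plim_add CS_add intro!: image_eqI[of _ J "\<lambda>k. u k + v k"])
  qed
  show "Fib (plim f + plim g) \<subseteq> vadd Z (Fib (plim f)) (Fib (plim g))"
  proof
    fix C assume "C \<in> Fib (plim f + plim g)"
    then obtain h where h: "h \<in> CS" "plim h = plim f + plim g" "C = J h" by (auto simp: Fib_def)
    have "C = vadd Y (J f) (J (\<lambda>k. h k - f k))"
      using h f by (simp add: Y_vadd CS_diff)
    moreover have "J (\<lambda>k. h k - f k) \<in> Fib (plim g)"
      using h f g unfolding Fib_def by (auto simp: plim_diff CS_diff)
    ultimately show "C \<in> vadd Z (Fib (plim f)) (Fib (plim g))"
      using Fib_nonempty[OF f] by (auto simp: Z_sel)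
  qed
qed

lemma Z_vscale:
  assumes f: "f \<in> CS"
  shows "vscale Z z (Fib (plim f)) = Fib (z *\<^sub>C plim f)"
proof -
  have "vcoset Y (product_kernel l) (vscale Y z c) = Fib (z *\<^sub>C plim f)" if c: "c \<in> Fib (plim f)" for c
  proof -
    obtain g where g: "g \<in> CS" "plim g = plim f" "c = J g" using c by (auto simp: Fib_def)
    then show ?thesis using vcoset_kernel[OF CS_fscale[OF g(1), of z]]
      by (simp add: Y_vscale plim_fscale)
  qed
  then show ?thesis using Fib_nonempty[OF f] by (auto simp: Z_sel)
qed

end

section \<open>Length in terms of approximate factorizations\<close>

lemma cstar_opspace_sel [simp]:
  "points cstar_opspace = UNIV" "vadd cstar_opspace = (+)" "vscale cstar_opspace = scaleC"
  "mnorm cstar_opspace = cstar_mnorm"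
  by (simp_all add: cstar_opspace_def)

context haagerup_length
begin

lemma Y_mnorm_nonneg:
  assumes n: "0 < n" and F: "\<And>i j. i < n \<Longrightarrow> j < n \<Longrightarrow> F i j \<in> CS"
  shows "0 \<le> mnorm Y (mat n n (\<lambda>(i, j). J (F i j)))"
proof (rule LIMSEQ_le_const[OF Y_mnorm[of n F]])
  show "\<exists>N. \<forall>k\<ge>N. 0 \<le> hn n (\<lambda>i j. F i j k)"
    using CS_homog[OF F] by (intro exI[of _ 0] allI impI hnorm_nonneg[OF Nl n]) auto
qed (use n F in auto)

lemma product_mat_limit:
  assumes n: "0 < n" and F: "\<And>i j. i < n \<Longrightarrow> j < n \<Longrightarrow> F i j \<in> CS"
  shows "(\<lambda>k. cstar_mnorm (product_mat n (\<lambda>i j. F i j k) - mat n n (\<lambda>(i, j). plim (F i j)))) \<longlonglongrightarrow> 0"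
  by (rule cstar_mnorm_entries_tendsto[of _ n n]) (auto simp: plim_tendsto[OF F])

lemma Y_approx:
  assumes n: "0 < n" and F: "\<And>i j. i < n \<Longrightarrow> j < n \<Longrightarrow> F i j \<in> CS"
    and c: "mnorm Y (mat n n (\<lambda>(i, j). J (F i j))) < c" and e: "0 < e"
  obtains k where "hn n (\<lambda>i j. F i j k) < c"
    "cstar_mnorm (product_mat n (\<lambda>i j. F i j k) - mat n n (\<lambda>(i, j). plim (F i j))) < e"
proof -
  have "\<forall>\<^sub>F k in sequentially. hn n (\<lambda>i j. F i j k) < c"
    by (rule order_tendstoD(2)[OF Y_mnorm c]) (use n F in auto)
  moreover have "\<forall>\<^sub>F k in sequentially. cstar_mnorm (product_mat n (\<lambda>i j. F i j k) - mat n n (\<lambda>(i, j). plim (F i j))) < e"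
    by (rule order_tendstoD(2)[OF product_mat_limit e]) (use n F in auto)
  ultimately have "\<forall>\<^sub>F k in sequentially. hn n (\<lambda>i j. F i j k) < c \<and>
      cstar_mnorm (product_mat n (\<lambda>i j. F i j k) - mat n n (\<lambda>(i, j). plim (F i j))) < e"
    by (rule eventually_conj)
  then obtain k where "hn n (\<lambda>i j. F i j k) < c \<and>
      cstar_mnorm (product_mat n (\<lambda>i j. F i j k) - mat n n (\<lambda>(i, j). plim (F i j))) < e"
    using eventually_happens by fastforce
  then show thesis using that by blast
qed

lemma Z_mnorm_eq:
  assumes "x \<in> carrier_mat n n"
  shows "mnorm Z x = Inf {mnorm Y y |y. y \<in> carrier_mat n n \<and> (\<forall>i<n. \<forall>j<n. y $$ (i, j) \<in> x $$ (i, j))}"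
  using assms by (simp add: Z_sel)

lemma Z_lift:
  assumes x: "\<And>i j. i < n \<Longrightarrow> j < n \<Longrightarrow> x $$ (i, j) \<in> points Z"
    and y: "y \<in> carrier_mat n n" "\<forall>i<n. \<forall>j<n. y $$ (i, j) \<in> x $$ (i, j)"
  obtains F where "\<And>i j. i < n \<Longrightarrow> j < n \<Longrightarrow> F i j \<in> CS \<and> plim (F i j) = induced_product_map (x $$ (i, j))"
    "y = mat n n (\<lambda>(i, j). J (F i j))"
proof -
  have "\<exists>f. f \<in> CS \<and> plim f = induced_product_map (x $$ (i, j)) \<and> y $$ (i, j) = J f" if ij: "i < n" "j < n" for i j
  proof -
    obtain f where f: "f \<in> CS" "x $$ (i, j) = Fib (plim f)" using x[OF ij] by (auto simp: Z_sel)
    have "y $$ (i, j) \<in> Fib (plim f)" using y(2) ij f(2) by metis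
    then obtain g where "g \<in> CS" "plim g = plim f" "y $$ (i, j) = J g"
      by (auto simp: Fib_def)
    then show ?thesis using induced_Fib f by metis
  qed
  then obtain F where F: "\<And>i j. i < n \<Longrightarrow> j < n \<Longrightarrow> F i j \<in> CS \<and> plim (F i j) = induced_product_map (x $$ (i, j)) \<and> y $$ (i, j) = J (F i j)"
    by metis
  have "y = mat n n (\<lambda>(i, j). J (F i j))" by (rule eq_matI) (use y F in auto)
  then show thesis using that[of F] F by blast
qed

lemma Z_mnorm_less:
  assumes n: "0 < n" and x: "x \<in> carrier_mat n n" "\<And>i j. i < n \<Longrightarrow> j < n \<Longrightarrow> x $$ (i, j) \<in> points Z"
    and c: "mnorm Z x < c"
  obtains F where "\<And>i j. i < n \<Longrightarrow> j < n \<Longrightarrow> F i j \<in> CS \<and> plim (F i j) = induced_product_map (x $$ (i, j))"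
    "mnorm Y (mat n n (\<lambda>(i, j). J (F i j))) < c"
proof -
  let ?S = "{mnorm Y y |y. y \<in> carrier_mat n n \<and> (\<forall>i<n. \<forall>j<n. y $$ (i, j) \<in> x $$ (i, j))}"
  have "\<exists>C. C \<in> x $$ (i, j)" if "i < n" "j < n" for i j
    using x(2)[OF that] Fib_nonempty by (auto simp: Z_sel)
  then obtain y where y: "\<And>i j. i < n \<Longrightarrow> j < n \<Longrightarrow> y i j \<in> x $$ (i, j)" by metis
  have "mnorm Y (mat n n (\<lambda>(i, j). y i j)) \<in> ?S" using y by auto
  then have "?S \<noteq> {}" by blast
  from cInf_lessD[OF this] c obtain y where y: "y \<in> carrier_mat n n" "\<forall>i<n. \<forall>j<n. y $$ (i, j) \<in> x $$ (i, j)" "mnorm Y y < c"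
    unfolding Z_mnorm_eq[OF x(1)] by blast
  obtain F where F: "\<And>i j. i < n \<Longrightarrow> j < n \<Longrightarrow> F i j \<in> CS \<and> plim (F i j) = induced_product_map (x $$ (i, j))"
    "y = mat n n (\<lambda>(i, j). J (F i j))"
    using Z_lift[OF x(2) y(1,2)] by blast
  show thesis by (rule that[of F]) (use F y in auto)
qed

lemma Z_mnorm_le:
  assumes n: "0 < n" and F: "\<And>i j. i < n \<Longrightarrow> j < n \<Longrightarrow> F i j \<in> CS"
    and x: "x \<in> carrier_mat n n" "\<And>i j. i < n \<Longrightarrow> j < n \<Longrightarrow> x $$ (i, j) = Fib (plim (F i j))"
  shows "mnorm Z x \<le> mnorm Y (mat n n (\<lambda>(i, j). J (F i j)))"
  unfolding Z_mnorm_eq[OF x(1)]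
proof (rule cInf_lower)
  show "mnorm Y (mat n n (\<lambda>(i, j). J (F i j))) \<in>
    {mnorm Y y |y. y \<in> carrier_mat n n \<and> (\<forall>i<n. \<forall>j<n. y $$ (i, j) \<in> x $$ (i, j))}"
    using x(2) Fib_nonempty F by auto
  have xZ: "x $$ (i, j) \<in> points Z" if "i < n" "j < n" for i j using x(2) F that by (auto simp: Z_sel)
  show "bdd_below {mnorm Y y |y. y \<in> carrier_mat n n \<and> (\<forall>i<n. \<forall>j<n. y $$ (i, j) \<in> x $$ (i, j))}"
  proof (rule bdd_belowI[of _ 0])
    fix r assume "r \<in> {mnorm Y y |y. y \<in> carrier_mat n n \<and> (\<forall>i<n. \<forall>j<n. y $$ (i, j) \<in> x $$ (i, j))}"
    then obtain y where y: "r = mnorm Y y" "y \<in> carrier_mat n n" "\<forall>i<n. \<forall>j<n. y $$ (i, j) \<in> x $$ (i, j)" by blast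
    obtain G where G: "\<And>i j. i < n \<Longrightarrow> j < n \<Longrightarrow> G i j \<in> CS \<and> plim (G i j) = induced_product_map (x $$ (i, j))"
      "y = mat n n (\<lambda>(i, j). J (G i j))"
      using Z_lift[OF xZ y(2,3)] by blast
    then show "0 \<le> r" using Y_mnorm_nonneg[OF n, of G] y(1) by simp
  qed
qed

lemma square_mats_Z:
  assumes "x \<in> square_mats Z"
  obtains n where "0 < n" "x \<in> carrier_mat n n" "\<And>i j. i < n \<Longrightarrow> j < n \<Longrightarrow> x $$ (i, j) \<in> points Z"
proof -
  obtain n where n: "0 < n" "x \<in> carrier_mat n n" "elements_mat x \<subseteq> points Z"
    using assms unfolding square_mats_def by blast
  have "x $$ (i, j) \<in> points Z" if "i < n" "j < n" for i j
    using elements_matI[OF n(2) that refl] n(3) by blast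
  then show thesis using that n by blast
qed

lemma induced_completely_bounded: "completely_bounded Z cstar_opspace induced_product_map"
  unfolding completely_bounded_def
proof
  show "linear_map Z cstar_opspace induced_product_map"
    unfolding linear_map_def
  proof (intro conjI allI ballI)
    fix x y and c :: complex assume "x \<in> points Z" "y \<in> points Z"
    then obtain f g where f: "f \<in> CS" "x = Fib (plim f)" and g: "g \<in> CS" "y = Fib (plim g)" by (auto simp: Z_sel)
    show "induced_product_map (vadd Z x y) = vadd cstar_opspace (induced_product_map x) (induced_product_map y)"
      using induced_Fib[OF CS_add[OF f(1) g(1)]] f g by (simp add: Z_vadd plim_add induced_Fib)
    show "induced_product_map (vscale Z c x) = vscale cstar_opspace c (induced_product_map x)"
      using induced_Fib[OF CS_fscale[OF f(1), of c]] f by (simp add: Z_vscale plim_fscale induced_Fib)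
  qed (auto simp: linear_map_def Z_sel Z_vscale)
  have "cb_norm Z cstar_opspace induced_product_map \<le> ereal 1"
    unfolding cb_norm_def
  proof (rule SUP_least)
    fix x assume "x \<in> {x \<in> square_mats Z. mnorm Z x \<le> 1}"
    then have x: "x \<in> square_mats Z" "mnorm Z x \<le> 1" by auto
    obtain n where n: "0 < n" "x \<in> carrier_mat n n" "\<And>i j. i < n \<Longrightarrow> j < n \<Longrightarrow> x $$ (i, j) \<in> points Z"
      using square_mats_Z[OF x(1)] by metis
    let ?b = "map_mat induced_product_map x"
    have "cstar_mnorm ?b \<le> 1 + e" if e: "0 < e" for e :: real
    proof -
      have "mnorm Z x < 1 + e / 2" using x(2) e by simp
      then obtain F where F: "\<And>i j. i < n \<Longrightarrow> j < n \<Longrightarrow> F i j \<in> CS \<and> plim (F i j) = induced_product_map (x $$ (i, j))"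
        "mnorm Y (mat n n (\<lambda>(i, j). J (F i j))) < 1 + e / 2"
        using Z_mnorm_less[OF n] by metis
      have FC: "F i j \<in> CS" if "i < n" "j < n" for i j using F that by blast
      have e2: "0 < e / 2" using e by simp
      obtain k where k: "hn n (\<lambda>i j. F i j k) < 1 + e / 2"
        "cstar_mnorm (product_mat n (\<lambda>i j. F i j k) - mat n n (\<lambda>(i, j). plim (F i j))) < e / 2"
        using Y_approx[OF n(1) FC F(2) e2] by metis
      have b: "?b = mat n n (\<lambda>(i, j). plim (F i j))" by (rule eq_matI) (use n F in auto)
      have "cstar_mnorm ?b \<le> cstar_mnorm (product_mat n (\<lambda>i j. F i j k)) + cstar_mnorm (?b - product_mat n (\<lambda>i j. F i j k))"
        by (rule cstar_mnorm_le_minus[of _ n n]) (use n in auto)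
      also have "cstar_mnorm (?b - product_mat n (\<lambda>i j. F i j k)) < e / 2"
        using k(2) cstar_mnorm_minus_commute[of ?b n n "product_mat n (\<lambda>i j. F i j k)"] n(2) by (simp add: b)
      also have "cstar_mnorm (product_mat n (\<lambda>i j. F i j k)) \<le> hn n (\<lambda>i j. F i j k)"
        using CS_homog[OF FC] by (intro product_mat_contraction[OF l n(1)]) auto
      finally show ?thesis using k(1) by simp
    qed
    then have "cstar_mnorm ?b \<le> 1" by (rule field_le_epsilon)
    then show "ereal (mnorm cstar_opspace ?b) \<le> ereal 1" by simp
  qed
  then show "cb_norm Z cstar_opspace induced_product_map < \<infinity>" by (auto simp: less_top[symmetric] top_ereal_def)
qed

lemma induced_inj: "inj_on induced_product_map (points Z)"
  by (auto simp: inj_on_def Z_sel induced_Fib)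

text \<open>A bound on the inverse of the induced map yields a lift of \<open>b\<close> to the completion; far out in a Cauchy
sequence that represents it the norm is still below \<open>K + e\<close> and the product is close to \<open>b\<close>.\<close>

lemma approximate_factorization:
  assumes len: "length_and_constant_at_most A l K" and n: "0 < n"
    and b: "b \<in> carrier_mat n n" "cstar_mnorm b \<le> 1" and e: "0 < e"
  obtains F where "homog_mat l n F" "hn n F < K + e" "cstar_mnorm (product_mat n F - b) < e"
proof -
  let ?R = "inv_into (points Z) induced_product_map"
  have bij: "bij_betw induced_product_map (points Z) UNIV"
    and cb: "cb_norm (cstar_opspace :: 'a opspace) Z ?R \<le> ereal K"
    using len by (auto simp: length_and_constant_at_most_def length_at_most_def cb_isomorphism_def Z_def)
  let ?x = "map_mat ?R b"
  have x: "?x \<in> carrier_mat n n" using b by simp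
  have R: "?R a \<in> points Z" "induced_product_map (?R a) = a" for a
    using bij by (auto simp: bij_betw_def inv_into_into f_inv_into_f)
  have xZ: "?x $$ (i, j) \<in> points Z" if "i < n" "j < n" for i j using that b R(1) by simp
  have "ereal (mnorm Z ?x) \<le> cb_norm cstar_opspace Z ?R"
    unfolding cb_norm_def by (rule SUP_upper) (use b n in \<open>auto simp: square_mats_def\<close>)
  from order_trans[OF this cb] have "mnorm Z ?x < K + e" using e by simp
  then obtain F where F: "\<And>i j. i < n \<Longrightarrow> j < n \<Longrightarrow> F i j \<in> CS \<and> plim (F i j) = induced_product_map (?x $$ (i, j))"
    "mnorm Y (mat n n (\<lambda>(i, j). J (F i j))) < K + e"
    using Z_mnorm_less[OF n x xZ] by metis
  have FC: "F i j \<in> CS" if "i < n" "j < n" for i j using F that by blast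
  obtain k where k: "hn n (\<lambda>i j. F i j k) < K + e"
    "cstar_mnorm (product_mat n (\<lambda>i j. F i j k) - mat n n (\<lambda>(i, j). plim (F i j))) < e"
    using Y_approx[OF n FC F(2) e] by metis
  have "mat n n (\<lambda>(i, j). plim (F i j)) = b" by (rule eq_matI) (use F R b in auto)
  then show thesis using that[of "\<lambda>i j. F i j k"] k CS_homog[OF FC] by auto
qed

text \<open>The remainder \<open>b - product_mat n F\<close> is factorized in turn, at half the scale.  The partial sums of the
successive approximations form a Cauchy sequence, whose class is an exact lift of \<open>b\<close>; the geometric
series doubles the bound.\<close>

lemma lift_of_approximate_factorization:
  assumes K: "0 \<le> K"
    and fact: "\<forall>n>0. \<forall>b\<in>carrier_mat n n. cstar_mnorm (b :: 'a mat) \<le> 1 \<longrightarrow>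
      (\<exists>F. homog_mat l n F \<and> hn n F \<le> K \<and> cstar_mnorm (b - product_mat n F) \<le> 1 / 2)"
    and n: "0 < n" and b: "b \<in> carrier_mat n n" "cstar_mnorm b \<le> 1"
  shows "\<exists>F. (\<forall>i<n. \<forall>j<n. F i j \<in> CS \<and> plim (F i j) = b $$ (i, j)) \<and>
    mnorm Y (mat n n (\<lambda>(i, j). J (F i j))) \<le> 2 * K"
proof -
  have scaled: "\<exists>F. homog_mat l n F \<and> hn n F \<le> K * r \<and> cstar_mnorm (b - product_mat n F) \<le> r / 2"
    if r: "0 < r" and b: "b \<in> carrier_mat n n" "cstar_mnorm b \<le> r" for r :: real and b :: "'a mat"
  proof -
    let ?b = "map_mat (scaleC (complex_of_real (1 / r))) b"
    have sb: "?b \<in> carrier_mat n n" "cstar_mnorm ?b \<le> 1"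
      using b r by (auto simp: cstar_mnorm_scaleC[OF b(1)] norm_divide)
    obtain F where F: "homog_mat l n F" "hn n F \<le> K" "cstar_mnorm (?b - product_mat n F) \<le> 1 / 2"
      using fact n sb by blast
    let ?G = "\<lambda>i j. fscale (complex_of_real r) (F i j)"
    have "hn n ?G \<le> cmod (complex_of_real r) * hn n F" by (rule hnorm_fscale[OF Nl n F(1)])
    also have "\<dots> \<le> r * K" using F(2) r by (simp add: mult_left_mono)
    finally have hG: "hn n ?G \<le> K * r" by (simp add: mult.commute)
    have "b - product_mat n ?G = map_mat (scaleC (complex_of_real r)) (?b - product_mat n F)"
      by (rule eq_matI) (use b r in \<open>auto simp: free_product_map_fscale scaleC_diff_right scaleC_scaleC\<close>)
    then have "cstar_mnorm (b - product_mat n ?G) \<le> r / 2"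
      using F(3) r cstar_mnorm_scaleC[of "?b - product_mat n F" n n "complex_of_real r"]
        minus_carrier_mat[of "product_mat n F" n n ?b] by simp
    with hG F(1) show ?thesis by (intro exI[of _ ?G]) (simp add: homog_fscale)
  qed
  have "\<forall>m b'. \<exists>F. b' \<in> carrier_mat n n \<and> cstar_mnorm b' \<le> (1 / 2) ^ m \<longrightarrow>
    homog_mat l n F \<and> hn n F \<le> K * (1 / 2) ^ m \<and> cstar_mnorm (b' - product_mat n F) \<le> (1 / 2) ^ Suc m"
  proof (intro allI)
    fix m b'
    have r: "(0::real) < (1 / 2) ^ m" by simp
    have half: "(1 / 2 :: real) ^ m / 2 = (1 / 2) ^ Suc m" by simp
    show "\<exists>F. b' \<in> carrier_mat n n \<and> cstar_mnorm b' \<le> (1 / 2) ^ m \<longrightarrow>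
      homog_mat l n F \<and> hn n F \<le> K * (1 / 2) ^ m \<and> cstar_mnorm (b' - product_mat n F) \<le> (1 / 2) ^ Suc m"
      using scaled[OF r, of b', unfolded half] by blast
  qed
  then obtain \<Phi> where Phi: "\<And>m b'. b' \<in> carrier_mat n n \<Longrightarrow> cstar_mnorm b' \<le> (1 / 2) ^ m \<Longrightarrow>
    homog_mat l n (\<Phi> m b') \<and> hn n (\<Phi> m b') \<le> K * (1 / 2) ^ m \<and> cstar_mnorm (b' - product_mat n (\<Phi> m b')) \<le> (1 / 2) ^ Suc m"
    by metis
  define bs where "bs = rec_nat b (\<lambda>m b'. b' - product_mat n (\<Phi> m b'))"
  have bs: "bs 0 = b" "bs (Suc m) = bs m - product_mat n (\<Phi> m (bs m))" for m by (simp_all add: bs_def)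
  have inv: "bs m \<in> carrier_mat n n \<and> cstar_mnorm (bs m) \<le> (1 / 2) ^ m" for m
  proof (induction m)
    case 0
    then show ?case using b by (simp add: bs)
  next
    case (Suc m)
    have "bs (Suc m) \<in> carrier_mat n n" unfolding bs by (rule minus_carrier_mat) simp
    moreover have "cstar_mnorm (bs (Suc m)) \<le> (1 / 2) ^ Suc m" unfolding bs using Phi[of "bs m" m] Suc by blast
    ultimately show ?case by blast
  qed
  define G where "G m = \<Phi> m (bs m)" for m
  have G: "homog_mat l n (G m)" "hn n (G m) \<le> K * (1 / 2) ^ m" for m
    using Phi[of "bs m" m] inv[of m] by (auto simp: G_def)
  define s where "s k i j = (\<Sum>m<k. G m i j)" for k i j
  have sh: "homog_mat l n (s k)" for k using G(1) by (auto simp: s_def intro: homog_sum)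
  have sS: "s (Suc k) = (\<lambda>i j. s k i j + G k i j)" for k by (simp add: s_def fun_eq_iff)
  have prod: "free_product_map (s k i j) = b $$ (i, j) - bs k $$ (i, j)" if ij: "i < n" "j < n" for k i j
  proof (induction k)
    case (Suc k)
    then show ?case using ij inv[of k] by (simp add: sS free_product_map_add bs G_def)
  qed (simp add: s_def bs)
  have hs: "hn n (s k) \<le> 2 * K * (1 - (1 / 2) ^ k)" for k
  proof (induction k)
    case 0
    have "hn n (\<lambda>i j. fscale 0 0) \<le> cmod 0 * hn n (\<lambda>i j. 0)" by (rule hnorm_fscale[OF Nl n]) simp
    then show ?case by (simp add: s_def)
  next
    case (Suc k)
    have "hn n (s (Suc k)) \<le> hn n (s k) + hn n (G k)"
      unfolding sS by (rule hnorm_triangle[OF Nl n sh G(1)])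
    also have "\<dots> \<le> 2 * K * (1 - (1 / 2) ^ k) + K * (1 / 2) ^ k" using Suc G(2)[of k] by simp
    finally show ?case by (simp add: algebra_simps)
  qed
  have tail: "nu (s k i j - s m i j) \<le> 2 * K * ((1 / 2) ^ m - (1 / 2) ^ k)" if mk: "m \<le> k" and ij: "i < n" "j < n" for m k i j
    using mk
  proof (induction k rule: dec_induct)
    case base
    then show ?case using nu_facts(7)[OF homog_zero homog_zero homog_zero] by simp
  next
    case (step k)
    have h: "homog l (s k i j)" "homog l (s m i j)" "homog l (G k i j)" using sh G(1) ij by blast+
    have "nu (s (Suc k) i j - s m i j) = nu ((s k i j - s m i j) + G k i j)" by (simp add: sS algebra_simps)
    also have "\<dots> \<le> nu (s k i j - s m i j) + nu (G k i j)"
      by (rule nu_facts(4)[OF homog_diff[OF h(1,2)] h(3) homog_zero])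
    also have "nu (G k i j) \<le> K * (1 / 2) ^ k"
      using hnorm_entry[OF Nl n G(1) ij, of k] G(2)[of k] by (simp add: nu_def)
    finally show ?case using step.IH by (simp add: algebra_simps)
  qed
  have half: "(\<lambda>k. c * (1 / 2) ^ k) \<longlonglongrightarrow> 0" for c :: real
    by (intro tendsto_mult_right_zero LIMSEQ_realpow_zero) auto
  have CS: "(\<lambda>k. s k i j) \<in> CS" if ij: "i < n" "j < n" for i j
    unfolding CS_def mem_Collect_eq
  proof (intro conjI allI impI)
    show "homog l (s k i j)" for k using sh ij by blast
    fix e :: real assume "0 < e"
    then obtain K0 where K0: "2 * K * (1 / 2) ^ K0 < e"
      using order_tendstoD(2)[OF half, of e "2 * K"] by (auto simp: eventually_sequentially)
    have le: "nu (s k i j - s m i j) < e" if "K0 \<le> m" "m \<le> k" for m k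
    proof -
      have "nu (s k i j - s m i j) \<le> 2 * K * ((1 / 2) ^ m - (1 / 2) ^ k)" by (rule tail[OF that(2) ij])
      also have "\<dots> \<le> 2 * K * (1 / 2) ^ m" using K by (intro mult_left_mono) auto
      also have "\<dots> \<le> 2 * K * (1 / 2) ^ K0" using K that(1) by (intro mult_left_mono power_decreasing) auto
      finally show ?thesis using K0 by simp
    qed
    have "nu (s k i j - s m i j) < e" if "m \<ge> K0" "k \<ge> K0" for m k
    proof (cases "m \<le> k")
      case True
      then show ?thesis using le that by blast
    next
      case False
      have "homog l (s k i j)" "homog l (s m i j)" using sh ij by blast+
      then have "nu (s k i j - s m i j) = nu (s m i j - s k i j)" using nu_facts(2) homog_zero by blast
      then show ?thesis using le[of k m] that False by simp
    qed
    then show "\<exists>K0. \<forall>m\<ge>K0. \<forall>k\<ge>K0. nu (s m i j - s k i j) < e" by blast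
  qed
  have lim: "plim (\<lambda>k. s k i j) = b $$ (i, j)" if ij: "i < n" "j < n" for i j
  proof (rule plim_eqI)
    have "(\<lambda>k. norm (bs k $$ (i, j))) \<longlonglongrightarrow> 0"
    proof (rule tendsto_sandwich[of "\<lambda>_. 0"])
      show "\<forall>\<^sub>F k in sequentially. norm (bs k $$ (i, j)) \<le> 1 * (1 / 2) ^ k"
      proof (intro always_eventually allI)
        show "norm (bs k $$ (i, j)) \<le> 1 * (1 / 2) ^ k" for k
          using norm_entry_le_cstar_mnorm[of "bs k" n n i j] inv[of k] ij by simp
      qed
    qed (use half[of 1] in auto)
    then have "(\<lambda>k. bs k $$ (i, j)) \<longlonglongrightarrow> 0" by (rule tendsto_norm_zero_cancel)
    then have "(\<lambda>k. b $$ (i, j) - bs k $$ (i, j)) \<longlonglongrightarrow> b $$ (i, j) - 0" by (intro tendsto_intros)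
    then show "(\<lambda>k. free_product_map (s k i j)) \<longlonglongrightarrow> b $$ (i, j)" by (simp add: prod[OF ij])
  qed
  have "mnorm Y (mat n n (\<lambda>(i, j). J (\<lambda>k. s k i j))) \<le> 2 * K"
  proof (rule LIMSEQ_le_const2[OF Y_mnorm[OF n CS]])
    have "hn n (s k) \<le> 2 * K" for k
    proof -
      have "2 * K * (1 - (1 / 2) ^ k) \<le> 2 * K * 1" using K by (intro mult_left_mono) auto
      then show ?thesis using hs[of k] by simp
    qed
    then show "\<exists>N. \<forall>k\<ge>N. hn n (\<lambda>i j. s k i j) \<le> 2 * K" by blast
  qed
  then show ?thesis using CS lim by (intro exI[of _ "\<lambda>i j k. s k i j"]) blast
qed

text \<open>Exact lifts of bounded norm make the induced map surjective and its inverse completely bounded; it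
is always injective and completely contractive.\<close>

lemma length_at_most_of_approximate_factorization:
  assumes K: "0 \<le> K"
    and fact: "\<forall>n>0. \<forall>b\<in>carrier_mat n n. cstar_mnorm (b :: 'a mat) \<le> 1 \<longrightarrow>
      (\<exists>F. homog_mat l n F \<and> hn n F \<le> K \<and> cstar_mnorm (b - product_mat n F) \<le> 1 / 2)"
  shows "length_at_most A l"
proof -
  note lift = lift_of_approximate_factorization[OF K fact]
  have surj: "\<exists>f\<in>CS. plim f = b" for b :: 'a
  proof -
    define r where "r = norm b + 1"
    have r: "0 < r" by (simp add: r_def add_nonneg_pos)
    let ?b = "complex_of_real (1 / r) *\<^sub>C b"
    have "norm ?b \<le> 1" using r by (simp add: norm_scaleC norm_divide r_def)
    then have nb: "cstar_mnorm (mat 1 1 (\<lambda>_. ?b)) \<le> 1" using cstar_mnorm_1_1[of ?b] by simp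
    obtain F where "\<forall>i<1. \<forall>j<1. F i j \<in> CS \<and> plim (F i j) = mat 1 1 (\<lambda>_. ?b) $$ (i, j)"
      using lift[OF zero_less_one_nat mat_carrier nb] by blast
    then have F: "F 0 0 \<in> CS" "plim (F 0 0) = ?b" by auto
    have "plim (\<lambda>k. fscale (complex_of_real r) (F 0 0 k)) = b"
      using r by (simp add: plim_fscale F scaleC_scaleC)
    then show ?thesis using CS_fscale[OF F(1)] by blast
  qed
  have img: "induced_product_map ` points Z = UNIV"
  proof (intro equalityI subsetI UNIV_I)
    fix b :: 'a
    obtain f where "f \<in> CS" "plim f = b" using surj by metis
    then have "b = induced_product_map (Fib (plim f))" "Fib (plim f) \<in> points Z"
      by (auto simp: induced_Fib Z_sel)
    then show "b \<in> induced_product_map ` points Z" by (rule image_eqI)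
  qed
  have bij: "bij_betw induced_product_map (points Z) (UNIV :: 'a set)"
    using img induced_inj by (simp add: bij_betw_def)
  let ?R = "inv_into (points Z) induced_product_map"
  have FibZ: "Fib b \<in> points Z" "induced_product_map (Fib b) = b" for b
    using surj[of b] induced_Fib by (auto simp: Z_sel)
  have R: "?R b = Fib b" for b
    by (rule inv_into_f_eq[OF induced_inj FibZ])
  have "completely_bounded cstar_opspace Z ?R"
    unfolding completely_bounded_def
  proof
    show "linear_map cstar_opspace Z ?R"
      unfolding linear_map_def R
    proof (intro conjI allI ballI)
      fix a b :: 'a and c :: complex
      obtain f g where fg: "f \<in> CS" "plim f = a" "g \<in> CS" "plim g = b" using surj by metis
      show "Fib (vadd cstar_opspace a b) = vadd Z (Fib a) (Fib b)" using Z_vadd[OF fg(1,3)] fg by simp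
      show "Fib (vscale cstar_opspace c a) = vscale Z c (Fib a)" using Z_vscale[OF fg(1)] fg by simp
    qed (rule FibZ)
    have "cb_norm (cstar_opspace :: 'a opspace) Z ?R \<le> ereal (2 * K)"
      unfolding cb_norm_def
    proof (rule SUP_least)
      fix b :: "'a mat" assume "b \<in> {x \<in> square_mats cstar_opspace. mnorm cstar_opspace x \<le> 1}"
      then obtain n where n: "0 < n" "b \<in> carrier_mat n n" "cstar_mnorm b \<le> 1" by (auto simp: square_mats_def)
      obtain F where F: "\<forall>i<n. \<forall>j<n. F i j \<in> CS \<and> plim (F i j) = b $$ (i, j)"
        "mnorm Y (mat n n (\<lambda>(i, j). J (F i j))) \<le> 2 * K"
        using lift[OF n] by blast
      have "mnorm Z (map_mat ?R b) \<le> mnorm Y (mat n n (\<lambda>(i, j). J (F i j)))"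
        by (rule Z_mnorm_le[OF n(1)]) (use F n in \<open>auto simp: R\<close>)
      then show "ereal (mnorm Z (map_mat ?R b)) \<le> ereal (2 * K)" using F(2) by simp
    qed
    then show "cb_norm (cstar_opspace :: 'a opspace) Z ?R < \<infinity>" by (auto simp: less_top[symmetric] top_ereal_def)
  qed
  then show ?thesis
    unfolding length_at_most_def cb_isomorphism_def Z_def[symmetric]
    using bij induced_completely_bounded by simp
qed

end

section \<open>Transfer of length\<close>

text \<open>Split off one factor at a time.  All partial products and their images are contractions, so the
errors just add up.\<close>

lemma almost_multiplicative_prod:
  fixes S :: "'a::unital_cstar_algebra \<Rightarrow> 'b::unital_cstar_algebra" and d :: real
  assumes S: "cb_le S 1" and M: "0 < M" and d: "0 \<le> d"
    and mult: "\<And>x y. x \<in> carrier_mat M M \<Longrightarrow> y \<in> carrier_mat M M \<Longrightarrow> cstar_mnorm x \<le> 1 \<Longrightarrow> cstar_mnorm y \<le> 1 \<Longrightarrow>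
      cstar_mnorm (map_mat S (x * y) - map_mat S x * map_mat S y) \<le> d"
    and xs: "xs \<noteq> []" "\<And>x. x \<in> set xs \<Longrightarrow> x \<in> carrier_mat M M \<and> cstar_mnorm x \<le> 1"
  shows "cstar_mnorm (map_mat S (mat_prod M xs) - mat_prod M (map (map_mat S) xs)) \<le> length xs * d"
  using xs
proof (induction xs rule: list_nonempty_induct)
  case (single x)
  then have x: "x \<in> carrier_mat M M" by simp
  then have "map_mat S (mat_prod M [x]) - mat_prod M (map (map_mat S) [x]) = 0\<^sub>m M M"
    by (intro eq_matI) auto
  then show ?case using d by simp
next
  case (cons x xs)
  let ?P = "mat_prod M xs" and ?Q = "mat_prod M (map (map_mat S) xs)"
  have x: "x \<in> carrier_mat M M" "cstar_mnorm x \<le> 1" using cons.prems by auto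
  have P: "?P \<in> carrier_mat M M" using cons.prems by (intro mat_prod_carrier) auto
  have nP: "cstar_mnorm ?P \<le> 1" using cons.prems by (intro cstar_mnorm_mat_prod[OF M]) auto
  have Q: "?Q \<in> carrier_mat M M" using cons.prems by (intro mat_prod_carrier) auto
  have Sx: "map_mat S x \<in> carrier_mat M M" "cstar_mnorm (map_mat S x) \<le> 1"
    using x cb_leD(3)[OF S M x(1)] by auto
  have SP: "map_mat S ?P \<in> carrier_mat M M" using P by simp
  have D: "map_mat S ?P - ?Q \<in> carrier_mat M M" by (rule minus_carrier_mat[OF Q])
  have "cstar_mnorm (map_mat S x * map_mat S ?P - map_mat S x * ?Q) = cstar_mnorm (map_mat S x * (map_mat S ?P - ?Q))"
    using mult_minus_distrib_mat[OF Sx(1) SP Q] by simp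
  also have "\<dots> \<le> cstar_mnorm (map_mat S x) * cstar_mnorm (map_mat S ?P - ?Q)"
    by (rule cstar_mnorm_mult[OF Sx(1) D])
  also have "\<dots> \<le> 1 * (length xs * d)"
    using Sx cstar_mnorm_nonneg[OF D] cons by (intro mult_mono) auto
  finally have 1: "cstar_mnorm (map_mat S x * map_mat S ?P - map_mat S x * ?Q) \<le> length xs * d" by simp
  have 2: "cstar_mnorm (map_mat S (x * ?P) - map_mat S x * map_mat S ?P) \<le> d"
    by (rule mult[OF x(1) P x(2) nP])
  have c: "map_mat S (x * ?P) \<in> carrier_mat M M" "map_mat S x * map_mat S ?P \<in> carrier_mat M M" "map_mat S x * ?Q \<in> carrier_mat M M"
    using mult_carrier_mat[OF x(1) P] mult_carrier_mat[OF Sx(1) SP] mult_carrier_mat[OF Sx(1) Q] by auto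
  have "cstar_mnorm (map_mat S (x * ?P) - map_mat S x * ?Q)
    \<le> cstar_mnorm (map_mat S (x * ?P) - map_mat S x * map_mat S ?P) + cstar_mnorm (map_mat S x * map_mat S ?P - map_mat S x * ?Q)"
    by (rule cstar_mnorm_triangle_minus[OF c])
  then show ?case using 1 2 by (simp add: algebra_simps)
qed

text \<open>Apply \<open>S\<close> to each factor.  The factors keep maximal norm at most \<open>1\<close> because \<open>S\<close> is contractive, and the
product changes only by the defect of multiplicativity.\<close>

lemma transport_factorization:
  fixes S :: "'a::unital_cstar_algebra \<Rightarrow> 'b::unital_cstar_algebra" and d :: real
  assumes S: "cb_le S 1" and l: "0 < l" and n: "0 < n" and d: "0 \<le> d"
    and mult: "\<And>M x y. 0 < M \<Longrightarrow> x \<in> carrier_mat M M \<Longrightarrow> y \<in> carrier_mat M M \<Longrightarrow> cstar_mnorm x \<le> 1 \<Longrightarrow> cstar_mnorm y \<le> 1 \<Longrightarrow>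
      cstar_mnorm (map_mat S (x * y) - map_mat S x * map_mat S y) \<le> d"
    and F: "haagerup_absorbs max_mnorm l n c F"
  obtains G where "homog_mat l n G" "haagerup_absorbs max_mnorm l n c G"
    "cstar_mnorm (map_mat S (product_mat n F) - product_mat n G) \<le> c * (l * d)"
proof -
  have c: "0 < c" using F by (simp add: haagerup_absorbs_def)
  obtain M xs where xs: "n \<le> M" "length xs = l"
    "\<And>x. x \<in> set xs \<Longrightarrow> x \<in> carrier_mat M M \<and> max_mnorm x \<le> 1 \<and> cstar_mnorm x \<le> 1"
    "product_mat n F = map_mat (scaleC (complex_of_real c)) (mat n n (\<lambda>(i, j). mat_prod M xs $$ (i, j)))"
    using haagerup_absorbs_factors[OF n F] by metis
  have M: "0 < M" using n xs(1) by simp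
  define ys where "ys = map (map_mat S) xs"
  have ys: "length ys = l" "y \<in> carrier_mat M M \<and> max_mnorm y \<le> 1" if "y \<in> set ys" for y
  proof -
    show "length ys = l" using xs by (simp add: ys_def)
    obtain x where x: "x \<in> set xs" "y = map_mat S x" using \<open>y \<in> set ys\<close> by (auto simp: ys_def)
    have "max_mnorm (map_mat S x) \<le> max_mnorm x"
      by (rule max_mnorm_contraction[OF cb_leD(1)[OF S] _ M]) (use cb_le_norm[OF S] xs(3)[OF x(1)] in auto)
    then show "y \<in> carrier_mat M M \<and> max_mnorm y \<le> 1" using x xs(3)[OF x(1)] by auto
  qed
  have lys: "length ys = l" using xs by (simp add: ys_def)
  define G where "G i j = fscale (complex_of_real c) (sq_tensor M ys i j)" for i j
  have "homog_mat l n G" using homog_sq_tensor[where xs = ys] by (simp add: G_def lys homog_fscale)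
  moreover have "haagerup_absorbs max_mnorm l n c G"
    unfolding haagerup_absorbs_def haagerup_ball_def
    using c xs(1) lys ys(2) by (intro conjI exI[of _ M] exI[of _ ys]) (auto simp: G_def)
  moreover have "cstar_mnorm (map_mat S (product_mat n F) - product_mat n G) \<le> c * (l * d)"
  proof -
    let ?P = "mat_prod M xs" and ?Q = "mat_prod M ys"
    have P: "?P \<in> carrier_mat M M" using xs(3) by (intro mat_prod_carrier) auto
    have Q: "?Q \<in> carrier_mat M M" using ys(2) by (intro mat_prod_carrier) auto
    let ?D = "map_mat S ?P - ?Q"
    have D: "?D \<in> carrier_mat M M" by (rule minus_carrier_mat[OF Q])
    have "product_mat n G = map_mat (scaleC (complex_of_real c)) (mat n n (\<lambda>(i, j). ?Q $$ (i, j)))"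
      by (rule eq_matI) (use xs(1) ys(2) in \<open>auto simp: G_def free_product_map_fscale free_product_map_sq_tensor\<close>)
    then have "map_mat S (product_mat n F) - product_mat n G
        = map_mat (scaleC (complex_of_real c)) (mat n n (\<lambda>(i, j). ?D $$ (i, j)))"
      unfolding xs(4) by (intro eq_matI)
        (use xs(1) P Q in \<open>auto simp: scaleC_linearD[OF cb_leD(1)[OF S]] scaleC_diff_right\<close>)
    then have "cstar_mnorm (map_mat S (product_mat n F) - product_mat n G)
        = c * cstar_mnorm (mat n n (\<lambda>(i, j). ?D $$ (i, j)))"
      using c by (simp add: cstar_mnorm_scaleC[of _ n n])
    also have "\<dots> \<le> c * cstar_mnorm ?D"
      using c by (intro mult_left_mono cstar_mnorm_corner[OF D n xs(1)]) auto
    also have "cstar_mnorm ?D \<le> length xs * d"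
      unfolding ys_def by (rule almost_multiplicative_prod[OF S M d mult[OF M]]) (use l xs in auto)
    finally show ?thesis using c xs(2) by (simp add: mult_left_mono)
  qed
  ultimately show thesis using that by blast
qed

lemma square_mats_cstar:
  "x \<in> square_mats cstar_opspace \<longleftrightarrow> (\<exists>n>0. x \<in> carrier_mat n n)"
  by (auto simp: square_mats_def)

lemma cb_norm_bound:
  fixes T :: "'a::unital_cstar_algebra \<Rightarrow> 'b::unital_cstar_algebra"
  assumes "completely_bounded cstar_opspace cstar_opspace T"
  obtains p where "cb_norm cstar_opspace cstar_opspace T = ereal p" "cb_le T p"
proof -
  have lin: "scaleC_linear T" and fin: "cb_norm cstar_opspace cstar_opspace T < \<infinity>"
    using assms by (auto simp: completely_bounded_def linear_map_def scaleC_linear_def)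
  have up: "ereal (cstar_mnorm (map_mat T x)) \<le> cb_norm cstar_opspace cstar_opspace T"
    if "0 < n" "x \<in> carrier_mat n n" "cstar_mnorm x \<le> 1" for n x
    unfolding cb_norm_def
    by (rule order_trans[OF _ SUP_upper[of x]]) (use that in \<open>auto simp: square_mats_cstar\<close>)
  have "ereal 0 \<le> cb_norm cstar_opspace cstar_opspace T"
    using up[of 1 "0\<^sub>m 1 1"] by (simp add: map_mat_zero[OF lin])
  with fin obtain p where p: "cb_norm cstar_opspace cstar_opspace T = ereal p" "0 \<le> p"
    by (cases "cb_norm cstar_opspace cstar_opspace T") auto
  have "cstar_mnorm (map_mat T x) \<le> p * cstar_mnorm x" if n: "0 < n" and x: "x \<in> carrier_mat n n" for n x
  proof (cases "cstar_mnorm x = 0")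
    case True
    then have "x = 0\<^sub>m n n" using cstar_mnorm_eq_0_iff[OF x] by simp
    then show ?thesis by (simp add: map_mat_zero[OF lin])
  next
    case False
    define r where "r = cstar_mnorm x"
    have r: "0 < r" using False cstar_mnorm_nonneg[OF x] by (simp add: r_def)
    let ?y = "map_mat (scaleC (complex_of_real (1 / r))) x"
    have y: "?y \<in> carrier_mat n n" "cstar_mnorm ?y \<le> 1"
      using x r by (auto simp: cstar_mnorm_scaleC[OF x] norm_divide simp flip: r_def)
    have "map_mat T ?y = map_mat (scaleC (complex_of_real (1 / r))) (map_mat T x)"
      by (rule map_mat_linear(3)[OF lin x x])
    then have "cstar_mnorm (map_mat T ?y) = cstar_mnorm (map_mat T x) / r"
      using r x by (simp add: cstar_mnorm_scaleC[of _ n n] norm_divide)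
    then show ?thesis using up[OF n y] p(1) r by (simp add: divide_le_eq r_def)
  qed
  then have "cb_le T p" using lin p(2) by (simp add: cb_le_def)
  with p(1) show thesis using that by blast
qed

lemma near_isometry_of_d_cb:
  assumes "d_cb (cstar_opspace :: 'a::unital_cstar_algebra opspace) (cstar_opspace :: 'b::unital_cstar_algebra opspace) < ereal L"
  obtains T :: "'a::unital_cstar_algebra \<Rightarrow> 'b::unital_cstar_algebra" and R :: "'b \<Rightarrow> 'a"
  where "near_isometry T R L"
proof -
  obtain T :: "'a \<Rightarrow> 'b" where T: "cb_isomorphism cstar_opspace cstar_opspace T"
    "cb_norm cstar_opspace cstar_opspace T * cb_norm cstar_opspace cstar_opspace (inv_into UNIV T) < ereal L"
    using assms unfolding d_cb_def by (auto simp: INF_less_iff)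
  let ?R = "inv_into UNIV T"
  have bij: "bij T" using T(1) by (simp add: cb_isomorphism_def)
  obtain p where p: "cb_norm cstar_opspace cstar_opspace T = ereal p" "cb_le T p"
    using cb_norm_bound[of T] T(1) by (auto simp: cb_isomorphism_def)
  obtain q where q: "cb_norm cstar_opspace cstar_opspace ?R = ereal q" "cb_le ?R q"
    using cb_norm_bound[of ?R] T(1) by (auto simp: cb_isomorphism_def)
  have pq: "p * q < L" using T(2) p q by simp
  have TR: "T (?R y) = y" "?R (T x) = x" for x y
    using bij by (auto simp: bij_is_surj surj_f_inv_f bij_is_inj)
  note lT = scaleC_linearD[OF cb_leD(1)[OF p(2)]] and lR = scaleC_linearD[OF cb_leD(1)[OF q(2)]]
  have "p \<noteq> 0"
  proof
    assume "p = 0"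
    then have "norm (T 1) \<le> 0" using cb_le_norm[OF p(2), of 1] by simp
    then have "?R (T 1) = 0" by (simp add: lR)
    then show False by (simp add: TR)
  qed
  then have p0: "0 < p" using cb_leD(2)[OF p(2)] by simp
  have q0: "0 \<le> q" using cb_leD(2)[OF q(2)] .
  have cb_scale: "cb_le (\<lambda>x. complex_of_real r *\<^sub>C x :: 'c::unital_cstar_algebra) r" if "0 \<le> r" for r
    unfolding cb_le_def scaleC_linear_def
    using that by (auto simp: scaleC_add_right scaleC_scaleC mult.commute cstar_mnorm_scaleC)
  have p1: "0 \<le> 1 / p" "0 \<le> p" using p0 by auto
  have 1: "cb_le (\<lambda>x. complex_of_real (1 / p) *\<^sub>C T x) (1 / p * p)"
    by (rule cb_le_compose[OF p(2) cb_scale[OF p1(1)]])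
  have 2: "cb_le (\<lambda>y. ?R (complex_of_real p *\<^sub>C y)) (q * p)"
    by (rule cb_le_compose[OF cb_scale[OF p1(2)] q(2)])
  have L: "0 < L" using pq p0 q0 by (meson mult_nonneg_nonneg less_imp_le order_le_less_trans)
  have "near_isometry (\<lambda>x. complex_of_real (1 / p) *\<^sub>C T x) (\<lambda>y. ?R (complex_of_real p *\<^sub>C y)) L"
  proof unfold_locales
    show "cb_le (\<lambda>x. complex_of_real (1 / p) *\<^sub>C T x) 1" using 1 p0 by simp
    show "cb_le (\<lambda>y. ?R (complex_of_real p *\<^sub>C y)) L" by (rule cb_le_mono[OF 2]) (use pq in \<open>simp add: mult.commute\<close>)
    show "complex_of_real (1 / p) *\<^sub>C T (?R (complex_of_real p *\<^sub>C y)) = y" for y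
      using p0 by (simp add: TR scaleC_scaleC)
    show "?R (complex_of_real p *\<^sub>C (complex_of_real (1 / p) *\<^sub>C T x)) = x" for x
      using p0 by (simp add: TR scaleC_scaleC)
  qed (rule L)
  then show thesis using that by blast
qed

text \<open>A contraction \<open>b\<close> is close to \<open>S (R' b)\<close>.  Factorize \<open>R' b\<close>, scaled by \<open>1 / L\<close>, up to an error \<open>1 / 10\<close> and
transport the factorization.  The total error is at most \<open>eta + L (1 / 10 + 1 / 20) < 1 / 2\<close>.\<close>

lemma (in near_isometry) length_at_most_transfer:
  assumes l: "0 < l" and K: "1 \<le> K" and len: "length_and_constant_at_most TYPE('a) l K"
    and L: "L \<le> 2" and small: "2 * K * (l * (12 * eta)) \<le> 1 / 20" "eta \<le> 1 / 20"
  shows "length_at_most TYPE('b) l"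
proof -
  interpret A: haagerup_length "TYPE('a)" l by unfold_locales (rule l)
  interpret B: haagerup_length "TYPE('b)" l by unfold_locales (rule l)
  have eta0: "0 \<le> eta"
    using order_trans[OF norm_ge_zero matseq_coisometry[of 1]] by simp
  show ?thesis
  proof (rule B.length_at_most_of_approximate_factorization[of "L * (2 * K)"])
    show "0 \<le> L * (2 * K)" using K L0 by simp
    show "\<forall>n>0. \<forall>b\<in>carrier_mat n n. cstar_mnorm (b :: 'b mat) \<le> 1 \<longrightarrow>
      (\<exists>F. homog_mat l n F \<and> hnorm max_mnorm l n F \<le> L * (2 * K) \<and> cstar_mnorm (b - product_mat n F) \<le> 1 / 2)"
    proof (intro allI impI ballI)
      fix n :: nat and b :: "'b mat" assume n: "0 < n" and b: "b \<in> carrier_mat n n" "cstar_mnorm b \<le> 1"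
      \<comment> \<open>\<open>R'\<close> may have norm \<open>L\<close>, so its value is scaled down to a contraction and \<open>L\<close> is restored afterwards\<close>
      let ?sc = "map_mat (scaleC (complex_of_real (1 / L))) :: 'a mat \<Rightarrow> 'a mat"
      let ?SC = "map_mat (scaleC (complex_of_real L)) :: 'b mat \<Rightarrow> 'b mat"
      define a where "a = ?sc (map_mat R' b)"
      have Rb: "map_mat R' b \<in> carrier_mat n n" using b by simp
      have a: "a \<in> carrier_mat n n" using b by (simp add: a_def)
      have "cstar_mnorm (map_mat R' b) \<le> L * 1"
        using cb_leD(3)[OF R'_cb n b(1)] b(2) L0 by (meson less_imp_le mult_left_mono order_trans)
      then have na: "cstar_mnorm a \<le> 1" using L0 by (simp add: a_def cstar_mnorm_scaleC[OF Rb] norm_divide)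
      have e: "(0::real) < 1 / 10" by simp
      obtain F where F: "homog_mat l n F" "hnorm max_mnorm l n F < K + 1 / 10" "cstar_mnorm (product_mat n F - a) < 1 / 10"
        using A.approximate_factorization[OF len n a na e] by metis
      have "hnorm max_mnorm l n F < 2 * K" using F(2) K by simp
      then have absF: "haagerup_absorbs max_mnorm l n (2 * K) F"
        by (rule hnorm_less[OF opspace_structure_max_mnorm l n F(1)])
      have d: "0 \<le> 12 * eta" using eta0 by simp
      obtain G where G: "homog_mat l n G" "haagerup_absorbs max_mnorm l n (2 * K) G"
        "cstar_mnorm (map_mat S (product_mat n F) - product_mat n G) \<le> 2 * K * (l * (12 * eta))"
        by (rule transport_factorization[OF S_cb l n d S_multiplicative absF])
      let ?H = "\<lambda>i j. fscale (complex_of_real L) (G i j)"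
      have "homog_mat l n ?H" using G(1) by (simp add: homog_fscale)
      moreover have "hnorm max_mnorm l n ?H \<le> L * (2 * K)"
        by (rule hnorm_le[OF opspace_structure_max_mnorm l n haagerup_absorbs_fscale[OF opspace_structure_max_mnorm l n G(2)]])
          (use K L0 in auto)
      moreover have "cstar_mnorm (b - product_mat n ?H) \<le> 1 / 2"
      proof -
        let ?Sa = "map_mat S a" and ?SF = "map_mat S (product_mat n F)" and ?G = "product_mat n G"
        note lin = cb_leD(1)[OF S_cb]
        have c: "?Sa \<in> carrier_mat n n" "?SF \<in> carrier_mat n n" "?G \<in> carrier_mat n n" using a by auto
        have SRb: "?SC ?Sa = map_mat S (map_mat R' b)"
          by (rule eq_matI) (use b L0 in \<open>auto simp: a_def scaleC_linearD[OF lin] scaleC_scaleC\<close>)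
        have 1: "cstar_mnorm (b - ?SC ?Sa) \<le> eta * 1"
          using S_near_inverse[OF n b(1)] mult_left_mono[OF b(2) eta0]
            cstar_mnorm_minus_commute[OF b(1), of "map_mat S (map_mat R' b)"] b(1) by (simp add: SRb)
        have "product_mat n F - a \<in> carrier_mat n n" by (rule minus_carrier_mat[OF a])
        then have "cstar_mnorm (?SF - ?Sa) \<le> 1 / 10"
          using cb_leD(3)[OF S_cb n, of "product_mat n F - a"] F(3) a
          by (simp add: map_mat_linear(2)[OF lin, of _ n n])
        then have 2: "cstar_mnorm (?Sa - ?SF) \<le> 1 / 10" using cstar_mnorm_minus_commute[OF c(1,2)] by simp
        have "cstar_mnorm (?Sa - ?G) \<le> 1 / 10 + 1 / 20"
          using cstar_mnorm_triangle_minus[OF c] 2 G(3) small(1) by simp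
        then have "L * cstar_mnorm (?Sa - ?G) \<le> 2 * (1 / 10 + 1 / 20)"
          using L L0 cstar_mnorm_nonneg[OF minus_carrier_mat[OF c(3)]] by (intro mult_mono) auto
        moreover have "?SC ?Sa - product_mat n ?H = ?SC (?Sa - ?G)"
          by (rule eq_matI) (use a in \<open>auto simp: free_product_map_fscale scaleC_diff_right\<close>)
        ultimately have 3: "cstar_mnorm (?SC ?Sa - product_mat n ?H) \<le> 2 * (1 / 10 + 1 / 20)"
          using L0 by (simp add: cstar_mnorm_scaleC[OF minus_carrier_mat[OF c(3)]])
        have "cstar_mnorm (b - product_mat n ?H) \<le> cstar_mnorm (b - ?SC ?Sa) + cstar_mnorm (?SC ?Sa - product_mat n ?H)"
          by (rule cstar_mnorm_triangle_minus[OF b(1)]) (use a in auto)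
        then show ?thesis using 1 3 small(2) by simp
      qed
      ultimately show "\<exists>F. homog_mat l n F \<and> hnorm max_mnorm l n F \<le> L * (2 * K) \<and> cstar_mnorm (b - product_mat n F) \<le> 1 / 2"
        by (intro exI[of _ ?H] conjI)
    qed
  qed
qed

theorem theoremC:
  fixes K :: real and l :: nat
  assumes "K \<ge> 1" and "l \<noteq> 0"
    and "d_cb (cstar_opspace :: 'a::unital_cstar_algebra opspace)
           (cstar_opspace :: 'b::unital_cstar_algebra opspace)
         < ereal (1 + 1 / (10 ^ 4 * 4 ^ l * K ^ 2))"
    and "length_and_constant_at_most TYPE('a) l K"
  shows "length_at_most TYPE('b) l"
proof -
  define e where "e = 1 / (10 ^ 4 * 4 ^ l * K ^ 2)"
  have K2: "K \<le> K ^ 2" using assms(1) by (simp add: power2_eq_square mult_le_cancel_left1)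
  \<comment> \<open>of the exponential factor only \<open>l \<le> 4 ^ l\<close> matters: the error is linear in \<open>l\<close>\<close>
  have l4: "real l \<le> 4 ^ l"
  proof -
    have "l < 4 ^ l" by (rule less_exp[of l, THEN less_le_trans]) (simp add: power_mono)
    then have "real l \<le> real (4 ^ l)" by linarith
    then show ?thesis by simp
  qed
  have pos: "0 < (10::real) ^ 4 * 4 ^ l * K ^ 2" using assms(1) by simp
  have e0: "0 < e" using pos by (simp add: e_def)
  have lKe: "real l * K * e \<le> 1 / 10 ^ 4"
  proof -
    have "real l * K \<le> 4 ^ l * K ^ 2" using l4 K2 assms(1) by (intro mult_mono) auto
    then show ?thesis using pos by (simp add: e_def field_simps)
  qed
  have l1: "1 \<le> real l" using assms(2) by simp
  have "1 * 1 \<le> real l * K" using l1 assms(1) by (intro mult_mono) auto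
  then have "1 * e \<le> real l * K * e" using e0 by (intro mult_right_mono) auto
  then have e_le: "e \<le> 1 / 10 ^ 4" using lKe by simp
  obtain T :: "'a \<Rightarrow> 'b" and R :: "'b \<Rightarrow> 'a" where "near_isometry T R (1 + e)"
    using near_isometry_of_d_cb assms(3) unfolding e_def by metis
  then interpret near_isometry T R "1 + e" .
  have eta: "eta \<le> 4 * e"
  proof -
    have "1 - 1 / (1 + e)\<^sup>2 \<le> 2 * e"
    proof -
      have "(1 - 2 * e) * (1 + e)\<^sup>2 \<le> 1"
        using e0 by (simp add: power2_eq_square algebra_simps)
      then have "1 - 2 * e \<le> 1 / (1 + e)\<^sup>2" using e0 by (simp add: pos_le_divide_eq)
      then show ?thesis by simp
    qed
    then show ?thesis by (simp add: eta_def)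
  qed
  show ?thesis
  proof (rule length_at_most_transfer[OF _ assms(1,4)])
    show "0 < l" using assms(2) by simp
    show "1 + e \<le> 2" using e_le by simp
    show "eta \<le> 1 / 20" using eta e_le by simp
    have "2 * K * (real l * (12 * eta)) \<le> 2 * K * (real l * (12 * (4 * e)))"
      using eta assms(1) by (intro mult_left_mono) auto
    also have "\<dots> = 96 * (real l * K * e)" by simp
    also have "\<dots> \<le> 96 * (1 / 10 ^ 4)" using lKe by (intro mult_left_mono) auto
    finally show "2 * K * (real l * (12 * eta)) \<le> 1 / 20" by simp
  qed
qed

end
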